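(* Let $\rho>0$. In the joint limit $m,n\to\infty$ (with $n$ a multiple of $3$), $\frac{n}{\sqrt3\,m}\to\rho$, the perturbed uniform partition function has the following asymptotic expansion. For all $(\alpha,\beta)\in\mathbb{R}^2$, $$Z_{m,n}(\alpha,\beta)=(-1)^{mn}\,e^{-\pi n\alpha/3}\,e^{-mn\,\mathsf{f}}\,\frac{e^{\pi\rho/6}}{\sqrt{2\rho}\,P(e^{-\rho\pi})^2}\ \sum_{(k,\ell)\in\mathbb{Z}^2}e^{\pi(\alpha k+\beta\ell)}\,e^{-\frac{\pi}{2}\left(\frac{k^2}{\rho}+\rho\ell^2\right)}\,(1+o(1)),$$ where $P(q)=\prod_{k=1}^\infty(1-q^{2k})$ and $\mathsf{f}$ is the free energy per fundamental domain, $$\mathsf{f}=-\frac{1}{4\pi^2}\int_0^{2\pi}\int_0^{2\pi}\log\bigl(2(\cos\psi+1)-e^{i\phi}\bigr)\,d\phi\,d\psi .$$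
   Context: Honeycomb lattice: let $\Lambda\subset\mathbb{R}^2$ be the lattice generated by $u=(\tfrac32,\tfrac{\sqrt3}{2})$ and $y=(0,\sqrt3)$. $H$ is the bipartite planar graph with white vertices $\Lambda$, black vertices $\Lambda+(1,0)$, each white vertex $v$ being joined to the black vertices $v+(1,0)$ (edge of type I), $v+(-\tfrac12,\tfrac{\sqrt3}{2})$ (type II) and $v+(-\tfrac12,-\tfrac{\sqrt3}{2})$ (type III). Let $x=(3,0)$. For positive integers $m,n$, $H_{m,n}$ is the finite bipartite (multi)graph $H/(\mathbb{Z}mx+\mathbb{Z}ny)$ embedded in the torus; it has $4mn$ vertices. A dimer configuration of $H_{m,n}$ is a perfect matching of it. For $\alpha,\beta\in\mathbb{R}$, assign to edges of type I, II, III of $H_{m,n}$ the weights $a=e^{-\alpha\pi/(2m)}$, $b^{-1}=e^{-\beta\pi/(2n)}$, $b=e^{\beta\pi/(2n)}$ respectively. The perturbed uniform partition function is $Z_{m,n}(\alpha,\beta)=\sum_M\prod_{e\in M}(\text{weight of }e)$, the sum being over all dimer configurations $M$ of $H_{m,n}$. The free energy per fundamental domain $\mathsf{f}$ is defined as $-\lim_{m,n\to\infty}\frac{1}{mn}\log Z_{m,n}(0,0)$ and is given by the integral in the claim (by symmetry, $\log(\cdot)$ in the integral may be replaced by $\log|\cdot|$).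
   Formalization: The factor (-1)^{mn} is dropped: all weights are positive and f is real, so Z and every other factor on the right are positive and the printed formula fails when m and n are both odd; for mn even the two formulas coincide. *)

theory Defs
  imports "HOL-Analysis.Analysis" "HOL-Library.Landau_Symbols"
begin

definition lat_u :: "real \<times> real" where "lat_u = (3/2, sqrt 3 / 2)"
definition lat_y :: "real \<times> real" where "lat_y = (0, sqrt 3)"
definition lat_x :: "real \<times> real" where "lat_x = (3, 0)"

definition lattice_span :: "real \<times> real \<Rightarrow> real \<times> real \<Rightarrow> (real \<times> real) set" where
  "lattice_span a b = {of_int i *\<^sub>R a + of_int j *\<^sub>R b | i j :: int. True}"

text \<open>The honeycomb graph \<open>H\<close>. An edge is recorded by its white end and its type.\<close>

definition honeycomb_white :: "(real \<times> real) set" where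
  "honeycomb_white = lattice_span lat_u lat_y"

definition honeycomb_black :: "(real \<times> real) set" where
  "honeycomb_black = (\<lambda>v. v + (1, 0)) ` honeycomb_white"

datatype edge_type = EdgeI | EdgeII | EdgeIII

fun edge_vec :: "edge_type \<Rightarrow> real \<times> real" where
  "edge_vec EdgeI = (1, 0)"
| "edge_vec EdgeII = (- 1/2, sqrt 3 / 2)"
| "edge_vec EdgeIII = (- 1/2, - sqrt 3 / 2)"

definition honeycomb_edges :: "((real \<times> real) \<times> edge_type) set" where
  "honeycomb_edges = honeycomb_white \<times> UNIV"

text \<open>
  The toroidal quotient. Its vertices are the cosets of points of \<open>H\<close> modulo the period lattice
  spanned by \<open>m x\<close> and \<open>n y\<close>. The period lattice acts on edges by translating the white end and
  preserves the type, so an orbit of edges is a pair of a white coset and a type. Edges are not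
  identified with their pairs of endpoints: for \<open>n = 1\<close> the types II and III are parallel.
\<close>

definition torus_class :: "nat \<Rightarrow> nat \<Rightarrow> real \<times> real \<Rightarrow> (real \<times> real) set" where
  "torus_class m n p = (\<lambda>l. p + l) ` lattice_span (real m *\<^sub>R lat_x) (real n *\<^sub>R lat_y)"

definition torus_white :: "nat \<Rightarrow> nat \<Rightarrow> (real \<times> real) set set" where
  "torus_white m n = torus_class m n ` honeycomb_white"

definition torus_black :: "nat \<Rightarrow> nat \<Rightarrow> (real \<times> real) set set" where
  "torus_black m n = torus_class m n ` honeycomb_black"

type_synonym torus_edge = "(real \<times> real) set \<times> edge_type"

definition torus_edges :: "nat \<Rightarrow> nat \<Rightarrow> torus_edge set" where
  "torus_edges m n = (\<lambda>(v, t). (torus_class m n v, t)) ` honeycomb_edges"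

definition white_end :: "torus_edge \<Rightarrow> (real \<times> real) set" where
  "white_end e = fst e"

definition black_end :: "torus_edge \<Rightarrow> (real \<times> real) set" where
  "black_end e = (\<lambda>p. p + edge_vec (snd e)) ` fst e"

definition dimer_configs :: "nat \<Rightarrow> nat \<Rightarrow> torus_edge set set" where
  "dimer_configs m n = {M. M \<subseteq> torus_edges m n
      \<and> (\<forall>w\<in>torus_white m n. \<exists>!e. e \<in> M \<and> white_end e = w)
      \<and> (\<forall>b\<in>torus_black m n. \<exists>!e. e \<in> M \<and> black_end e = b)}"

fun edge_weight :: "nat \<Rightarrow> nat \<Rightarrow> real \<Rightarrow> real \<Rightarrow> edge_type \<Rightarrow> real" where
  "edge_weight m n \<alpha> \<beta> EdgeI = exp (- \<alpha> * pi / (2 * real m))"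
| "edge_weight m n \<alpha> \<beta> EdgeII = exp (- \<beta> * pi / (2 * real n))"
| "edge_weight m n \<alpha> \<beta> EdgeIII = exp (\<beta> * pi / (2 * real n))"

text \<open>
  All weights are positive, hence so is the partition function for \<open>m, n > 0\<close>: its asymptotic
  expansion in terms of the (real) free energy cannot carry an alternating sign \<open>(-1)^(m n)\<close>.
  For \<open>m = 0\<close> or \<open>n = 0\<close> the quotient is infinite and the value is meaningless.
\<close>

definition partition_function :: "nat \<Rightarrow> nat \<Rightarrow> real \<Rightarrow> real \<Rightarrow> real" where
  "partition_function m n \<alpha> \<beta> =
     (\<Sum>M\<in>dimer_configs m n. \<Prod>e\<in>M. edge_weight m n \<alpha> \<beta> (snd e))"

definition free_energy_approx :: "nat \<times> nat \<Rightarrow> real" where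
  "free_energy_approx = (\<lambda>(m, n). - ln (partition_function m n 0 0) / (real m * real n))"

definition free_energy :: real where
  "free_energy = Lim (at_top \<times>\<^sub>F at_top) free_energy_approx"

definition P_prod :: "real \<Rightarrow> real" where
  "P_prod q = (\<Prod>k. 1 - q ^ (2 * Suc k))"

end

theory Submission
  imports Defs "Jordan_Normal_Form.Determinant" "HOL-Library.FuncSet" "HOL-Complex_Analysis.Complex_Analysis"
    "HOL-Library.Nat_Bijection" "HOL-Real_Asymp.Real_Asymp"
begin

text \<open>
  Twisting the weights by signs across the two seams of the torus turns the weighted count of perfect
  matchings into a determinant, up to a sign that only depends on the winding of a matching. Plane
  waves diagonalise the four twisted determinants, and \<open>Z\<close> is a combination of the four products
  \<open>F(z, \<xi>) = \<Prod>s<n. (c + z (2 + 2 cos (2 \<pi> (s + \<xi>) / n))\<^sup>m)\<close> with \<open>c = exp (- \<alpha> \<pi>)\<close>, \<open>z = 1, -1\<close> and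
  \<open>\<xi> = - \<i> \<beta> / 2\<close> or \<open>\<xi> = 1 / 2 - \<i> \<beta> / 2\<close>.

  In the scaling limit the factors with \<open>2 + 2 cos > 1\<close> behave like \<open>(2 + 2 cos)\<^sup>m\<close> and the others like
  \<open>c\<close>; the midpoint rule evaluates this bulk contribution, including its bounded correction. What
  remains is concentrated at the two Fermi points \<open>2 + 2 cos = 1\<close>, where a factor tends to
  \<open>1 + q\<^sup>2\<^sup>s\<^sup>+\<^sup>1 w\<close>, so that the triple product identity expands each point into a theta series. The four
  sectors combine into a sum over integral charge and integral current, and the modular
  transformations of theta and eta bring it to the stated form. The condition \<open>3 dvd n\<close> keeps the
  position of the Fermi points relative to the momenta fixed.
\<close>

subsection \<open>Signs of translations on a torus\<close>

text \<open>What could fail is the sign of a matching: as a permutation of cells it might depend on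
  every edge. With type I edges as fixed points, every column has equally many moved cells, and
  replacing a cell by its rank among the moved cells of its column conjugates the permutation to a
  rigid shift of a smaller torus; only winding numbers survive. The analytic obstacle is uniformity:
  the number of factors grows together with the exponent \<open>m\<close>, so every half line of
  modes at a Fermi point needs a geometric majorant. The shift \<xi> is complex, which is why the
  bulk is treated with holomorphic functions; it perturbs the modulus of a mode only by a
  \<open>sinh\<close> term, so it costs a bounded factor. Factors may vanish in the limit when a
  momentum sits on a Fermi point, so products are compared there without logarithms. The free energy
  is a limit over all pairs \<open>(m, n)\<close>, with neither divisibility nor a fixed ratio,
  hence it cannot be read off from the expansion: a cruder estimate compares logarithms of products
  with Riemann sums, and the subtracted product is dominated by its positive partner.\<close>

lemma sign_on_transfer:
  assumes "finite A" and f: "bij_betw f A A" and e: "bij_betw e A B"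
    and eq: "\<And>x. x \<in> A \<Longrightarrow> g (e x) = e (f x)"
  shows "sign_on B g = sign_on A f"
proof -
  have r: "restrict_id f A permutes A"
    using f by (simp add: permutes_restrict_id)
  have "restrict_id g B = map_permutation A e (restrict_id f A)"
  proof
    fix y
    show "restrict_id g B y = map_permutation A e (restrict_id f A) y"
    proof (cases "y \<in> B")
      case True
      then obtain x where x: "x \<in> A" "y = e x"
        using e by (auto simp: bij_betw_def)
      have "map_permutation A e (restrict_id f A) y = e (restrict_id f A x)"
        unfolding x(2) using e x(1) by (subst map_permutation_apply) (auto simp: bij_betw_def)
      then show ?thesis
        using True x eq by (simp add: restrict_id_def)
    next
      case False
      then show ?thesis
        using e by (auto simp: map_permutation_def restrict_id_def bij_betw_def)
    qed
  qed
  then show ?thesis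
    unfolding sign_on_def
    using sign_map_permutation[OF _ r \<open>finite A\<close>, of e] e by (simp add: bij_betw_def)
qed

lemma sign_on_Un_disjoint:
  assumes "finite A" "finite B" "A \<inter> B = {}" "bij_betw f A A" "bij_betw f B B"
  shows "sign_on (A \<union> B) f = sign_on A f * sign_on B f"
proof -
  have "restrict_id f (A \<union> B) = restrict_id f A \<circ> restrict_id f B"
    using assms(3-5) by (fastforce simp: fun_eq_iff restrict_id_def bij_betw_def)
  then show ?thesis
    unfolding sign_on_def
    using assms permutes_restrict_id[OF assms(4)] permutes_restrict_id[OF assms(5)]
    by (simp add: sign_compose permutation_permutes) (metis permutation_permutes sign_compose)
qed

lemma sign_on_columns:
  assumes "finite I" "finite A" "\<And>i. i \<in> I \<Longrightarrow> bij_betw (h i) A A"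
  shows "sign_on (I \<times> A) (\<lambda>(i, k). (i, h i k)) = (\<Prod>i\<in>I. sign_on A (h i))"
  using assms(1,3)
proof (induction rule: finite_induct)
  case empty
  have "restrict_id (\<lambda>(i, k). (i, h i k)) {} = (id :: 'a \<times> 'b \<Rightarrow> _)"
    by (auto simp: restrict_id_def fun_eq_iff)
  then show ?case by (simp add: sign_on_def)
next
  case (insert i I)
  let ?f = "\<lambda>(i, k). (i, h i k)"
  have hi: "bij_betw (h i) A A" using insert by auto
  have b: "bij_betw ?f (J \<times> A) (J \<times> A)" if "J \<subseteq> insert i I" for J
  proof -
    have "inj_on ?f (J \<times> A)"
      using insert.prems that by (auto simp: inj_on_def bij_betw_def) blast
    moreover have "?f ` (J \<times> A) = J \<times> A"
    proof safe
      fix a k assume *: "a \<in> J" "k \<in> A"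
      then have "bij_betw (h a) A A" using insert.prems[of a] that by auto
      then show "h a k \<in> A" using *(2) by (auto simp: bij_betw_def)
    next
      fix a k assume *: "a \<in> J" "k \<in> A"
      then have "k \<in> h a ` A" using insert.prems[of a] that by (auto simp: bij_betw_def)
      then show "(a, k) \<in> ?f ` (J \<times> A)" using * by (auto simp: image_iff)
    qed
    ultimately show ?thesis by (simp add: bij_betw_def)
  qed
  have "sign_on (insert i I \<times> A) ?f = sign_on (({i} \<times> A) \<union> (I \<times> A)) ?f"
    by (rule arg_cong[where f = "\<lambda>X. sign_on X ?f"]) auto
  also have "\<dots> = sign_on ({i} \<times> A) ?f * sign_on (I \<times> A) ?f"
    using insert assms(2) b by (intro sign_on_Un_disjoint) auto
  also have "sign_on ({i} \<times> A) ?f = sign_on A (h i)"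
    by (rule sign_on_transfer[where e = "Pair i"])
       (use assms(2) hi in \<open>auto simp: bij_betw_def inj_on_def\<close>)
  finally show ?case using insert by simp
qed

lemma bij_betw_succ_mod:
  assumes "(0::int) < N"
  shows "bij_betw (\<lambda>k. (k + c) mod N) {0..<N} {0..<N}"
proof (rule bij_betwI[where g = "\<lambda>k. (k - c) mod N"])
  show "(\<lambda>k. (k + c) mod N) \<in> {0..<N} \<rightarrow> {0..<N}" "(\<lambda>k. (k - c) mod N) \<in> {0..<N} \<rightarrow> {0..<N}"
    using assms by auto
qed (auto simp: mod_simps)

text \<open>A cycle on one more point is the shorter cycle composed with one transposition of the
  two last points, so each step of the induction flips the sign.\<close>

lemma sign_on_cycle_nat:
  "sign_on {0..<Suc N} (\<lambda>k. if k < N then Suc k else 0) = (- 1) ^ N"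
proof (induction N)
  case 0
  have "restrict_id (\<lambda>k. if k < 0 then Suc k else 0) {0..<Suc 0} = id"
    by (auto simp: restrict_id_def fun_eq_iff)
  then show ?case by (simp add: sign_on_def)
next
  case (Suc N)
  let ?f = "\<lambda>N k. if k < N then Suc k else 0"
  have b: "bij_betw (?f N) {0..<Suc N} {0..<Suc N}" for N
  proof -
    have "inj_on (?f N) {0..<Suc N}" by (auto simp: inj_on_def)
    moreover have "?f N ` {0..<Suc N} \<subseteq> {0..<Suc N}" by auto
    ultimately show ?thesis
      unfolding bij_betw_def using endo_inj_surj[OF finite_atLeastLessThan] by blast
  qed
  have "restrict_id (?f (Suc N)) {0..<Suc (Suc N)}
      = restrict_id (?f N) {0..<Suc N} \<circ> Transposition.transpose N (Suc N)"
    by (auto simp: fun_eq_iff restrict_id_def Transposition.transpose_def)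
  moreover have "permutation (restrict_id (?f N) {0..<Suc N})"
    using permutes_restrict_id[OF b] by (auto simp: permutation_permutes)
  ultimately show ?case
    using Suc unfolding sign_on_def
    by (simp add: sign_compose permutation_swap_id sign_swap_id)
qed

lemma sign_on_shift_one:
  assumes "(0::int) < N"
  shows "sign_on {0..<N} (\<lambda>k. (k + 1) mod N) = (- 1) ^ (nat N - 1)"
proof -
  obtain n where n: "N = int (Suc n)" using assms by (metis gr0_implies_Suc zero_less_imp_eq_int)
  have b: "bij_betw int {0..<Suc n} {0..<N}"
    unfolding n by (rule bij_betwI[where g = nat]) auto
  have f: "bij_betw (\<lambda>k. if k < n then Suc k else 0) {0..<Suc n} {0..<Suc n}"
  proof -
    have "inj_on (\<lambda>k. if k < n then Suc k else 0) {0..<Suc n}" by (auto simp: inj_on_def)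
    moreover have "(\<lambda>k. if k < n then Suc k else 0) ` {0..<Suc n} \<subseteq> {0..<Suc n}" by auto
    ultimately show ?thesis
      unfolding bij_betw_def using endo_inj_surj[OF finite_atLeastLessThan] by blast
  qed
  have "sign_on {0..<N} (\<lambda>k. (k + 1) mod N) = sign_on {0..<Suc n} (\<lambda>k. if k < n then Suc k else 0)"
  proof (rule sign_on_transfer[OF _ f b])
    fix x assume x: "x \<in> {0..<Suc n}"
    show "(int x + 1) mod N = int (if x < n then Suc x else 0)"
      using x n by (cases "x = n") (auto simp: add.commute)
  qed auto
  then show ?thesis by (simp add: sign_on_cycle_nat n nat_add_distrib)
qed

lemma sign_on_shift_minus_one:
  assumes "(0::int) < N"
  shows "sign_on {0..<N} (\<lambda>k. (k - 1) mod N) = (- 1) ^ (nat N - 1)"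
proof -
  let ?A = "{0..<N}"
  have b1: "bij_betw (\<lambda>k. (k + 1) mod N) ?A ?A" using bij_betw_succ_mod[OF assms, of 1] .
  have b2: "bij_betw (\<lambda>k. (k - 1) mod N) ?A ?A" using bij_betw_succ_mod[OF assms, of "-1"] by simp
  have "restrict_id (\<lambda>k. (k + 1) mod N) ?A \<circ> restrict_id (\<lambda>k. (k - 1) mod N) ?A = id"
    using assms by (auto simp: fun_eq_iff restrict_id_def mod_simps)
  moreover have "permutation (restrict_id (\<lambda>k. (k + 1) mod N) ?A)"
      "permutation (restrict_id (\<lambda>k. (k - 1) mod N) ?A)"
    using permutes_restrict_id[OF b1] permutes_restrict_id[OF b2]
    by (auto simp: permutation_permutes)
  ultimately have "sign_on ?A (\<lambda>k. (k + 1) mod N) * sign_on ?A (\<lambda>k. (k - 1) mod N) = 1"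
    unfolding sign_on_def by (simp flip: sign_compose)
  then have "sign_on ?A (\<lambda>k. (k - 1) mod N) = sign_on ?A (\<lambda>k. (k + 1) mod N)"
    by (auto simp: sign_on_def sign_def split: if_splits)
  then show ?thesis using sign_on_shift_one[OF assms] by simp
qed

lemma sign_on_shift:
  assumes "(0::int) < N" "w \<in> {-1, 0, 1}"
  shows "sign_on {0..<N} (\<lambda>k. (k + w) mod N) = (- 1) ^ ((nat N - 1) * nat \<bar>w\<bar>)"
proof -
  have "restrict_id (\<lambda>k. (k + 0) mod N) {0..<N} = id"
    by (auto simp: fun_eq_iff restrict_id_def)
  then have "sign_on {0..<N} (\<lambda>k. (k + 0) mod N) = 1" by (simp add: sign_on_def)
  then show ?thesis
    using assms sign_on_shift_one[OF assms(1)] sign_on_shift_minus_one[OF assms(1)] by auto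
qed

text \<open>The map is a rotation of the first coordinate composed with an independent rotation
  inside each column. The former consists of \<open>K\<close> cycles of length \<open>M\<close>; the
  latter contributes \<open>K - 1\<close> transpositions for every column with
  \<open>w i \<noteq> 0\<close>.\<close>

lemma sign_on_torus_shift:
  assumes M: "(0::int) < M" and K: "(0::int) < K" and w: "\<And>i. w i \<in> {-1, 0, 1::int}"
  shows "sign_on ({0..<M} \<times> {0..<K}) (\<lambda>(i, k). ((i - 1) mod M, (k + w i) mod K))
       = (- 1) ^ ((nat M - 1) * nat K + (nat K - 1) * (\<Sum>i\<in>{0..<M}. nat \<bar>w i\<bar>))"
proof -
  let ?X = "{0..<M} \<times> {0..<K}"
  let ?r = "\<lambda>(i, k). ((i - 1) mod M, k)" and ?s = "\<lambda>(i, k). (i, (k + w i) mod K)"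
  have bM: "bij_betw (\<lambda>i. (i - 1) mod M) {0..<M} {0..<M}"
    using bij_betw_succ_mod[OF M, of "-1"] by simp
  have bK: "bij_betw (\<lambda>k. (k + w i) mod K) {0..<K} {0..<K}" for i
    using bij_betw_succ_mod[OF K] .
  have s: "sign_on ?X ?s = (\<Prod>i\<in>{0..<M}. (- 1) ^ ((nat K - 1) * nat \<bar>w i\<bar>))"
    by (subst sign_on_columns) (use bK sign_on_shift[OF K w] in auto)
  let ?X' = "{0..<K} \<times> {0..<M}"
  have r': "sign_on ?X' (\<lambda>(k, i). (k, (i - 1) mod M)) = (\<Prod>k\<in>{0..<K}. (- 1) ^ (nat M - 1))"
    by (subst sign_on_columns) (use bM sign_on_shift_minus_one[OF M] in auto)
  have br': "bij_betw (\<lambda>(k, i). (k, (i - 1) mod M)) ?X' ?X'"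
  proof (rule bij_betwI[where g = "\<lambda>(k, i). (k, (i + 1) mod M)"])
  qed (use M in \<open>auto simp: mod_simps\<close>)
  have br: "bij_betw ?r ?X ?X"
  proof (rule bij_betwI[where g = "\<lambda>(i, k). ((i + 1) mod M, k)"])
  qed (use M in \<open>auto simp: mod_simps\<close>)
  have bs: "bij_betw ?s ?X ?X"
  proof (rule bij_betwI[where g = "\<lambda>(i, k). (i, (k - w i) mod K)"])
  qed (use K in \<open>auto simp: mod_simps\<close>)
  have r: "sign_on ?X ?r = sign_on ?X' (\<lambda>(k, i). (k, (i - 1) mod M))"
    by (rule sign_on_transfer[where e = prod.swap, OF _ br']) 
       (auto simp: bij_betw_def inj_on_def image_iff)
  have "restrict_id (\<lambda>(i, k). ((i - 1) mod M, (k + w i) mod K)) ?X = restrict_id ?r ?X \<circ> restrict_id ?s ?X"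
    using M K by (auto simp: fun_eq_iff restrict_id_def)
  then have "sign_on ?X (\<lambda>(i, k). ((i - 1) mod M, (k + w i) mod K)) = sign_on ?X ?r * sign_on ?X ?s"
    unfolding sign_on_def using permutes_restrict_id[OF br] permutes_restrict_id[OF bs]
    by (subst sign_compose[symmetric]) (auto simp: permutation_permutes)
  also have "\<dots> = (- 1) ^ ((nat M - 1) * nat K) * (\<Prod>i\<in>{0..<M}. (- 1) ^ ((nat K - 1) * nat \<bar>w i\<bar>))"
    using M K by (simp add: r r' s power_mult)
  finally show ?thesis
    by (simp add: power_add power_sum sum_distrib_left)
qed

section \<open>Cyclic order of particles moving on a column\<close>

definition rank_in :: "int set \<Rightarrow> int \<Rightarrow> int" where
  "rank_in S j = int (card {k \<in> S. k < j})"

lemma rank_in_less: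
  assumes "finite S" "j \<in> S" shows "rank_in S j < int (card S)"
proof -
  have "{k \<in> S. k < j} \<subset> S" using assms(2) by blast
  then show ?thesis unfolding rank_in_def using assms(1) by (simp add: psubset_card_mono)
qed

lemma rank_in_strict_mono:
  assumes "finite S" "j \<in> S" "j < k" shows "rank_in S j < rank_in S k"
proof -
  have "{l \<in> S. l < j} \<subset> {l \<in> S. l < k}" using assms(2,3) by force
  then show ?thesis unfolding rank_in_def using assms(1) by (simp add: psubset_card_mono)
qed

lemma bij_betw_rank_in:
  assumes "finite S" shows "bij_betw (rank_in S) S {0..<int (card S)}"
proof -
  have i: "inj_on (rank_in S) S"
    by (rule inj_onI) (metis assms less_irrefl linorder_neqE rank_in_strict_mono)
  have "rank_in S ` S \<subseteq> {0..<int (card S)}"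
    using assms by (auto simp: rank_in_less) (auto simp: rank_in_def)
  moreover have "card (rank_in S ` S) = card {0..<int (card S)}"
    using i by (simp add: card_image)
  ultimately have "rank_in S ` S = {0..<int (card S)}"
    by (intro card_subset_eq) auto
  then show ?thesis using i by (simp add: bij_betw_def)
qed

text \<open>Particles on a cycle that advance by at most one site without colliding keep their
  cyclic order. Ranks are therefore unchanged unless the particle at the last site crosses to 0; it
  then becomes the lowest one and every other rank grows by one.\<close>

lemma rank_in_step:
  assumes S: "S \<subseteq> {0..<N}" and f: "bij_betw f S S'" and S': "S' \<subseteq> {0..<N}"
    and d: "\<And>j. j \<in> S \<Longrightarrow> d j \<in> {0, 1::int}" and fd: "\<And>j. j \<in> S \<Longrightarrow> f j = (j + d j) mod N"
    and j: "j \<in> S"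
  shows "rank_in S' (f j) = (rank_in S j + (if N - 1 \<in> S \<and> d (N - 1) = 1 then 1 else 0)) mod int (card S)"
proof -
  have fin: "finite S" "finite S'" using S S' finite_subset by blast+
  have inj: "inj_on f S" and img: "f ` S = S'" using f by (auto simp: bij_betw_def)
  have noflow: "f k = k + d k" if "k \<in> S" "\<not> (k = N - 1 \<and> d k = 1)" for k
  proof -
    have "0 \<le> k" "k < N" using that(1) S by auto
    moreover have "d k = 0 \<or> d k = 1" using d[OF that(1)] by auto
    ultimately have "0 \<le> k + d k" "k + d k < N" using that(2) by (cases "k = N - 1"; force)+
    then show ?thesis using fd[OF that(1)] by simp
  qed
  \<comment> \<open>A single step can close a gap but not reverse it, and injectivity excludes
    equality; only the particle that crosses the end is exempt.\<close>
  have mono: "f k < f l" if "k \<in> S" "l \<in> S" "k < l" "\<not> (l = N - 1 \<and> d l = 1)" for k l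
  proof -
    have "k \<noteq> N - 1" using that S by (auto simp: subset_iff)
    then have "f k = k + d k" "f l = l + d l" using noflow that by auto
    then have "f k \<le> f l" using d[OF that(1)] d[OF that(2)] that by auto
    moreover have "f k \<noteq> f l" using inj that by (metis inj_on_eq_iff less_irrefl)
    ultimately show ?thesis by simp
  qed
  show ?thesis
  proof (cases "N - 1 \<in> S \<and> d (N - 1) = 1")
    case False
    have "{k \<in> S'. k < f j} = f ` {k \<in> S. k < j}"
    proof safe
      fix y assume "y \<in> S'" "y < f j"
      then obtain k where k: "k \<in> S" "y = f k" using img by auto
      have "\<not> (k = N - 1 \<and> d k = 1)" using False k by blast
      then have "\<not> j \<le> k" using mono[of j k] k j \<open>y < f j\<close> by (cases "j = k") auto
      then show "y \<in> f ` {k \<in> S. k < j}" using k by auto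
    next
      fix k assume "k \<in> S" "k < j"
      then show "f k \<in> S'" "f k < f j" using mono[of k j] j img False by auto
    qed
    then have "rank_in S' (f j) = rank_in S j"
      unfolding rank_in_def using inj by (simp add: card_image inj_on_subset)
    moreover have "0 \<le> rank_in S j" "rank_in S j < int (card S)"
      using rank_in_less[OF fin(1) j] by (auto simp: rank_in_def)
    ultimately show ?thesis unfolding if_not_P[OF False] by simp
  next
    case True
    then have f0: "f (N - 1) = 0" using fd by auto
    have zero: "0 \<in> S'" using True f0 img by force
    have top: "rank_in S (N - 1) = int (card S) - 1"
    proof -
      have "{k \<in> S. k < N - 1} = S - {N - 1}" using S by force
      then show ?thesis unfolding rank_in_def using True fin
        by (simp add: card_Diff_singleton) (metis True card_gt_0_iff empty_iff int_ops(6) less_le_not_le linorder_not_less of_nat_1 of_nat_diff Suc_leI One_nat_def)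
    qed
    show ?thesis
    proof (cases "j = N - 1")
      case j1: True
      have "{k \<in> S'. k < 0} = {}" using S' by auto
      then have "rank_in S' (f j) = 0" unfolding rank_in_def j1 f0 by (metis card.empty of_nat_0)
      moreover have "(rank_in S j + 1) mod int (card S) = 0" by (simp add: j1 top)
      ultimately show ?thesis using True by simp
    next
      case j1: False
      have ne: "f k \<noteq> 0" if "k \<in> S" "k \<noteq> N - 1" for k
        using inj that True f0 by (metis inj_on_eq_iff)
      have pos: "0 < f k" if "k \<in> S" "k \<noteq> N - 1" for k
        using ne[OF that] S' img that(1) by force
      have "{k \<in> S'. k < f j} = insert 0 (f ` {k \<in> S. k < j})"
      proof safe
        fix y assume "y \<in> S'" "y < f j" and y: "y \<notin> f ` {k \<in> S. k < j}"
        then obtain k where k: "k \<in> S" "y = f k" using img by auto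
        have "j \<le> k"
        proof (rule ccontr)
          assume "\<not> j \<le> k"
          then have "y \<in> f ` {k \<in> S. k < j}" using k by auto
          then show False using y by blast
        qed
        show "y = 0"
        proof (rule ccontr)
          assume "y \<noteq> 0"
          then have "k \<noteq> N - 1" using k f0 by auto
          then show False using mono[of j k] k j \<open>y < f j\<close> \<open>j \<le> k\<close> by (cases "j = k") auto
        qed
      next
        fix k assume "k \<in> S" "k < j"
        then show "f k \<in> S'" "f k < f j" using mono[of k j] j j1 img by auto
      qed (use zero pos j j1 in auto)
      moreover have "0 \<notin> f ` {k \<in> S. k < j}"
      proof
        assume "0 \<in> f ` {k \<in> S. k < j}"
        then obtain k where k: "k \<in> S" "k < j" "f k = 0" by auto
        moreover have "j \<le> N - 1" using j S by auto
        ultimately show False using ne[of k] by auto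
      qed
      ultimately have r: "rank_in S' (f j) = rank_in S j + 1"
        unfolding rank_in_def using inj fin by (simp add: card_image inj_on_subset)
      have "j < N - 1" using j j1 S by force
      then have "rank_in S j < rank_in S (N - 1)" using rank_in_strict_mono[OF fin(1) j] by simp
      then have "rank_in S j + 1 < int (card S)" "0 \<le> rank_in S j" using top by (auto simp: rank_in_def)
      then show ?thesis using r True by simp
    qed
  qed
qed

text \<open>The inverse of a downward step is an upward step, to which \<open>rank_in_step\<close>
  applies. The particle that leaves site 0 downwards is the one that the inverse carries across from
  \<open>N - 1\<close>.\<close>

lemma rank_in_step_down:
  assumes S: "S \<subseteq> {0..<N}" and f: "bij_betw f S S'" and S': "S' \<subseteq> {0..<N}"
    and d: "\<And>j. j \<in> S \<Longrightarrow> d j \<in> {0, 1::int}" and fd: "\<And>j. j \<in> S \<Longrightarrow> f j = (j - d j) mod N"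
    and j: "j \<in> S"
  shows "rank_in S' (f j) = (rank_in S j - (if 0 \<in> S \<and> d 0 = 1 then 1 else 0)) mod int (card S)"
proof -
  define g where "g = inv_into S f"
  have g: "bij_betw g S' S" unfolding g_def using f by (rule bij_betw_inv_into)
  have cS: "card S' = card S" using f by (simp add: bij_betw_same_card)
  have gf: "g (f k) = k" if "k \<in> S" for k unfolding g_def using f that by (simp add: bij_betw_inv_into_left)
  have fg: "f (g y) = y" "g y \<in> S" if "y \<in> S'" for y
    using f g that by (auto simp: g_def bij_betw_inv_into_right bij_betw_def)
  have fin: "finite S" using S finite_subset by blast
  have gd: "g y = (y + d (g y)) mod N" if "y \<in> S'" for y
  proof -
    have "y = (g y - d (g y)) mod N" using fd[OF fg(2)[OF that]] fg(1)[OF that] by simp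
    then have "(y + d (g y)) mod N = g y mod N" by (metis diff_add_cancel mod_add_left_eq)
    then show ?thesis using fg(2)[OF that] S by (auto simp: subset_iff)
  qed
  have fj: "f j \<in> S'" using f j by (auto simp: bij_betw_def)
  have *: "rank_in S (g (f j)) =
      (rank_in S' (f j) + (if N - 1 \<in> S' \<and> d (g (N - 1)) = 1 then 1 else 0)) mod int (card S')"
    by (rule rank_in_step[OF S' g S, where d = "\<lambda>y. d (g y)"]) (use d fg gd fj in auto)
  have wrap: "(N - 1 \<in> S' \<and> d (g (N - 1)) = 1) \<longleftrightarrow> (0 \<in> S \<and> d 0 = 1)"
  proof
    assume a: "N - 1 \<in> S' \<and> d (g (N - 1)) = 1"
    then have "g (N - 1) = 0" using gd[of "N - 1"] by simp
    then show "0 \<in> S \<and> d 0 = 1" using a fg(2)[of "N - 1"] by simp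
  next
    assume a: "0 \<in> S \<and> d 0 = 1"
    then have "0 < N" using S by auto
    have "f 0 = (- 1) mod N" using fd[of 0] a by simp
    then have "f 0 = N - 1" using \<open>0 < N\<close> by (simp add: zmod_minus1)
    moreover have "f 0 \<in> S'" using a f by (auto simp: bij_betw_def)
    ultimately show "N - 1 \<in> S' \<and> d (g (N - 1)) = 1" using a gf[of 0] by auto
  qed
  have "0 \<le> rank_in S' (f j)" "rank_in S' (f j) < int (card S')"
    using rank_in_less[of S' "f j"] fj fin f by (auto simp: rank_in_def bij_betw_finite)
  then show ?thesis
    using * unfolding wrap gf[OF j] cS by (auto simp: mod_simps)
qed

text \<open>A black vertex gets the coordinates of the white vertex to its left, its neighbour along
  type I; so an edge becomes a map from cells to cells. The dependence on the parity of
  \<open>i\<close> reflects the zigzag of the columns: a step of \<open>- lat_u\<close> alone moves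
  half a cell vertically.\<close>

fun hop :: "int \<Rightarrow> int \<Rightarrow> int \<times> int \<Rightarrow> edge_type \<Rightarrow> int \<times> int" where
  "hop M N (i, j) EdgeI = (i, j)"
| "hop M N (i, j) EdgeII = ((i - 1) mod M, (j + (if odd i then 1 else 0)) mod N)"
| "hop M N (i, j) EdgeIII = ((i - 1) mod M, (j - (if odd i then 0 else 1)) mod N)"

definition crosses_seam :: "int \<times> int \<Rightarrow> edge_type \<Rightarrow> bool" where
  "crosses_seam x t \<longleftrightarrow> t \<noteq> EdgeI \<and> fst x = 0"

text \<open>In an odd column only type II changes the height, in an even column only type III; these
  are all the ways of crossing the horizontal seam.\<close>

definition wraps :: "int \<Rightarrow> int \<times> int \<Rightarrow> edge_type \<Rightarrow> bool" where
  "wraps N x t \<longleftrightarrow> (odd (fst x) \<and> t = EdgeII \<and> snd x = N - 1) \<or> (even (fst x) \<and> t = EdgeIII \<and> snd x = 0)"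

text \<open>The moved cells of column \<open>i\<close> are carried bijectively to those of column
  \<open>i - 1\<close>, so all columns have the same number \<open>K\<close> of them, which is also
  the number of seam crossings. In rank coordinates the motion is a torus shift with
  \<open>W i\<close> in \<open>{-1, 0, 1}\<close>, nonzero exactly for the columns with a wrap.
  Since \<open>M\<close> is even, the factor for the rotation of columns has the parity of
  \<open>K\<close>.\<close>

lemma sign_on_hop:
  fixes M N :: int and t :: "int \<times> int \<Rightarrow> edge_type"
  assumes M: "0 < M" "even M" and N: "0 < N"
  defines "X \<equiv> {0..<M} \<times> {0..<N}"
  assumes bij: "bij_betw (\<lambda>x. hop M N x (t x)) X X"
  shows "sign_on X (\<lambda>x. hop M N x (t x)) =
     (- 1) ^ (card {x \<in> X. crosses_seam x (t x)}
       + (card {x \<in> X. crosses_seam x (t x)} + 1) * card {x \<in> X. wraps N x (t x)})"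
proof -
  let ?f = "\<lambda>x. hop M N x (t x)"
  define S where "S i = {j \<in> {0..<N}. t (i, j) \<noteq> EdgeI}" for i
  define d where "d i j = (if odd i then (if t (i, j) = EdgeII then 1 else 0)
      else (if t (i, j) = EdgeIII then 1 else (0::int)))" for i j
  define v where "v i j = snd (?f (i, j))" for i j
  define Mv where "Mv = {x \<in> X. t x \<noteq> EdgeI}"
  define W where "W i = (if odd i then (if N - 1 \<in> S i \<and> d i (N - 1) = 1 then 1 else 0)
      else - (if 0 \<in> S i \<and> d i 0 = 1 then 1 else (0::int)))" for i
  have S: "S i \<subseteq> {0..<N}" "finite (S i)" for i
    unfolding S_def by (auto intro: finite_subset[of _ "{0..<N}"])
  have finX: "finite X" unfolding X_def by auto
  have fixed: "?f x = x" if "t x = EdgeI" for x using that by (cases x) auto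
  have moved: "?f (i, j) = ((i - 1) mod M, v i j)" if "t (i, j) \<noteq> EdgeI" for i j
    using that by (cases "t (i, j)") (auto simp: v_def)
  have v: "v i j = (if odd i then (j + d i j) mod N else (j - d i j) mod N)" if "t (i, j) \<noteq> EdgeI" for i j
    using that by (cases "t (i, j)") (auto simp: v_def d_def)
  have bij_fix: "bij_betw ?f (X - Mv) (X - Mv)"
    by (rule bij_betw_cong[THEN iffD2, of _ _ id]) (auto simp: Mv_def fixed)
  have bijMv: "bij_betw ?f Mv Mv"
  proof -
    have inj: "inj_on ?f Mv" using bij by (auto simp: bij_betw_def Mv_def inj_on_subset)
    \<comment> \<open>An image of type I would itself be a fixed point, hence would have two
      preimages.\<close>
    have "?f x \<in> Mv" if "x \<in> Mv" for x
    proof (rule ccontr)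
      assume n: "?f x \<notin> Mv"
      have x: "x \<in> X" using that by (simp add: Mv_def)
      have fx: "?f x \<in> X" using bij x by (auto simp: bij_betw_def)
      then have "t (?f x) = EdgeI" using n by (simp add: Mv_def)
      then have "?f (?f x) = ?f x" by (rule fixed)
      then have "?f x = x" using bij x fx by (auto simp: bij_betw_def inj_on_def)
      then show False using that n by simp
    qed
    moreover have "finite Mv" using finX by (simp add: Mv_def)
    ultimately show ?thesis unfolding bij_betw_def using inj endo_inj_surj[of Mv ?f] by blast
  qed
  have Mv_eq: "(i, j) \<in> Mv \<longleftrightarrow> i \<in> {0..<M} \<and> j \<in> S i" for i j
    by (auto simp: Mv_def X_def S_def)
  have col: "bij_betw (v i) (S i) (S ((i - 1) mod M))" if i: "i \<in> {0..<M}" for i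
    unfolding bij_betw_def
  proof
    show "inj_on (v i) (S i)"
    proof (rule inj_onI)
      fix j k assume jk: "j \<in> S i" "k \<in> S i" "v i j = v i k"
      then have "?f (i, j) = ?f (i, k)" using moved by (simp add: S_def)
      moreover have "(i, j) \<in> Mv" "(i, k) \<in> Mv" using jk i by (auto simp: Mv_eq)
      ultimately show "j = k" using bijMv by (auto simp: bij_betw_def inj_on_def)
    qed
    show "v i ` S i = S ((i - 1) mod M)"
    proof safe
      fix j assume j: "j \<in> S i"
      then have "?f (i, j) \<in> Mv" using bijMv i Mv_eq by (auto simp: bij_betw_def)
      then show "v i j \<in> S ((i - 1) mod M)" using moved[of i j] j by (simp add: S_def Mv_eq)
    next
      fix k assume "k \<in> S ((i - 1) mod M)"
      then have "((i - 1) mod M, k) \<in> Mv" using M by (simp add: Mv_eq)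
      then have "((i - 1) mod M, k) \<in> ?f ` Mv" using bijMv by (simp add: bij_betw_def)
      then obtain i' j' where x: "(i', j') \<in> Mv" "?f (i', j') = ((i - 1) mod M, k)"
        by (metis (no_types, lifting) imageE surj_pair)
      have t': "t (i', j') \<noteq> EdgeI" using x(1) by (simp add: Mv_def)
      have "(i' - 1) mod M = (i - 1) mod M" using x(2) moved[OF t'] by simp
      then have "(i' - 1 + 1) mod M = (i - 1 + 1) mod M" by (metis mod_add_left_eq)
      then have "i' = i" using i x(1) by (simp add: Mv_eq)
      then show "k \<in> v i ` S i" using x moved[OF t'] by (auto simp: Mv_eq)
    qed
  qed
  define K where "K = card (S 0)"
  have cardS: "card (S i) = K" if "i \<in> {0..<M}" for i
  proof -
    have "card (S (int k)) = K" if "int k < M" for k using that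
    proof (induction k)
      case (Suc k)
      have "bij_betw (v (int (Suc k))) (S (int (Suc k))) (S ((int (Suc k) - 1) mod M))"
        using Suc.prems by (intro col) auto
      moreover have "(int (Suc k) - 1) mod M = int k" using Suc.prems by simp
      ultimately show ?case using Suc by (simp add: bij_betw_same_card)
    qed (simp add: K_def)
    from this[of "nat i"] that show ?thesis by simp
  qed
  have step: "rank_in (S ((i - 1) mod M)) (v i j) = (rank_in (S i) j + W i) mod int K"
    if i: "i \<in> {0..<M}" and j: "j \<in> S i" for i j
  proof (cases "odd i")
    case True
    have "rank_in (S ((i - 1) mod M)) (v i j)
      = (rank_in (S i) j + (if N - 1 \<in> S i \<and> d i (N - 1) = 1 then 1 else 0)) mod int (card (S i))"
      by (rule rank_in_step[OF S(1) col[OF i] S(1) _ _ j]) (use True v in \<open>auto simp: d_def S_def\<close>)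
    then show ?thesis using True cardS[OF i] by (simp add: W_def)
  next
    case False
    have "rank_in (S ((i - 1) mod M)) (v i j)
      = (rank_in (S i) j - (if 0 \<in> S i \<and> d i 0 = 1 then 1 else 0)) mod int (card (S i))"
      by (rule rank_in_step_down[OF S(1) col[OF i] S(1) _ _ j]) (use False v in \<open>auto simp: d_def S_def\<close>)
    then show ?thesis using False cardS[OF i] by (simp add: W_def)
  qed
  have seam: "card {x \<in> X. crosses_seam x (t x)} = K"
  proof -
    have "bij_betw (Pair 0) (S 0) {x \<in> X. crosses_seam x (t x)}"
      using M by (auto simp: bij_betw_def inj_on_def X_def crosses_seam_def S_def image_iff)
    then show ?thesis unfolding K_def by (metis bij_betw_same_card)
  qed
  have wrap: "(\<Sum>i\<in>{0..<M}. nat \<bar>W i\<bar>) = card {x \<in> X. wraps N x (t x)}"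
  proof -
    have W1: "nat \<bar>W i\<bar> = card {j \<in> {0..<N}. wraps N (i, j) (t (i, j))}" if "i \<in> {0..<M}" for i
    proof (cases "odd i")
      case True
      have "{j \<in> {0..<N}. wraps N (i, j) (t (i, j))} = (if t (i, N - 1) = EdgeII then {N - 1} else {})"
        using True N by (auto simp: wraps_def)
      then show ?thesis using True N by (auto simp: W_def d_def S_def)
    next
      case False
      have "{j \<in> {0..<N}. wraps N (i, j) (t (i, j))} = (if t (i, 0) = EdgeIII then {0} else {})"
        using False N by (auto simp: wraps_def)
      then show ?thesis using False N by (auto simp: W_def d_def S_def)
    qed
    have "card {x \<in> X. wraps N x (t x)} = card (SIGMA i:{0..<M}. {j \<in> {0..<N}. wraps N (i, j) (t (i, j))})"
      by (rule arg_cong[where f = card]) (auto simp: X_def)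
    also have "\<dots> = (\<Sum>i\<in>{0..<M}. card {j \<in> {0..<N}. wraps N (i, j) (t (i, j))})"
      by (rule card_SigmaI) (auto intro: finite_subset[of _ "{0..<N}"])
    finally show ?thesis using W1 by simp
  qed
  have "sign_on X ?f = sign_on (Mv \<union> (X - Mv)) ?f"
    by (rule arg_cong[where f = "\<lambda>A. sign_on A ?f"]) (auto simp: Mv_def)
  also have "\<dots> = sign_on Mv ?f * sign_on (X - Mv) ?f"
    by (rule sign_on_Un_disjoint[OF _ _ _ bijMv bij_fix]) (use finX in \<open>auto simp: Mv_def\<close>)
  also have "sign_on (X - Mv) ?f = sign_on (X - Mv) id"
    by (rule sign_on_cong) (auto simp: Mv_def fixed)
  finally have red: "sign_on X ?f = sign_on Mv ?f" by simp
  \<comment> \<open>The smaller torus has \<open>K\<close> sites per column, so the shift argument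
    applies only if there are moved cells.\<close>
  show ?thesis
  proof (cases "K = 0")
    case True
    then have "S i = {}" if "i \<in> {0..<M}" for i using cardS[OF that] S(2)[of i] by simp
    then have e: "Mv = {}" using Mv_eq by auto
    then have "{x \<in> X. wraps N x (t x)} = {}" by (auto simp: wraps_def Mv_def)
    moreover have "sign_on Mv ?f = 1"
      unfolding e sign_on_def by (metis permutes_empty permutes_restrict_id sign_id bij_betw_def inj_on_empty image_empty)
    ultimately show ?thesis using red seam True by (simp only: card.empty mult_0_right power_0 add_0_left)
  next
    case False
    let ?e = "\<lambda>(i, j). (i, rank_in (S i) j)"
    have e: "bij_betw ?e Mv ({0..<M} \<times> {0..<int K})"
      unfolding bij_betw_def
    proof
      have b: "bij_betw (rank_in (S i)) (S i) {0..<int K}" if "i \<in> {0..<M}" for i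
        using bij_betw_rank_in[OF S(2)] cardS[OF that] by metis
      show "inj_on ?e Mv"
        using b by (auto simp: inj_on_def Mv_eq bij_betw_def)
      show "?e ` Mv = {0..<M} \<times> {0..<int K}"
      proof safe
        fix i j assume "(i, j) \<in> Mv"
        then show "i \<in> {0..<M}" "rank_in (S i) j \<in> {0..<int K}"
          using b[of i] by (auto simp: Mv_eq bij_betw_def)
      next
        fix i k assume i: "i \<in> {0..<M}" and k: "k \<in> {0..<int K}"
        then obtain j where "j \<in> S i" "k = rank_in (S i) j"
          using b[OF i] by (metis bij_betw_def imageE)
        then have "(i, j) \<in> Mv" "(i, k) = ?e (i, j)" using i by (auto simp: Mv_eq)
        then show "(i, k) \<in> ?e ` Mv" by (rule rev_image_eqI)
      qed
    qed
    have "sign_on ({0..<M} \<times> {0..<int K}) (\<lambda>(i, k). ((i - 1) mod M, (k + W i) mod int K)) = sign_on Mv ?f"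
    proof (rule sign_on_transfer[OF _ bijMv e])
      show "finite Mv" using finX by (simp add: Mv_def)
      fix x assume x: "x \<in> Mv"
      obtain i j where ij: "x = (i, j)" by (cases x)
      have "t (i, j) \<noteq> EdgeI" "i \<in> {0..<M}" "j \<in> S i" using x by (auto simp: ij Mv_eq S_def)
      then show "(case ?e x of (i, k) \<Rightarrow> ((i - 1) mod M, (k + W i) mod int K)) = ?e (?f x)"
        using moved[of i j] step[of i j] by (simp add: ij)
    qed
    moreover have "W i \<in> {-1, 0, 1}" for i by (simp add: W_def)
    ultimately have "sign_on X ?f = (- 1) ^ ((nat M - 1) * nat (int K) + (nat (int K) - 1) * (\<Sum>i\<in>{0..<M}. nat \<bar>W i\<bar>))"
      using sign_on_torus_shift[of M "int K" W] M False red by simp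
    moreover have "(- 1 :: int) ^ ((nat M - 1) * K) = (- 1) ^ K"
    proof -
      have "odd (nat M - 1)" using M by (simp add: even_nat_iff)
      then show ?thesis by (simp add: power_mult)
    qed
    \<comment> \<open>\<open>K - 1\<close> is traded for \<open>K + 1\<close> of the same parity;
      this form also covers \<open>K = 0\<close>, where truncated subtraction would
      interfere.\<close>
    moreover have "(- 1 :: int) ^ ((K - 1) * c) = (- 1) ^ ((K + 1) * c)" for c
      using False by (cases "even K") (simp_all add: uminus_power_if)
    ultimately show ?thesis by (simp add: wrap seam power_add)
  qed
qed

subsection \<open>Diagonalising the twisted determinants\<close>

text \<open>From \<open>A * F = F * D\<close> the factor \<open>det F\<close> can be cancelled, and
  \<open>G * F\<close> being a nonzero multiple of the identity shows
  \<open>det F \<noteq> 0\<close>. The eigenvectors are thus certified by an explicit dual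
  family.\<close>

lemma det_eigenbasis:
  fixes A F G :: "complex mat"
  assumes A: "A \<in> carrier_mat d d" and F: "F \<in> carrier_mat d d" and G: "G \<in> carrier_mat d d"
    and eig: "\<And>i k. i < d \<Longrightarrow> k < d \<Longrightarrow> (\<Sum>j<d. A $$ (i, j) * F $$ (j, k)) = l k * F $$ (i, k)"
    and inv: "\<And>k k'. k < d \<Longrightarrow> k' < d \<Longrightarrow> (\<Sum>i<d. G $$ (k, i) * F $$ (i, k')) = (if k = k' then C else 0)"
    and C: "C \<noteq> 0"
  shows "det A = (\<Prod>k<d. l k)"
proof -
  define D where "D f = mat d d (\<lambda>(i, j). if i = j then f i else 0 :: complex)" for f
  have D: "D f \<in> carrier_mat d d" for f by (simp add: D_def)
  have detD: "det (D f) = (\<Prod>k<d. f k)" for f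
  proof -
    have "upper_triangular (D f)" by (auto simp: D_def upper_triangular_def)
    then have "det (D f) = prod_list (diag_mat (D f))" using D by (rule det_upper_triangular)
    also have "\<dots> = (\<Prod>k<d. f k)"
      unfolding prod_list_diag_prod by (auto simp: D_def atLeast0LessThan intro!: prod.cong)
    finally show ?thesis .
  qed
  have "A * F = F * D l"
  proof (rule eq_matI)
    fix i k assume "i < dim_row (F * D l)" "k < dim_col (F * D l)"
    then have ik: "i < d" "k < d" using F by (auto simp: D_def)
    have "(A * F) $$ (i, k) = (\<Sum>j<d. A $$ (i, j) * F $$ (j, k))"
      using ik A F by (auto simp: scalar_prod_def atLeast0LessThan intro!: sum.cong)
    also have "\<dots> = F $$ (i, k) * l k" using eig[OF ik] by simp
    also have "\<dots> = (\<Sum>j<d. F $$ (i, j) * (if j = k then l j else 0))"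
      using ik by (simp add: if_distrib[of "\<lambda>x. _ * x"] cong: if_cong)
    also have "\<dots> = (F * D l) $$ (i, k)"
      using ik F by (auto simp: scalar_prod_def D_def atLeast0LessThan intro!: sum.cong)
    finally show "(A * F) $$ (i, k) = (F * D l) $$ (i, k)" .
  qed (use A F in \<open>auto simp: D_def\<close>)
  then have AF: "det A * det F = det F * det (D l)"
    using det_mult[OF A F] det_mult[OF F D[of l]] by metis
  have "G * F = D (\<lambda>_. C)"
  proof (rule eq_matI)
    fix i k assume "i < dim_row (D (\<lambda>_. C))" "k < dim_col (D (\<lambda>_. C))"
    then have ik: "i < d" "k < d" by (auto simp: D_def)
    have "(G * F) $$ (i, k) = (\<Sum>j<d. G $$ (i, j) * F $$ (j, k))"
      using ik G F by (auto simp: scalar_prod_def atLeast0LessThan intro!: sum.cong)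
    then show "(G * F) $$ (i, k) = D (\<lambda>_. C) $$ (i, k)"
      using inv[OF ik] ik by (simp add: D_def)
  qed (use G F in \<open>auto simp: D_def\<close>)
  then have "det G * det F = C ^ d"
    using det_mult[OF G F] detD[of "\<lambda>_. C"] by simp
  then have "det F \<noteq> 0" using C by auto
  then show ?thesis using AF detD[of l] by simp
qed

text \<open>Each row is expanded over edge types rather than over target cells, so that parallel
  edges are counted separately. What remains is a sum over functions from cells to types, that is,
  over a choice of one edge at every white vertex.\<close>

lemma leibniz_hops:
  fixes h :: "'a \<Rightarrow> 't \<Rightarrow> 'a" and w :: "'a \<Rightarrow> 't \<Rightarrow> complex"
  assumes X: "finite X" and T: "finite T" and e: "bij_betw e {0..<d} X"
  shows "det (mat d d (\<lambda>(i, j). \<Sum>t\<in>T. if h (e i) t = e j then w (e i) t else 0))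
    = (\<Sum>f\<in>X \<rightarrow>\<^sub>E T. if bij_betw (\<lambda>x. h x (f x)) X X
         then of_int (sign_on X (\<lambda>x. h x (f x))) * (\<Prod>x\<in>X. w x (f x)) else 0)"
proof -
  let ?D = "{0..<d}"
  let ?P = "{p. p permutes ?D}"
  let ?c = "\<lambda>p f i. if h (e i) (f (e i)) = e (p i) then 1 else 0 :: complex"
  have finP: "finite ?P" by (simp add: finite_permutations)
  have inv_e: "inv_into ?D e (e i) = i" if "i < d" for i
    using e that by (simp add: bij_betw_def)
  have e_inv: "e (inv_into ?D e x) = x" if "x \<in> X" for x
    using e that by (auto simp: bij_betw_def f_inv_into_f)
  have inv_less: "inv_into ?D e x < d" if "x \<in> X" for x
    using inv_into_into[of x e ?D] e that by (simp add: bij_betw_def)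
  have prod_e: "(\<Prod>i\<in>?D. g (e i)) = (\<Prod>x\<in>X. g x)" for g :: "'a \<Rightarrow> complex"
    using e by (rule prod.reindex_bij_betw)
  have expand: "(\<Prod>i\<in>?D. \<Sum>t\<in>T. if h (e i) t = e (p i) then w (e i) t else 0)
      = (\<Sum>f\<in>X \<rightarrow>\<^sub>E T. (\<Prod>x\<in>X. w x (f x)) * (\<Prod>i\<in>?D. ?c p f i))" if p: "p permutes ?D" for p
  proof -
    have "(\<Prod>i\<in>?D. \<Sum>t\<in>T. if h (e i) t = e (p i) then w (e i) t else 0)
      = (\<Prod>i\<in>?D. \<Sum>t\<in>T. if h (e i) t = e (p (inv_into ?D e (e i))) then w (e i) t else 0)"
      by (intro prod.cong) (auto simp: inv_e)
    also have "\<dots> = (\<Prod>x\<in>X. \<Sum>t\<in>T. if h x t = e (p (inv_into ?D e x)) then w x t else 0)"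
      by (rule prod_e)
    also have "\<dots> = (\<Sum>f\<in>X \<rightarrow>\<^sub>E T. \<Prod>x\<in>X. if h x (f x) = e (p (inv_into ?D e x)) then w x (f x) else 0)"
      using X T by (subst prod_sum_PiE) auto
    also have "\<dots> = (\<Sum>f\<in>X \<rightarrow>\<^sub>E T. (\<Prod>x\<in>X. w x (f x)) * (\<Prod>x\<in>X. if h x (f x) = e (p (inv_into ?D e x)) then 1 else 0))"
      by (intro sum.cong refl, subst prod.distrib[symmetric]) (auto intro!: prod.cong)
    also have "\<dots> = (\<Sum>f\<in>X \<rightarrow>\<^sub>E T. (\<Prod>x\<in>X. w x (f x)) * (\<Prod>i\<in>?D. ?c p f i))"
      by (intro sum.cong refl arg_cong2[where f = times], subst prod_e[symmetric])
         (auto intro!: prod.cong simp: inv_e)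
    finally show ?thesis .
  qed
  \<comment> \<open>For a fixed choice \<open>f\<close> at most one permutation contributes, namely
    the map induced by \<open>f\<close> transported along \<open>e\<close>; if that map is not
    bijective, every permutation has a vanishing factor.\<close>
  have inner: "(\<Sum>p\<in>?P. of_int (sign p) * (\<Prod>i\<in>?D. ?c p f i))
      = (if bij_betw (\<lambda>x. h x (f x)) X X then of_int (sign_on X (\<lambda>x. h x (f x))) else 0)"
    (is "?L = ?R") for f
  proof -
    let ?H = "\<lambda>x. h x (f x)"
    let ?q = "\<lambda>i. inv_into ?D e (?H (e i))"
    have zero: "(\<Prod>i\<in>?D. ?c p f i) = 0" if "p \<in> ?P" "\<not> (\<forall>i\<in>?D. ?H (e i) = e (p i))" for p
      using that by auto
    show ?thesis
    proof (cases "bij_betw ?H X X")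
      case True
      have q: "bij_betw ?q ?D ?D"
        using bij_betw_trans[OF bij_betw_trans[OF e True] bij_betw_inv_into[OF e]] by (simp add: o_def)
      define p0 where "p0 = restrict_id ?q ?D"
      have p0: "p0 permutes ?D" unfolding p0_def using q by (rule permutes_restrict_id)
      have HX: "?H (e i) \<in> X" if "i < d" for i using True e that by (auto simp: bij_betw_def)
      have p0e: "?H (e i) = e (p0 i)" if "i < d" for i
        using e_inv[OF HX[OF that]] that by (simp add: p0_def)
      have uniq: "p = p0" if "p \<in> ?P" "\<forall>i\<in>?D. ?H (e i) = e (p i)" for p
      proof
        fix i
        show "p i = p0 i"
        proof (cases "i < d")
          case True
          then have "e (p i) = e (p0 i)" using p0e that(2) by auto
          moreover have "p i \<in> ?D" "p0 i \<in> ?D" using that(1) p0 True by (auto simp: permutes_in_image simp del: atLeastLessThan_iff) (auto simp: permutes_in_image)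
          ultimately show ?thesis using e by (auto simp: bij_betw_def inj_on_def)
        next
          case False
          then show ?thesis using that(1) p0 by (auto simp: permutes_not_in)
        qed
      qed
      have "?L = (\<Sum>p\<in>?P. if p = p0 then of_int (sign p0) else 0)"
      proof (intro sum.cong refl)
        fix p assume p: "p \<in> ?P"
        show "of_int (sign p) * (\<Prod>i\<in>?D. ?c p f i) = (if p = p0 then of_int (sign p0) else 0)"
        proof (cases "p = p0")
          case True
          then show ?thesis using p0e by simp
        next
          case False
          then have "(\<Prod>i\<in>?D. ?c p f i) = 0" using zero[OF p] uniq[OF p] by blast
          then show ?thesis using False by (metis mult_zero_right)
        qed
      qed
      also have "\<dots> = of_int (sign p0)" using p0 finP by simp
      also have "sign p0 = sign_on X ?H"
        unfolding p0_def sign_on_def[symmetric]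
        by (rule sign_on_transfer[symmetric, OF _ q e]) (use e_inv HX in auto)
      finally show ?thesis using True by simp
    next
      case False
      have "(\<Prod>i\<in>?D. ?c p f i) = 0" if p: "p \<in> ?P" for p
      proof (rule zero[OF p], rule notI)
        assume *: "\<forall>i\<in>?D. ?H (e i) = e (p i)"
        have "bij_betw (e \<circ> p \<circ> inv_into ?D e) X X"
          using bij_betw_trans[OF bij_betw_trans[OF bij_betw_inv_into[OF e] permutes_imp_bij[of p ?D]] e] p
          by (simp add: o_assoc)
        moreover have "(e \<circ> p \<circ> inv_into ?D e) x = ?H x" if "x \<in> X" for x
          using *[rule_format, of "inv_into ?D e x"] e_inv[OF that] inv_less[OF that] by simp
        ultimately have "bij_betw ?H X X" by (subst bij_betw_cong[of X ?H "e \<circ> p \<circ> inv_into ?D e"]) auto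
        then show False using False by simp
      qed
      then show ?thesis using False by (simp del: prod_zero_iff)
    qed
  qed
  have perm_less: "p i < d" if "p permutes ?D" "i < d" for p i
    using permutes_in_image[OF that(1), of i] that(2) by simp
  have "det (mat d d (\<lambda>(i, j). \<Sum>t\<in>T. if h (e i) t = e j then w (e i) t else 0))
    = (\<Sum>p\<in>?P. of_int (sign p) * (\<Prod>i\<in>?D. \<Sum>t\<in>T. if h (e i) t = e (p i) then w (e i) t else 0))"
    by (subst det_def'[of _ d]) (auto intro!: sum.cong prod.cong arg_cong2[where f = times] simp: perm_less)
  also have "\<dots> = (\<Sum>p\<in>?P. \<Sum>f\<in>X \<rightarrow>\<^sub>E T. (\<Prod>x\<in>X. w x (f x)) * (of_int (sign p) * (\<Prod>i\<in>?D. ?c p f i)))"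
    using expand by (intro sum.cong refl) (simp add: sum_distrib_left mult_ac)
  also have "\<dots> = (\<Sum>f\<in>X \<rightarrow>\<^sub>E T. (\<Prod>x\<in>X. w x (f x)) * (\<Sum>p\<in>?P. of_int (sign p) * (\<Prod>i\<in>?D. ?c p f i)))"
    by (subst sum.swap) (simp add: sum_distrib_left)
  also have "\<dots> = (\<Sum>f\<in>X \<rightarrow>\<^sub>E T. (\<Prod>x\<in>X. w x (f x)) * (if bij_betw (\<lambda>x. h x (f x)) X X then of_int (sign_on X (\<lambda>x. h x (f x))) else 0))"
    by (simp only: inner)
  also have "\<dots> = (\<Sum>f\<in>X \<rightarrow>\<^sub>E T. if bij_betw (\<lambda>x. h x (f x)) X X
         then of_int (sign_on X (\<lambda>x. h x (f x))) * (\<Prod>x\<in>X. w x (f x)) else 0)"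
    by (intro sum.cong refl) auto
  finally show ?thesis .
qed

section \<open>Roots of unity and plane waves on the twisted torus\<close>

definition unity_root :: "nat \<Rightarrow> complex" where "unity_root M = cis (2 * pi / real M)"

lemma unity_root_nonzero [simp]: "unity_root M \<noteq> 0"
  by (simp add: unity_root_def)

lemma unity_root_power: "unity_root M ^ r = cis (2 * pi * real r / real M)"
  unfolding unity_root_def Complex.DeMoivre by (simp add: mult_ac)

lemma inj_unity_root_power: "M > 0 \<Longrightarrow> inj_on (\<lambda>r. unity_root M ^ r) {..<M}"
  using Complex.bij_betw_roots_unity[of M] by (simp add: unity_root_power bij_betw_def)

lemma unity_root_power_self: "M > 0 \<Longrightarrow> unity_root M ^ M = 1"
  by (simp add: unity_root_power)

text \<open>Two monic polynomials of degree \<open>M\<close> that agree at \<open>M\<close> distinct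
  points coincide; the homogeneous form follows by scaling with \<open>y\<close>, the case
  \<open>y = 0\<close> being separate.\<close>

lemma prod_unity_roots:
  assumes M: "M > 0"
  shows "(\<Prod>r<M. x - y * unity_root M ^ r) = x ^ M - y ^ M"
proof (cases "y = 0")
  case True
  then show ?thesis using M by (simp add: zero_power)
next
  case False
  let ?p = "\<Prod>r<M. [:- (unity_root M ^ r), 1:]"
  let ?q = "monom 1 M - 1 :: complex poly"
  have *: "?p = ?q"
  proof (rule poly_eqI_degree_lead_coeff[where n = M and A = "(\<lambda>r. unity_root M ^ r) ` {..<M}"])
    show "degree ?p \<le> M" using degree_prod_sum_le[of "{..<M}" "\<lambda>r. [:- (unity_root M ^ r), 1:]"] by (simp add: o_def)
    show "degree ?q \<le> M" by (intro degree_diff_le) (auto simp: degree_monom_le)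
    have "degree ?p = M" by (subst degree_prod_eq_sum_degree) auto
    moreover have "lead_coeff ?p = 1" by (simp add: lead_coeff_prod)
    ultimately show "coeff ?p M = coeff ?q M" using M by simp
    show "card ((\<lambda>r. unity_root M ^ r) ` {..<M}) \<ge> M"
      using inj_unity_root_power[OF M] by (simp add: card_image)
    fix z assume "z \<in> (\<lambda>r. unity_root M ^ r) ` {..<M}"
    then obtain r where r: "r < M" "z = unity_root M ^ r" by auto
    have "poly ?p z = 0" using r by (auto simp: poly_prod)
    moreover have "z ^ M = 1" using unity_root_power_self[OF M] r by (simp add: power_mult[symmetric] mult.commute) (metis mult.commute power_mult power_one)
    ultimately show "poly ?p z = poly ?q z" by (simp add: poly_monom)
  qed
  have "(\<Prod>r<M. x - y * unity_root M ^ r) = (\<Prod>r<M. y * (x / y - unity_root M ^ r))"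
    using False by (intro prod.cong) (auto simp: field_simps)
  also have "\<dots> = y ^ M * poly ?p (x / y)"
    by (simp add: prod.distrib poly_prod)
  also have "\<dots> = y ^ M * ((x / y) ^ M - 1)" unfolding * by (simp add: poly_monom)
  also have "\<dots> = x ^ M - y ^ M" using False by (simp add: field_simps)
  finally show ?thesis .
qed

lemma sum_unity_root_quotient:
  assumes "r < N" "s < N"
  shows "(\<Sum>j\<in>{0..<int N}. (unity_root N ^ r / unity_root N ^ s) powi j) = (if r = s then of_nat N else 0)"
proof -
  let ?z = "unity_root N ^ r / unity_root N ^ s"
  have "(\<Sum>j\<in>{0..<int N}. ?z powi j) = (\<Sum>j<N. ?z ^ j)"
    by (rule sum.reindex_bij_witness[where i = int and j = nat]) (auto simp: power_int_def)
  moreover have "?z \<noteq> 1" if "r \<noteq> s"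
    using inj_unity_root_power[of N] assms that by (auto simp: inj_on_def)
  moreover have "?z ^ N = 1" using unity_root_power_self[of N] assms
    by (simp add: power_divide power_mult[symmetric] mult.commute[of _ N]) (simp add: power_mult)
  ultimately show ?thesis by (auto simp: geometric_sum)
qed

lemma UNIV_edge_type: "(UNIV :: edge_type set) = {EdgeI, EdgeII, EdgeIII}"
  using edge_type.exhaust by auto

lemma finite_edge_type: "finite (UNIV :: edge_type set)"
  by (simp add: UNIV_edge_type)

lemma sum_edge_type: "(\<Sum>t\<in>UNIV. g t) = g EdgeI + g EdgeII + g EdgeIII" for g :: "edge_type \<Rightarrow> complex"
  by (simp add: UNIV_edge_type)

definition torus_cells :: "nat \<Rightarrow> nat \<Rightarrow> (int \<times> int) set" where
  "torus_cells m n = {0..<2 * int m} \<times> {0..<int n}"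

definition twisted_weight :: "nat \<Rightarrow> (edge_type \<Rightarrow> complex) \<Rightarrow> complex \<Rightarrow> complex \<Rightarrow> int \<times> int \<Rightarrow> edge_type \<Rightarrow> complex" where
  "twisted_weight n v \<epsilon>1 \<epsilon> x t =
     v t * (if crosses_seam x t then \<epsilon>1 else 1) * (if wraps (int n) x t then \<epsilon> else 1)"

text \<open>A matching is encoded by the type of the edge at each white cell; bijectivity of the
  induced map says that every black cell is covered once. Extensional functions make the encoding
  unique and the set finite.\<close>

definition hop_matchings :: "nat \<Rightarrow> nat \<Rightarrow> (int \<times> int \<Rightarrow> edge_type) set" where
  "hop_matchings m n = {f \<in> torus_cells m n \<rightarrow>\<^sub>E UNIV.
     bij_betw (\<lambda>x. hop (2 * int m) (int n) x (f x)) (torus_cells m n) (torus_cells m n)}"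

definition twisted_sum :: "nat \<Rightarrow> nat \<Rightarrow> (edge_type \<Rightarrow> complex) \<Rightarrow> complex \<Rightarrow> complex \<Rightarrow> complex" where
  "twisted_sum m n v \<epsilon>1 \<epsilon> = (\<Sum>f\<in>hop_matchings m n.
     of_int (sign_on (torus_cells m n) (\<lambda>x. hop (2 * int m) (int n) x (f x))) *
     (\<Prod>x\<in>torus_cells m n. twisted_weight n v \<epsilon>1 \<epsilon> x (f x)))"

lemma finite_torus_cells: "finite (torus_cells m n)"
  by (simp add: torus_cells_def)

text \<open>With \<open>K\<close> seam crossings and \<open>W\<close> wraps a twist contributes
  \<open>\<epsilon>1 ^ K * \<epsilon> ^ W\<close>, while the sign is
  \<open>(-1) ^ (K + (K + 1) * W)\<close>. The half sum of \<open>(-1) ^ K\<close>,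
  \<open>- 1\<close>, \<open>(-1) ^ (K + W)\<close> and \<open>(-1) ^ W\<close> equals that sign for
  all four parities, which undoes it. The only sector with a minus sign is the untwisted
  one.\<close>

lemma untwisted_sum:
  assumes m: "m > 0" and n: "n > 0"
  shows "(\<Sum>f\<in>hop_matchings m n. \<Prod>x\<in>torus_cells m n. v (f x))
    = (twisted_sum m n v (-1) 1 - twisted_sum m n v 1 1
       + twisted_sum m n v (-1) (-1) + twisted_sum m n v 1 (-1)) / 2"
proof -
  let ?X = "torus_cells m n"
  have tw: "(\<Prod>x\<in>?X. twisted_weight n v \<epsilon>1 \<epsilon> x (f x)) = (\<Prod>x\<in>?X. v (f x))
      * \<epsilon>1 ^ card {x \<in> ?X. crosses_seam x (f x)} * \<epsilon> ^ card {x \<in> ?X. wraps (int n) x (f x)}" for \<epsilon>1 \<epsilon> f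
    unfolding twisted_weight_def prod.distrib
    by (simp add: prod.If_cases finite_torus_cells Int_def)
  have "(\<Prod>x\<in>?X. v (f x)) =
     (let s = complex_of_int (sign_on ?X (\<lambda>x. hop (2 * int m) (int n) x (f x)));
          p = (\<lambda>\<epsilon>1 \<epsilon>. s * (\<Prod>x\<in>?X. twisted_weight n v \<epsilon>1 \<epsilon> x (f x)))
      in (p (-1) 1 - p 1 1 + p (-1) (-1) + p 1 (-1)) / 2)" if f: "f \<in> hop_matchings m n" for f
  proof -
    define K where "K = card {x \<in> ?X. crosses_seam x (f x)}"
    define W where "W = card {x \<in> ?X. wraps (int n) x (f x)}"
    have s: "sign_on ?X (\<lambda>x. hop (2 * int m) (int n) x (f x)) = (- 1) ^ (K + (K + 1) * W)"
      unfolding K_def W_def torus_cells_def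
      by (rule sign_on_hop) (use m n f in \<open>auto simp: hop_matchings_def torus_cells_def\<close>)
    show ?thesis
      unfolding s tw Let_def K_def[symmetric] W_def[symmetric]
      by (cases "even K"; cases "even W") (simp_all add: uminus_power_if)
  qed
  then have "(\<Sum>f\<in>hop_matchings m n. \<Prod>x\<in>?X. v (f x)) =
    (\<Sum>f\<in>hop_matchings m n. (let s = complex_of_int (sign_on ?X (\<lambda>x. hop (2 * int m) (int n) x (f x)));
          p = (\<lambda>\<epsilon>1 \<epsilon>. s * (\<Prod>x\<in>?X. twisted_weight n v \<epsilon>1 \<epsilon> x (f x)))
      in (p (-1) 1 - p 1 1 + p (-1) (-1) + p 1 (-1)) / 2))"
    by (rule sum.cong[OF refl])
  also have "\<dots> = (twisted_sum m n v (-1) 1 - twisted_sum m n v 1 1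
       + twisted_sum m n v (-1) (-1) + twisted_sum m n v 1 (-1)) / 2"
    by (simp add: Let_def twisted_sum_def sum.distrib sum_subtractf sum_divide_distrib[symmetric])
  finally show ?thesis .
qed

lemma hop_in_torus_cells:
  "m > 0 \<Longrightarrow> n > 0 \<Longrightarrow> x \<in> torus_cells m n \<Longrightarrow> hop (2 * int m) (int n) x t \<in> torus_cells m n"
  by (cases x; cases t) (auto simp: torus_cells_def)

text \<open>The plane waves \<open>\<zeta>\<^sup>i \<omega>\<^sup>j\<close> in the lattice coordinates; the second coordinate is sheared so that
  the period \<open>m x\<close> becomes horizontal.\<close>

definition plane_wave :: "complex \<Rightarrow> complex \<Rightarrow> int \<times> int \<Rightarrow> complex" where
  "plane_wave \<zeta> \<omega> x = \<zeta> powi fst x * \<omega> powi (snd x - fst x div 2)"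

lemma plane_wave_hop:
  assumes m: "m > 0" and n: "n > 0" and x: "x \<in> torus_cells m n"
    and z: "\<zeta> \<noteq> 0" "\<omega> \<noteq> 0" and \<omega>: "\<omega> ^ n = \<epsilon>" and \<zeta>: "\<zeta> ^ (2 * m) = \<epsilon>1 * \<omega> ^ m"
    and e: "\<epsilon> \<in> {1, -1}" "\<epsilon>1 \<in> {1, -1}"
  shows "(\<Sum>t\<in>UNIV. twisted_weight n v \<epsilon>1 \<epsilon> x t * plane_wave \<zeta> \<omega> (hop (2 * int m) (int n) x t))
    = (v EdgeI + (v EdgeII * \<omega> + v EdgeIII) / \<zeta>) * plane_wave \<zeta> \<omega> x"
proof -
  obtain i j where ij: "x = (i, j)" by (cases x)
  have i: "0 \<le> i" "i < 2 * int m" and j: "0 \<le> j" "j < int n" using x by (auto simp: ij torus_cells_def)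
  have ep: "\<epsilon> * \<epsilon> = 1" "\<epsilon>1 * \<epsilon>1 = 1" using e by auto
  have pi: "\<omega> powi int n = \<epsilon>" using \<omega> by simp
  have col: "(if i = 0 then \<epsilon>1 else 1) * plane_wave \<zeta> \<omega> ((i - 1) mod (2 * int m), k)
      = plane_wave \<zeta> \<omega> (i - 1, k)" for k
  proof (cases "i = 0")
    case True
    have "(i - 1) mod (2 * int m) = 2 * int m - 1"
      using True m by (simp add: zmod_minus1)
    moreover have "(2 * int m - 1) div 2 = int m - 1" by simp
    moreover have "\<zeta> powi (2 * int m - 1) = \<zeta> ^ (2 * m) / \<zeta>"
    proof -
      have "\<zeta> powi (2 * int m - 1) = \<zeta> powi (int (2 * m)) / \<zeta>" using z by (simp add: power_int_diff)
      then show ?thesis by (simp only: power_int_of_nat)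
    qed
    moreover have "\<omega> powi (k - (int m - 1)) = \<omega> powi (k + 1) / \<omega> ^ m"
    proof -
      have "\<omega> powi (k - (int m - 1)) = \<omega> powi ((k + 1) - int m)" by (simp add: algebra_simps)
      then show ?thesis using z by (simp add: power_int_diff)
    qed
    ultimately have "plane_wave \<zeta> \<omega> ((i - 1) mod (2 * int m), k) = \<epsilon>1 * (\<omega> powi (k + 1) / \<zeta>)"
      using z \<zeta> by (simp add: plane_wave_def)
    moreover have "plane_wave \<zeta> \<omega> (i - 1, k) = \<omega> powi (k + 1) / \<zeta>"
      using True by (simp add: plane_wave_def power_int_minus divide_inverse)
    ultimately show ?thesis using True ep by (simp flip: mult.assoc)
  qed (use i in auto)
  have up: "(if k = int n - 1 then \<epsilon> else 1) * plane_wave \<zeta> \<omega> (l, (k + 1) mod int n) = plane_wave \<zeta> \<omega> (l, k + 1)"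
    if "0 \<le> k" "k < int n" for k l
  proof (cases "k = int n - 1")
    case True
    then have "plane_wave \<zeta> \<omega> (l, k + 1) = \<epsilon> * plane_wave \<zeta> \<omega> (l, 0)"
      using z pi by (simp add: plane_wave_def power_int_diff power_int_minus divide_inverse)
    then show ?thesis using True by simp
  qed (use that in auto)
  have down: "(if k = 0 then \<epsilon> else 1) * plane_wave \<zeta> \<omega> (l, (k - 1) mod int n) = plane_wave \<zeta> \<omega> (l, k - 1)"
    if "0 \<le> k" "k < int n" for k l
  proof (cases "k = 0")
    case True
    have "plane_wave \<zeta> \<omega> (l, int n - 1) = \<epsilon> * plane_wave \<zeta> \<omega> (l, - 1)"
      using z pi by (simp add: plane_wave_def power_int_diff power_int_minus divide_inverse power_int_add)
    moreover have "(k - 1) mod int n = int n - 1" using True n by (simp add: zmod_minus1)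
    ultimately show ?thesis using True ep by (simp flip: mult.assoc)
  qed (use that in auto)
  have left: "plane_wave \<zeta> \<omega> (i - 1, j) = (if odd i then 1 else \<omega>) * plane_wave \<zeta> \<omega> (i, j) / \<zeta>"
  proof (cases "odd i")
    case True
    then have "(i - 1) div 2 = i div 2" by presburger
    then show ?thesis using True z by (simp add: plane_wave_def power_int_diff)
  next
    case False
    then have "(i - 1) div 2 = i div 2 - 1" by presburger
    moreover have "\<omega> powi (j - (i div 2 - 1)) = \<omega> * \<omega> powi (j - i div 2)"
    proof -
      have "\<omega> powi (j - (i div 2 - 1)) = \<omega> powi (1 + (j - i div 2))" by (simp add: algebra_simps)
      then show ?thesis using z by (simp add: power_int_add)
    qed
    ultimately show ?thesis using False z by (simp add: plane_wave_def power_int_diff mult_ac)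
  qed
  have vert: "plane_wave \<zeta> \<omega> (l, k + 1) = \<omega> * plane_wave \<zeta> \<omega> (l, k)"
      "plane_wave \<zeta> \<omega> (l, k - 1) = plane_wave \<zeta> \<omega> (l, k) / \<omega>" for l k
  proof -
    have "\<omega> powi (k + 1 - l div 2) = \<omega> powi (1 + (k - l div 2))" by (simp add: algebra_simps)
    then show "plane_wave \<zeta> \<omega> (l, k + 1) = \<omega> * plane_wave \<zeta> \<omega> (l, k)"
      using z by (simp add: plane_wave_def power_int_add)
    have "\<omega> powi (k - 1 - l div 2) = \<omega> powi ((k - l div 2) - 1)" by (simp add: algebra_simps)
    then show "plane_wave \<zeta> \<omega> (l, k - 1) = plane_wave \<zeta> \<omega> (l, k) / \<omega>"
      using z by (simp add: plane_wave_def power_int_diff)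
  qed
  have II: "twisted_weight n v \<epsilon>1 \<epsilon> x EdgeII * plane_wave \<zeta> \<omega> (hop (2 * int m) (int n) x EdgeII)
      = v EdgeII * \<omega> / \<zeta> * plane_wave \<zeta> \<omega> x"
  proof (cases "odd i")
    case True
    have "twisted_weight n v \<epsilon>1 \<epsilon> x EdgeII * plane_wave \<zeta> \<omega> (hop (2 * int m) (int n) x EdgeII)
      = v EdgeII * ((if j = int n - 1 then \<epsilon> else 1) * ((if i = 0 then \<epsilon>1 else 1)
          * plane_wave \<zeta> \<omega> ((i - 1) mod (2 * int m), (j + 1) mod int n)))"
      using True by (simp add: ij twisted_weight_def crosses_seam_def wraps_def)
    also have "\<dots> = v EdgeII * ((if j = int n - 1 then \<epsilon> else 1) * plane_wave \<zeta> \<omega> (i - 1, (j + 1) mod int n))"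
      unfolding col ..
    also have "\<dots> = v EdgeII * (\<omega> * plane_wave \<zeta> \<omega> (i - 1, j))"
      unfolding up[OF j] vert ..
    finally show ?thesis using True left by (simp add: ij)
  next
    case False
    have "twisted_weight n v \<epsilon>1 \<epsilon> x EdgeII * plane_wave \<zeta> \<omega> (hop (2 * int m) (int n) x EdgeII)
      = v EdgeII * ((if i = 0 then \<epsilon>1 else 1) * plane_wave \<zeta> \<omega> ((i - 1) mod (2 * int m), j))"
      using False j by (simp add: ij twisted_weight_def crosses_seam_def wraps_def)
    also have "\<dots> = v EdgeII * plane_wave \<zeta> \<omega> (i - 1, j)" unfolding col ..
    finally show ?thesis using False left by (simp add: ij)
  qed
  have III: "twisted_weight n v \<epsilon>1 \<epsilon> x EdgeIII * plane_wave \<zeta> \<omega> (hop (2 * int m) (int n) x EdgeIII)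
      = v EdgeIII / \<zeta> * plane_wave \<zeta> \<omega> x"
  proof (cases "odd i")
    case True
    have "twisted_weight n v \<epsilon>1 \<epsilon> x EdgeIII * plane_wave \<zeta> \<omega> (hop (2 * int m) (int n) x EdgeIII)
      = v EdgeIII * ((if i = 0 then \<epsilon>1 else 1) * plane_wave \<zeta> \<omega> ((i - 1) mod (2 * int m), j))"
      using True j by (simp add: ij twisted_weight_def crosses_seam_def wraps_def)
    also have "\<dots> = v EdgeIII * plane_wave \<zeta> \<omega> (i - 1, j)" unfolding col ..
    finally show ?thesis using True left by (simp add: ij)
  next
    case False
    have "twisted_weight n v \<epsilon>1 \<epsilon> x EdgeIII * plane_wave \<zeta> \<omega> (hop (2 * int m) (int n) x EdgeIII)
      = v EdgeIII * ((if j = 0 then \<epsilon> else 1) * ((if i = 0 then \<epsilon>1 else 1)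
          * plane_wave \<zeta> \<omega> ((i - 1) mod (2 * int m), (j - 1) mod int n)))"
      using False by (simp add: ij twisted_weight_def crosses_seam_def wraps_def)
    also have "\<dots> = v EdgeIII * ((if j = 0 then \<epsilon> else 1) * plane_wave \<zeta> \<omega> (i - 1, (j - 1) mod int n))"
      unfolding col ..
    also have "\<dots> = v EdgeIII * (plane_wave \<zeta> \<omega> (i - 1, j) / \<omega>)"
      unfolding down[OF j] vert ..
    finally show ?thesis using False left z by (simp add: ij)
  qed
  have I: "twisted_weight n v \<epsilon>1 \<epsilon> x EdgeI * plane_wave \<zeta> \<omega> (hop (2 * int m) (int n) x EdgeI)
      = v EdgeI * plane_wave \<zeta> \<omega> x"
    by (simp add: ij twisted_weight_def crosses_seam_def wraps_def)
  show ?thesis unfolding sum_edge_type I II III by (simp add: field_simps add_divide_distrib)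
qed

text \<open>For different \<omega> the inner sum over a column vanishes; for equal \<omega> the
  shear cancels in the quotient and the sum over \<open>i\<close> is a plain sum of powers of a root
  of unity.\<close>

lemma plane_wave_orthogonal:
  assumes n: "s < n" "s' < n" and r: "r < 2 * m" "r' < 2 * m" and w0: "w0 \<noteq> 0" and z: "\<And>s. z s \<noteq> 0"
  defines "\<omega> \<equiv> \<lambda>s. w0 * unity_root n ^ s" and "\<zeta> \<equiv> \<lambda>s r. z s * unity_root (2 * m) ^ r"
  shows "(\<Sum>x\<in>torus_cells m n. inverse (plane_wave (\<zeta> s r) (\<omega> s) x) * plane_wave (\<zeta> s' r') (\<omega> s') x)
    = (if s = s' \<and> r = r' then of_nat (2 * m * n) else 0)"
proof -
  have nz: "\<omega> s \<noteq> 0" "\<zeta> s r \<noteq> 0" for s r using w0 z by (auto simp: \<omega>_def \<zeta>_def)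
  have "(\<Sum>x\<in>torus_cells m n. inverse (plane_wave (\<zeta> s r) (\<omega> s) x) * plane_wave (\<zeta> s' r') (\<omega> s') x)
    = (\<Sum>i\<in>{0..<2 * int m}. \<Sum>j\<in>{0..<int n}. (\<zeta> s' r' / \<zeta> s r) powi i * (\<omega> s' / \<omega> s) powi (- (i div 2)) * (\<omega> s' / \<omega> s) powi j)"
    unfolding torus_cells_def sum.cartesian_product
  proof (intro sum.cong refl)
    fix x assume "x \<in> {0..<2 * int m} \<times> {0..<int n}"
    obtain i j where x: "x = (i, j)" by (cases x)
    show "inverse (plane_wave (\<zeta> s r) (\<omega> s) x) * plane_wave (\<zeta> s' r') (\<omega> s') x
      = (case x of (i, j) \<Rightarrow> (\<zeta> s' r' / \<zeta> s r) powi i * (\<omega> s' / \<omega> s) powi (- (i div 2)) * (\<omega> s' / \<omega> s) powi j)"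
      using nz by (simp add: x plane_wave_def power_int_divide_distrib power_int_diff power_int_minus field_simps)
  qed
  also have "\<dots> = (\<Sum>i\<in>{0..<2 * int m}. (\<zeta> s' r' / \<zeta> s r) powi i * (\<omega> s' / \<omega> s) powi (- (i div 2)))
      * (\<Sum>j\<in>{0..<int n}. (\<omega> s' / \<omega> s) powi j)"
    by (simp only: sum_product)
  also have "\<dots> = (if s = s' \<and> r = r' then of_nat (2 * m * n) else 0)"
  proof (cases "s = s'")
    case True
    have "\<zeta> s' r' / \<zeta> s r = unity_root (2 * m) ^ r' / unity_root (2 * m) ^ r"
      using z True by (simp add: \<zeta>_def)
    moreover have "(\<Sum>i\<in>{0..<2 * int m}. (unity_root (2 * m) ^ r' / unity_root (2 * m) ^ r) powi i)
        = (if r' = r then of_nat (2 * m) else 0)"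
      using sum_unity_root_quotient[OF r(2) r(1)] by simp
    ultimately show ?thesis using True nz by auto
  next
    case False
    have "\<omega> s' / \<omega> s = unity_root n ^ s' / unity_root n ^ s" using w0 by (simp add: \<omega>_def)
    then have "(\<Sum>j\<in>{0..<int n}. (\<omega> s' / \<omega> s) powi j) = 0"
      using sum_unity_root_quotient[OF n(2) n(1)] False by simp
    then show ?thesis using False by simp
  qed
  finally show ?thesis .
qed

text \<open>The admissible \<omega> are the \<open>n\<close> roots of \<epsilon>, and each comes
  with \<open>2 * m\<close> values of \<zeta>, all with the same power
  \<open>\<zeta> ^ (2 * m)\<close>. The product of the eigenvalues over these \<zeta> closes up by
  the factorisation of a difference of powers.\<close>

lemma twisted_sum_eq_prod:
  assumes m: "m > 0" and n: "n > 0"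
    and w0: "w0 ^ n = \<epsilon>" and e: "\<epsilon> \<in> {1, -1}" "\<epsilon>1 \<in> {1, -1}"
  shows "twisted_sum m n v \<epsilon>1 \<epsilon> = (\<Prod>s<n. v EdgeI ^ (2 * m)
     - \<epsilon>1 * ((v EdgeII * (w0 * unity_root n ^ s) + v EdgeIII)\<^sup>2 / (w0 * unity_root n ^ s)) ^ m)"
proof -
  let ?X = "torus_cells m n"
  let ?K = "{..<n} \<times> {..<2 * m}"
  define \<omega> where "\<omega> s = w0 * unity_root n ^ s" for s
  have w0nz: "w0 \<noteq> 0" using w0 e n by (auto simp: zero_power)
  have \<omega>nz: "\<omega> s \<noteq> 0" for s using w0nz by (simp add: \<omega>_def)
  have \<omega>n: "\<omega> s ^ n = \<epsilon>" for s
  proof -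
    have "(unity_root n ^ s) ^ n = (unity_root n ^ n) ^ s" by (simp add: power_mult[symmetric] mult.commute)
    then show ?thesis using w0 unity_root_power_self[OF n] by (simp add: \<omega>_def power_mult_distrib)
  qed
  have "\<exists>z. z ^ (2 * m) = \<epsilon>1 * \<omega> s ^ m" for s
    using exists_complex_root[of "2 * m" "\<epsilon>1 * \<omega> s ^ m"] m by (metis mult_is_0 neq0_conv zero_neq_numeral)
  then obtain z where z: "\<And>s. z s ^ (2 * m) = \<epsilon>1 * \<omega> s ^ m" by metis
  have znz: "z s \<noteq> 0" for s using z[of s] \<omega>nz[of s] e m by (auto simp: zero_power)
  define \<zeta> where "\<zeta> s r = z s * unity_root (2 * m) ^ r" for s r
  have \<zeta>nz: "\<zeta> s r \<noteq> 0" for s r using znz by (simp add: \<zeta>_def)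
  have \<zeta>m: "\<zeta> s r ^ (2 * m) = \<epsilon>1 * \<omega> s ^ m" for s r
  proof -
    have "(unity_root (2 * m) ^ r) ^ (2 * m) = (unity_root (2 * m) ^ (2 * m)) ^ r"
      by (simp only: power_mult[symmetric] mult.commute)
    then show ?thesis using z[of s] unity_root_power_self[of "2 * m"] m by (simp add: \<zeta>_def power_mult_distrib)
  qed
  define d where "d = card ?X"
  have d: "d = 2 * m * n" by (simp add: d_def torus_cells_def nat_mult_distrib)
  obtain e where e_bij: "bij_betw e {0..<d} ?X"
    using ex_bij_betw_nat_finite[OF finite_torus_cells] by (auto simp: d_def)
  have "card ?K = d" by (simp add: d mult_ac)
  then obtain e' where e'_bij: "bij_betw e' {0..<d} ?K"
    using ex_bij_betw_nat_finite[of ?K] by auto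
  have e_in: "e i \<in> ?X" if "i < d" for i using e_bij that by (auto simp: bij_betw_def)
  have e'_in: "fst (e' k) < n" "snd (e' k) < 2 * m" if "k < d" for k
    using bij_betw_apply[OF e'_bij, of k] that by (auto simp: mem_Times_iff)
  let ?\<phi> = "\<lambda>k. plane_wave (\<zeta> (fst k) (snd k)) (\<omega> (fst k))"
  let ?l = "\<lambda>k. v EdgeI + (v EdgeII * \<omega> (fst k) + v EdgeIII) / \<zeta> (fst k) (snd k)"
  let ?w = "twisted_weight n v \<epsilon>1 \<epsilon>"
  let ?h = "hop (2 * int m) (int n)"
  define A where "A = mat d d (\<lambda>(i, j). \<Sum>t\<in>UNIV. if ?h (e i) t = e j then ?w (e i) t else 0)"
  define F where "F = mat d d (\<lambda>(i, k). ?\<phi> (e' k) (e i))"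
  define G where "G = mat d d (\<lambda>(k, i). inverse (?\<phi> (e' k) (e i)))"
  have "twisted_sum m n v \<epsilon>1 \<epsilon> = det A"
    unfolding A_def leibniz_hops[OF finite_torus_cells finite_edge_type e_bij]
    unfolding twisted_sum_def hop_matchings_def
    by (subst sum.inter_filter) (auto intro!: finite_PiE simp: finite_torus_cells finite_edge_type)
  also have "\<dots> = (\<Prod>k<d. ?l (e' k))"
  proof (rule det_eigenbasis[where F = F and G = G and C = "of_nat d"])
    show "A \<in> carrier_mat d d" "F \<in> carrier_mat d d" "G \<in> carrier_mat d d"
      by (simp_all add: A_def F_def G_def)
    show "of_nat d \<noteq> (0 :: complex)" using m n by (simp add: d)
  next
    fix i k assume ik: "i < d" "k < d"
    have "(\<Sum>j<d. A $$ (i, j) * F $$ (j, k)) = (\<Sum>j\<in>{0..<d}. (\<Sum>t\<in>UNIV. if ?h (e i) t = e j then ?w (e i) t else 0) * ?\<phi> (e' k) (e j))"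
      using ik by (simp add: A_def F_def atLeast0LessThan)
    also have "\<dots> = (\<Sum>y\<in>?X. (\<Sum>t\<in>UNIV. if ?h (e i) t = y then ?w (e i) t else 0) * ?\<phi> (e' k) y)"
      using sum.reindex_bij_betw[OF e_bij, of "\<lambda>y. (\<Sum>t\<in>UNIV. if ?h (e i) t = y then ?w (e i) t else 0) * ?\<phi> (e' k) y"] .
    also have "\<dots> = (\<Sum>t\<in>UNIV. \<Sum>y\<in>?X. if y = ?h (e i) t then ?w (e i) t * ?\<phi> (e' k) y else 0)"
      unfolding sum_distrib_right by (subst sum.swap) (intro sum.cong refl, auto)
    also have "\<dots> = (\<Sum>t\<in>UNIV. ?w (e i) t * ?\<phi> (e' k) (?h (e i) t))"
      using hop_in_torus_cells[OF m n e_in[OF ik(1)]] by (intro sum.cong refl) (simp add: finite_torus_cells)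
    also have "\<dots> = ?l (e' k) * ?\<phi> (e' k) (e i)"
      by (rule plane_wave_hop[OF m n e_in[OF ik(1)] \<zeta>nz \<omega>nz \<omega>n \<zeta>m e])
    finally show "(\<Sum>j<d. A $$ (i, j) * F $$ (j, k)) = ?l (e' k) * F $$ (i, k)"
      using ik by (simp add: F_def)
  next
    fix k k' assume kk: "k < d" "k' < d"
    have "(\<Sum>i<d. G $$ (k, i) * F $$ (i, k')) = (\<Sum>i\<in>{0..<d}. inverse (?\<phi> (e' k) (e i)) * ?\<phi> (e' k') (e i))"
      using kk by (simp add: G_def F_def atLeast0LessThan)
    also have "\<dots> = (\<Sum>x\<in>?X. inverse (?\<phi> (e' k) x) * ?\<phi> (e' k') x)"
      using sum.reindex_bij_betw[OF e_bij, of "\<lambda>x. inverse (?\<phi> (e' k) x) * ?\<phi> (e' k') x"] .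
    also have "\<dots> = (if fst (e' k) = fst (e' k') \<and> snd (e' k) = snd (e' k') then of_nat (2 * m * n) else 0)"
      unfolding \<omega>_def \<zeta>_def by (rule plane_wave_orthogonal) (use e'_in kk w0nz znz in auto)
    also have "fst (e' k) = fst (e' k') \<and> snd (e' k) = snd (e' k') \<longleftrightarrow> k = k'"
      using e'_bij kk by (auto simp: bij_betw_def inj_on_def prod_eq_iff)
    finally show "(\<Sum>i<d. G $$ (k, i) * F $$ (i, k')) = (if k = k' then of_nat d else 0)" by (simp add: d)
  qed
  also have "\<dots> = (\<Prod>k\<in>?K. ?l k)"
    using prod.reindex_bij_betw[OF e'_bij, of ?l] by (simp add: atLeast0LessThan)
  also have "\<dots> = (\<Prod>s<n. \<Prod>r<2 * m. v EdgeI + (v EdgeII * \<omega> s + v EdgeIII) / \<zeta> s r)"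
    by (simp add: prod.cartesian_product case_prod_unfold)
  also have "\<dots> = (\<Prod>s<n. v EdgeI ^ (2 * m) - \<epsilon>1 * ((v EdgeII * \<omega> s + v EdgeIII)\<^sup>2 / \<omega> s) ^ m)"
  proof (intro prod.cong refl)
    fix s
    let ?L = "v EdgeII * \<omega> s + v EdgeIII"
    \<comment> \<open>The eigenvalue contains \<open>1 / \<zeta>\<close>; negating the index modulo
      \<open>2 * m\<close> moves the root of unity into the numerator.\<close>
    have "bij_betw (\<lambda>r. (2 * m - r) mod (2 * m)) {..<2 * m} {..<2 * m}"
      by (rule bij_betwI[where g = "\<lambda>r. (2 * m - r) mod (2 * m)"])
         (use m in \<open>auto simp: mod_if split: if_splits\<close>)
    then have "(\<Prod>r<2 * m. v EdgeI + ?L / \<zeta> s r) = (\<Prod>r<2 * m. v EdgeI + ?L / \<zeta> s ((2 * m - r) mod (2 * m)))"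
      using prod.reindex_bij_betw[of _ "{..<2 * m}" "{..<2 * m}" "\<lambda>r. v EdgeI + ?L / \<zeta> s r"] by metis
    also have "\<dots> = (\<Prod>r<2 * m. v EdgeI - (- ?L / z s) * unity_root (2 * m) ^ r)"
    proof (intro prod.cong refl)
      fix r assume r: "r \<in> {..<2 * m}"
      have "unity_root (2 * m) ^ ((2 * m - r) mod (2 * m)) * unity_root (2 * m) ^ r = 1"
        using r m unity_root_power_self[of "2 * m"]
        by (cases "r = 0") (auto simp flip: power_add)
      then have "1 / unity_root (2 * m) ^ ((2 * m - r) mod (2 * m)) = unity_root (2 * m) ^ r"
        by (simp add: field_simps)
      then show "v EdgeI + ?L / \<zeta> s ((2 * m - r) mod (2 * m)) = v EdgeI - (- ?L / z s) * unity_root (2 * m) ^ r"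
        unfolding \<zeta>_def by (metis (no_types, opaque_lifting) diff_minus_eq_add divide_divide_eq_left minus_divide_left minus_mult_left mult.right_neutral times_divide_eq_right)
    qed
    also have "\<dots> = v EdgeI ^ (2 * m) - (- ?L / z s) ^ (2 * m)"
      using m by (intro prod_unity_roots) simp
    also have "(- ?L / z s) ^ (2 * m) = ?L ^ (2 * m) / (\<epsilon>1 * \<omega> s ^ m)"
      unfolding power_divide z by (simp only: power_mult power2_minus)
    also have "\<dots> = \<epsilon>1 * (?L\<^sup>2 / \<omega> s) ^ m"
      using e(2) by (auto simp: power_divide power_mult)
    finally show "(\<Prod>r<2 * m. v EdgeI + ?L / \<zeta> s r) = v EdgeI ^ (2 * m) - \<epsilon>1 * (?L\<^sup>2 / \<omega> s) ^ m" .
  qed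
  finally show ?thesis by (simp add: \<omega>_def)
qed

subsection \<open>The honeycomb graph in lattice coordinates\<close>

text \<open>Since \<open>lat_x = 2 lat_u - lat_y\<close>, subtracting \<open>i div 2\<close> makes
  both periods parallel to the coordinate axes: they become \<open>(2 * m, 0)\<close> and
  \<open>(0, n)\<close>, and the cells form a rectangle.\<close>

definition cell_point :: "int \<times> int \<Rightarrow> real \<times> real" where
  "cell_point x = of_int (fst x) *\<^sub>R lat_u + of_int (snd x - fst x div 2) *\<^sub>R lat_y"

lemma honeycomb_white_eq: "honeycomb_white = range cell_point"
proof -
  have "of_int i *\<^sub>R lat_u + of_int k *\<^sub>R lat_y = cell_point (i, k + i div 2)" for i k
    by (simp add: cell_point_def)
  then show ?thesis
    unfolding honeycomb_white_def lattice_span_def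
  proof (intro equalityI subsetI)
    fix p assume "p \<in> range cell_point"
    then obtain x where "p = cell_point x" by blast
    then show "p \<in> {of_int i *\<^sub>R lat_u + of_int j *\<^sub>R lat_y | i j. True}"
      unfolding cell_point_def by blast
  qed auto
qed

lemma inj_cell_point: "cell_point x = cell_point y \<Longrightarrow> x = y"
proof -
  assume a: "cell_point x = cell_point y"
  obtain i j i' j' where x: "x = (i, j)" and y: "y = (i', j')" by (cases x, cases y)
  have i: "i = i'"
    using arg_cong[OF a, of fst] by (simp add: x y cell_point_def lat_u_def lat_y_def)
  have "sqrt 3 * of_int (j - i div 2) = sqrt 3 * (of_int (j' - i div 2) :: real)"
    using arg_cong[OF a, of snd] by (simp add: x y i cell_point_def lat_u_def lat_y_def)
  then have "of_int (j - i div 2) = (of_int (j' - i div 2) :: real)" by simp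
  then show ?thesis using i by (simp add: x y)
qed

lemma cell_point_translate:
  "cell_point (i, j) + (of_int A *\<^sub>R (real m *\<^sub>R lat_x) + of_int B *\<^sub>R (real n *\<^sub>R lat_y))
    = cell_point (i + 2 * int m * A, j + int n * B)"
proof -
  have "(i + 2 * int m * A) div 2 = i div 2 + int m * A"
    by (simp add: mult.assoc)
  then show ?thesis
    by (simp add: cell_point_def lat_u_def lat_y_def lat_x_def algebra_simps)
qed

lemma lattice_span_minus: "l \<in> lattice_span a b \<Longrightarrow> - l \<in> lattice_span a b"
proof -
  assume "l \<in> lattice_span a b"
  then obtain i j where "l = of_int i *\<^sub>R a + of_int j *\<^sub>R b" by (auto simp: lattice_span_def)
  then have "- l = of_int (- i) *\<^sub>R a + of_int (- j) *\<^sub>R b" by simp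
  then show ?thesis unfolding lattice_span_def by blast
qed

lemma lattice_span_add: "l \<in> lattice_span a b \<Longrightarrow> l' \<in> lattice_span a b \<Longrightarrow> l + l' \<in> lattice_span a b"
proof -
  assume "l \<in> lattice_span a b" "l' \<in> lattice_span a b"
  then obtain i j i' j' where "l = of_int i *\<^sub>R a + of_int j *\<^sub>R b" "l' = of_int i' *\<^sub>R a + of_int j' *\<^sub>R b"
    by (auto simp: lattice_span_def)
  then have "l + l' = of_int (i + i') *\<^sub>R a + of_int (j + j') *\<^sub>R b" by (simp add: algebra_simps)
  then show ?thesis unfolding lattice_span_def by blast
qed

lemma lattice_span_zero: "0 \<in> lattice_span a b"
proof -
  have "0 = of_int 0 *\<^sub>R a + of_int 0 *\<^sub>R b" by simp
  then show ?thesis unfolding lattice_span_def by blast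
qed

lemma torus_class_eq_iff:
  "torus_class m n p = torus_class m n q \<longleftrightarrow> (\<exists>l \<in> lattice_span (real m *\<^sub>R lat_x) (real n *\<^sub>R lat_y). q = p + l)"
  (is "_ \<longleftrightarrow> (\<exists>l\<in>?L. _)")
proof
  assume "torus_class m n p = torus_class m n q"
  moreover have "q \<in> torus_class m n q" unfolding torus_class_def
    using lattice_span_zero by (intro image_eqI[where x = 0]) auto
  ultimately show "\<exists>l\<in>?L. q = p + l" by (auto simp: torus_class_def)
next
  assume "\<exists>l\<in>?L. q = p + l"
  then obtain l where l: "l \<in> ?L" "q = p + l" by auto
  show "torus_class m n p = torus_class m n q"
  proof (rule Set.set_eqI)
    fix z
    have "(\<exists>k\<in>?L. z = p + k) \<longleftrightarrow> (\<exists>k\<in>?L. z = q + k)"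
    proof
      assume "\<exists>k\<in>?L. z = p + k"
      then obtain k where "k \<in> ?L" "z = p + k" by auto
      then show "\<exists>k\<in>?L. z = q + k" using l lattice_span_add[OF _ lattice_span_minus[OF l(1)], of k]
        by (intro bexI[of _ "k + - l"]) auto
    next
      assume "\<exists>k\<in>?L. z = q + k"
      then obtain k where "k \<in> ?L" "z = q + k" by auto
      then show "\<exists>k\<in>?L. z = p + k" using l lattice_span_add[OF l(1), of k]
        by (intro bexI[of _ "l + k"]) (auto simp: add.assoc)
    qed
    then show "z \<in> torus_class m n p \<longleftrightarrow> z \<in> torus_class m n q" by (auto simp: torus_class_def image_iff)
  qed
qed

lemma image_torus_class: "(\<lambda>p. p + v) ` torus_class m n p = torus_class m n (p + v)"
  unfolding torus_class_def image_image by (intro image_cong) (auto simp: algebra_simps)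

definition cell_class :: "nat \<Rightarrow> nat \<Rightarrow> int \<times> int \<Rightarrow> (real \<times> real) set" where
  "cell_class m n x = torus_class m n (cell_point x)"

definition cell_black :: "nat \<Rightarrow> nat \<Rightarrow> int \<times> int \<Rightarrow> (real \<times> real) set" where
  "cell_black m n x = torus_class m n (cell_point x + (1, 0))"

lemma cell_class_eq_iff:
  "cell_class m n (i, j) = cell_class m n (i', j') \<longleftrightarrow> (\<exists>A B. i' = i + 2 * int m * A \<and> j' = j + int n * B)"
proof -
  have "cell_class m n (i, j) = cell_class m n (i', j') \<longleftrightarrow>
    (\<exists>A B. cell_point (i', j') = cell_point (i + 2 * int m * A, j + int n * B))"
    unfolding cell_class_def torus_class_eq_iff cell_point_translate[symmetric] lattice_span_def
    by blast
  then show ?thesis by (metis inj_cell_point prod.inject)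
qed

lemma cell_black_eq_iff: "cell_black m n x = cell_black m n y \<longleftrightarrow> cell_class m n x = cell_class m n y"
  unfolding cell_black_def cell_class_def torus_class_eq_iff by (auto simp: algebra_simps)

lemma cell_class_mod: "cell_class m n (i mod (2 * int m), j mod int n) = cell_class m n (i, j)"
  unfolding cell_class_eq_iff
  by (intro exI[of _ "i div (2 * int m)"] exI[of _ "j div int n"]) simp

lemma inj_on_cell_class: "inj_on (cell_class m n) (torus_cells m n)"
proof (rule inj_onI)
  fix x y assume *: "x \<in> torus_cells m n" "y \<in> torus_cells m n" "cell_class m n x = cell_class m n y"
  obtain i j i' j' where x: "x = (i, j)" and y: "y = (i', j')" by (cases x, cases y)
  obtain A B where "i' = i + 2 * int m * A" "j' = j + int n * B"
    using *(3) unfolding x y cell_class_eq_iff by auto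
  then have "i' mod (2 * int m) = i mod (2 * int m)" "j' mod int n = j mod int n"
    by (simp_all only: mod_mult_self2)
  then show "x = y" using *(1,2) by (simp add: x y torus_cells_def)
qed

lemma cell_mod_in: "m > 0 \<Longrightarrow> n > 0 \<Longrightarrow> (i mod (2 * int m), j mod int n) \<in> torus_cells m n"
  by (simp add: torus_cells_def)

lemma range_cell_class:
  assumes "m > 0" "n > 0" shows "range (cell_class m n) = cell_class m n ` torus_cells m n"
proof -
  have "cell_class m n x \<in> cell_class m n ` torus_cells m n" for x
    using cell_class_mod[of m n "fst x" "snd x"] cell_mod_in[OF assms, of "fst x" "snd x"]
    by (metis image_eqI prod.collapse)
  then show ?thesis by auto
qed

lemma range_cell_black:
  assumes "m > 0" "n > 0" shows "range (cell_black m n) = cell_black m n ` torus_cells m n"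
proof -
  have "cell_black m n x \<in> cell_black m n ` torus_cells m n" for x
  proof -
    have "cell_class m n x \<in> cell_class m n ` torus_cells m n" using range_cell_class[OF assms] by blast
    then show ?thesis by (auto simp: cell_black_eq_iff[symmetric])
  qed
  then show ?thesis by auto
qed

lemma torus_white_eq: "torus_white m n = range (cell_class m n)"
  by (auto simp: torus_white_def honeycomb_white_eq cell_class_def)

lemma torus_black_eq: "torus_black m n = range (cell_black m n)"
  by (auto simp: torus_black_def honeycomb_black_def honeycomb_white_eq cell_black_def)

lemma torus_edges_eq: "torus_edges m n = range (cell_class m n) \<times> UNIV"
  by (auto simp: torus_edges_def honeycomb_edges_def honeycomb_white_eq cell_class_def image_iff)

text \<open>Relative to type I the displacements are lattice vectors: \<open>lat_y - lat_u\<close>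
  for type II and \<open>- lat_u\<close> for type III. Moving one column left realises the former if
  \<open>i\<close> is even and the latter if \<open>i\<close> is odd, and the other type differs by
  one vertical step.\<close>

lemma black_end_cell: "black_end (cell_class m n x, t) = cell_black m n (hop (2 * int m) (int n) x t)"
proof -
  obtain i j where x: "x = (i, j)" by (cases x)
  have even_div: "(i - 1) div 2 = i div 2 - 1" if "even i" using that by presburger
  have odd_div: "(i - 1) div 2 = i div 2" if "odd i" using that by presburger
  have even_pt: "cell_point (i - 1, k) = cell_point (i, k) - lat_u + lat_y" if "even i" for k
  proof -
    have "i div 2 = (i - 1) div 2 + 1" using even_div[OF that] by simp
    then show ?thesis by (simp only: cell_point_def fst_conv snd_conv) (simp add: algebra_simps)
  qed
  have odd_pt: "cell_point (i - 1, k) = cell_point (i, k) - lat_u" if "odd i" for k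
    using odd_div[OF that] by (simp add: cell_point_def algebra_simps)
  have vert: "cell_point (i, k + 1) = cell_point (i, k) + lat_y"
      "cell_point (i, 1 + k) = cell_point (i, k) + lat_y"
      "cell_point (i, k - 1) = cell_point (i, k) - lat_y" for k
    by (simp_all add: cell_point_def algebra_simps)
  have "black_end (cell_class m n x, t) = torus_class m n (cell_point x + edge_vec t)"
    by (simp add: black_end_def cell_class_def image_torus_class)
  also have "\<dots> = cell_black m n (hop (2 * int m) (int n) x t)"
  proof (cases t)
    case EdgeI
    then show ?thesis by (simp add: x cell_black_def)
  next
    case EdgeII
    let ?y = "(i - 1, j + (if odd i then 1 else 0))"
    have "cell_point x + edge_vec t = cell_point ?y + (1, 0)"
      using EdgeII by (cases "even i")
        (auto simp: x even_pt odd_pt vert lat_u_def lat_y_def prod_eq_iff field_simps)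
    moreover have "cell_black m n ?y = cell_black m n (hop (2 * int m) (int n) x t)"
      unfolding cell_black_eq_iff using EdgeII by (simp add: x cell_class_mod)
    ultimately show ?thesis by (simp add: cell_black_def)
  next
    case EdgeIII
    let ?y = "(i - 1, j - (if odd i then 0 else 1))"
    have "cell_point x + edge_vec t = cell_point ?y + (1, 0)"
      using EdgeIII by (cases "even i")
        (auto simp: x even_pt odd_pt vert lat_u_def lat_y_def prod_eq_iff field_simps)
    moreover have "cell_black m n ?y = cell_black m n (hop (2 * int m) (int n) x t)"
      unfolding cell_black_eq_iff using EdgeIII by (simp add: x cell_class_mod)
    ultimately show ?thesis by (simp add: cell_black_def)
  qed
  finally show ?thesis .
qed

text \<open>The condition at white vertices makes a configuration the graph of a function on cells.
  In the converse direction uniqueness at black vertices gives injectivity of the induced map, and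
  an injective self-map of a finite set is bijective.\<close>

lemma bij_betw_dimer_configs:
  assumes m: "m > 0" and n: "n > 0"
  shows "bij_betw (\<lambda>f. (\<lambda>x. (cell_class m n x, f x)) ` torus_cells m n) (hop_matchings m n) (dimer_configs m n)"
proof -
  let ?X = "torus_cells m n" and ?c = "cell_class m n" and ?b = "cell_black m n"
  let ?h = "hop (2 * int m) (int n)"
  let ?M = "\<lambda>f. (\<lambda>x. (?c x, f x)) ` ?X"
  have c_inj: "x = y" if "?c x = ?c y" "x \<in> ?X" "y \<in> ?X" for x y
    using inj_on_cell_class that by (auto simp: inj_on_def)
  have b_inj: "x = y" if "?b x = ?b y" "x \<in> ?X" "y \<in> ?X" for x y
    using c_inj that by (simp add: cell_black_eq_iff)
  have hX: "?h x t \<in> ?X" if "x \<in> ?X" for x t using hop_in_torus_cells[OF m n that] .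
  show ?thesis
  proof (rule bij_betw_imageI)
    show "inj_on ?M (hop_matchings m n)"
    proof (rule inj_onI)
      fix f g assume f: "f \<in> hop_matchings m n" and g: "g \<in> hop_matchings m n" and eq: "?M f = ?M g"
      show "f = g"
      proof
        fix x
        show "f x = g x"
        proof (cases "x \<in> ?X")
          case True
          then have "(?c x, f x) \<in> ?M g" using eq by blast
          then obtain y where "y \<in> ?X" "?c x = ?c y" "f x = g y" by auto
          then show ?thesis using c_inj[of x y] True by simp
        next
          case False
          then show ?thesis using f g PiE_arb[of f ?X "\<lambda>_. UNIV" x] PiE_arb[of g ?X "\<lambda>_. UNIV" x]
            by (simp add: hop_matchings_def)
        qed
      qed
    qed
    show "?M ` hop_matchings m n = dimer_configs m n"
    proof (intro equalityI subsetI)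
      fix E assume "E \<in> ?M ` hop_matchings m n"
      then obtain f where f: "f \<in> hop_matchings m n" and E: "E = ?M f" by auto
      have bij: "bij_betw (\<lambda>x. ?h x (f x)) ?X ?X" using f by (simp add: hop_matchings_def)
      show "E \<in> dimer_configs m n"
        unfolding dimer_configs_def
      proof (intro CollectI conjI ballI)
        show "E \<subseteq> torus_edges m n" by (auto simp: E torus_edges_eq)
      next
        fix w assume "w \<in> torus_white m n"
        then obtain x where x: "x \<in> ?X" "w = ?c x" unfolding torus_white_eq range_cell_class[OF m n] by auto
        show "\<exists>!e. e \<in> E \<and> white_end e = w"
        proof (rule ex1I[of _ "(?c x, f x)"])
          fix e assume "e \<in> E \<and> white_end e = w"
          then obtain y where "y \<in> ?X" "e = (?c y, f y)" "?c y = ?c x" by (auto simp: E white_end_def x(2))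
          then show "e = (?c x, f x)" using c_inj[of y x] x(1) by simp
        qed (use x in \<open>auto simp: E white_end_def\<close>)
      next
        fix b assume "b \<in> torus_black m n"
        then obtain y where y: "y \<in> ?X" "b = ?b y" unfolding torus_black_eq range_cell_black[OF m n] by auto
        then have "y \<in> (\<lambda>x. ?h x (f x)) ` ?X" using bij by (simp add: bij_betw_def)
        then obtain x where x: "x \<in> ?X" "?h x (f x) = y" by blast
        show "\<exists>!e. e \<in> E \<and> black_end e = b"
        proof (rule ex1I[of _ "(?c x, f x)"])
          show "(?c x, f x) \<in> E \<and> black_end (?c x, f x) = b"
            using x y by (auto simp: E black_end_cell)
          fix e assume "e \<in> E \<and> black_end e = b"
          then obtain x' where x': "x' \<in> ?X" "e = (?c x', f x')" "?b (?h x' (f x')) = ?b y"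
            by (auto simp: E y(2) black_end_cell)
          then have "?h x' (f x') = ?h x (f x)" using b_inj[of "?h x' (f x')" y] hX y(1) x(2) by simp
          then have "x' = x" using bij x(1) x'(1) by (auto simp: bij_betw_def inj_on_def)
          then show "e = (?c x, f x)" using x'(2) by simp
        qed
      qed
    next
      fix E assume E: "E \<in> dimer_configs m n"
      have E_sub: "E \<subseteq> range ?c \<times> UNIV" using E by (simp add: dimer_configs_def torus_edges_eq)
      have white: "\<exists>!e. e \<in> E \<and> fst e = ?c x" for x
      proof -
        have "?c x \<in> torus_white m n" by (simp add: torus_white_eq)
        moreover have "\<forall>w\<in>torus_white m n. \<exists>!e. e \<in> E \<and> white_end e = w"
          using E unfolding dimer_configs_def by (elim CollectE conjE)
        ultimately show ?thesis unfolding white_end_def by (rule bspec[rotated])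
      qed
      have black: "\<exists>!e. e \<in> E \<and> black_end e = ?b x" for x
      proof -
        have "?b x \<in> torus_black m n" by (simp add: torus_black_eq)
        moreover have "\<forall>b\<in>torus_black m n. \<exists>!e. e \<in> E \<and> black_end e = b"
          using E unfolding dimer_configs_def by (elim CollectE conjE)
        ultimately show ?thesis by (rule bspec[rotated])
      qed
      define f where "f = restrict (\<lambda>x. snd (THE e. e \<in> E \<and> fst e = ?c x)) ?X"
      have fE: "(?c x, f x) \<in> E" if "x \<in> ?X" for x
      proof -
        let ?e = "THE e. e \<in> E \<and> fst e = ?c x"
        have e: "?e \<in> E" "fst ?e = ?c x" using theI'[OF white[of x]] by auto
        have "f x = snd ?e" using that by (simp add: f_def)
        then have "(?c x, f x) = ?e" using e(2) by (simp add: prod_eq_iff)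
        then show ?thesis using e(1) by simp
      qed
      have E_eq: "E = ?M f"
      proof (intro equalityI subsetI)
        fix e assume e: "e \<in> E"
        then obtain x where x: "x \<in> ?X" "fst e = ?c x" using E_sub range_cell_class[OF m n] by (auto simp: mem_Times_iff)
        then have "e = (?c x, f x)" using white[of x] e fE[OF x(1)] by (metis fst_conv)
        then show "e \<in> ?M f" using x by blast
      qed (use fE in auto)
      have inj: "inj_on (\<lambda>x. ?h x (f x)) ?X"
      proof (rule inj_onI)
        fix x y assume *: "x \<in> ?X" "y \<in> ?X" "?h x (f x) = ?h y (f y)"
        then have "black_end (?c x, f x) = black_end (?c y, f y)" by (simp add: black_end_cell)
        then have "(?c x, f x) = (?c y, f y)"
          using black[of "?h y (f y)"] fE[OF *(1)] fE[OF *(2)] by (metis black_end_cell)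
        then show "x = y" using c_inj * by simp
      qed
      have "(\<lambda>x. ?h x (f x)) ` ?X \<subseteq> ?X" using hX by auto
      then have "bij_betw (\<lambda>x. ?h x (f x)) ?X ?X"
        unfolding bij_betw_def using inj endo_inj_surj[OF finite_torus_cells] by blast
      then have "f \<in> hop_matchings m n" by (simp add: hop_matchings_def f_def)
      then show "E \<in> ?M ` hop_matchings m n" using E_eq by blast
    qed
  qed
qed

lemma partition_function_eq_sum_hops:
  assumes m: "m > 0" and n: "n > 0"
  shows "partition_function m n \<alpha> \<beta> = (\<Sum>f\<in>hop_matchings m n. \<Prod>x\<in>torus_cells m n. edge_weight m n \<alpha> \<beta> (f x))"
proof -
  let ?M = "\<lambda>f :: int \<times> int \<Rightarrow> edge_type. (\<lambda>x. (cell_class m n x, f x)) ` torus_cells m n"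
  have "partition_function m n \<alpha> \<beta> = (\<Sum>f\<in>hop_matchings m n. \<Prod>e\<in>?M f. edge_weight m n \<alpha> \<beta> (snd e))"
    unfolding partition_function_def
    using sum.reindex_bij_betw[OF bij_betw_dimer_configs[OF m n], of "\<lambda>E. \<Prod>e\<in>E. edge_weight m n \<alpha> \<beta> (snd e)"] by simp
  also have "\<dots> = (\<Sum>f\<in>hop_matchings m n. \<Prod>x\<in>torus_cells m n. edge_weight m n \<alpha> \<beta> (f x))"
  proof (intro sum.cong refl)
    fix f :: "int \<times> int \<Rightarrow> edge_type"
    have "inj_on (\<lambda>x. (cell_class m n x, f x)) (torus_cells m n)"
      using inj_on_cell_class by (auto simp: inj_on_def)
    then show "(\<Prod>e\<in>?M f. edge_weight m n \<alpha> \<beta> (snd e)) = (\<Prod>x\<in>torus_cells m n. edge_weight m n \<alpha> \<beta> (f x))"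
      by (subst prod.reindex) auto
  qed
  finally show ?thesis .
qed

text \<open>With the shift \<open>\<xi> = - \<i> \<beta> / 2\<close> the weights turn into the product over the fermion momenta
  \<open>2 \<pi> (s + \<xi>) / n\<close>.\<close>

definition momentum_product :: "nat \<Rightarrow> nat \<Rightarrow> complex \<Rightarrow> complex \<Rightarrow> complex \<Rightarrow> complex" where
  "momentum_product m n c z \<xi> = (\<Prod>s<n. c + z * (2 + 2 * cos (2 * complex_of_real pi * (of_nat s + \<xi>) / of_nat n)) ^ m)"

text \<open>With \<open>b = \<beta> \<pi> / (2 n)\<close> and
  \<open>\<omega> = exp (\<i> \<theta> + 2 b)\<close>, the factor \<open>exp b\<close> can be pulled
  out of both vertical weights and cancels against \<omega>, leaving
  \<open>2 + 2 cos \<theta>\<close>. So \<beta> enters only as an imaginary shift of the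
  momentum.\<close>

lemma twisted_sum_momentum:
  fixes \<alpha> \<beta> :: real and \<delta> \<epsilon> :: complex
  assumes m: "m > 0" and n: "n > 0" and z: "z \<in> {1, -1}"
    and \<delta>: "(\<delta>, \<epsilon>) = (0, 1) \<or> (\<delta>, \<epsilon>) = (1/2, -1)"
  shows "twisted_sum m n (\<lambda>t. complex_of_real (edge_weight m n \<alpha> \<beta> t)) (-z) \<epsilon>
    = momentum_product m n (of_real (exp (- \<alpha> * pi))) z (\<delta> - \<i> * of_real \<beta> / 2)"
    (is "twisted_sum m n ?v _ _ = _")
proof -
  \<comment> \<open>The negative angle produces momenta
    \<open>s - (\<delta> - \<i> \<beta> / 2)\<close>. The reflection of \<open>s\<close> modulo
    \<open>n\<close> at the end turns them into \<open>s + (\<delta> - \<i> \<beta> / 2)\<close>, as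
    the cosine is even and periodic.\<close>
  define w0 where "w0 = exp (2 * of_real pi * \<i> * (- \<delta>) / of_nat n)"
  have w0n: "w0 ^ n = \<epsilon>"
  proof -
    have "w0 ^ n = exp (of_nat n * (2 * of_real pi * \<i> * (- \<delta>) / of_nat n))"
      unfolding w0_def by (simp only: exp_of_nat_mult)
    also have "of_nat n * (2 * of_real pi * \<i> * (- \<delta>) / of_nat n) = - (2 * \<delta>) * (of_real pi * \<i>)" using n by simp
    finally have e: "w0 ^ n = exp (- (2 * \<delta>) * (of_real pi * \<i>))" .
    show ?thesis using \<delta>
    proof
      assume "(\<delta>, \<epsilon>) = (1/2, -1)"
      then have half: "\<delta> = 1/2" "\<epsilon> = -1" by auto
      show ?thesis unfolding e half by (simp add: exp_minus)
    qed (use e in auto)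
  qed
  have \<epsilon>: "\<epsilon> \<in> {1, -1}" using \<delta> by auto
  have "twisted_sum m n ?v (-z) \<epsilon> = (\<Prod>s<n. ?v EdgeI ^ (2 * m)
     - (-z) * ((?v EdgeII * (w0 * unity_root n ^ s) + ?v EdgeIII)\<^sup>2 / (w0 * unity_root n ^ s)) ^ m)"
    by (rule twisted_sum_eq_prod[OF m n w0n \<epsilon>]) (use z in auto)
  also have "\<dots> = (\<Prod>s<n. of_real (exp (- \<alpha> * pi)) + z * (2 + 2 * cos (2 * complex_of_real pi * (of_nat s - (\<delta> - \<i> * of_real \<beta> / 2)) / of_nat n)) ^ m)"
  proof (intro prod.cong refl)
    fix s
    let ?\<theta> = "2 * complex_of_real pi * (of_nat s - (\<delta> - \<i> * of_real \<beta> / 2)) / of_nat n"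
    let ?b = "complex_of_real (\<beta> * pi / (2 * real n))"
    have I: "?v EdgeI ^ (2 * m) = of_real (exp (- \<alpha> * pi))"
    proof -
      have "exp (- \<alpha> * pi / (2 * real m)) ^ (2 * m) = exp (- \<alpha> * pi)"
        using m by (simp flip: exp_of_nat_mult)
      then show ?thesis by (simp flip: of_real_power)
    qed
    have om: "w0 * unity_root n ^ s = exp (\<i> * ?\<theta> + 2 * ?b)"
    proof -
      have "unity_root n ^ s = exp (\<i> * (2 * of_real pi * of_nat s / of_nat n))"
        by (simp add: unity_root_power cis_conv_exp mult_ac)
      then have "w0 * unity_root n ^ s = exp (2 * of_real pi * \<i> * (- \<delta>) / of_nat n + \<i> * (2 * of_real pi * of_nat s / of_nat n))"
        unfolding w0_def by (simp only: exp_add)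
      also have "2 * of_real pi * \<i> * (- \<delta>) / of_nat n + \<i> * (2 * of_real pi * of_nat s / of_nat n) = \<i> * ?\<theta> + 2 * ?b"
      proof -
        define h where "h = \<i> * complex_of_real \<beta> / 2"
        have h: "2 * \<i> * h = - of_real \<beta>" by (simp add: h_def)
        have "\<i> * (2 * complex_of_real pi * (of_nat s - (\<delta> - h)) / of_nat n) =
          2 * of_real pi * \<i> * (- \<delta>) / of_nat n + \<i> * (2 * of_real pi * of_nat s / of_nat n)
            + (2 * \<i> * h) * of_real pi / of_nat n"
          using n by (simp add: field_simps)
        moreover have "2 * ?b = of_real \<beta> * of_real pi / of_nat n" using n by (simp add: field_simps)
        ultimately show ?thesis unfolding h by (simp add: h_def)
      qed
      finally show ?thesis .
    qed
    have II: "?v EdgeII = exp (- ?b)" and III: "?v EdgeIII = exp ?b"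
      by (simp_all flip: exp_of_real)
    have "(?v EdgeII * (w0 * unity_root n ^ s) + ?v EdgeIII)\<^sup>2 / (w0 * unity_root n ^ s)
      = (exp (- ?b) * exp (\<i> * ?\<theta> + 2 * ?b) + exp ?b)\<^sup>2 / exp (\<i> * ?\<theta> + 2 * ?b)"
      unfolding om II III ..
    also have "exp (- ?b) * exp (\<i> * ?\<theta> + 2 * ?b) + exp ?b = exp ?b * (exp (\<i> * ?\<theta>) + 1)"
      by (simp add: algebra_simps flip: exp_add)
    also have "(exp ?b * (exp (\<i> * ?\<theta>) + 1))\<^sup>2 / exp (\<i> * ?\<theta> + 2 * ?b) = (exp (\<i> * ?\<theta>) + 1)\<^sup>2 / exp (\<i> * ?\<theta>)"
      unfolding exp_add exp_double power_mult_distrib by simp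
    also have "\<dots> = 2 + 2 * cos ?\<theta>"
      by (simp add: cos_exp_eq exp_minus power2_eq_square field_simps)
    finally show "?v EdgeI ^ (2 * m) - (-z) * ((?v EdgeII * (w0 * unity_root n ^ s) + ?v EdgeIII)\<^sup>2 / (w0 * unity_root n ^ s)) ^ m
       = of_real (exp (- \<alpha> * pi)) + z * (2 + 2 * cos ?\<theta>) ^ m" unfolding I by simp
  qed
  also have "\<dots> = (\<Prod>s<n. of_real (exp (- \<alpha> * pi)) + z * (2 + 2 * cos (2 * complex_of_real pi * (of_nat s + (\<delta> - \<i> * of_real \<beta> / 2)) / of_nat n)) ^ m)"
  proof -
    have "bij_betw (\<lambda>s. (n - s) mod n) {..<n} {..<n}"
      by (rule bij_betwI[where g = "\<lambda>s. (n - s) mod n"]) (use n in \<open>auto simp: mod_if split: if_splits\<close>)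
    note b = this
    have c: "cos (2 * complex_of_real pi * (of_nat ((n - s) mod n) + \<xi>) / of_nat n)
        = cos (2 * complex_of_real pi * (of_nat s - \<xi>) / of_nat n)" if "s < n" for s \<xi>
    proof (cases "s = 0")
      case True
      have "2 * complex_of_real pi * (of_nat 0 - \<xi>) / of_nat n = - (2 * complex_of_real pi * (of_nat 0 + \<xi>) / of_nat n)" by simp
      then show ?thesis using True by (metis cos_minus diff_zero mod_self)
    next
      case False
      then have "(n - s) mod n = n - s" using that by simp
      moreover have "2 * complex_of_real pi * (of_nat (n - s) + \<xi>) / of_nat n
          = 2 * complex_of_real pi - 2 * complex_of_real pi * (of_nat s - \<xi>) / of_nat n"
        using that n by (simp add: of_nat_diff field_simps)
      moreover have "cos (2 * complex_of_real pi - u) = cos u" for u :: complex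
        by (simp add: cos_diff)
      ultimately show ?thesis by simp
    qed
    have "(\<Prod>s<n. of_real (exp (- \<alpha> * pi)) + z * (2 + 2 * cos (2 * complex_of_real pi * (of_nat s - (\<delta> - \<i> * of_real \<beta> / 2)) / of_nat n)) ^ m)
       = (\<Prod>s<n. of_real (exp (- \<alpha> * pi)) + z * (2 + 2 * cos (2 * complex_of_real pi * (of_nat ((n - s) mod n) + (\<delta> - \<i> * of_real \<beta> / 2)) / of_nat n)) ^ m)"
      by (intro prod.cong refl) (simp add: c)
    also have "\<dots> = (\<Prod>s<n. of_real (exp (- \<alpha> * pi)) + z * (2 + 2 * cos (2 * complex_of_real pi * (of_nat s + (\<delta> - \<i> * of_real \<beta> / 2)) / of_nat n)) ^ m)"
      by (rule prod.reindex_bij_betw[OF b])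
    finally show ?thesis .
  qed
  finally show ?thesis by (simp add: momentum_product_def)
qed

lemma partition_function_exact:
  fixes \<alpha> \<beta> :: real
  assumes m: "m > 0" and n: "n > 0"
  defines "F \<equiv> momentum_product m n (of_real (exp (- \<alpha> * pi)))"
  shows "complex_of_real (partition_function m n \<alpha> \<beta>) =
    (F 1 (- \<i> * of_real \<beta> / 2) - F (-1) (- \<i> * of_real \<beta> / 2)
     + F 1 (1/2 - \<i> * of_real \<beta> / 2) + F (-1) (1/2 - \<i> * of_real \<beta> / 2)) / 2"
proof -
  let ?v = "\<lambda>t. complex_of_real (edge_weight m n \<alpha> \<beta> t)"
  have "complex_of_real (partition_function m n \<alpha> \<beta>) = (\<Sum>f\<in>hop_matchings m n. \<Prod>x\<in>torus_cells m n. ?v (f x))"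
    by (simp add: partition_function_eq_sum_hops[OF m n])
  also have "\<dots> = (twisted_sum m n ?v (-1) 1 - twisted_sum m n ?v 1 1
       + twisted_sum m n ?v (-1) (-1) + twisted_sum m n ?v 1 (-1)) / 2"
    by (rule untwisted_sum[OF m n])
  finally show ?thesis
    using twisted_sum_momentum[OF m n, of 1 0 1 \<alpha> \<beta>] twisted_sum_momentum[OF m n, of "-1" 0 1 \<alpha> \<beta>]
      twisted_sum_momentum[OF m n, of 1 "1/2" "-1" \<alpha> \<beta>] twisted_sum_momentum[OF m n, of "-1" "1/2" "-1" \<alpha> \<beta>]
    by (simp add: F_def)
qed

subsection \<open>Dominated convergence for series and products over the integers\<close>

lemma bij_int_decode_nat: "bij_betw int_decode UNIV UNIV"
  by (rule bij_betwI[where g = int_encode]) auto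

lemma summable_on_int_iff_suminf:
  fixes f :: "int \<Rightarrow> complex"
  assumes "summable (\<lambda>k. norm (f (int_decode k)))"
  shows "f summable_on UNIV" "infsum f UNIV = (\<Sum>k. f (int_decode k))"
proof -
  have *: "((\<lambda>k. f (int_decode k)) has_sum (\<Sum>k. f (int_decode k))) UNIV"
    using norm_summable_imp_has_sum[OF assms summable_sums[OF summable_norm_cancel[OF assms]]] .
  then have "(f has_sum (\<Sum>k. f (int_decode k))) UNIV"
    using has_sum_reindex_bij_betw[OF bij_int_decode_nat, of f] by simp
  then show "f summable_on UNIV" "infsum f UNIV = (\<Sum>k. f (int_decode k))"
    by (auto simp: has_sum_iff)
qed

text \<open>The majorant makes all the series absolutely convergent, so enumerating the integers by
  \<open>int_decode\<close> reduces the claim to series over the naturals.\<close>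

lemma tannery_int:
  fixes a :: "nat \<Rightarrow> int \<Rightarrow> complex" and M :: "int \<Rightarrow> real"
  assumes lim: "\<And>k. (\<lambda>n. a n k) \<longlonglongrightarrow> b k"
    and bound: "eventually (\<lambda>n. \<forall>k. norm (a n k) \<le> M k) sequentially"
    and M: "M summable_on UNIV"
  shows "(\<lambda>n. infsum (a n) UNIV) \<longlonglongrightarrow> infsum b UNIV"
proof -
  have sM: "summable (\<lambda>k. M (int_decode k))"
  proof -
    have "(\<lambda>k. M (int_decode k)) summable_on UNIV"
      using M summable_on_reindex_bij_betw[OF bij_int_decode_nat, of M] by simp
    then show ?thesis by (rule summable_on_imp_summable)
  qed
  have bd: "norm (b k) \<le> M k" for k
    by (rule Lim_norm_ubound[OF _ lim]) (use bound in \<open>auto elim: eventually_mono\<close>)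
  have T: "(\<lambda>n. suminf (\<lambda>k. a n (int_decode k))) \<longlonglongrightarrow> suminf (\<lambda>k. b (int_decode k))"
  proof -
    have "eventually (\<lambda>n. summable (\<lambda>k. norm (a n (int_decode k)))) sequentially \<and>
       summable (\<lambda>k. norm (b (int_decode k))) \<and>
       (\<lambda>n. suminf (\<lambda>k. a n (int_decode k))) \<longlonglongrightarrow> suminf (\<lambda>k. b (int_decode k))"
    proof (rule tannerys_theorem[where M = "\<lambda>k. M (int_decode k)"])
    show "\<forall>\<^sub>F (k, n) in at_top \<times>\<^sub>F sequentially. norm (a n (int_decode k)) \<le> M (int_decode k)"
      unfolding eventually_prod_filter
      by (intro exI[of _ "\<lambda>_. True"] exI[of _ "\<lambda>n. \<forall>k. norm (a n k) \<le> M k"]) (use bound in auto)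
    qed (use lim sM in auto)
    then show ?thesis by blast
  qed
  have "summable (\<lambda>k. norm (b (int_decode k)))"
    by (rule summable_comparison_test'[OF sM]) (use bd in auto)
  then have "infsum b UNIV = (\<Sum>k. b (int_decode k))" by (rule summable_on_int_iff_suminf)
  moreover have "eventually (\<lambda>n. infsum (a n) UNIV = (\<Sum>k. a n (int_decode k))) sequentially"
    using bound
  proof eventually_elim
    case (elim n)
    have "summable (\<lambda>k. norm (a n (int_decode k)))"
      by (rule summable_comparison_test'[OF sM]) (use elim in auto)
    then show ?case by (rule summable_on_int_iff_suminf)
  qed
  ultimately show ?thesis using T by (simp add: tendsto_cong)
qed

lemma prod_one_plus_telescope:
  fixes a :: "nat \<Rightarrow> complex"
  shows "(\<Prod>s<n. 1 + a s) = 1 + (\<Sum>s<n. a s * (\<Prod>r<s. 1 + a r))"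
proof (induction n)
  case (Suc n)
  have "(\<Prod>s<Suc n. 1 + a s) = (\<Prod>s<n. 1 + a s) + a n * (\<Prod>s<n. 1 + a s)"
    by (simp add: ring_distribs mult.commute)
  also have "\<dots> = 1 + (\<Sum>s<n. a s * (\<Prod>r<s. 1 + a r)) + a n * (\<Prod>s<n. 1 + a s)"
    by (simp only: Suc.IH)
  also have "\<dots> = 1 + (\<Sum>s<Suc n. a s * (\<Prod>r<s. 1 + a r))"
    by (simp only: sum.lessThan_Suc add.assoc)
  finally show ?case .
qed simp

lemma norm_prod_one_plus_le:
  fixes a :: "nat \<Rightarrow> complex"
  assumes "\<And>r. r < s \<Longrightarrow> norm (a r) \<le> M r" "summable M" "\<And>r. 0 \<le> M r"
  shows "norm (\<Prod>r<s. 1 + a r) \<le> exp (suminf M)"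
proof -
  have "norm (\<Prod>r<s. 1 + a r) \<le> (\<Prod>r<s. exp (M r))"
    unfolding prod_norm[symmetric]
  proof (intro prod_mono conjI norm_ge_zero)
    fix r assume "r \<in> {..<s}"
    then have "norm (1 + a r) \<le> 1 + M r" using norm_triangle_ineq[of 1 "a r"] assms(1)[of r] by auto
    also have "\<dots> \<le> exp (M r)" by (rule exp_ge_add_one_self)
    finally show "norm (1 + a r) \<le> exp (M r)" .
  qed
  also have "\<dots> = exp (\<Sum>r<s. M r)" by (simp add: exp_sum)
  also have "\<dots> \<le> exp (suminf M)" using assms(2,3) by (simp add: sum_le_suminf)
  finally show ?thesis .
qed

lemma convergent_prod_one_plus:
  fixes b :: "nat \<Rightarrow> complex"
  assumes "summable (\<lambda>k. norm (b k))"
  shows "convergent_prod (\<lambda>k. 1 + b k)"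
  using assms by (intro abs_convergent_prod_imp_convergent_prod summable_imp_abs_convergent_prod) simp

lemma prod_lessThan_tendsto_prodinf:
  fixes f :: "nat \<Rightarrow> complex"
  assumes "convergent_prod f"
  shows "(\<lambda>n. \<Prod>k<n. f k) \<longlonglongrightarrow> prodinf f"
  using convergent_prod_LIMSEQ[OF assms] by (simp add: LIMSEQ_lessThan_iff_atMost)

text \<open>Telescoping writes the product as 1 plus the sum of \<open>a s\<close> times the partial
  product before \<open>s\<close>. Partial products are bounded by \<open>exp (suminf M)\<close>, so
  dominated convergence for series applies. Taking no logarithms matters, because some limiting
  factors can vanish.\<close>

lemma tannery_prod:
  fixes a :: "nat \<Rightarrow> nat \<Rightarrow> complex" and M :: "nat \<Rightarrow> real"
  assumes lim: "\<And>s. (\<lambda>n. a n s) \<longlonglongrightarrow> b s"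
    and bound: "eventually (\<lambda>n. \<forall>s<K n. norm (a n s) \<le> M s) sequentially"
    and M: "summable M" "\<And>s. 0 \<le> M s" and K: "filterlim K at_top sequentially"
  shows "(\<lambda>n. \<Prod>s<K n. 1 + a n s) \<longlonglongrightarrow> (\<Prod>s. 1 + b s)" "summable (\<lambda>s. norm (b s))"
proof -
  define A where "A n s = (if s < K n then a n s * (\<Prod>r<s. 1 + a n r) else 0)" for n s
  define B where "B s = b s * (\<Prod>r<s. 1 + b r)" for s
  have evK: "eventually (\<lambda>n. s < K n) sequentially" for s
    using K by (auto simp: filterlim_at_top Suc_le_eq dest: spec[of _ "Suc s"])
  have bd: "norm (b s) \<le> M s" for s
    by (rule Lim_norm_ubound[OF _ lim], simp)
       (use bound evK[of s] in \<open>eventually_elim, auto\<close>)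
  show sb: "summable (\<lambda>s. norm (b s))"
    by (rule summable_comparison_test'[OF M(1)]) (use bd in auto)
  have T: "summable (\<lambda>s. norm (B s))" "(\<lambda>n. suminf (A n)) \<longlonglongrightarrow> suminf B"
  proof -
    have "eventually (\<lambda>n. summable (\<lambda>k. norm (A n k))) sequentially \<and>
           summable (\<lambda>n. norm (B n)) \<and> ((\<lambda>n. suminf (\<lambda>k. A n k)) \<longlonglongrightarrow> suminf B)"
    proof (rule tannerys_theorem[where M = "\<lambda>s. M s * exp (suminf M)"])
      fix s
      have "(\<lambda>n. a n s * (\<Prod>r<s. 1 + a n r)) \<longlonglongrightarrow> B s"
        unfolding B_def by (intro tendsto_intros lim)
      moreover have "eventually (\<lambda>n. a n s * (\<Prod>r<s. 1 + a n r) = A n s) sequentially"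
        using evK[of s] by eventually_elim (simp add: A_def)
      ultimately show "(\<lambda>n. A n s) \<longlonglongrightarrow> B s" by (rule Lim_transform_eventually)
    next
      have "eventually (\<lambda>n. \<forall>s. norm (A n s) \<le> M s * exp (suminf M)) sequentially"
        using bound
      proof eventually_elim
        case (elim n)
        show ?case
        proof
          fix s
          show "norm (A n s) \<le> M s * exp (suminf M)"
          proof (cases "s < K n")
            case True
            have "norm (\<Prod>r<s. 1 + a n r) \<le> exp (suminf M)"
              by (rule norm_prod_one_plus_le[OF _ M]) (use elim True in auto)
            then show ?thesis using True elim M(2)[of s]
              by (simp add: A_def norm_mult mult_mono)
          qed (use M in \<open>auto simp: A_def\<close>)
        qed
      qed
      then show "\<forall>\<^sub>F (k, n) in at_top \<times>\<^sub>F sequentially. norm (A n k) \<le> M k * exp (suminf M)"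
        unfolding eventually_prod_filter
        by (intro exI[of _ "\<lambda>_. True"] exI[of _ "\<lambda>n. \<forall>s. norm (A n s) \<le> M s * exp (suminf M)"]) auto
      show "summable (\<lambda>s. M s * exp (suminf M))" using M(1) by (rule summable_mult2)
    qed simp
    then show "summable (\<lambda>s. norm (B s))" "(\<lambda>n. suminf (A n)) \<longlonglongrightarrow> suminf B" by auto
  qed
  have sumA: "suminf (A n) = (\<Prod>s<K n. 1 + a n s) - 1" for n
  proof -
    have "suminf (A n) = sum (A n) {..<K n}" by (rule suminf_finite) (auto simp: A_def)
    also have "\<dots> = (\<Sum>s<K n. a n s * (\<Prod>r<s. 1 + a n r))" by (rule sum.cong) (auto simp: A_def)
    finally show ?thesis using prod_one_plus_telescope[of "a n" "K n"] by simp
  qed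
  have "(\<lambda>n. \<Sum>s<n. B s) \<longlonglongrightarrow> suminf B"
    using summable_LIMSEQ[OF summable_norm_cancel[OF T(1)]] .
  moreover have "(\<Sum>s<n. B s) = (\<Prod>s<n. 1 + b s) - 1" for n
    unfolding B_def using prod_one_plus_telescope[of b n] by simp
  ultimately have "(\<lambda>n. (\<Prod>s<n. 1 + b s) - 1) \<longlonglongrightarrow> suminf B" by simp
  moreover have "(\<lambda>n. (\<Prod>s<n. 1 + b s) - 1) \<longlonglongrightarrow> prodinf (\<lambda>s. 1 + b s) - 1"
    using prod_lessThan_tendsto_prodinf[OF convergent_prod_one_plus[OF sb]] by (intro tendsto_intros)
  ultimately have "suminf B = prodinf (\<lambda>s. 1 + b s) - 1" by (rule LIMSEQ_unique)
  then have "(\<lambda>n. (\<Prod>s<K n. 1 + a n s) - 1) \<longlonglongrightarrow> prodinf (\<lambda>s. 1 + b s) - 1"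
    using T(2) by (simp add: sumA)
  from tendsto_add[OF this tendsto_const[of 1]]
  show "(\<lambda>n. \<Prod>s<K n. 1 + a n s) \<longlonglongrightarrow> (\<Prod>s. 1 + b s)" by simp
qed

section \<open>Powers of numbers near one, and Gaussian majorants\<close>

text \<open>The error in \<open>m * ln (1 + y)\<close> is of order \<open>m * |y|^2\<close>, a
  bounded factor \<open>m * |y|\<close> times one that tends to 0.\<close>

lemma tendsto_one_plus_power:
  fixes y :: "nat \<Rightarrow> complex" and m :: "nat \<Rightarrow> nat"
  assumes m: "filterlim m at_top sequentially"
    and lim: "(\<lambda>j. of_nat (m j) * y j) \<longlonglongrightarrow> x"
  shows "(\<lambda>j. (1 + y j) ^ m j) \<longlonglongrightarrow> exp x"
proof -
  have inv: "(\<lambda>j. inverse (of_nat (m j) :: complex)) \<longlonglongrightarrow> 0"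
    using filterlim_compose[OF tendsto_inverse_0 filterlim_compose[OF tendsto_of_nat m]] by (simp add: o_def)
  have m0: "eventually (\<lambda>j. m j > 0) sequentially"
    using m by (auto simp: filterlim_at_top Suc_le_eq dest: spec[of _ "Suc 0"])
  have y0: "y \<longlonglongrightarrow> 0"
  proof -
    have "(\<lambda>j. inverse (of_nat (m j)) * (of_nat (m j) * y j)) \<longlonglongrightarrow> 0 * x"
      by (intro tendsto_mult inv lim)
    moreover have "eventually (\<lambda>j. inverse (of_nat (m j)) * (of_nat (m j) * y j) = y j) sequentially"
      using m0 by eventually_elim auto
    ultimately show ?thesis by (simp add: Lim_transform_eventually)
  qed
  have small: "eventually (\<lambda>j. norm (y j) < 1/2) sequentially"
    using order_tendstoD(2)[OF tendsto_norm[OF y0], of "1/2"] by simp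
  have "(\<lambda>j. of_nat (m j) * (ln (1 + y j) - y j)) \<longlonglongrightarrow> 0"
  proof (rule Lim_null_comparison)
    show "eventually (\<lambda>j. norm (of_nat (m j) * (ln (1 + y j) - y j)) \<le> norm (of_nat (m j) * y j) * norm (y j) * 2) sequentially"
      using small
    proof eventually_elim
      case (elim j)
      have "norm (ln (1 + y j) - y j) \<le> norm (y j) ^ 2 / (1 - norm (y j))"
        using elim by (intro Ln_approx_linear) auto
      also have "\<dots> \<le> norm (y j) ^ 2 / (1/2)" using elim by (intro divide_left_mono) auto
      finally have "of_nat (m j) * norm (ln (1 + y j) - y j) \<le> of_nat (m j) * (norm (y j) ^ 2 / (1/2))"
        by (intro mult_left_mono) auto
      then show ?case by (simp add: norm_mult power2_eq_square mult_ac)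
    qed
    have "(\<lambda>j. norm (of_nat (m j) * y j) * norm (y j) * 2) \<longlonglongrightarrow> norm x * norm (0 :: complex) * 2"
      by (intro tendsto_intros lim y0)
    then show "(\<lambda>j. norm (of_nat (m j) * y j) * norm (y j) * 2) \<longlonglongrightarrow> 0" by simp
  qed
  then have "(\<lambda>j. of_nat (m j) * (ln (1 + y j) - y j) + of_nat (m j) * y j) \<longlonglongrightarrow> 0 + x"
    using lim by (rule tendsto_add)
  then have "(\<lambda>j. exp (of_nat (m j) * (ln (1 + y j) - y j) + of_nat (m j) * y j)) \<longlonglongrightarrow> exp x"
    by (intro tendsto_intros) simp
  moreover have "eventually (\<lambda>j. exp (of_nat (m j) * (ln (1 + y j) - y j) + of_nat (m j) * y j) = (1 + y j) ^ m j) sequentially"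
    using small
  proof eventually_elim
    case (elim j)
    have "1 + y j \<noteq> 0" using elim by (metis add_eq_0_iff norm_minus_cancel norm_one one_less_numeral_iff less_divide_eq_1_pos linorder_not_le mult_2 order.asym order_less_imp_le semiring_norm(76) zero_less_numeral)
    then show ?case by (simp add: right_diff_distrib exp_of_nat_mult)
  qed
  ultimately show ?thesis by (rule Lim_transform_eventually)
qed

lemma summable_on_exp_minus_abs: "(\<lambda>k :: int. exp (- real_of_int \<bar>k\<bar>)) summable_on UNIV"
proof -
  have g: "summable (\<lambda>n. exp (- 1 :: real) ^ n)" by (rule summable_geometric) simp
  have e: "exp (- real n) = exp (-1) ^ n" for n :: nat by (simp flip: exp_of_nat_mult)
  have 1: "(\<lambda>n. exp (- real n)) summable_on UNIV"
    unfolding e using g by (subst summable_on_UNIV_nonneg_real_iff) auto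
  have "(\<lambda>k :: int. exp (- real_of_int \<bar>k\<bar>)) summable_on (range int \<union> range (\<lambda>n. - int n))"
  proof (rule summable_on_union)
    show "(\<lambda>k :: int. exp (- real_of_int \<bar>k\<bar>)) summable_on range int"
      using 1 by (subst summable_on_reindex) (auto simp: o_def)
    show "(\<lambda>k :: int. exp (- real_of_int \<bar>k\<bar>)) summable_on range (\<lambda>n. - int n)"
      using 1 by (subst summable_on_reindex) (auto simp: o_def inj_on_def)
  qed
  moreover have "range int \<union> range (\<lambda>n. - int n) = UNIV"
    by (auto simp: image_iff) (metis int_cases2)
  ultimately show ?thesis by simp
qed

text \<open>Completing the square absorbs the linear term \<open>(x + 1) * |k|\<close> at the price
  of the constant \<open>(x + 1)^2 / (4 t)\<close> in the exponent and leaves the summable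
  \<open>exp (- |k|)\<close>.\<close>

lemma summable_on_gaussian:
  assumes "t > 0"
  shows "(\<lambda>k :: int. exp (- t * (real_of_int k)\<^sup>2 + x * real_of_int \<bar>k\<bar>)) summable_on UNIV"
proof (rule summable_on_comparison_test)
  show "(\<lambda>k :: int. exp ((x + 1)\<^sup>2 / (4 * t)) * exp (- real_of_int \<bar>k\<bar>)) summable_on UNIV"
    by (intro summable_on_cmult_right summable_on_exp_minus_abs)
  fix k :: int
  let ?u = "real_of_int \<bar>k\<bar>"
  have "0 \<le> t * (?u - (x + 1) / (2 * t))\<^sup>2" using assms by simp
  also have "\<dots> = t * ?u\<^sup>2 - (x + 1) * ?u + (x + 1)\<^sup>2 / (4 * t)"
    using assms by (simp add: power2_diff field_simps power2_eq_square)
  finally have "- t * ?u\<^sup>2 + x * ?u \<le> (x + 1)\<^sup>2 / (4 * t) - ?u" by (simp add: algebra_simps)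
  then show "exp (- t * (real_of_int k)\<^sup>2 + x * real_of_int \<bar>k\<bar>) \<le> exp ((x + 1)\<^sup>2 / (4 * t)) * exp (- real_of_int \<bar>k\<bar>)"
    by (simp flip: exp_add)
qed auto

subsection \<open>The triple product and the inversion of theta and eta\<close>

definition qpoch :: "real \<Rightarrow> nat \<Rightarrow> real" where
  "qpoch r n = (\<Prod>i<n. 1 - r ^ (2 * Suc i))"

text \<open>Extending the reciprocal by 0 to negative indices makes the recursion valid for all
  integers: at index 0 its factor \<open>1 - r powi 0\<close> vanishes. No boundary cases arise in
  the expansion below.\<close>

definition qpoch_inv :: "real \<Rightarrow> int \<Rightarrow> real" where
  "qpoch_inv r j = (if j < 0 then 0 else inverse (qpoch r (nat j)))"

text \<open>This is the Gaussian binomial coefficient with parameters \<open>2 * N\<close> and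
  \<open>N + k\<close> in base \<open>r^2\<close>.\<close>

definition jacobi_coeff :: "real \<Rightarrow> nat \<Rightarrow> int \<Rightarrow> real" where
  "jacobi_coeff r N k = qpoch r (2 * N) * qpoch_inv r (int N + k) * qpoch_inv r (int N - k)"

lemma qpoch_factor_pos: "0 < r \<Longrightarrow> r < 1 \<Longrightarrow> 0 < 1 - (r :: real) ^ (2 * Suc i)"
  using power_Suc_less_one[of r "Suc (2 * i)"] by (simp del: power_Suc)

lemma qpoch_pos: "0 < r \<Longrightarrow> r < 1 \<Longrightarrow> 0 < qpoch r n"
  unfolding qpoch_def by (intro prod_pos ballI qpoch_factor_pos)

lemma qpoch_inv_step:
  assumes "0 < r" "r < 1"
  shows "qpoch_inv r (j - 1) = (1 - r powi (2 * j)) * qpoch_inv r j"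
proof (cases "j \<le> 0")
  case True
  then show ?thesis by (auto simp: qpoch_inv_def)
next
  case False
  then obtain n where j: "j = int (Suc n)" by (metis gr0_implies_Suc not_le zero_less_imp_eq_int)
  have "r powi (2 * j) = r powi (int (2 * Suc n))" by (simp add: j)
  then have "r powi (2 * j) = r ^ (2 * Suc n)" by (simp only: power_int_of_nat)
  moreover have "nat j = Suc n" "nat (j - 1) = n" by (simp_all add: j)
  moreover have "qpoch r (Suc n) = qpoch r n * (1 - r ^ (2 * Suc n))" by (simp add: qpoch_def)
  ultimately show ?thesis
    using False qpoch_factor_pos[OF assms, of n] by (simp add: qpoch_inv_def del: power_Suc)
qed

text \<open>Two steps of the \<open>q\<close>-Pascal rule at once. All terms are multiples of the
  product of the two reciprocals with the largest indices, which reduces the claim to a polynomial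
  identity in \<open>X\<close>, \<open>Y\<close> and \<open>1 / r^2\<close>, with
  \<open>r ^ (4 * N + 2) = X * Y / r^2\<close>.\<close>

lemma jacobi_coeff_step:
  fixes k :: int and N :: nat and r :: real
  assumes r: "0 < r" "r < 1"
  defines "X \<equiv> r powi (2 * (int N + 1 + k))" and "Y \<equiv> r powi (2 * (int N + 1 - k))"
  shows "jacobi_coeff r (Suc N) k = (1 + r ^ (4 * N + 2)) * jacobi_coeff r N k
     + Y * jacobi_coeff r N (k - 1) + X * jacobi_coeff r N (k + 1)"
proof -
  let ?hX = "qpoch_inv r (int N + 1 + k)" and ?hY = "qpoch_inv r (int N + 1 - k)"
  have X1: "qpoch_inv r (int N + k) = (1 - X) * ?hX"
    using qpoch_inv_step[OF r, of "int N + 1 + k"] by (simp add: X_def algebra_simps)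
  have Y1: "qpoch_inv r (int N - k) = (1 - Y) * ?hY"
    using qpoch_inv_step[OF r, of "int N + 1 - k"] by (simp add: Y_def algebra_simps)
  have X2: "qpoch_inv r (int N + (k - 1)) = (1 - X / r\<^sup>2) * ((1 - X) * ?hX)"
  proof -
    have "r powi (2 * (int N + k)) = X / r\<^sup>2"
    proof -
      have "r powi (2 * (int N + k)) = r powi (2 * (int N + 1 + k) - 2)" by (simp add: algebra_simps)
      then show ?thesis using r power_int_diff[of r "2 * (int N + 1 + k)" 2] by (simp add: X_def)
    qed
    then show ?thesis using qpoch_inv_step[OF r, of "int N + k"] X1 by (simp only: add_diff_eq)
  qed
  have Y2: "qpoch_inv r (int N - (k + 1)) = (1 - Y / r\<^sup>2) * ((1 - Y) * ?hY)"
  proof -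
    have "r powi (2 * (int N - k)) = Y / r\<^sup>2"
    proof -
      have "r powi (2 * (int N - k)) = r powi (2 * (int N + 1 - k) - 2)" by (simp add: algebra_simps)
      then show ?thesis using r power_int_diff[of r "2 * (int N + 1 - k)" 2] by (simp add: Y_def)
    qed
    then show ?thesis using qpoch_inv_step[OF r, of "int N - k"] Y1 by (simp add: algebra_simps)
  qed
  have XY: "r ^ (4 * N + 4) = X * Y" "r ^ (4 * N + 2) = X * Y / r\<^sup>2"
  proof -
    have "X * Y = r powi (int (4 * N + 4))" using r by (simp add: X_def Y_def algebra_simps flip: power_int_add)
    then show "r ^ (4 * N + 4) = X * Y" by (simp only: power_int_of_nat)
    then show "r ^ (4 * N + 2) = X * Y / r\<^sup>2" using r by (simp add: power_add field_simps power2_eq_square power4_eq_xxxx)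
  qed
  have q: "qpoch r (2 * Suc N) = qpoch r (2 * N) * (1 - X * Y / r\<^sup>2) * (1 - X * Y)"
  proof -
    have Suc: "qpoch r (Suc n) = qpoch r n * (1 - r ^ (2 * Suc n))" for n by (simp add: qpoch_def)
    have e: "2 * Suc N = Suc (Suc (2 * N))" "2 * Suc (2 * N) = 4 * N + 2" "2 * Suc (Suc (2 * N)) = 4 * N + 4"
      by simp_all
    have "qpoch r (2 * Suc N) = qpoch r (2 * N) * (1 - r ^ (4 * N + 2)) * (1 - r ^ (4 * N + 4))"
      unfolding e(1) Suc e(2,3) ..
    then show ?thesis by (simp only: XY)
  qed
  have idx: "int (Suc N) + k = int N + 1 + k" "int (Suc N) - k = int N + 1 - k"
      "int N - (k - 1) = int N + 1 - k" "int N + (k + 1) = int N + 1 + k" by simp_all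
  have "(1 - X * Y / r\<^sup>2) * (1 - X * Y) = (1 + X * Y / r\<^sup>2) * ((1 - X) * (1 - Y))
      + Y * ((1 - X / r\<^sup>2) * (1 - X)) + X * ((1 - Y / r\<^sup>2) * (1 - Y))"
    by (simp add: diff_divide_distrib add_divide_distrib algebra_simps)
  moreover have "c2 * c3 = c1 * (a1 * b1) + Y * (a2 * a1) + X * (b2 * b1) \<Longrightarrow>
      Q * c2 * c3 * hX * hY = c1 * (Q * (a1 * hX) * (b1 * hY)) + Y * (Q * (a2 * (a1 * hX)) * hY)
        + X * (Q * hX * (b2 * (b1 * hY)))" for a1 a2 b1 b2 c1 c2 c3 Q hX hY :: real
  proof -
    assume *: "c2 * c3 = c1 * (a1 * b1) + Y * (a2 * a1) + X * (b2 * b1)"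
    have "Q * c2 * c3 * hX * hY = Q * hX * hY * (c2 * c3)" by simp
    then show ?thesis unfolding * by (simp add: algebra_simps)
  qed
  ultimately show ?thesis
    unfolding jacobi_coeff_def idx X1 Y1 X2 Y2 XY(2) q by blast
qed

lemma jacobi_coeff_outside: "int N < \<bar>k\<bar> \<Longrightarrow> jacobi_coeff r N k = 0"
  by (auto simp: jacobi_coeff_def qpoch_inv_def)

text \<open>Multiplication by the next pair of factors shifts the exponent of \<open>w\<close> by at
  most one. Against the Gaussian \<open>r powi k^2\<close> this shift produces exactly the weights
  of \<open>jacobi_coeff_step\<close>; coefficients outside the range vanish, so all sums may run
  over the larger range.\<close>

lemma finite_jacobi:
  fixes w :: complex
  assumes r: "0 < r" "r < 1" and w: "w \<noteq> 0"
  shows "(\<Prod>s<N. (1 + of_real (r ^ (2 * s + 1)) * w) * (1 + of_real (r ^ (2 * s + 1)) / w))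
    = (\<Sum>k\<in>{- int N..int N}. of_real (jacobi_coeff r N k * r powi (k\<^sup>2)) * w powi k)"
proof (induction N)
  case 0
  then show ?case by (simp add: jacobi_coeff_def qpoch_inv_def qpoch_def)
next
  case (Suc N)
  define T where "T N k = of_real (jacobi_coeff r N k * r powi (k\<^sup>2)) * w powi k" for N k
  have T0: "T N k = 0" if "int N < \<bar>k\<bar>" for k using that by (simp add: T_def jacobi_coeff_outside)
  let ?R = "{- int (Suc N)..int (Suc N)}"
  have S0: "(\<Sum>k\<in>{- int N..int N}. T N k) = (\<Sum>k\<in>?R. T N k)"
    by (rule sum.mono_neutral_left) (auto simp: T0)
  have S1: "(\<Sum>k\<in>{- int N..int N}. T N k) = (\<Sum>k\<in>?R. T N (k - 1))"
  proof -
    have "(\<Sum>k\<in>?R. T N (k - 1)) = (\<Sum>k\<in>{- int N - 2..int N}. T N k)"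
      by (rule sum.reindex_bij_witness[where i = "\<lambda>k. k + 1" and j = "\<lambda>k. k - 1"]) auto
    also have "\<dots> = (\<Sum>k\<in>{- int N..int N}. T N k)"
      by (rule sum.mono_neutral_right) (auto simp: T0)
    finally show ?thesis ..
  qed
  have S2: "(\<Sum>k\<in>{- int N..int N}. T N k) = (\<Sum>k\<in>?R. T N (k + 1))"
  proof -
    have "(\<Sum>k\<in>?R. T N (k + 1)) = (\<Sum>k\<in>{- int N..int N + 2}. T N k)"
      by (rule sum.reindex_bij_witness[where i = "\<lambda>k. k - 1" and j = "\<lambda>k. k + 1"]) auto
    also have "\<dots> = (\<Sum>k\<in>{- int N..int N}. T N k)"
      by (rule sum.mono_neutral_right) (auto simp: T0)
    finally show ?thesis ..
  qed
  let ?q = "complex_of_real (r ^ (2 * N + 1))"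
  have step: "T (Suc N) k = (1 + of_real (r ^ (4 * N + 2))) * T N k + ?q * w * T N (k - 1) + ?q / w * T N (k + 1)" for k
  proof -
    have p1: "r powi (k\<^sup>2) * r powi (2 * (int N + 1 - k)) = r ^ (2 * N + 1) * r powi ((k - 1)\<^sup>2)"
    proof -
      have "r powi (k\<^sup>2) * r powi (2 * (int N + 1 - k)) = r powi (int (2 * N + 1) + (k - 1)\<^sup>2)"
        using r by (simp add: power2_eq_square algebra_simps flip: power_int_add)
      also have "\<dots> = r powi int (2 * N + 1) * r powi ((k - 1)\<^sup>2)" using r by (subst power_int_add) auto
      finally show ?thesis by (simp only: power_int_of_nat)
    qed
    have p2: "r powi (k\<^sup>2) * r powi (2 * (int N + 1 + k)) = r ^ (2 * N + 1) * r powi ((k + 1)\<^sup>2)"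
    proof -
      have "r powi (k\<^sup>2) * r powi (2 * (int N + 1 + k)) = r powi (int (2 * N + 1) + (k + 1)\<^sup>2)"
        using r by (simp add: power2_eq_square algebra_simps flip: power_int_add)
      also have "\<dots> = r powi int (2 * N + 1) * r powi ((k + 1)\<^sup>2)" using r by (subst power_int_add) auto
      finally show ?thesis by (simp only: power_int_of_nat)
    qed
    have "jacobi_coeff r (Suc N) k * r powi (k\<^sup>2) = (1 + r ^ (4 * N + 2)) * (jacobi_coeff r N k * r powi (k\<^sup>2))
      + jacobi_coeff r N (k - 1) * (r powi (k\<^sup>2) * r powi (2 * (int N + 1 - k)))
      + jacobi_coeff r N (k + 1) * (r powi (k\<^sup>2) * r powi (2 * (int N + 1 + k)))"
      unfolding jacobi_coeff_step[OF r] by (simp add: algebra_simps)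
    then have c: "jacobi_coeff r (Suc N) k * r powi (k\<^sup>2) = (1 + r ^ (4 * N + 2)) * (jacobi_coeff r N k * r powi (k\<^sup>2))
      + r ^ (2 * N + 1) * (jacobi_coeff r N (k - 1) * r powi ((k - 1)\<^sup>2))
      + r ^ (2 * N + 1) * (jacobi_coeff r N (k + 1) * r powi ((k + 1)\<^sup>2))"
      unfolding p1 p2 by (simp add: mult_ac)
    have w1: "w * w powi (k - 1) = w powi k" "w powi (k + 1) / w = w powi k"
      using w by (simp_all add: power_int_diff power_int_add)
    have "?q * w * T N (k - 1) = ?q * of_real (jacobi_coeff r N (k - 1) * r powi ((k - 1)\<^sup>2)) * (w * w powi (k - 1))"
      by (simp add: T_def mult_ac)
    then have e1: "?q * w * T N (k - 1) = ?q * of_real (jacobi_coeff r N (k - 1) * r powi ((k - 1)\<^sup>2)) * w powi k"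
      unfolding w1 .
    have "?q / w * T N (k + 1) = ?q * of_real (jacobi_coeff r N (k + 1) * r powi ((k + 1)\<^sup>2)) * (w powi (k + 1) / w)"
      by (simp add: T_def mult_ac)
    then have e2: "?q / w * T N (k + 1) = ?q * of_real (jacobi_coeff r N (k + 1) * r powi ((k + 1)\<^sup>2)) * w powi k"
      unfolding w1 .
    have gen: "of_real ((1 + u) * a + t * b + t * d) * W
        = (1 + of_real u) * (of_real a * W) + of_real t * of_real b * W + of_real t * of_real d * W"
      for u a t b d :: real and W :: complex by (simp add: algebra_simps)
    show ?thesis unfolding e1 e2 unfolding T_def c by (rule gen)
  qed
  have rr: "?q * ?q = of_real (r ^ (4 * N + 2))"
  proof -
    have "(2 * N + 1) + (2 * N + 1) = 4 * N + 2" by simp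
    then show ?thesis by (metis of_real_mult power_add)
  qed
  have gen: "(1 + q * w) * (1 + q / w) = (1 + q * q) + q * w + q / w" for q
    using w by (simp add: field_simps)
  have "(\<Prod>s<Suc N. (1 + of_real (r ^ (2 * s + 1)) * w) * (1 + of_real (r ^ (2 * s + 1)) / w))
    = (\<Sum>k\<in>{- int N..int N}. T N k) * ((1 + ?q * w) * (1 + ?q / w))"
    using Suc.IH by (simp add: T_def)
  also have "(1 + ?q * w) * (1 + ?q / w) = (1 + of_real (r ^ (4 * N + 2))) + ?q * w + ?q / w"
    by (simp only: gen rr)
  also have "(\<Sum>k\<in>{- int N..int N}. T N k) * ((1 + of_real (r ^ (4 * N + 2))) + ?q * w + ?q / w)
    = (1 + of_real (r ^ (4 * N + 2))) * (\<Sum>k\<in>{- int N..int N}. T N k)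
      + ?q * w * (\<Sum>k\<in>{- int N..int N}. T N k) + ?q / w * (\<Sum>k\<in>{- int N..int N}. T N k)"
    by (simp only: ring_distribs mult.commute)
  also have "\<dots> = (1 + of_real (r ^ (4 * N + 2))) * (\<Sum>k\<in>?R. T N k)
      + ?q * w * (\<Sum>k\<in>?R. T N (k - 1)) + ?q / w * (\<Sum>k\<in>?R. T N (k + 1))"
    by (metis S0 S1 S2)
  also have "\<dots> = (\<Sum>k\<in>?R. T (Suc N) k)"
    unfolding sum_distrib_left sum.distrib[symmetric] by (intro sum.cong refl) (simp only: step)
  finally show ?case by (simp only: T_def)
qed

lemma summable_qpoch: "0 < r \<Longrightarrow> r < 1 \<Longrightarrow> summable (\<lambda>i. (r :: real) ^ (2 * Suc i))"
proof -
  assume r: "0 < r" "r < 1"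
  have "r\<^sup>2 < 1" using r by (simp add: power_less_one_iff)
  then have "summable (\<lambda>i. r\<^sup>2 * (r\<^sup>2) ^ i)" using r by (intro summable_mult summable_geometric) auto
  moreover have "r\<^sup>2 * (r\<^sup>2) ^ i = r ^ (2 * Suc i)" for i by (simp only: power_mult power_Suc)
  ultimately show ?thesis by (simp only:)
qed

lemma qpoch_tendsto:
  assumes r: "0 < r" "r < 1"
  shows "qpoch r \<longlonglongrightarrow> P_prod r" "P_prod r > 0" "P_prod r \<le> qpoch r n" "qpoch r n \<le> 1"
proof -
  have conv: "convergent_prod (\<lambda>k. 1 - r ^ (2 * Suc k))"
    using summable_qpoch[OF r] r
    by (intro abs_convergent_prod_imp_convergent_prod summable_imp_abs_convergent_prod) (simp add: abs_of_pos)
  have lim: "qpoch r \<longlonglongrightarrow> P_prod r"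
    using convergent_prod_LIMSEQ[OF conv]
    unfolding qpoch_def P_prod_def by (simp add: LIMSEQ_lessThan_iff_atMost)
  then show "qpoch r \<longlonglongrightarrow> P_prod r" .
  have "1 - r ^ (2 * Suc k) \<noteq> 0" for k using qpoch_factor_pos[OF r, of k] by simp
  then have nz: "P_prod r \<noteq> 0" unfolding P_prod_def using conv by (intro prodinf_nonzero) auto
  have "qpoch r (Suc n) \<le> qpoch r n" for n
    using qpoch_pos[OF r, of n] r by (simp add: qpoch_def mult_left_le)
  then have "decseq (qpoch r)" by (intro decseq_SucI)
  then show le: "P_prod r \<le> qpoch r n" for n using decseq_ge[OF _ lim] by blast
  have "0 \<le> P_prod r" by (rule LIMSEQ_le_const[OF lim]) (use qpoch_pos[OF r] in \<open>auto intro: less_imp_le\<close>)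
  then show "P_prod r > 0" using nz by simp
  show "qpoch r n \<le> 1" unfolding qpoch_def
    using qpoch_factor_pos[OF r] r by (intro prod_le_1) (auto intro: less_imp_le simp del: power_Suc)
qed

definition theta_series :: "real \<Rightarrow> complex \<Rightarrow> complex" where
  "theta_series r w = (\<Sum>\<^sub>\<infinity>k\<in>UNIV. of_real (r powi (k\<^sup>2)) * w powi k)"

lemma norm_theta_term_le:
  assumes r: "0 < r" and w: "w \<noteq> 0"
  shows "norm (complex_of_real (r powi (k\<^sup>2)) * w powi k) \<le> exp (ln r * (real_of_int k)\<^sup>2 + \<bar>ln (norm w)\<bar> * real_of_int \<bar>k\<bar>)"
proof -
  have "r powi (k\<^sup>2) = exp (ln r * (real_of_int k)\<^sup>2)"
    using r by (simp add: powr_real_of_int'[symmetric] powr_def)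
  moreover have "norm w powi k = exp (real_of_int k * ln (norm w))"
    using w by (simp add: powr_real_of_int'[symmetric] powr_def)
  moreover have "real_of_int k * ln (norm w) \<le> \<bar>ln (norm w)\<bar> * real_of_int \<bar>k\<bar>"
    by (metis abs_ge_self abs_mult mult.commute of_int_abs)
  ultimately show ?thesis
    by (simp add: norm_mult norm_power_int exp_add)
qed

lemma summable_theta_majorant:
  assumes "0 < r" "r < 1"
  shows "(\<lambda>k. exp (ln r * (real_of_int k)\<^sup>2 + x * real_of_int \<bar>k\<bar>)) summable_on UNIV"
  using summable_on_gaussian[of "- ln r" x] assms by simp

lemma summable_theta_series:
  assumes "0 < r" "r < 1" "w \<noteq> 0"
  shows "(\<lambda>k. norm (complex_of_real (r powi (k\<^sup>2)) * w powi k)) summable_on UNIV"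
  by (rule summable_on_comparison_test[OF summable_theta_majorant[OF assms(1,2), of "\<bar>ln (norm w)\<bar>"]])
     (use norm_theta_term_le[OF assms(1,3)] in auto)

text \<open>The limit of the finite identity. The coefficients tend to \<open>1 / P_prod r\<close>
  and, since each \<open>qpoch\<close> lies between \<open>P_prod r\<close> and 1, never exceed
  \<open>1 / (P_prod r)^2\<close>; so the theta terms themselves serve as majorant.\<close>

theorem jacobi_triple_product:
  fixes w :: complex
  assumes r: "0 < r" "r < 1" and w: "w \<noteq> 0"
  shows "(\<Prod>s. 1 + of_real (r ^ (2 * s + 1)) * w) * (\<Prod>s. 1 + of_real (r ^ (2 * s + 1)) / w)
    = theta_series r w / of_real (P_prod r)"
proof -
  let ?P = "P_prod r"
  have P: "?P > 0" using qpoch_tendsto[OF r] by simp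
  have sr: "summable (\<lambda>s. r ^ (2 * s + 1))"
  proof -
    have "summable (\<lambda>i. inverse r * r ^ (2 * Suc i))" by (intro summable_mult summable_qpoch r)
    then show ?thesis using r by (simp add: field_simps)
  qed
  have conv: "(\<lambda>N. \<Prod>s<N. 1 + of_real (r ^ (2 * s + 1)) * v) \<longlonglongrightarrow> (\<Prod>s. 1 + of_real (r ^ (2 * s + 1)) * v)" for v :: complex
    using sr r by (intro prod_lessThan_tendsto_prodinf convergent_prod_one_plus)
      (auto simp: norm_mult norm_power intro: summable_mult2)
  have L: "(\<lambda>N. \<Prod>s<N. (1 + of_real (r ^ (2 * s + 1)) * w) * (1 + of_real (r ^ (2 * s + 1)) / w))
    \<longlonglongrightarrow> (\<Prod>s. 1 + of_real (r ^ (2 * s + 1)) * w) * (\<Prod>s. 1 + of_real (r ^ (2 * s + 1)) / w)"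
    using tendsto_mult[OF conv[of w] conv[of "inverse w"]] by (simp add: prod.distrib divide_inverse)
  let ?a = "\<lambda>N k. complex_of_real (jacobi_coeff r N k * r powi (k\<^sup>2)) * w powi k"
  have R: "(\<lambda>N. infsum (?a N) UNIV) \<longlonglongrightarrow> (\<Sum>\<^sub>\<infinity>k\<in>UNIV. of_real (1 / ?P * r powi (k\<^sup>2)) * w powi k)"
  proof (rule tannery_int)
    fix k :: int
    have ni: "filterlim (\<lambda>N. nat (int N + j)) at_top sequentially" for j
      unfolding filterlim_at_top
    proof
      fix Z show "eventually (\<lambda>N. Z \<le> nat (int N + j)) sequentially"
        using eventually_ge_at_top[of "Z + nat \<bar>j\<bar>"] by eventually_elim auto
    qed
    have qi: "(\<lambda>N. qpoch_inv r (int N + j)) \<longlonglongrightarrow> inverse ?P" for j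
    proof (rule Lim_transform_eventually)
      show "(\<lambda>N. inverse (qpoch r (nat (int N + j)))) \<longlonglongrightarrow> inverse ?P"
        using P by (intro tendsto_inverse filterlim_compose[OF qpoch_tendsto(1)[OF r] ni]) simp
      show "eventually (\<lambda>N. inverse (qpoch r (nat (int N + j))) = qpoch_inv r (int N + j)) sequentially"
        using eventually_ge_at_top[of "nat \<bar>j\<bar>"] by eventually_elim (auto simp: qpoch_inv_def)
    qed
    have q2: "(\<lambda>N. qpoch r (2 * N)) \<longlonglongrightarrow> ?P"
      by (rule filterlim_compose[OF qpoch_tendsto(1)[OF r]]) (rule filterlim_subseq, simp add: strict_mono_def)
    have "(\<lambda>N. jacobi_coeff r N k) \<longlonglongrightarrow> ?P * inverse ?P * inverse ?P"
      unfolding jacobi_coeff_def using tendsto_mult[OF tendsto_mult[OF q2 qi[of k]] qi[of "- k"]] by simp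
    then have "(\<lambda>N. jacobi_coeff r N k) \<longlonglongrightarrow> 1 / ?P" using P by (simp add: divide_inverse)
    then show "(\<lambda>N. ?a N k) \<longlonglongrightarrow> of_real (1 / ?P * r powi (k\<^sup>2)) * w powi k"
      by (intro tendsto_intros)
  next
    show "(\<lambda>k. 1 / ?P\<^sup>2 * exp (ln r * (real_of_int k)\<^sup>2 + \<bar>ln (norm w)\<bar> * real_of_int \<bar>k\<bar>)) summable_on UNIV"
      by (intro summable_on_cmult_right summable_theta_majorant r)
    show "eventually (\<lambda>N. \<forall>k. norm (?a N k) \<le> 1 / ?P\<^sup>2 * exp (ln r * (real_of_int k)\<^sup>2 + \<bar>ln (norm w)\<bar> * real_of_int \<bar>k\<bar>)) sequentially"
    proof (intro always_eventually allI)
      fix N k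
      have qi: "0 \<le> qpoch_inv r j" "qpoch_inv r j \<le> 1 / ?P" for j
        using qpoch_pos[OF r, of "nat j"] qpoch_tendsto(3)[OF r, of "nat j"] P
        by (auto simp: qpoch_inv_def field_simps)
      have "jacobi_coeff r N k \<le> 1 * (1 / ?P) * (1 / ?P)"
        unfolding jacobi_coeff_def using qi qpoch_tendsto(4)[OF r] qpoch_pos[OF r, of "2 * N"] P
        by (intro mult_mono) auto
      moreover have "0 \<le> jacobi_coeff r N k"
        unfolding jacobi_coeff_def using qi qpoch_pos[OF r, of "2 * N"] by simp
      ultimately have c: "\<bar>jacobi_coeff r N k\<bar> \<le> 1 / ?P\<^sup>2" by (simp add: power2_eq_square)
      have "norm (?a N k) = \<bar>jacobi_coeff r N k\<bar> * norm (complex_of_real (r powi (k\<^sup>2)) * w powi k)"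
        by (simp add: norm_mult)
      also have "\<dots> \<le> 1 / ?P\<^sup>2 * exp (ln r * (real_of_int k)\<^sup>2 + \<bar>ln (norm w)\<bar> * real_of_int \<bar>k\<bar>)"
        by (intro mult_mono c norm_theta_term_le r w) auto
      finally show "norm (?a N k) \<le> 1 / ?P\<^sup>2 * exp (ln r * (real_of_int k)\<^sup>2 + \<bar>ln (norm w)\<bar> * real_of_int \<bar>k\<bar>)" .
    qed
  qed
  have fin: "infsum (?a N) UNIV = (\<Prod>s<N. (1 + of_real (r ^ (2 * s + 1)) * w) * (1 + of_real (r ^ (2 * s + 1)) / w))" for N
  proof -
    have "infsum (?a N) UNIV = infsum (?a N) {- int N..int N}"
      by (rule infsum_cong_neutral) (auto simp: jacobi_coeff_outside)
    also have "\<dots> = (\<Sum>k\<in>{- int N..int N}. ?a N k)" by (rule infsum_finite) simp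
    finally show ?thesis unfolding finite_jacobi[OF r w] .
  qed
  have "(\<Sum>\<^sub>\<infinity>k\<in>UNIV. complex_of_real (1 / ?P * r powi (k\<^sup>2)) * w powi k)
      = (\<Sum>\<^sub>\<infinity>k\<in>UNIV. (1 / of_real ?P) * (complex_of_real (r powi (k\<^sup>2)) * w powi k))"
    by (simp add: mult_ac)
  also have "\<dots> = theta_series r w / of_real ?P"
    unfolding theta_series_def by (subst infsum_cmult_right') simp
  finally show ?thesis using LIMSEQ_unique[OF L] R unfolding fin by simp
qed

section \<open>Binomial and hyperbolic estimates for the theta transformation\<close>

text \<open>Each factor lies between \<open>exp (- k / (m - k))\<close> and
  \<open>exp (- k / (m + k))\<close>, bounds that are independent of \<open>i\<close>; the
  \<open>k\<close>-th power gives Gaussians on both sides.\<close>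

lemma prod_one_minus_bounds:
  fixes m k :: nat
  assumes k: "k < m"
  shows "exp (- (real k)\<^sup>2 / (real m - real k)) \<le> (\<Prod>i\<in>{1..k}. 1 - real k / real (m + i))"
    and "(\<Prod>i\<in>{1..k}. 1 - real k / real (m + i)) \<le> exp (- (real k)\<^sup>2 / (real m + real k))"
proof -
  have lower: "exp (- real k / (real m - real k)) \<le> 1 - real k / real (m + i)" for i
  proof -
    let ?x = "real k / real (m + i)"
    have "1 / (1 - ?x) = 1 + real k / (real m + real i - real k)" using k by (simp add: field_simps)
    also have "\<dots> \<le> exp (real k / (real m + real i - real k))" by (rule exp_ge_add_one_self)
    also have "\<dots> \<le> exp (real k / (real m - real k))" using k by (simp add: frac_le)
    finally have "1 / (1 - ?x) \<le> exp (real k / (real m - real k))" .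
    moreover have "0 < 1 - ?x" using k by (simp add: field_simps)
    ultimately have "1 \<le> exp (real k / (real m - real k)) * (1 - ?x)" by (simp add: field_simps)
    then have "exp (- (real k / (real m - real k))) * 1 \<le> exp (- (real k / (real m - real k))) * (exp (real k / (real m - real k)) * (1 - ?x))"
      by (intro mult_left_mono) auto
    also have "\<dots> = 1 - ?x" by (simp add: exp_minus field_simps)
    finally show ?thesis by simp
  qed
  have upper: "1 - real k / real (m + i) \<le> exp (- real k / (real m + real k))" if "i \<le> k" for i
  proof -
    have "1 - real k / real (m + i) \<le> exp (- (real k / real (m + i)))"
      using exp_ge_add_one_self[of "- (real k / real (m + i))"] by simp
    also have "\<dots> \<le> exp (- (real k / (real m + real k)))" using that k by (simp add: frac_le)
    finally show ?thesis by simp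
  qed
  have pos: "0 \<le> 1 - real k / real (m + i)" for i using k by (simp add: field_simps)
  have "(\<Prod>i\<in>{1..k}. exp (- real k / (real m - real k))) \<le> (\<Prod>i\<in>{1..k}. 1 - real k / real (m + i))"
    by (intro prod_mono conjI lower) simp
  then show "exp (- (real k)\<^sup>2 / (real m - real k)) \<le> (\<Prod>i\<in>{1..k}. 1 - real k / real (m + i))"
    by (simp add: power2_eq_square flip: exp_of_nat_mult)
  have "(\<Prod>i\<in>{1..k}. 1 - real k / real (m + i)) \<le> (\<Prod>i\<in>{1..k}. exp (- real k / (real m + real k)))"
    by (intro prod_mono conjI upper pos) simp
  then show "(\<Prod>i\<in>{1..k}. 1 - real k / real (m + i)) \<le> exp (- (real k)\<^sup>2 / (real m + real k))"
    by (simp add: power2_eq_square flip: exp_of_nat_mult)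
qed

text \<open>Together with the preceding bounds this yields the Gaussian profile of the binomial
  coefficients relative to the central one, without Stirling's formula.\<close>

lemma binomial_ratio:
  fixes m k :: nat
  assumes "k \<le> m"
  shows "real (2 * m choose (m + k)) = real (2 * m choose m) * (\<Prod>i\<in>{1..k}. 1 - real k / real (m + i))"
proof -
  have a: "fact (m + k) = (fact m :: real) * (\<Prod>i\<in>{1..k}. real (m + i))"
    by (induction k) (auto simp: algebra_simps)
  have b: "(fact m :: real) = fact (m - k) * (\<Prod>i\<in>{1..k}. real (m + i) - real k)"
  proof -
    have "(fact ((m - k) + k) :: real) = fact (m - k) * (\<Prod>i\<in>{1..k}. real ((m - k) + i))"
    proof -
      have "(fact (c + k) :: real) = fact c * (\<Prod>i\<in>{1..k}. real (c + i))" for c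
        by (induction k) (auto simp: algebra_simps)
      then show ?thesis .
    qed
    moreover have "real ((m - k) + i) = real (m + i) - real k" for i using assms by (simp add: of_nat_diff)
    ultimately show ?thesis using assms by simp
  qed
  let ?A = "\<Prod>i\<in>{1..k}. real (m + i)" and ?B = "\<Prod>i\<in>{1..k}. real (m + i) - real k"
  have nz: "?A \<noteq> 0" "(fact (m - k) :: real) \<noteq> 0" "(fact m :: real) \<noteq> 0" "(fact (m + k) :: real) \<noteq> 0"
    using assms by (auto simp: prod_zero_iff)
  have "(\<Prod>i\<in>{1..k}. 1 - real k / real (m + i)) = (\<Prod>i\<in>{1..k}. (real (m + i) - real k) / real (m + i))"
    by (intro prod.cong refl) (simp add: field_simps)
  also have "\<dots> = ?B / ?A" by (rule prod_dividef)
  finally have c: "(\<Prod>i\<in>{1..k}. 1 - real k / real (m + i)) = ?B / ?A" .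
  have 1: "real (2 * m choose (m + k)) = fact (2 * m) / (fact (m + k) * fact (m - k))"
    using assms by (subst binomial_fact) (auto simp: mult_2)
  have 2: "real (2 * m choose m) = fact (2 * m) / (fact m * fact m)"
    by (subst binomial_fact) (auto simp: mult_2)
  have "f2 / (fm * A * fk) = f2 / (fm * fm) * (B / A)" if "fm = fk * B" "A \<noteq> 0" "fk \<noteq> 0" "fm \<noteq> 0"
    for f2 fm A fk B :: real
    using that by (simp add: field_simps)
  from this[OF b nz(1,2,3)] show ?thesis unfolding c 1 2 a .
qed

text \<open>The product on the right is the partial Wallis product, whose limit
  \<open>\<pi> / 2\<close> is the source of the factor \<open>1 / sqrt (\<pi> t)\<close> in the
  theta transformation.\<close>

lemma central_binomial_sq:
  "(real (2 * m choose m) / 4 ^ m)\<^sup>2 * (2 * real m + 1) = inverse (\<Prod>k=1..m. (4*real k^2) / (4*real k^2 - 1))"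
proof (induction m)
  case (Suc m)
  have c: "real (2 * Suc m choose Suc m) / 4 ^ Suc m = real (2 * m choose m) / 4 ^ m * ((2 * real m + 1) / (2 * real m + 2))"
  proof -
    have bf: "real (2 * n choose n) = fact (2 * n) / (fact n * fact n)" for n
      by (subst binomial_fact) (auto simp: mult_2)
    have 1: "(fact (2 * Suc m) :: real) = (2 * real m + 2) * ((2 * real m + 1) * fact (2 * m))"
      by (simp add: algebra_simps)
    have 2: "(fact (Suc m) :: real) = (real m + 1) * fact m" by simp
    have "(2 * x + 2) * ((2 * x + 1) * f2) / ((x + 1) * fm * ((x + 1) * fm)) / (4 * p)
        = f2 / (fm * fm) / p * ((2 * x + 1) / (2 * x + 2))" if "x \<ge> 0" "fm \<noteq> 0" "p \<noteq> 0" for x f2 fm p :: real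
    proof -
      have e: "2 * x + 2 = 2 * (x + 1)" by simp
      have "x + 1 \<noteq> 0" using that by simp
      then show ?thesis unfolding e using that by (simp add: divide_simps) (simp add: algebra_simps)
    qed
    from this[of "real m" "fact m" "4 ^ m" "fact (2 * m)"]
    show ?thesis unfolding bf 1 2 by simp
  qed
  have k: "4 * real (Suc m) ^ 2 - 1 = (2 * real m + 1) * (2 * real m + 3)"
    by (simp add: power2_eq_square algebra_simps)
  have "(real (2 * Suc m choose Suc m) / 4 ^ Suc m)\<^sup>2 * (2 * real (Suc m) + 1)
    = ((real (2 * m choose m) / 4 ^ m)\<^sup>2 * (2 * real m + 1)) * ((2 * real m + 1) * (2 * real m + 3) / (4 * real (Suc m) ^ 2))"
    unfolding c power_mult_distrib by (simp add: divide_simps) (simp add: power2_eq_square algebra_simps)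
  also have "\<dots> = inverse (\<Prod>k=1..m. (4*real k^2) / (4*real k^2 - 1)) * inverse ((4 * real (Suc m) ^ 2) / (4 * real (Suc m) ^ 2 - 1))"
    unfolding Suc.IH k inverse_divide ..
  also have "\<dots> = inverse (\<Prod>k=1..Suc m. (4*real k^2) / (4*real k^2 - 1))"
    by (subst prod.nat_ivl_Suc') (simp, simp only: inverse_mult_distrib mult.commute)
  finally show ?case .
qed simp

lemma jordan_sin:
  fixes x :: real
  assumes "0 \<le> x" "x \<le> pi / 2"
  shows "2 / pi * x \<le> sin x"
proof -
  have conc: "concave_on {0..pi/2} sin"
    unfolding concave_on_def
    by (rule f''_ge0_imp_convex[where f' = "\<lambda>x. - cos x" and f'' = sin])
       (auto intro!: derivative_eq_intros sin_ge_zero)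
  have "sin ((1 - x * 2 / pi) *\<^sub>R 0 + (x * 2 / pi) *\<^sub>R (pi / 2)) \<ge> (1 - x * 2 / pi) * sin 0 + (x * 2 / pi) * sin (pi / 2)"
    using assms by (intro concave_onD[OF conc]) (auto simp: field_simps)
  then show ?thesis by (simp add: field_simps)
qed

text \<open>\<open>|cosh (x + \<i> y)|^2 = 1 + (sinh x)^2 - (sin y)^2\<close>, which is at most the
  exponential of the difference. On the strip \<open>|y| \<le> \<pi> / 2\<close> Jordan's inequality
  replaces \<open>sin y\<close> by a multiple of \<open>y\<close>, so powers decay like a Gaussian
  in \<open>y\<close>.\<close>

lemma norm_cosh_le:
  fixes z :: complex
  assumes "\<bar>Im z\<bar> \<le> pi / 2"
  shows "(norm (cosh z))\<^sup>2 \<le> exp ((sinh (Re z))\<^sup>2 - 4 * (Im z)\<^sup>2 / pi\<^sup>2)"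
proof -
  have c: "cosh z = of_real (cosh (Re z) * cos (Im z)) + \<i> * of_real (sinh (Re z) * sin (Im z))"
  proof -
    have "cosh z = cosh (of_real (Re z) + \<i> * of_real (Im z))" by (metis complex_eq)
    also have "\<dots> = cosh (of_real (Re z)) * cosh (\<i> * of_real (Im z)) + sinh (of_real (Re z)) * sinh (\<i> * of_real (Im z))"
      by (rule cosh_add)
    also have "cosh (\<i> * complex_of_real (Im z)) = cos (of_real (Im z))" by (simp add: cosh_def cos_exp_eq exp_minus scaleR_conv_of_real field_simps)
    also have "sinh (\<i> * complex_of_real (Im z)) = \<i> * sin (of_real (Im z))" by (simp add: sinh_def sin_exp_eq exp_minus scaleR_conv_of_real field_simps)
    also have "cosh (complex_of_real (Re z)) = of_real (cosh (Re z))"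
      by (simp add: cosh_def scaleR_conv_of_real exp_of_real flip: of_real_minus)
    also have "sinh (complex_of_real (Re z)) = of_real (sinh (Re z))"
      by (simp add: sinh_def scaleR_conv_of_real exp_of_real flip: of_real_minus)
    finally show ?thesis by (simp add: cos_of_real sin_of_real mult_ac)
  qed
  have "(norm (cosh z))\<^sup>2 = (cosh (Re z) * cos (Im z))\<^sup>2 + (sinh (Re z) * sin (Im z))\<^sup>2"
    unfolding c cmod_power2 by simp
  also have "\<dots> = 1 + ((sinh (Re z))\<^sup>2 - (sin (Im z))\<^sup>2)"
    unfolding power_mult_distrib cosh_square_eq cos_squared_eq by (simp add: algebra_simps)
  also have "\<dots> \<le> exp ((sinh (Re z))\<^sup>2 - (sin (Im z))\<^sup>2)" by (rule exp_ge_add_one_self)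
  also have "\<dots> \<le> exp ((sinh (Re z))\<^sup>2 - 4 * (Im z)\<^sup>2 / pi\<^sup>2)"
  proof -
    have "2 * \<bar>Im z\<bar> / pi \<le> \<bar>sin (Im z)\<bar>"
    proof -
      from jordan_sin[of "\<bar>Im z\<bar>"] assms show ?thesis
        by (cases "Im z \<ge> 0") (auto simp: abs_if sin_ge_zero split: if_splits)
    qed
    then have "(2 * \<bar>Im z\<bar> / pi)\<^sup>2 \<le> \<bar>sin (Im z)\<bar>\<^sup>2" by (intro power_mono) auto
    then show ?thesis by (simp add: power_divide power_mult_distrib)
  qed
  finally show ?thesis .
qed

text \<open>An odd order lets the residues be centred at 0, so that the frequencies in the filter
  stay inside the strip where powers of \<open>cosh\<close> can be bounded.\<close>

lemma odd_roots_sum: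
  fixes L :: nat and k :: int
  defines "l \<equiv> 2 * L + 1"
  shows "(\<Sum>\<nu>\<in>{- int L..int L}. exp (2 * of_real pi * \<i> * of_int (\<nu> * k) / of_nat l))
    = (if int l dvd k then of_nat l else (0 :: complex))"
proof -
  define z where "z = exp (2 * of_real pi * \<i> * of_int k / of_nat l :: complex)"
  have l: "l > 0" by (simp add: l_def)
  have zl: "z ^ l = 1"
  proof -
    have "z ^ l = exp (of_nat l * (2 * of_real pi * \<i> * of_int k / of_nat l))"
      unfolding z_def by (simp only: exp_of_nat_mult)
    also have "of_nat l * (2 * of_real pi * \<i> * of_int k / of_nat l) = 2 * of_int k * of_real pi * \<i>" using l by simp
    finally show ?thesis by (simp add: exp_eq_1) 
  qed
  have z1: "z = 1 \<longleftrightarrow> int l dvd k"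
  proof
    assume "z = 1"
    then obtain n :: int where "Im (2 * of_real pi * \<i> * of_int k / of_nat l) = of_int (2 * n) * pi"
      unfolding z_def exp_eq_1 by blast
    then have "real_of_int k = real_of_int (int l * n)" using l by (simp add: field_simps)
    then have "k = int l * n" by linarith
    then show "int l dvd k" by simp
  next
    assume "int l dvd k"
    then obtain n where "k = int l * n" by auto
    then have "2 * of_real pi * \<i> * of_int k / of_nat l = (2 * of_int n * of_real pi * \<i> :: complex)" using l by simp
    then show "z = 1" unfolding z_def by (simp add: exp_eq_1)
  qed
  have znz: "z \<noteq> 0" by (simp add: z_def)
  have "(\<Sum>\<nu>\<in>{- int L..int L}. exp (2 * of_real pi * \<i> * of_int (\<nu> * k) / of_nat l))
    = (\<Sum>\<nu>\<in>{- int L..int L}. z powi \<nu>)"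
  proof (intro sum.cong refl)
    fix \<nu> :: int
    show "exp (2 * of_real pi * \<i> * of_int (\<nu> * k) / of_nat l) = z powi \<nu>"
    proof -
      have "z powi \<nu> = exp (of_int \<nu> * (2 * of_real pi * \<i> * of_int k / of_nat l))"
        unfolding z_def by (rule exp_power_int)
      also have "of_int \<nu> * (2 * of_real pi * \<i> * of_int k / of_nat l) = 2 * of_real pi * \<i> * of_int (\<nu> * k) / of_nat l" by simp
      finally show ?thesis ..
    qed
  qed
  also have "\<dots> = (\<Sum>i<l. z powi (int i - int L))"
    by (rule sum.reindex_bij_witness[where i = "\<lambda>i. int i - int L" and j = "\<lambda>\<nu>. nat (\<nu> + int L)"]) (auto simp: l_def)
  also have "\<dots> = (\<Sum>i<l. z ^ i) / z ^ L"
    using znz by (simp add: power_int_diff sum_divide_distrib)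
  also have "\<dots> = (if int l dvd k then of_nat l else 0)"
  proof (cases "z = 1")
    case True
    then show ?thesis using z1 by simp
  next
    case False
    then show ?thesis using z1 zl by (simp add: geometric_sum)
  qed
  finally show ?thesis .
qed

text \<open>Polya's proof of the theta transformation: a root-of-unity filter applied to
  \<open>(2 cosh)\<^sup>2\<^sup>m\<close> is an exact finite identity whose limit is the transformation formula.\<close>

lemma polya_identity:
  fixes s :: complex and L m :: nat
  defines "l \<equiv> 2 * L + 1"
  shows "(\<Sum>\<nu>\<in>{- int L..int L}. cosh ((s + 2 * of_real pi * \<i> * of_int \<nu>) / (2 * of_nat l)) ^ (2 * m))
    = (\<Sum>j\<in>{- int m..int m}. if \<bar>int l * j\<bar> \<le> int m
        then of_real (real l * real (2 * m choose nat (int m + int l * j)) / 4 ^ m) * exp (of_int j * s) else 0)"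
proof -
  have l: "l > 0" by (simp add: l_def)
  have pw: "cosh z ^ (2 * m) = (\<Sum>k\<in>{- int m..int m}. of_nat (2 * m choose nat (int m + k)) / 4 ^ m * exp (of_int (2 * k) * z))"
    for z :: complex
  proof -
    have "cosh z ^ (2 * m) = (exp z + exp (- z)) ^ (2 * m) / 4 ^ m"
      by (simp add: cosh_def scaleR_conv_of_real power_mult_distrib power_mult)
         (simp add: power_mult_distrib power_divide power_mult field_simps)
    also have "(exp z + exp (- z)) ^ (2 * m) = (\<Sum>i\<le>2 * m. of_nat (2 * m choose i) * exp z ^ i * exp (- z) ^ (2 * m - i))"
      by (rule binomial_ring)
    also have "\<dots> = (\<Sum>k\<in>{- int m..int m}. of_nat (2 * m choose nat (int m + k)) * exp (of_int (2 * k) * z))"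
    proof (rule sum.reindex_bij_witness[where i = "\<lambda>k. nat (int m + k)" and j = "\<lambda>i. int i - int m"])
      fix i assume "i \<in> {..2 * m}"
      then have i: "i \<le> 2 * m" by simp
      have "exp z ^ i * exp (- z) ^ (2 * m - i) = exp (of_nat i * z + of_nat (2 * m - i) * (- z))"
        by (simp only: exp_add exp_of_nat_mult)
      also have "of_nat i * z + of_nat (2 * m - i) * (- z) = of_int (2 * (int i - int m)) * z"
        using i by (simp add: of_nat_diff algebra_simps)
      finally show "of_nat (2 * m choose nat (int m + (int i - int m))) * exp (of_int (2 * (int i - int m)) * z)
        = of_nat (2 * m choose i) * exp z ^ i * exp (- z) ^ (2 * m - i)" by (simp add: mult.assoc)
    qed auto
    finally show ?thesis by (simp add: sum_divide_distrib)
  qed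
  let ?c = "\<lambda>k. of_nat (2 * m choose nat (int m + k)) / 4 ^ m :: complex"
  have "(\<Sum>\<nu>\<in>{- int L..int L}. cosh ((s + 2 * of_real pi * \<i> * of_int \<nu>) / (2 * of_nat l)) ^ (2 * m))
    = (\<Sum>\<nu>\<in>{- int L..int L}. \<Sum>k\<in>{- int m..int m}. ?c k * exp (of_int k * s / of_nat l) * exp (2 * of_real pi * \<i> * of_int (\<nu> * k) / of_nat l))"
  proof (intro sum.cong refl, unfold pw, intro sum.cong refl)
    fix \<nu> k :: int
    have "of_int (2 * k) * ((s + 2 * of_real pi * \<i> * of_int \<nu>) / (2 * of_nat l))
        = of_int k * s / of_nat l + 2 * of_real pi * \<i> * of_int (\<nu> * k) / of_nat l"
      using l by (simp add: field_simps)
    then show "?c k * exp (of_int (2 * k) * ((s + 2 * of_real pi * \<i> * of_int \<nu>) / (2 * of_nat l)))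
        = ?c k * exp (of_int k * s / of_nat l) * exp (2 * of_real pi * \<i> * of_int (\<nu> * k) / of_nat l)"
      by (simp only: exp_add mult.assoc)
  qed
  also have "\<dots> = (\<Sum>k\<in>{- int m..int m}. ?c k * exp (of_int k * s / of_nat l) * (if int l dvd k then of_nat l else 0))"
    unfolding l_def odd_roots_sum[symmetric] by (subst sum.swap) (simp add: sum_distrib_left)
  also have "\<dots> = (\<Sum>k\<in>{k\<in>{- int m..int m}. int l dvd k}. of_nat l * ?c k * exp (of_int k * s / of_nat l))"
    by (subst sum.inter_filter) (auto intro!: sum.cong)
  also have "\<dots> = (\<Sum>j\<in>{j\<in>{- int m..int m}. \<bar>int l * j\<bar> \<le> int m}. of_nat l * ?c (int l * j) * exp (of_int j * s))"
  proof (rule sum.reindex_bij_witness[where i = "\<lambda>j. int l * j" and j = "\<lambda>k. k div int l"])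
    fix k assume k: "k \<in> {k \<in> {- int m..int m}. int l dvd k}"
    then obtain j where j: "k = int l * j" by auto
    have "\<bar>j\<bar> \<le> int l * \<bar>j\<bar>" using l by (simp add: mult_le_cancel_right1)
    also have "\<dots> = \<bar>k\<bar>" by (simp add: j abs_mult)
    finally have "\<bar>j\<bar> \<le> int m" using k by auto
    then show "k div int l \<in> {j \<in> {- int m..int m}. \<bar>int l * j\<bar> \<le> int m}" "int l * (k div int l) = k"
      using k j l by auto
    show "of_nat l * ?c (int l * (k div int l)) * exp (of_int (k div int l) * s) = of_nat l * ?c k * exp (of_int k * s / of_nat l)"
      using j l by simp
  qed (use l in auto)
  also have "\<dots> = (\<Sum>j\<in>{- int m..int m}. if \<bar>int l * j\<bar> \<le> int m
        then of_real (real l * real (2 * m choose nat (int m + int l * j)) / 4 ^ m) * exp (of_int j * s) else 0)"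
    by (subst sum.inter_filter) (auto intro!: sum.cong)
  finally show ?thesis .
qed

definition odd_scale :: "nat \<Rightarrow> nat" where "odd_scale L = 2 * L + 1"
text \<open>The exponent grows like \<open>t\<close> times the square of the scale \<open>l\<close>.
  This is the scaling in which \<open>cosh (z / (2 l))\<close> to twice that power tends to
  \<open>exp (t z^2 / 4)\<close>.\<close>

definition polya_exponent :: "real \<Rightarrow> nat \<Rightarrow> nat" where "polya_exponent t L = nat \<lceil>t * (real (odd_scale L))\<^sup>2\<rceil>"

lemma odd_scale_at_top: "filterlim (\<lambda>L. real (odd_scale L)) at_top sequentially"
  unfolding odd_scale_def by real_asymp

lemma polya_exponent_bounds:
  assumes "t > 0"
  shows "t * (real (odd_scale L))\<^sup>2 \<le> real (polya_exponent t L)" "real (polya_exponent t L) \<le> t * (real (odd_scale L))\<^sup>2 + 1"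
proof -
  have "0 \<le> t * (real (odd_scale L))\<^sup>2" using assms by simp
  then have "real (polya_exponent t L) = of_int \<lceil>t * (real (odd_scale L))\<^sup>2\<rceil>"
    unfolding polya_exponent_def by (simp add: of_nat_nat)
  then show "t * (real (odd_scale L))\<^sup>2 \<le> real (polya_exponent t L)" "real (polya_exponent t L) \<le> t * (real (odd_scale L))\<^sup>2 + 1"
    by linarith+
qed

lemma polya_exponent_limit:
  assumes t: "t > 0"
  shows "(\<lambda>L. real (polya_exponent t L) / (real (odd_scale L))\<^sup>2) \<longlonglongrightarrow> t"
proof (rule real_tendsto_sandwich)
  have p: "(real (odd_scale L))\<^sup>2 > 0" for L by (simp add: odd_scale_def)
  show "eventually (\<lambda>L. t \<le> real (polya_exponent t L) / (real (odd_scale L))\<^sup>2) sequentially"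
    using polya_exponent_bounds(1)[OF t] p by (intro always_eventually allI) (simp add: pos_le_divide_eq)
  show "eventually (\<lambda>L. real (polya_exponent t L) / (real (odd_scale L))\<^sup>2 \<le> t + 1 / (real (odd_scale L))\<^sup>2) sequentially"
  proof (intro always_eventually allI)
    fix L
    have "real (polya_exponent t L) / (real (odd_scale L))\<^sup>2 \<le> (t * (real (odd_scale L))\<^sup>2 + 1) / (real (odd_scale L))\<^sup>2"
      using polya_exponent_bounds(2)[OF t, of L] by (intro divide_right_mono) auto
    then show "real (polya_exponent t L) / (real (odd_scale L))\<^sup>2 \<le> t + 1 / (real (odd_scale L))\<^sup>2"
      using p[of L] by (simp add: add_divide_distrib)
  qed
  show "(\<lambda>L. t + 1 / (real (odd_scale L))\<^sup>2) \<longlonglongrightarrow> t"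
    unfolding odd_scale_def by real_asymp
qed simp

lemma polya_exponent_at_top:
  assumes "t > 0" shows "filterlim (polya_exponent t) at_top sequentially"
proof -
  have "filterlim (\<lambda>L. t * (real (odd_scale L))\<^sup>2) at_top sequentially"
    using assms unfolding odd_scale_def by real_asymp
  then have "filterlim (\<lambda>L. real (polya_exponent t L)) at_top sequentially"
    by (rule filterlim_at_top_mono) (use polya_exponent_bounds(1)[OF assms] in auto)
  then show ?thesis by (simp add: filterlim_sequentially_iff_filterlim_real)
qed

lemma tendsto_cosh_power:
  fixes z :: complex
  assumes t: "t > 0"
  shows "(\<lambda>L. cosh (z / (2 * of_nat (odd_scale L))) ^ (2 * polya_exponent t L)) \<longlonglongrightarrow> exp (of_real t * z\<^sup>2 / 4)"
proof -
  let ?l = "\<lambda>L. of_nat (odd_scale L) :: complex"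
  have l: "?l L \<noteq> 0" for L unfolding of_nat_eq_0_iff by (simp add: odd_scale_def)
  have inv: "(\<lambda>L. 1 / ?l L) \<longlonglongrightarrow> 0"
  proof -
    have "(\<lambda>L. 1 / real (odd_scale L)) \<longlonglongrightarrow> 0" unfolding odd_scale_def by real_asymp
    from tendsto_of_real[OF this, where 'a = complex] show ?thesis by simp
  qed
  have sl: "(\<lambda>L. ?l L * sinh (z / (2 * ?l L))) \<longlonglongrightarrow> z / 2"
  proof (cases "z = 0")
    case False
    have "((\<lambda>w :: complex. sinh w) has_field_derivative cosh 0) (at 0)"
      by (auto intro!: derivative_eq_intros)
    then have "((\<lambda>w :: complex. sinh w / w) \<longlongrightarrow> 1) (at 0)"
      by (simp add: has_field_derivative_iff)
    moreover have "filterlim (\<lambda>L. z / (2 * ?l L)) (at 0) sequentially"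
    proof (rule filterlim_atI)
      have "(\<lambda>L. z / 2 * (1 / ?l L)) \<longlonglongrightarrow> z / 2 * 0" by (intro tendsto_intros inv)
      then show "(\<lambda>L. z / (2 * ?l L)) \<longlonglongrightarrow> 0" by simp
      show "eventually (\<lambda>L. z / (2 * ?l L) \<noteq> 0) sequentially" using l False by simp
    qed
    ultimately have "(\<lambda>L. sinh (z / (2 * ?l L)) / (z / (2 * ?l L))) \<longlonglongrightarrow> 1"
      by (rule filterlim_compose)
    then have "(\<lambda>L. z / 2 * (sinh (z / (2 * ?l L)) / (z / (2 * ?l L)))) \<longlonglongrightarrow> z / 2 * 1"
      by (intro tendsto_intros)
    then show ?thesis using False by (simp add: mult_ac)
  qed simp
  have ml: "(\<lambda>L. of_nat (polya_exponent t L) / (?l L)\<^sup>2) \<longlonglongrightarrow> of_real t"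
    using tendsto_of_real[OF polya_exponent_limit[OF t], where 'a = complex] by simp
  have "(\<lambda>L. of_nat (polya_exponent t L) / (?l L)\<^sup>2 * (?l L * sinh (z / (2 * ?l L)))\<^sup>2) \<longlonglongrightarrow> of_real t * (z / 2)\<^sup>2"
    by (intro tendsto_intros ml sl)
  then have "(\<lambda>L. of_nat (polya_exponent t L) * (sinh (z / (2 * ?l L)))\<^sup>2) \<longlonglongrightarrow> of_real t * z\<^sup>2 / 4"
  proof -
    have "of_nat (polya_exponent t L) / (?l L)\<^sup>2 * (?l L * w)\<^sup>2 = of_nat (polya_exponent t L) * w\<^sup>2" for L w
      using l[of L] by (simp add: power_mult_distrib)
    moreover assume "(\<lambda>L. of_nat (polya_exponent t L) / (?l L)\<^sup>2 * (?l L * sinh (z / (2 * ?l L)))\<^sup>2) \<longlonglongrightarrow> of_real t * (z / 2)\<^sup>2"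
    ultimately show ?thesis by (simp only: power_divide) simp
  qed
  from tendsto_one_plus_power[OF polya_exponent_at_top[OF t] this]
  have "(\<lambda>L. (1 + (sinh (z / (2 * ?l L)))\<^sup>2) ^ polya_exponent t L) \<longlonglongrightarrow> exp (of_real t * z\<^sup>2 / 4)" .
  moreover have "(1 + (sinh w)\<^sup>2) ^ k = cosh w ^ (2 * k)" for w :: complex and k
    by (simp add: power_mult cosh_square_eq add.commute)
  ultimately show ?thesis by simp
qed

text \<open>By Bernoulli's inequality the left side is at most \<open>(1 + sinh^2)\<close> to the
  power \<open>m\<close>, that is \<open>cosh ^ (2 * m)\<close>, which converges and is therefore
  bounded.\<close>

lemma sinh_sq_bound:
  assumes "t > 0"
  shows "\<exists>C. \<forall>L. real (polya_exponent t L) * (sinh (x / (2 * real (odd_scale L))))\<^sup>2 \<le> C"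
proof -
  have "(\<lambda>L. cosh (complex_of_real x / (2 * of_nat (odd_scale L))) ^ (2 * polya_exponent t L)) \<longlonglongrightarrow> exp (of_real t * (of_real x)\<^sup>2 / 4)"
    by (rule tendsto_cosh_power[OF assms])
  then have "Bseq (\<lambda>L. cosh (complex_of_real x / (2 * of_nat (odd_scale L))) ^ (2 * polya_exponent t L))"
    by (intro convergent_imp_Bseq convergentI)
  then obtain K where K: "\<And>L. norm (cosh (complex_of_real x / (2 * of_nat (odd_scale L))) ^ (2 * polya_exponent t L)) \<le> K"
    by (auto simp: Bseq_def)
  have "real (polya_exponent t L) * (sinh (x / (2 * real (odd_scale L))))\<^sup>2 \<le> K" for L
  proof -
    let ?w = "x / (2 * real (odd_scale L))" and ?m = "polya_exponent t L"
    have "real ?m * (sinh ?w)\<^sup>2 \<le> (1 + (sinh ?w)\<^sup>2) ^ ?m"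
      using Bernoulli_inequality[of "(sinh ?w)\<^sup>2" ?m] zero_le_power2[of "sinh ?w"] by linarith
    also have "\<dots> = cosh ?w ^ (2 * ?m)" by (simp add: power_mult cosh_square_eq add.commute)
    also have "\<dots> = norm (cosh (complex_of_real x / (2 * of_nat (odd_scale L))) ^ (2 * ?m))"
    proof -
      have c: "cosh (complex_of_real u) = of_real (cosh u)" for u
        by (simp add: cosh_def scaleR_conv_of_real exp_of_real flip: of_real_minus)
      show ?thesis using c[of ?w] by (simp add: norm_power)
    qed
    finally show ?thesis using K[of L] by linarith
  qed
  then show ?thesis by blast
qed

text \<open>The majorant, uniform in \<open>L\<close>. For \<open>|\<nu>| \<le> L\<close> and scale
  \<open>2 * L + 1\<close> the hypothesis \<open>|Im s| \<le> \<pi>\<close> places the argument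
  exactly in the strip of \<open>norm_cosh_le\<close>, and it also gives
  \<open>|Im s + 2 \<pi> \<nu>| \<ge> \<pi> (2 |\<nu>| - 1)\<close>, from which the Gaussian in
  \<nu> arises.\<close>

lemma cosh_power_bound:
  fixes s :: complex
  assumes t: "t > 0" and s: "\<bar>Im s\<bar> \<le> pi"
  shows "\<exists>C. \<forall>L \<nu>. \<bar>\<nu>\<bar> \<le> int L \<longrightarrow>
    norm (cosh ((s + 2 * of_real pi * \<i> * of_int \<nu>) / (2 * of_nat (odd_scale L))) ^ (2 * polya_exponent t L))
      \<le> C * exp (- t * (real_of_int \<nu>)\<^sup>2 * 4 + 4 * t * real_of_int \<bar>\<nu>\<bar>)"
proof -
  obtain C where C: "\<And>L. real (polya_exponent t L) * (sinh (Re s / (2 * real (odd_scale L))))\<^sup>2 \<le> C"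
    using sinh_sq_bound[OF t] by blast
  show ?thesis
  proof (intro exI[of _ "exp C"] allI impI)
    fix L and \<nu> :: int assume \<nu>: "\<bar>\<nu>\<bar> \<le> int L"
    let ?l = "real (odd_scale L)" and ?m = "polya_exponent t L"
    define z where "z = (s + 2 * of_real pi * \<i> * of_int \<nu>) / (2 * of_nat (odd_scale L))"
    have l: "?l > 0" by (simp add: odd_scale_def)
    have z_eq: "z = (s + 2 * of_real pi * \<i> * of_int \<nu>) / of_real (2 * ?l)" by (simp add: z_def)
    have Re: "Re z = Re s / (2 * ?l)" and Im: "Im z = (Im s + 2 * pi * \<nu>) / (2 * ?l)"
      unfolding z_eq Re_divide_of_real Im_divide_of_real by simp_all
    have a: "\<bar>Im s + 2 * pi * \<nu>\<bar> \<le> pi * ?l"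
    proof -
      have "\<bar>Im s + 2 * pi * \<nu>\<bar> \<le> \<bar>Im s\<bar> + 2 * pi * \<bar>real_of_int \<nu>\<bar>"
        using abs_triangle_ineq[of "Im s" "2 * pi * \<nu>"] by (simp add: abs_mult)
      also have "\<dots> \<le> pi + 2 * pi * real L" using s \<nu> by (intro add_mono mult_left_mono) auto
      finally show ?thesis by (simp add: odd_scale_def algebra_simps)
    qed
    then have "\<bar>Im z\<bar> \<le> pi / 2" using l by (simp add: Im abs_divide field_simps)
    from norm_cosh_le[OF this]
    have "norm (cosh z ^ (2 * ?m)) \<le> exp ((sinh (Re z))\<^sup>2 - 4 * (Im z)\<^sup>2 / pi\<^sup>2) ^ ?m"
      unfolding norm_power power_mult by (intro power_mono) auto
    also have "\<dots> = exp (real ?m * (sinh (Re z))\<^sup>2 - real ?m * (4 * (Im z)\<^sup>2 / pi\<^sup>2))"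
      by (simp add: algebra_simps flip: exp_of_nat_mult)
    also have "\<dots> \<le> exp (C - (4 * t * (real_of_int \<nu>)\<^sup>2 - 4 * t * real_of_int \<bar>\<nu>\<bar>))"
    proof -
      have "4 * t * (real_of_int \<nu>)\<^sup>2 - 4 * t * real_of_int \<bar>\<nu>\<bar> \<le> real ?m * (4 * (Im z)\<^sup>2 / pi\<^sup>2)"
      proof -
        have "pi * (2 * \<bar>real_of_int \<nu>\<bar> - 1) \<le> \<bar>Im s + 2 * pi * \<nu>\<bar>"
        proof -
          have "2 * pi * \<bar>real_of_int \<nu>\<bar> \<le> \<bar>Im s + 2 * pi * \<nu>\<bar> + \<bar>Im s\<bar>"
            using abs_triangle_ineq4[of "Im s + 2 * pi * \<nu>" "Im s"] by (simp add: abs_mult)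
          then show ?thesis using s by (simp add: algebra_simps)
        qed
        then have sq: "pi\<^sup>2 * (4 * \<bar>real_of_int \<nu>\<bar>\<^sup>2 - 4 * \<bar>real_of_int \<nu>\<bar>) \<le> (Im s + 2 * pi * \<nu>)\<^sup>2"
        proof (cases "\<nu> = 0")
          case False
          then have "0 \<le> pi * (2 * \<bar>real_of_int \<nu>\<bar> - 1)" by simp
          then have "(pi * (2 * \<bar>real_of_int \<nu>\<bar> - 1))\<^sup>2 \<le> \<bar>Im s + 2 * pi * \<nu>\<bar>\<^sup>2"
            using \<open>pi * (2 * \<bar>real_of_int \<nu>\<bar> - 1) \<le> \<bar>Im s + 2 * pi * \<nu>\<bar>\<close> by (intro power_mono)
          moreover have "(pi * (2 * \<bar>real_of_int \<nu>\<bar> - 1))\<^sup>2 = pi\<^sup>2 * (4 * \<bar>real_of_int \<nu>\<bar>\<^sup>2 - 4 * \<bar>real_of_int \<nu>\<bar>) + pi\<^sup>2"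
            unfolding power2_eq_square by (simp add: algebra_simps)
          moreover have "0 \<le> pi\<^sup>2" by simp
          ultimately show ?thesis unfolding power2_abs by linarith
        qed simp
        have "4 * t * (real_of_int \<nu>)\<^sup>2 - 4 * t * real_of_int \<bar>\<nu>\<bar> = t * ((pi\<^sup>2 * (4 * \<bar>real_of_int \<nu>\<bar>\<^sup>2 - 4 * \<bar>real_of_int \<nu>\<bar>)) / pi\<^sup>2)"
          by (subst nonzero_mult_div_cancel_left) (auto simp: algebra_simps)
        also have "\<dots> \<le> t * ((Im s + 2 * pi * \<nu>)\<^sup>2 / pi\<^sup>2)"
          using t sq by (intro mult_left_mono divide_right_mono) auto
        also have "\<dots> = (t * ?l\<^sup>2) * (4 * (Im z)\<^sup>2 / pi\<^sup>2)"
          using l by (simp add: Im power_divide power_mult_distrib)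
        also have "\<dots> \<le> real ?m * (4 * (Im z)\<^sup>2 / pi\<^sup>2)"
          by (intro mult_right_mono polya_exponent_bounds(1)[OF t]) auto
        finally show ?thesis .
      qed
      then show ?thesis using C[of L] by (simp add: Re)
    qed
    also have "\<dots> = exp C * exp (- t * (real_of_int \<nu>)\<^sup>2 * 4 + 4 * t * real_of_int \<bar>\<nu>\<bar>)"
      by (simp flip: exp_add)
    finally show "norm (cosh ((s + 2 * of_real pi * \<i> * of_int \<nu>) / (2 * of_nat (odd_scale L))) ^ (2 * ?m))
      \<le> exp C * exp (- t * (real_of_int \<nu>)\<^sup>2 * 4 + 4 * t * real_of_int \<bar>\<nu>\<bar>)" by (simp add: z_def)
  qed
qed

lemma central_binomial_limit:
  assumes t: "t > 0"
  shows "(\<lambda>L. real (odd_scale L) * real (2 * polya_exponent t L choose polya_exponent t L) / 4 ^ polya_exponent t L) \<longlonglongrightarrow> 1 / sqrt (pi * t)"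
proof -
  let ?b = "\<lambda>m. real (2 * m choose m) / 4 ^ m" and ?l = "\<lambda>L. real (odd_scale L)" and ?m = "polya_exponent t"
  have l: "?l L > 0" for L by (simp add: odd_scale_def)
  have 1: "(\<lambda>m. (?b m)\<^sup>2 * (2 * real m + 1)) \<longlonglongrightarrow> inverse (pi / 2)"
    unfolding central_binomial_sq by (intro tendsto_inverse wallis) simp
  have 2: "(\<lambda>L. (?b (?m L))\<^sup>2 * (2 * real (?m L) + 1)) \<longlonglongrightarrow> inverse (pi / 2)"
    by (rule filterlim_compose[OF 1 polya_exponent_at_top[OF t]])
  have il: "(\<lambda>L. 1 / (?l L)\<^sup>2) \<longlonglongrightarrow> 0" unfolding odd_scale_def by real_asymp
  have "(\<lambda>L. 2 * (real (?m L) / (?l L)\<^sup>2) + 1 / (?l L)\<^sup>2) \<longlonglongrightarrow> 2 * t + 0"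
    by (intro tendsto_intros polya_exponent_limit t il)
  then have "(\<lambda>L. (?b (?m L))\<^sup>2 * (2 * real (?m L) + 1) / (2 * (real (?m L) / (?l L)\<^sup>2) + 1 / (?l L)\<^sup>2)) \<longlonglongrightarrow> inverse (pi / 2) / (2 * t + 0)"
    using t by (intro tendsto_divide 2) auto
  moreover have "(?b (?m L))\<^sup>2 * (2 * real (?m L) + 1) / (2 * (real (?m L) / (?l L)\<^sup>2) + 1 / (?l L)\<^sup>2) = (?l L * ?b (?m L))\<^sup>2" for L
  proof -
    have "2 * (real (?m L) / (?l L)\<^sup>2) + 1 / (?l L)\<^sup>2 = (2 * real (?m L) + 1) / (?l L)\<^sup>2" by (simp add: add_divide_distrib)
    moreover have "2 * real (?m L) + 1 \<noteq> 0" using of_nat_0_le_iff[of "?m L", where ?'a = real] by linarith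
    ultimately show ?thesis using l[of L] by (simp add: power_mult_distrib power_divide)
  qed
  ultimately have "(\<lambda>L. (?l L * ?b (?m L))\<^sup>2) \<longlonglongrightarrow> inverse (pi / 2) / (2 * t + 0)" by (simp only:)
  moreover have "inverse (pi / 2) / (2 * t + 0) = 1 / (pi * t)" by (simp add: field_simps)
  ultimately have "(\<lambda>L. (?l L * ?b (?m L))\<^sup>2) \<longlonglongrightarrow> 1 / (pi * t)" by (simp only:)
  then have "(\<lambda>L. sqrt ((?l L * ?b (?m L))\<^sup>2)) \<longlonglongrightarrow> sqrt (1 / (pi * t))" by (intro tendsto_intros)
  moreover have "sqrt ((?l L * ?b (?m L))\<^sup>2) = ?l L * real (2 * ?m L choose ?m L) / 4 ^ ?m L" for L
    using l[of L] by (simp add: abs_of_nonneg)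
  ultimately show ?thesis by (simp add: real_sqrt_divide)
qed

text \<open>The limit is a squeeze between the two Gaussian bounds. The second part is the majorant
  for every \<open>L\<close>: with scale \<open>l\<close> and exponent \<open>m\<close>,
  \<open>m + l j \<le> 2 m \<le> 2 (t l^2 + 1) \<le> (2 t + 2) l^2\<close>, so
  \<open>(l j)^2 / (m + l j)\<close> is at least \<open>j^2 / (2 t + 2)\<close>.\<close>

lemma local_binomial_limit:
  assumes t: "t > 0"
  shows "(\<lambda>L. real (odd_scale L) * real (2 * polya_exponent t L choose (polya_exponent t L + odd_scale L * j)) / 4 ^ polya_exponent t L)
     \<longlonglongrightarrow> 1 / sqrt (pi * t) * exp (- (real j)\<^sup>2 / t)"
    and "odd_scale L * j \<le> polya_exponent t L \<Longrightarrow>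
      real (2 * polya_exponent t L choose (polya_exponent t L + odd_scale L * j))
        \<le> real (2 * polya_exponent t L choose polya_exponent t L) * exp (- (real j)\<^sup>2 / (2 * t + 2))"
proof -
  let ?m = "polya_exponent t" and ?k = "\<lambda>L. odd_scale L * j" and ?l = "\<lambda>L. real (odd_scale L)"
  let ?P = "\<lambda>L. \<Prod>i\<in>{1..?k L}. 1 - real (?k L) / real (?m L + i)"
  have l: "?l L \<ge> 1" for L by (simp add: odd_scale_def)
  have inv: "(\<lambda>L. 1 / ?l L) \<longlonglongrightarrow> 0" unfolding odd_scale_def by real_asymp
  have small: "eventually (\<lambda>L. ?k L < ?m L) sequentially"
  proof -
    have "eventually (\<lambda>L. real j / t < ?l L) sequentially"
      using odd_scale_at_top by (simp add: filterlim_at_top_dense)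
    then show ?thesis
    proof eventually_elim
      case (elim L)
      then have "real j < t * ?l L" using t by (simp add: field_simps)
      then have "?l L * real j < ?l L * (t * ?l L)" using l[of L] by (intro mult_strict_left_mono) auto
      also have "\<dots> \<le> real (?m L)" using polya_exponent_bounds(1)[OF t, of L] by (simp add: power2_eq_square mult_ac)
      finally have "real (?k L) < real (?m L)" by simp
      then show ?case by linarith
    qed
  qed
  have Plim: "?P \<longlonglongrightarrow> exp (- (real j)\<^sup>2 / t)"
  proof (rule real_tendsto_sandwich)
    show "eventually (\<lambda>L. exp (- (real (?k L))\<^sup>2 / (real (?m L) - real (?k L))) \<le> ?P L) sequentially"
      using small by eventually_elim (rule prod_one_minus_bounds)
    show "eventually (\<lambda>L. ?P L \<le> exp (- (real (?k L))\<^sup>2 / (real (?m L) + real (?k L)))) sequentially"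
      using small by eventually_elim (rule prod_one_minus_bounds)
    have e: "- (real (?k L))\<^sup>2 / (real (?m L) + c * real (?k L)) = - (real j)\<^sup>2 / (real (?m L) / (?l L)\<^sup>2 + c * real j * (1 / ?l L))" for L c
    proof -
      have 1: "real (?m L) + c * real (?k L) = (?l L)\<^sup>2 * (real (?m L) / (?l L)\<^sup>2 + c * real j * (1 / ?l L))"
        using l[of L] by (simp add: field_simps power2_eq_square)
      have 2: "(real (?k L))\<^sup>2 = (?l L)\<^sup>2 * (real j)\<^sup>2" by (simp add: power_mult_distrib)
      have 3: "(?l L)\<^sup>2 \<noteq> 0" using l[of L] by auto
      have "- (A * J) / (A * D) = - J / D" if "A \<noteq> 0" for A J D :: real using that by simp
      from this[OF 3] show ?thesis unfolding 1 2 .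
    qed
    have "(\<lambda>L. exp (- (real j)\<^sup>2 / (real (?m L) / (?l L)\<^sup>2 + c * real j * (1 / ?l L)))) \<longlonglongrightarrow> exp (- (real j)\<^sup>2 / (t + c * real j * 0))" for c
      using t by (intro tendsto_intros polya_exponent_limit inv) auto
    then have G: "(\<lambda>L. exp (- (real (?k L))\<^sup>2 / (real (?m L) + c * real (?k L)))) \<longlonglongrightarrow> exp (- (real j)\<^sup>2 / t)" for c
      unfolding e by simp
    show "(\<lambda>L. exp (- (real (?k L))\<^sup>2 / (real (?m L) - real (?k L)))) \<longlonglongrightarrow> exp (- (real j)\<^sup>2 / t)"
      using G[of "-1"] by simp
    show "(\<lambda>L. exp (- (real (?k L))\<^sup>2 / (real (?m L) + real (?k L)))) \<longlonglongrightarrow> exp (- (real j)\<^sup>2 / t)"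
      using G[of 1] by simp
  qed
  have "(\<lambda>L. ?l L * real (2 * ?m L choose ?m L) / 4 ^ ?m L * ?P L) \<longlonglongrightarrow> 1 / sqrt (pi * t) * exp (- (real j)\<^sup>2 / t)"
    by (intro tendsto_mult central_binomial_limit t Plim)
  moreover have "eventually (\<lambda>L. ?l L * real (2 * ?m L choose ?m L) / 4 ^ ?m L * ?P L
      = ?l L * real (2 * ?m L choose (?m L + ?k L)) / 4 ^ ?m L) sequentially"
    using small by eventually_elim (simp add: binomial_ratio)
  ultimately show "(\<lambda>L. ?l L * real (2 * ?m L choose (?m L + ?k L)) / 4 ^ ?m L) \<longlonglongrightarrow> 1 / sqrt (pi * t) * exp (- (real j)\<^sup>2 / t)"
    by (rule Lim_transform_eventually)
  assume le: "?k L \<le> ?m L"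
  show "real (2 * ?m L choose (?m L + ?k L)) \<le> real (2 * ?m L choose ?m L) * exp (- (real j)\<^sup>2 / (2 * t + 2))"
    unfolding binomial_ratio[OF le]
  proof (rule mult_left_mono)
    \<comment> \<open>At the extreme index the general bound, stated for \<open>k < m\<close>, is
      out of reach; its upper half is reproved for equality.\<close>
    have "?P L \<le> exp (- (real (?k L))\<^sup>2 / (real (?m L) + real (?k L)))"
    proof (cases "?k L = ?m L")
      case True
      show ?thesis
      proof (cases "?k L = 0")
        case False
        have "?P L \<le> (\<Prod>i\<in>{1..?k L}. exp (- real (?k L) / (real (?m L) + real (?k L))))"
        proof (intro prod_mono conjI)
          fix i assume i: "i \<in> {1..?k L}"
          show "0 \<le> 1 - real (?k L) / real (?m L + i)" using True False by (simp add: field_simps)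
          have e1: "1 - real (?k L) / real (?m L + i) \<le> exp (- (real (?k L) / real (?m L + i)))"
            using exp_ge_add_one_self[of "- (real (?k L) / real (?m L + i))"] by simp
          have "real (?k L) / (real (?m L) + real (?k L)) \<le> real (?k L) / real (?m L + i)"
          proof (rule divide_left_mono)
            show "real (?m L + i) \<le> real (?m L) + real (?k L)"
              using i unfolding of_nat_add[symmetric] of_nat_le_iff by simp
            show "0 < (real (?m L) + real (?k L)) * real (?m L + i)"
            proof (intro mult_pos_pos add_nonneg_pos)
              show "0 < real (?k L)" using False unfolding of_nat_0_less_iff by simp
              show "0 < real (?m L + i)" using i unfolding of_nat_0_less_iff by auto
            qed simp
          qed simp
          then have e2: "exp (- (real (?k L) / real (?m L + i))) \<le> exp (- (real (?k L) / (real (?m L) + real (?k L))))" by simp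
          show "1 - real (?k L) / real (?m L + i) \<le> exp (- real (?k L) / (real (?m L) + real (?k L)))"
            using order_trans[OF e1 e2] by (simp only: minus_divide_left)
        qed
        also have "\<dots> = exp (- (real (?k L))\<^sup>2 / (real (?m L) + real (?k L)))"
          by (simp add: power2_eq_square flip: exp_of_nat_mult)
        finally show ?thesis .
      next
        case zero: True
        show ?thesis unfolding zero by simp
      qed
    next
      case False
      then show ?thesis using le by (intro prod_one_minus_bounds(2)) simp
    qed
    also have "\<dots> \<le> exp (- (real j)\<^sup>2 / (2 * t + 2))"
    proof -
      have "(real j)\<^sup>2 / (2 * t + 2) \<le> (real (?k L))\<^sup>2 / (real (?m L) + real (?k L))"
      proof (cases "j = 0")
        case False
        have pos: "0 < real (?m L) + real (?k L)"
          using False by (intro add_nonneg_pos) (auto simp: odd_scale_def intro!: add_pos_nonneg)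
        have "real (?k L) \<le> real (?m L)" using le by (rule of_nat_mono)
        then have "real (?m L) + real (?k L) \<le> 2 * real (?m L)" by linarith
        also have "\<dots> \<le> 2 * (t * (?l L)\<^sup>2 + 1)" using polya_exponent_bounds(2)[OF t, of L] by simp
        also have "\<dots> \<le> (2 * t + 2) * (?l L)\<^sup>2"
        proof -
          have "1 \<le> (?l L)\<^sup>2" using l[of L] by (simp add: one_le_power)
          then show ?thesis by (simp add: algebra_simps)
        qed
        finally have "(real j)\<^sup>2 * (real (?m L) + real (?k L)) \<le> (real j)\<^sup>2 * ((2 * t + 2) * (?l L)\<^sup>2)"
          by (intro mult_left_mono) auto
        also have "\<dots> = (real (?k L))\<^sup>2 * (2 * t + 2)" by (simp add: power_mult_distrib)
        finally show ?thesis using pos t by (simp add: divide_le_eq pos_le_divide_eq mult_ac)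
      qed simp
      then show ?thesis by simp
    qed
    finally show "?P L \<le> exp (- (real j)\<^sup>2 / (2 * t + 2))" .
  qed simp
qed

text \<open>Both sides of \<open>polya_identity\<close>, extended by 0 to all integers, have
  Gaussian majorants, so the limits may be taken termwise. It serves for \<open>s = 0\<close>, for
  \<open>s = \<i> \<pi>\<close>, and for real \<open>s\<close>, where \<beta> enters.\<close>

theorem theta_transformation:
  fixes s :: complex
  assumes t: "t > 0" and s: "\<bar>Im s\<bar> \<le> pi"
  shows "(\<Sum>\<^sub>\<infinity>\<nu>\<in>(UNIV :: int set). exp (of_real t * (s + 2 * of_real pi * \<i> * of_int \<nu>)\<^sup>2 / 4))
    = of_real (1 / sqrt (pi * t)) * (\<Sum>\<^sub>\<infinity>j\<in>(UNIV :: int set). exp (- of_int (j\<^sup>2) / of_real t + of_int j * s))"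
proof -
  let ?l = odd_scale and ?m = "polya_exponent t"
  define A where "A L \<nu> = (if \<bar>\<nu>\<bar> \<le> int L then cosh ((s + 2 * of_real pi * \<i> * of_int \<nu>) / (2 * of_nat (?l L))) ^ (2 * ?m L) else 0)"
    for L and \<nu> :: int
  define B where "B L j = (if \<bar>int (?l L) * j\<bar> \<le> int (?m L)
      then of_real (real (?l L) * real (2 * ?m L choose nat (int (?m L) + int (?l L) * j)) / 4 ^ ?m L) * exp (of_int j * s) else 0)"
    for L and j :: int
  have AB: "infsum (A L) UNIV = infsum (B L) UNIV" for L
  proof -
    have "infsum (A L) UNIV = infsum (A L) {- int L..int L}"
      by (rule infsum_cong_neutral) (auto simp: A_def)
    also have "\<dots> = (\<Sum>\<nu>\<in>{- int L..int L}. cosh ((s + 2 * of_real pi * \<i> * of_int \<nu>) / (2 * of_nat (?l L))) ^ (2 * ?m L))"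
      unfolding infsum_finite[OF finite_atLeastAtMost_int] by (intro sum.cong) (auto simp: A_def)
    also have "\<dots> = (\<Sum>j\<in>{- int (?m L)..int (?m L)}. B L j)"
      unfolding odd_scale_def polya_identity B_def ..
    also have "\<dots> = infsum (B L) {- int (?m L)..int (?m L)}" by simp
    also have "\<dots> = infsum (B L) UNIV"
    proof (rule infsum_cong_neutral)
      fix j assume "j \<in> UNIV - {- int (?m L)..int (?m L)}"
      then have j: "int (?m L) < \<bar>j\<bar>" by auto
      also have "\<bar>j\<bar> \<le> int (?l L) * \<bar>j\<bar>" by (simp add: mult_le_cancel_right1 odd_scale_def)
      finally show "B L j = 0" by (simp add: B_def abs_mult)
    qed auto
    finally show ?thesis .
  qed
  obtain C where C: "\<And>L \<nu>. \<bar>\<nu>\<bar> \<le> int L \<Longrightarrow>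
    norm (cosh ((s + 2 * of_real pi * \<i> * of_int \<nu>) / (2 * of_nat (?l L))) ^ (2 * ?m L))
      \<le> C * exp (- t * (real_of_int \<nu>)\<^sup>2 * 4 + 4 * t * real_of_int \<bar>\<nu>\<bar>)"
    using cosh_power_bound[OF t s] by blast
  have C0: "C \<ge> 0"
  proof -
    have "0 \<le> C * exp (- t * (real_of_int 0)\<^sup>2 * 4 + 4 * t * real_of_int \<bar>0\<bar>)"
      by (rule order_trans[OF norm_ge_zero C[of 0 0]]) simp
    then show ?thesis by simp
  qed
  have limA: "(\<lambda>L. infsum (A L) UNIV) \<longlonglongrightarrow> (\<Sum>\<^sub>\<infinity>\<nu>\<in>(UNIV :: int set). exp (of_real t * (s + 2 * of_real pi * \<i> * of_int \<nu>)\<^sup>2 / 4))"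
  proof (rule tannery_int)
    fix \<nu> :: int
    show "(\<lambda>L. A L \<nu>) \<longlonglongrightarrow> exp (of_real t * (s + 2 * of_real pi * \<i> * of_int \<nu>)\<^sup>2 / 4)"
    proof (rule Lim_transform_eventually[OF tendsto_cosh_power[OF t]])
      show "eventually (\<lambda>L. cosh ((s + 2 * of_real pi * \<i> * of_int \<nu>) / (2 * of_nat (?l L))) ^ (2 * ?m L) = A L \<nu>) sequentially"
        using eventually_ge_at_top[of "nat \<bar>\<nu>\<bar>"] by eventually_elim (auto simp: A_def)
    qed
  next
    show "eventually (\<lambda>L. \<forall>\<nu>. norm (A L \<nu>) \<le> C * exp (- (4 * t) * (real_of_int \<nu>)\<^sup>2 + 4 * t * real_of_int \<bar>\<nu>\<bar>)) sequentially"
      using C C0 by (intro always_eventually allI) (auto simp: A_def mult_ac)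
    show "(\<lambda>\<nu>. C * exp (- (4 * t) * (real_of_int \<nu>)\<^sup>2 + 4 * t * real_of_int \<bar>\<nu>\<bar>)) summable_on UNIV"
      using t by (intro summable_on_cmult_right summable_on_gaussian) simp
  qed
  have conv: "convergent (\<lambda>L. real (?l L) * real (2 * ?m L choose ?m L) / 4 ^ ?m L)"
    using central_binomial_limit[OF t] by (rule convergentI)
  then obtain K where K: "\<And>L. norm (real (?l L) * real (2 * ?m L choose ?m L) / 4 ^ ?m L) \<le> K"
    using BseqE[OF convergent_imp_Bseq[OF conv]] by metis
  have K0: "K \<ge> 0" using K[of 0] norm_ge_zero order_trans by blast
  have sym: "2 * M choose nat (int M + i) = 2 * M choose (M + nat \<bar>i\<bar>)" if "\<bar>i\<bar> \<le> int M" for M i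
  proof (cases "i \<ge> 0")
    case True
    then show ?thesis by (simp add: nat_add_distrib)
  next
    case False
    have "2 * M choose (M + nat \<bar>i\<bar>) = 2 * M choose (2 * M - (M + nat \<bar>i\<bar>))"
      using that by (intro binomial_symmetric) linarith
    also have "2 * M - (M + nat \<bar>i\<bar>) = nat (int M + i)" using False that by linarith
    finally show ?thesis ..
  qed
  have idx: "nat \<bar>int (?l L) * j\<bar> = ?l L * nat \<bar>j\<bar>" for L j by (simp add: abs_mult nat_mult_distrib)
  have limB: "(\<lambda>L. infsum (B L) UNIV) \<longlonglongrightarrow>
     (\<Sum>\<^sub>\<infinity>j\<in>(UNIV :: int set). of_real (1 / sqrt (pi * t)) * exp (- of_int (j\<^sup>2) / of_real t + of_int j * s))"
  proof (rule tannery_int)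
    fix j :: int
    let ?b = "\<lambda>L. real (?l L) * real (2 * ?m L choose (?m L + ?l L * nat \<bar>j\<bar>)) / 4 ^ ?m L"
    have "(\<lambda>L. complex_of_real (?b L) * exp (of_int j * s)) \<longlonglongrightarrow> of_real (1 / sqrt (pi * t) * exp (- (real (nat \<bar>j\<bar>))\<^sup>2 / t)) * exp (of_int j * s)"
      by (intro tendsto_intros tendsto_of_real local_binomial_limit t)
    also have "complex_of_real (1 / sqrt (pi * t) * exp (- (real (nat \<bar>j\<bar>))\<^sup>2 / t)) * exp (of_int j * s)
       = of_real (1 / sqrt (pi * t)) * exp (- of_int (j\<^sup>2) / of_real t + of_int j * s)"
    proof -
      have "complex_of_real (exp (- (real (nat \<bar>j\<bar>))\<^sup>2 / t)) = exp (of_real (- (real (nat \<bar>j\<bar>))\<^sup>2 / t))"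
        by (rule exp_of_real[symmetric])
      also have "complex_of_real (- (real (nat \<bar>j\<bar>))\<^sup>2 / t) = - of_int (j\<^sup>2) / of_real t" by simp
      finally show ?thesis unfolding exp_add of_real_mult by simp
    qed
    finally show "(\<lambda>L. B L j) \<longlonglongrightarrow> of_real (1 / sqrt (pi * t)) * exp (- of_int (j\<^sup>2) / of_real t + of_int j * s)"
    proof (rule Lim_transform_eventually)
      show "eventually (\<lambda>L. complex_of_real (?b L) * exp (of_int j * s) = B L j) sequentially"
      proof -
        have "eventually (\<lambda>L. real (nat \<bar>j\<bar>) / t < real (?l L)) sequentially"
          using odd_scale_at_top by (simp add: filterlim_at_top_dense)
        then show ?thesis
        proof eventually_elim
          case (elim L)
          have l1: "real (?l L) > 0" by (simp add: odd_scale_def)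
          have "real (nat \<bar>j\<bar>) < t * real (?l L)" using elim t by (simp add: field_simps)
          then have "real (?l L) * real (nat \<bar>j\<bar>) \<le> real (?l L) * (t * real (?l L))" using l1 by (intro mult_left_mono) auto
          also have "\<dots> \<le> real (?m L)" using polya_exponent_bounds(1)[OF t, of L] by (simp add: power2_eq_square mult_ac)
          finally have "real (?l L * nat \<bar>j\<bar>) \<le> real (?m L)" by simp
          then have "?l L * nat \<bar>j\<bar> \<le> ?m L" by linarith
          then have le: "\<bar>int (?l L) * j\<bar> \<le> int (?m L)" using idx[of L j] by linarith
          then show ?case by (simp add: B_def sym[OF le] idx)
        qed
      qed
    qed
  next
    show "(\<lambda>j. K * exp (- (1 / (2 * t + 2)) * (real_of_int j)\<^sup>2 + norm s * real_of_int \<bar>j\<bar>)) summable_on UNIV"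
      using t by (intro summable_on_cmult_right summable_on_gaussian) simp
    show "eventually (\<lambda>L. \<forall>j. norm (B L j) \<le> K * exp (- (1 / (2 * t + 2)) * (real_of_int j)\<^sup>2 + norm s * real_of_int \<bar>j\<bar>)) sequentially"
    proof (intro always_eventually allI)
      fix L and j :: int
      show "norm (B L j) \<le> K * exp (- (1 / (2 * t + 2)) * (real_of_int j)\<^sup>2 + norm s * real_of_int \<bar>j\<bar>)"
      proof (cases "\<bar>int (?l L) * j\<bar> \<le> int (?m L)")
        case True
        let ?n = "nat \<bar>j\<bar>"
        have le: "?l L * ?n \<le> ?m L" using True idx[of L j] by linarith
        have "real (?l L) * real (2 * ?m L choose (?m L + ?l L * ?n)) / 4 ^ ?m L
          \<le> real (?l L) * (real (2 * ?m L choose ?m L) * exp (- (real ?n)\<^sup>2 / (2 * t + 2))) / 4 ^ ?m L"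
          by (intro divide_right_mono mult_left_mono local_binomial_limit(2)[OF t le]) auto
        also have "\<dots> = (real (?l L) * real (2 * ?m L choose ?m L) / 4 ^ ?m L) * exp (- (real ?n)\<^sup>2 / (2 * t + 2))" by simp
        also have "\<dots> \<le> K * exp (- (real ?n)\<^sup>2 / (2 * t + 2))" using K[of L] by (intro mult_right_mono) auto
        finally have b: "real (?l L) * real (2 * ?m L choose (?m L + ?l L * ?n)) / 4 ^ ?m L \<le> K * exp (- (real ?n)\<^sup>2 / (2 * t + 2))" .
        have e: "norm (exp (of_int j * s)) \<le> exp (norm s * real_of_int \<bar>j\<bar>)"
        proof -
          have "norm (exp (of_int j * s)) \<le> exp (norm (of_int j * s))" by (rule norm_exp)
          then show ?thesis by (simp add: norm_mult mult.commute)
        qed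
        have "norm (B L j) = (real (?l L) * real (2 * ?m L choose (?m L + ?l L * ?n)) / 4 ^ ?m L) * norm (exp (of_int j * s))"
          using True unfolding B_def sym[OF True] idx by (simp add: norm_mult norm_divide norm_power)
        also have "\<dots> \<le> (K * exp (- (real ?n)\<^sup>2 / (2 * t + 2))) * exp (norm s * real_of_int \<bar>j\<bar>)"
          using K0 by (intro mult_mono b e) auto
        also have "\<dots> = K * exp (- (1 / (2 * t + 2)) * (real_of_int j)\<^sup>2 + norm s * real_of_int \<bar>j\<bar>)"
          by (simp add: mult.assoc flip: exp_add)
        finally show ?thesis .
      qed (use K0 in \<open>auto simp: B_def\<close>)
    qed
  qed
  have "(\<Sum>\<^sub>\<infinity>\<nu>\<in>(UNIV :: int set). exp (of_real t * (s + 2 * of_real pi * \<i> * of_int \<nu>)\<^sup>2 / 4))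
      = (\<Sum>\<^sub>\<infinity>j\<in>(UNIV :: int set). of_real (1 / sqrt (pi * t)) * exp (- of_int (j\<^sup>2) / of_real t + of_int j * s))"
    by (rule LIMSEQ_unique[OF limA]) (use limB in \<open>simp only: AB\<close>)
  also have "\<dots> = of_real (1 / sqrt (pi * t)) * (\<Sum>\<^sub>\<infinity>j\<in>(UNIV :: int set). exp (- of_int (j\<^sup>2) / of_real t + of_int j * s))"
    by (rule infsum_cmult_right')
  finally show ?thesis .
qed

section \<open>Theta constants and the eta function\<close>

lemma prodinf_factors:
  assumes r: "0 < r" "r < 1" and c: "c \<in> {-1, 1 :: complex}"
  defines "Od \<equiv> \<lambda>s. complex_of_real (r ^ (2 * s + 1))" and "Ev \<equiv> \<lambda>s. complex_of_real (r ^ (2 * s + 2))"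
  shows "summable (\<lambda>s. norm (Od s * c))" "summable (\<lambda>s. norm (Ev s * c))"
    "convergent_prod (\<lambda>s. 1 + Od s * c)" "convergent_prod (\<lambda>s. 1 + Ev s * c)"
proof -
  have e: "summable (\<lambda>s. r ^ (2 * s + 2))" using summable_qpoch[OF r] by simp
  have "summable (\<lambda>s. inverse r * r ^ (2 * Suc s))" by (intro summable_mult summable_qpoch r)
  then have o: "summable (\<lambda>s. r ^ (2 * s + 1))" using r by (simp add: field_simps)
  have c1: "norm c = 1" using c by auto
  show 1: "summable (\<lambda>s. norm (Od s * c))" using o c1 r by (simp add: Od_def norm_mult norm_power)
  show 2: "summable (\<lambda>s. norm (Ev s * c))" using e c1 r by (simp add: Ev_def norm_mult norm_power)
  show "convergent_prod (\<lambda>s. 1 + Od s * c)" "convergent_prod (\<lambda>s. 1 + Ev s * c)"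
    by (intro convergent_prod_one_plus 1 2)+
qed

text \<open>Multiplied by \<open>qpoch r N\<close> the partial products collapse to
  \<open>qpoch r (2 * N)\<close>, since \<open>(1 - O^2) * (1 - E^2)\<close> supplies its next two
  factors. Both sequences have the same nonzero limit.\<close>

lemma euler_odd_product:
  assumes r: "0 < r" "r < 1"
  shows "(\<Prod>s. 1 + complex_of_real (r ^ (2 * s + 2))) * (\<Prod>s. 1 + complex_of_real (r ^ (2 * s + 1)))
    * (\<Prod>s. 1 - complex_of_real (r ^ (2 * s + 1))) = 1"
proof -
  let ?O = "\<lambda>s. complex_of_real (r ^ (2 * s + 1))" and ?E = "\<lambda>s. complex_of_real (r ^ (2 * s + 2))"
  have L: "(\<lambda>N. \<Prod>s<N. 1 + ?E s) \<longlonglongrightarrow> (\<Prod>s. 1 + ?E s)" "(\<lambda>N. \<Prod>s<N. 1 + ?O s) \<longlonglongrightarrow> (\<Prod>s. 1 + ?O s)"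
      "(\<lambda>N. \<Prod>s<N. 1 - ?O s) \<longlonglongrightarrow> (\<Prod>s. 1 - ?O s)"
    using prodinf_factors[OF r, of 1] prodinf_factors[OF r, of "-1"]
    by (auto intro!: prod_lessThan_tendsto_prodinf)
  have P: "(\<lambda>N. complex_of_real (qpoch r N)) \<longlonglongrightarrow> of_real (P_prod r)"
    using qpoch_tendsto(1)[OF r] by (rule tendsto_of_real)
  have P2: "(\<lambda>N. complex_of_real (qpoch r (2 * N))) \<longlonglongrightarrow> of_real (P_prod r)"
    by (rule filterlim_compose[OF P]) (rule filterlim_subseq, simp add: strict_mono_def)
  have fin: "(\<Prod>s<N. 1 + ?E s) * (\<Prod>s<N. 1 + ?O s) * (\<Prod>s<N. 1 - ?O s) * of_real (qpoch r N) = of_real (qpoch r (2 * N))" for N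
  proof (induction N)
    case (Suc N)
    have q: "qpoch r (Suc n) = qpoch r n * (1 - r ^ (2 * Suc n))" for n by (simp add: qpoch_def)
    have e: "2 * Suc N = Suc (Suc (2 * N))" by simp
    have o2: "r ^ (2 * Suc (2 * N)) = (r ^ (2 * N + 1))\<^sup>2"
      unfolding power_mult[symmetric] by (rule arg_cong[where f = "\<lambda>k. r ^ k"]) simp
    have e2: "r ^ (2 * Suc (Suc (2 * N))) = (r ^ (2 * N + 2))\<^sup>2"
      unfolding power_mult[symmetric] by (rule arg_cong[where f = "\<lambda>k. r ^ k"]) simp
    have "(\<Prod>s<Suc N. 1 + ?E s) * (\<Prod>s<Suc N. 1 + ?O s) * (\<Prod>s<Suc N. 1 - ?O s) * of_real (qpoch r (Suc N))
      = ((\<Prod>s<N. 1 + ?E s) * (\<Prod>s<N. 1 + ?O s) * (\<Prod>s<N. 1 - ?O s) * of_real (qpoch r N))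
        * ((1 + ?E N) * (1 + ?O N) * (1 - ?O N) * (1 - ?E N))"
      unfolding q by (simp del: power_Suc of_real_power)
    also have "\<dots> = of_real (qpoch r (2 * N)) * ((1 + ?E N) * (1 + ?O N) * (1 - ?O N) * (1 - ?E N))"
      by (simp only: Suc.IH)
    also have "(1 + ?E N) * (1 + ?O N) * (1 - ?O N) * (1 - ?E N) = (1 - ?O N ^ 2) * (1 - ?E N ^ 2)"
      by (simp add: power2_eq_square algebra_simps del: power_Suc of_real_power)
    also have "of_real (qpoch r (2 * N)) * \<dots> = of_real (qpoch r (2 * Suc N))"
      unfolding e q o2 e2 by (simp del: power_Suc)
    finally show ?case .
  qed (simp add: qpoch_def)
  have "(\<lambda>N. (\<Prod>s<N. 1 + ?E s) * (\<Prod>s<N. 1 + ?O s) * (\<Prod>s<N. 1 - ?O s) * of_real (qpoch r N))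
    \<longlonglongrightarrow> (\<Prod>s. 1 + ?E s) * (\<Prod>s. 1 + ?O s) * (\<Prod>s. 1 - ?O s) * of_real (P_prod r)"
    by (intro tendsto_mult L P)
  then have "(\<Prod>s. 1 + ?E s) * (\<Prod>s. 1 + ?O s) * (\<Prod>s. 1 - ?O s) * of_real (P_prod r) = of_real (P_prod r)"
    unfolding fin using P2 LIMSEQ_unique by blast
  then show ?thesis using qpoch_tendsto(2)[OF r] by simp
qed

text \<open>Jacobi's relation between the three theta constants and the cube of eta, up to powers of
  the nome: the triple product at \<open>w = 1\<close>, \<open>-1\<close> and \<open>r\<close> gives
  squares of the three products in Euler's identity.\<close>

lemma theta_product_identity:
  assumes r: "0 < r" "r < 1"
  shows "theta_series r 1 * theta_series r (-1) * theta_series r (of_real r) = 2 * of_real (P_prod r) ^ 3"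
proof -
  let ?O = "\<lambda>s. complex_of_real (r ^ (2 * s + 1))" and ?E = "\<lambda>s. complex_of_real (r ^ (2 * s + 2))"
  let ?P = "complex_of_real (P_prod r)"
  have P: "?P \<noteq> 0" using qpoch_tendsto(2)[OF r] by simp
  define A B C where "A = (\<Prod>s. 1 + ?E s)" and "B = (\<Prod>s. 1 + ?O s)" and "C = (\<Prod>s. 1 - ?O s)"
  have t1: "theta_series r 1 = ?P * B\<^sup>2"
    using jacobi_triple_product[OF r, of 1] P by (simp add: B_def power2_eq_square field_simps)
  have t2: "theta_series r (-1) = ?P * C\<^sup>2"
    using jacobi_triple_product[OF r, of "-1"] P by (simp add: C_def power2_eq_square field_simps)
  have t3: "theta_series r (of_real r) = 2 * ?P * A\<^sup>2"
  proof -
    have 1: "?O s * of_real r = ?E s" for s by (simp add: mult_ac)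
    \<comment> \<open>At \<open>w = r\<close> the reflected product starts with the factor
      \<open>1 + 1\<close>, the origin of the 2; the remaining factors are those of
      \<open>A\<close>.\<close>
    have 2: "(\<Prod>s. 1 + ?O s / of_real r) = 2 * A"
    proof -
      have "?O s / of_real r = of_real (r ^ (2 * s))" for s using r by simp
      then have "(\<Prod>s. 1 + ?O s / of_real r) = (\<Prod>s. 1 + of_real (r ^ (2 * s)))" by (simp only:)
      also have "\<dots> = 2 * A"
      proof -
        have f: "(\<lambda>N. \<Prod>s<N. 1 + complex_of_real (r ^ (2 * s))) \<longlonglongrightarrow> (\<Prod>s. 1 + of_real (r ^ (2 * s)))"
        proof (intro prod_lessThan_tendsto_prodinf convergent_prod_one_plus)
          have "summable (\<lambda>s. (r\<^sup>2) ^ s)" using r by (intro summable_geometric) (simp add: power_less_one_iff)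
          then show "summable (\<lambda>s. norm (complex_of_real (r ^ (2 * s))))" using r by (simp add: norm_power power_mult)
        qed
        have g: "(\<lambda>N. 2 * (\<Prod>s<N. 1 + ?E s)) \<longlonglongrightarrow> 2 * A"
          unfolding A_def using prodinf_factors(4)[OF r, of 1]
          by (intro tendsto_intros) (auto intro!: prod_lessThan_tendsto_prodinf)
        have "(\<Prod>s<Suc N. 1 + complex_of_real (r ^ (2 * s))) = 2 * (\<Prod>s<N. 1 + ?E s)" for N
          by (subst prod.lessThan_Suc_shift) simp
        with LIMSEQ_Suc[OF f] have "(\<lambda>N. 2 * (\<Prod>s<N. 1 + ?E s)) \<longlonglongrightarrow> (\<Prod>s. 1 + of_real (r ^ (2 * s)))" by (simp only:)
        then show ?thesis using g LIMSEQ_unique by blast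
      qed
      finally show ?thesis .
    qed
    have "A * (2 * A) = theta_series r (of_real r) / ?P"
      using jacobi_triple_product[OF r, of "of_real r"] r unfolding 1 2 A_def by simp
    then show ?thesis using P by (simp add: power2_eq_square field_simps)
  qed
  have "A * B * C = 1" using euler_odd_product[OF r] by (simp add: A_def B_def C_def)
  then have "2 * ?P ^ 3 * (A * B * C)\<^sup>2 = 2 * ?P ^ 3" by simp
  then show ?thesis unfolding t1 t2 t3 by (simp add: power2_eq_square power3_eq_cube mult_ac)
qed

lemma exp_powi_sq: "exp (- pi * x) powi (k\<^sup>2) = exp (- pi * x * (real_of_int k)\<^sup>2)"
proof -
  have "exp (of_int (k\<^sup>2) * (- pi * x)) = exp (- pi * x) powi (k\<^sup>2)" by (rule exp_power_int[symmetric])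
  then show ?thesis by (simp add: mult_ac)
qed

text \<open>\<open>s = 0\<close> maps the symmetric theta constant to itself, while
  \<open>s = \<i> \<pi>\<close> exchanges the half-shifted one with the alternating one. The
  prefactor \<open>exp (- pi * x / 4)\<close> completes \<open>k^2 + k\<close> to
  \<open>(k + 1/2)^2\<close>.\<close>

lemma theta_inversion:
  assumes x: "x > 0"
  shows "theta_series (exp (- pi * x)) 1 = of_real (1 / sqrt x) * theta_series (exp (- pi / x)) 1"
    and "of_real (exp (- pi * x / 4)) * theta_series (exp (- pi * x)) (of_real (exp (- pi * x)))
       = of_real (1 / sqrt x) * theta_series (exp (- pi / x)) (-1)"
proof -
  define t where "t = x / pi"
  have t: "t > 0" using x by (simp add: t_def)
  have st: "sqrt (pi * t) = sqrt x" by (simp add: t_def)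
  have R: "- complex_of_int (j\<^sup>2) / of_real t = of_real (- pi * (1 / x) * (real_of_int j)\<^sup>2)" for j
    using x by (simp add: t_def)
  have pix: "exp (- pi / x) = exp (- pi * (1 / x))" by simp
  have "theta_series (exp (- pi * x)) 1 = (\<Sum>\<^sub>\<infinity>\<nu>\<in>(UNIV :: int set). exp (of_real t * (0 + 2 * of_real pi * \<i> * of_int \<nu>)\<^sup>2 / 4))"
    unfolding theta_series_def exp_powi_sq
  proof (intro infsum_cong)
    fix \<nu> :: int
    have "of_real t * (0 + 2 * of_real pi * \<i> * of_int \<nu>)\<^sup>2 / 4 = of_real t * (\<i> * of_real (2 * pi * \<nu>))\<^sup>2 / 4"
      by (simp add: mult_ac)
    also have "\<dots> = complex_of_real (- (t * (2 * pi * \<nu>)\<^sup>2 / 4))"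
      unfolding power_mult_distrib[of \<i>] by simp
    also have "t * (2 * pi * \<nu>)\<^sup>2 / 4 = pi * x * (real_of_int \<nu>)\<^sup>2"
      by (simp add: t_def power2_eq_square field_simps)
    finally have "of_real t * (0 + 2 * of_real pi * \<i> * of_int \<nu>)\<^sup>2 / 4 = complex_of_real (- pi * x * (real_of_int \<nu>)\<^sup>2)"
      by simp
    then show "complex_of_real (exp (- pi * x * (real_of_int \<nu>)\<^sup>2)) * 1 powi \<nu> = exp (of_real t * (0 + 2 * of_real pi * \<i> * of_int \<nu>)\<^sup>2 / 4)"
      by (simp only: exp_of_real power_int_1_left mult_1_right)
  qed
  also have "\<dots> = of_real (1 / sqrt (pi * t)) * (\<Sum>\<^sub>\<infinity>j\<in>(UNIV :: int set). exp (- of_int (j\<^sup>2) / of_real t + of_int j * 0))"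
    by (rule theta_transformation[OF t]) simp
  also have "(\<Sum>\<^sub>\<infinity>j\<in>(UNIV :: int set). exp (- of_int (j\<^sup>2) / of_real t + of_int j * 0)) = theta_series (exp (- pi / x)) 1"
    unfolding theta_series_def pix exp_powi_sq R
    by (simp only: exp_of_real power_int_1_left mult_1_right mult_zero_right add_0_right)
  finally show "theta_series (exp (- pi * x)) 1 = of_real (1 / sqrt x) * theta_series (exp (- pi / x)) 1"
    unfolding st .
  have "of_real (exp (- pi * x / 4)) * theta_series (exp (- pi * x)) (of_real (exp (- pi * x)))
     = (\<Sum>\<^sub>\<infinity>\<nu>\<in>(UNIV :: int set). of_real (exp (- pi * x / 4)) * (of_real (exp (- pi * x) powi (\<nu>\<^sup>2)) * of_real (exp (- pi * x)) powi \<nu>))"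
    unfolding theta_series_def by (rule infsum_cmult_right'[symmetric])
  also have "\<dots> = (\<Sum>\<^sub>\<infinity>\<nu>\<in>(UNIV :: int set). exp (of_real t * (\<i> * of_real pi + 2 * of_real pi * \<i> * of_int \<nu>)\<^sup>2 / 4))"
    unfolding exp_powi_sq
  proof (intro infsum_cong)
    fix \<nu> :: int
    have p: "exp (- pi * x) powi \<nu> = exp (- pi * x * of_int \<nu>)"
      using exp_power_int[of "- pi * x" \<nu>] by (simp add: mult_ac)
    have "of_real t * (\<i> * of_real pi + 2 * of_real pi * \<i> * of_int \<nu>)\<^sup>2 / 4
        = of_real t * (\<i> * of_real (pi * (1 + 2 * \<nu>)))\<^sup>2 / 4" by (simp add: algebra_simps)
    also have "\<dots> = complex_of_real (- (t * (pi * (1 + 2 * \<nu>))\<^sup>2 / 4))"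
      unfolding power_mult_distrib[of \<i>] by simp
    also have "t * (pi * (1 + 2 * \<nu>))\<^sup>2 / 4 = - (- pi * x / 4 + - pi * x * (real_of_int \<nu>)\<^sup>2 + - pi * x * \<nu>)"
      by (simp add: t_def power2_eq_square field_simps)
    finally have e: "of_real t * (\<i> * of_real pi + 2 * of_real pi * \<i> * of_int \<nu>)\<^sup>2 / 4
        = complex_of_real (- pi * x / 4 + - pi * x * (real_of_int \<nu>)\<^sup>2 + - pi * x * \<nu>)" by simp
    have "complex_of_real (exp (- pi * x / 4)) * (of_real (exp (- pi * x * (real_of_int \<nu>)\<^sup>2)) * of_real (exp (- pi * x)) powi \<nu>)
       = of_real (exp (- pi * x / 4) * exp (- pi * x * (real_of_int \<nu>)\<^sup>2) * exp (- pi * x * \<nu>))"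
      unfolding p[symmetric] of_real_power_int of_real_mult by simp
    also have "\<dots> = of_real (exp (- pi * x / 4 + - pi * x * (real_of_int \<nu>)\<^sup>2 + - pi * x * \<nu>))"
      by (simp only: exp_add)
    also have "\<dots> = exp (complex_of_real (- pi * x / 4 + - pi * x * (real_of_int \<nu>)\<^sup>2 + - pi * x * \<nu>))"
      by (rule exp_of_real[symmetric])
    finally show "complex_of_real (exp (- pi * x / 4)) * (of_real (exp (- pi * x * (real_of_int \<nu>)\<^sup>2)) * of_real (exp (- pi * x)) powi \<nu>)
       = exp (of_real t * (\<i> * of_real pi + 2 * of_real pi * \<i> * of_int \<nu>)\<^sup>2 / 4)" unfolding e .
  qed
  also have "\<dots> = of_real (1 / sqrt (pi * t)) * (\<Sum>\<^sub>\<infinity>j\<in>(UNIV :: int set). exp (- of_int (j\<^sup>2) / of_real t + of_int j * (\<i> * of_real pi)))"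
    by (rule theta_transformation[OF t]) simp
  also have "(\<Sum>\<^sub>\<infinity>j\<in>(UNIV :: int set). exp (- of_int (j\<^sup>2) / of_real t + of_int j * (\<i> * of_real pi))) = theta_series (exp (- pi / x)) (-1)"
    unfolding theta_series_def pix exp_powi_sq R
  proof (intro infsum_cong)
    fix j :: int
    have "exp (of_int j * (\<i> * of_real pi)) = exp (\<i> * of_real pi) powi j" by (rule exp_power_int[symmetric])
    then have "exp (of_int j * (\<i> * of_real pi)) = (-1 :: complex) powi j" by simp
    then show "exp (complex_of_real (- pi * (1 / x) * (real_of_int j)\<^sup>2) + of_int j * (\<i> * of_real pi))
       = of_real (exp (- pi * (1 / x) * (real_of_int j)\<^sup>2)) * (- 1) powi j"
      unfolding exp_add by (simp only: exp_of_real)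
  qed
  finally show "of_real (exp (- pi * x / 4)) * theta_series (exp (- pi * x)) (of_real (exp (- pi * x)))
       = of_real (1 / sqrt x) * theta_series (exp (- pi / x)) (-1)"
    unfolding st .
qed

text \<open>\<open>Q y\<close> is the Dedekind eta function at \<open>\<i> y\<close>. The inversion
  permutes the three theta constants up to powers of \<open>sqrt x\<close>, so their product relates
  \<open>(Q x)^3\<close> to \<open>(Q (1 / x))^3\<close>, and positivity of \<open>Q\<close> permits
  real cube roots.\<close>

theorem eta_inversion:
  assumes x: "x > 0"
  shows "exp (pi / (6 * x)) / (P_prod (exp (- pi / x)))\<^sup>2 = exp (pi * x / 6) / (x * (P_prod (exp (- pi * x)))\<^sup>2)"
proof -
  define Q where "Q y = exp (- pi * y / 12) * P_prod (exp (- pi * y))" for y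
  have r: "0 < exp (- pi * y)" "exp (- pi * y) < 1" if "y > 0" for y using that by auto
  have Qpos: "Q y > 0" if "y > 0" for y
    unfolding Q_def using qpoch_tendsto(2)[OF r[OF that]] by simp
  let ?T = "\<lambda>y. theta_series (exp (- pi * y))"
  have prod: "?T y 1 * ?T y (-1) * (of_real (exp (- pi * y / 4)) * ?T y (of_real (exp (- pi * y)))) = 2 * of_real (Q y ^ 3)" if "y > 0" for y
  proof -
    have "exp (- pi * y / 4) = exp (- pi * y / 12) ^ 3" by (simp flip: exp_of_nat_mult)
    then have e: "complex_of_real (exp (- pi * y / 4)) = of_real (exp (- pi * y / 12)) ^ 3" by simp
    have "?T y 1 * ?T y (-1) * (of_real (exp (- pi * y / 4)) * ?T y (of_real (exp (- pi * y))))
      = of_real (exp (- pi * y / 4)) * (?T y 1 * ?T y (-1) * ?T y (of_real (exp (- pi * y))))" by (simp only: mult_ac)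
    also have "\<dots> = 2 * of_real (Q y ^ 3)"
      unfolding theta_product_identity[OF r[OF that]] e Q_def by (simp add: power_mult_distrib)
    finally show ?thesis .
  qed
  have ix: "1 / x > 0" using x by simp
  have a1: "?T x 1 = of_real (1 / sqrt x) * ?T (1 / x) 1" using theta_inversion(1)[OF x] by simp
  have a2: "of_real (exp (- pi * x / 4)) * ?T x (of_real (exp (- pi * x))) = of_real (1 / sqrt x) * ?T (1 / x) (-1)"
    using theta_inversion(2)[OF x] by simp
  have a3: "of_real (exp (- pi * (1 / x) / 4)) * ?T (1 / x) (of_real (exp (- pi * (1 / x)))) = of_real (sqrt x) * ?T x (-1)"
    using theta_inversion(2)[OF ix] by (simp add: real_sqrt_divide)
  have "2 * complex_of_real (Q x ^ 3) = of_real (1 / sqrt x) * ?T (1 / x) 1 * ?T x (-1) * (of_real (1 / sqrt x) * ?T (1 / x) (-1))"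
    unfolding prod[OF x, symmetric] a1 a2 ..
  also have "\<dots> = of_real (1 / sqrt x) ^ 3 * (?T (1 / x) 1 * ?T (1 / x) (-1) * (of_real (sqrt x) * ?T x (-1)))"
    using x by (simp add: power3_eq_cube)
  also have "\<dots> = of_real (1 / sqrt x) ^ 3 * (2 * of_real (Q (1 / x) ^ 3))"
    unfolding a3[symmetric] prod[OF ix] ..
  finally have "2 * complex_of_real (Q x ^ 3) = 2 * of_real ((1 / sqrt x * Q (1 / x)) ^ 3)"
    by (simp only: power_mult_distrib of_real_mult of_real_power mult_ac)
  then have "complex_of_real (Q x ^ 3) = of_real ((1 / sqrt x * Q (1 / x)) ^ 3)" by (simp only: mult_cancel_left) simp
  then have "Q x ^ 3 = (1 / sqrt x * Q (1 / x)) ^ 3" by (simp only: of_real_eq_iff)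
  then have "Q x = 1 / sqrt x * Q (1 / x)"
    using Qpos[OF x] Qpos[OF ix] x by (simp add: power_eq_iff_eq_base)
  then have "(Q x)\<^sup>2 * x = (Q (1 / x))\<^sup>2" using x by (simp add: power_mult_distrib power_divide)
  then have "1 / (Q (1 / x))\<^sup>2 = 1 / (x * (Q x)\<^sup>2)" by (simp add: mult.commute)
  moreover have "1 / (Q (1 / x))\<^sup>2 = exp (pi / (6 * x)) / (P_prod (exp (- pi / x)))\<^sup>2"
  proof -
    have "exp (pi / (6 * x)) * (exp (- pi * (1 / x) / 12))\<^sup>2 = 1"
      by (simp flip: exp_of_nat_mult exp_add)
    then have "(exp (- pi * (1 / x) / 12))\<^sup>2 = 1 / exp (pi / (6 * x))" by (simp add: field_simps)
    then show ?thesis by (simp add: Q_def power_mult_distrib)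
  qed
  moreover have "1 / (x * (Q x)\<^sup>2) = exp (pi * x / 6) / (x * (P_prod (exp (- pi * x)))\<^sup>2)"
  proof -
    have "exp (pi * x / 6) * (exp (- pi * x / 12))\<^sup>2 = 1"
      by (simp flip: exp_of_nat_mult exp_add)
    then have "(exp (- pi * x / 12))\<^sup>2 = 1 / exp (pi * x / 6)" by (simp add: field_simps)
    then show ?thesis by (simp add: Q_def power_mult_distrib)
  qed
  ultimately show ?thesis by simp
qed

subsection \<open>Modes away from the Fermi points\<close>

text \<open>A holomorphic branch of the logarithm of \<open>2 + 2 cos z\<close> on the whole strip:
  \<open>2 + 2 cos z\<close> is the square of \<open>2 cos (z / 2)\<close>, which has positive real
  part there.\<close>

definition log_band :: "complex \<Rightarrow> complex" where
  "log_band z = 2 * Ln (2 * cos (z / 2))"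

definition band_strip :: "complex set" where "band_strip = {z. \<bar>Re z\<bar> < pi}"

lemma convex_band_strip: "convex band_strip" and open_band_strip: "open band_strip"
proof -
  have e: "band_strip = {z. Re z < pi} \<inter> {z. - pi < Re z}" by (auto simp: band_strip_def)
  show "convex band_strip" unfolding e
    by (intro convex_Int convex_halfspace_Re_lt convex_halfspace_Re_gt)
  show "open band_strip" unfolding e
    by (intro open_Int open_halfspace_Re_lt open_halfspace_Re_gt)
qed

lemma Re_cos_half_pos:
  assumes "z \<in> band_strip" shows "Re (2 * cos (z / 2)) > 0"
proof -
  have "Re (cos (z / 2)) = cos (Re z / 2) * cosh (Im z / 2)"
    by (simp add: Re_cos cosh_def)
  moreover have "cos (Re z / 2) > 0" using assms by (intro cos_gt_zero_pi) (auto simp: band_strip_def)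
  ultimately show ?thesis by (simp add: cosh_real_pos)
qed

lemma cos_half_nonzero: "z \<in> band_strip \<Longrightarrow> cos (z / 2) \<noteq> 0"
  using Re_cos_half_pos[of z] by auto

lemma exp_log_band:
  assumes "z \<in> band_strip" shows "exp (log_band z) = 2 + 2 * cos z"
proof -
  have "exp (log_band z) = (2 * cos (z / 2))\<^sup>2"
    unfolding log_band_def exp_double using cos_half_nonzero[OF assms] by simp
  also have "\<dots> = 2 + 2 * cos (2 * (z / 2))" unfolding cos_double_cos by (simp add: power_mult_distrib)
  finally show ?thesis by simp
qed

lemma log_band_derivs:
  assumes "z \<in> band_strip"
  shows "(log_band has_field_derivative - (sin (z / 2) / cos (z / 2))) (at z)"
    "((\<lambda>z. - (sin (z / 2) / cos (z / 2))) has_field_derivative - (1 / (2 * (cos (z / 2))\<^sup>2))) (at z)"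
    "((\<lambda>z. - (1 / (2 * (cos (z / 2))\<^sup>2))) has_field_derivative - (sin (z / 2) / (2 * (cos (z / 2)) ^ 3))) (at z)"
proof -
  have nz: "cos (z / 2) \<noteq> 0" using cos_half_nonzero[OF assms] .
  have nr: "2 * cos (z / 2) \<notin> \<real>\<^sub>\<le>\<^sub>0"
    using Re_cos_half_pos[OF assms] complex_nonpos_Reals_iff by fastforce
  show "(log_band has_field_derivative - (sin (z / 2) / cos (z / 2))) (at z)"
    unfolding log_band_def using nz nr by (auto intro!: derivative_eq_intros simp: field_simps)
  have sc: "(sin (z / 2))\<^sup>2 + (cos (z / 2))\<^sup>2 = 1" by simp
  show "((\<lambda>z. - (sin (z / 2) / cos (z / 2))) has_field_derivative - (1 / (2 * (cos (z / 2))\<^sup>2))) (at z)"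
  proof -
    have "((\<lambda>z. - (sin (z / 2) / cos (z / 2))) has_field_derivative
       - ((cos (z / 2) * (1 / 2) * cos (z / 2) - sin (z / 2) * (- sin (z / 2) * (1 / 2))) / (cos (z / 2) * cos (z / 2)))) (at z)"
      using nz by (auto intro!: derivative_eq_intros)
    also have "cos (z / 2) * (1 / 2) * cos (z / 2) - sin (z / 2) * (- sin (z / 2) * (1 / 2)) = ((sin (z / 2))\<^sup>2 + (cos (z / 2))\<^sup>2) / 2"
      by (simp add: power2_eq_square field_simps)
    finally show ?thesis unfolding sc by (simp add: power2_eq_square)
  qed
  show "((\<lambda>z. - (1 / (2 * (cos (z / 2))\<^sup>2))) has_field_derivative - (sin (z / 2) / (2 * (cos (z / 2)) ^ 3))) (at z)"
    using nz by (auto intro!: derivative_eq_intros simp: field_simps power2_eq_square power3_eq_cube)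
qed

text \<open>One cell of the Euler-Maclaurin formula with the node displaced by
  \<open>h * \<xi>\<close> from the midpoint; \<open>f 0\<close> is a primitive of the summand
  \<open>f 1\<close>. The coefficient \<open>\<xi>^2 / 2 - 1 / 24\<close> is half the second
  Bernoulli polynomial at \<open>\<xi> + 1 / 2\<close>. It is written with differences at the cell
  ends so that the correction telescopes.\<close>

lemma midpoint_cell:
  fixes f :: "nat \<Rightarrow> complex \<Rightarrow> complex" and w \<xi> h :: complex
  assumes S: "convex S"
    and f: "\<And>i x. x \<in> S \<Longrightarrow> i \<le> 3 \<Longrightarrow> (f i has_field_derivative f (Suc i) x) (at x within S)"
    and B: "\<And>x. x \<in> S \<Longrightarrow> norm (f 4 x) \<le> B"
    and S_in: "w \<in> S" "w + h / 2 \<in> S" "w - h / 2 \<in> S" "w + h * \<xi> \<in> S"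
  shows "norm (h * f 1 (w + h * \<xi>) - ((f 0 (w + h / 2) - f 0 (w - h / 2))
      + h * \<xi> * (f 1 (w + h / 2) - f 1 (w - h / 2))
      + h\<^sup>2 * (\<xi>\<^sup>2 / 2 - 1 / 24) * (f 2 (w + h / 2) - f 2 (w - h / 2))))
    \<le> B * norm h ^ 4 * (norm \<xi> ^ 3 + 1 + norm \<xi> + norm (\<xi>\<^sup>2 / 2 - 1 / 24))"
proof -
  have T0: "norm (f 0 z - (f 0 w + f 1 w * (z - w) + f 2 w * (z - w)\<^sup>2 / 2 + f 3 w * (z - w) ^ 3 / 6)) \<le> B * norm (z - w) ^ 4 / 6"
    if "z \<in> S" for z
    using complex_Taylor[of S 3 f B w z] S f B S_in(1) that
    by (simp add: numeral_eq_Suc)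
  have T1: "norm (f 1 z - (f 1 w + f 2 w * (z - w) + f 3 w * (z - w)\<^sup>2 / 2)) \<le> B * norm (z - w) ^ 3 / 2"
    if "z \<in> S" for z
    using complex_Taylor[of S 2 "\<lambda>i. f (Suc i)" B w z] S f B S_in(1) that
    by (simp add: numeral_eq_Suc)
  have T2: "norm (f 2 z - (f 2 w + f 3 w * (z - w))) \<le> B * norm (z - w) ^ 2" if "z \<in> S" for z
    using complex_Taylor[of S 1 "\<lambda>i. f (Suc (Suc i))" B w z] S f B S_in(1) that
    by (simp add: numeral_eq_Suc)
  define a where "a = h / 2"
  define R0 where "R0 z = f 0 z - (f 0 w + f 1 w * (z - w) + f 2 w * (z - w)\<^sup>2 / 2 + f 3 w * (z - w) ^ 3 / 6)" for z
  define R1 where "R1 z = f 1 z - (f 1 w + f 2 w * (z - w) + f 3 w * (z - w)\<^sup>2 / 2)" for z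
  define R2 where "R2 z = f 2 z - (f 2 w + f 3 w * (z - w))" for z
  have f0: "f 0 z = R0 z + (f 0 w + f 1 w * (z - w) + f 2 w * (z - w)\<^sup>2 / 2 + f 3 w * (z - w) ^ 3 / 6)"
   and f1: "f 1 z = R1 z + (f 1 w + f 2 w * (z - w) + f 3 w * (z - w)\<^sup>2 / 2)"
   and f2: "f 2 z = R2 z + (f 2 w + f 3 w * (z - w))" for z by (simp_all add: R0_def R1_def R2_def)
  have B0: "0 \<le> B" using B[OF S_in(1)] norm_ge_zero order_trans by blast
  let ?k = "\<xi>\<^sup>2 / 2 - 1 / 24"
  \<comment> \<open>The Taylor polynomials cancel through third order, by the choice of the
    coefficients; only the remainders survive.\<close>
  have gen: "h * (r + (A1 + A2 * (h * \<xi>) + A3 * (h * \<xi>)\<^sup>2 / 2))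
     - (((rp + (A0 + A1 * (h/2) + A2 * (h/2)\<^sup>2 / 2 + A3 * (h/2)^3 / 6)) - (rm + (A0 + A1 * (- (h/2)) + A2 * (- (h/2))\<^sup>2 / 2 + A3 * (- (h/2))^3 / 6)))
      + h * \<xi> * ((sp + (A1 + A2 * (h/2) + A3 * (h/2)\<^sup>2 / 2)) - (sm + (A1 + A2 * (- (h/2)) + A3 * (- (h/2))\<^sup>2 / 2)))
      + h\<^sup>2 * ?k * ((tp + (A2 + A3 * (h/2))) - (tm + (A2 + A3 * (- (h/2))))))
     = h * r - (rp - rm) - h * \<xi> * (sp - sm) - h\<^sup>2 * ?k * (tp - tm)"
    for r rp rm sp sm tp tm A0 A1 A2 A3 :: complex
    by (simp add: power2_eq_square power3_eq_cube field_simps)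
  have d: "w + h / 2 - w = h / 2" "w - h / 2 - w = - (h / 2)" "w + h * \<xi> - w = h * \<xi>" by simp_all
  have "h * f 1 (w + h * \<xi>) - ((f 0 (w + h / 2) - f 0 (w - h / 2))
      + h * \<xi> * (f 1 (w + h / 2) - f 1 (w - h / 2))
      + h\<^sup>2 * ?k * (f 2 (w + h / 2) - f 2 (w - h / 2)))
    = h * R1 (w + h * \<xi>) - (R0 (w + h / 2) - R0 (w - h / 2)) - h * \<xi> * (R1 (w + h / 2) - R1 (w - h / 2))
      - h\<^sup>2 * ?k * (R2 (w + h / 2) - R2 (w - h / 2))"
    unfolding f0[of "w + h / 2"] f0[of "w - h / 2"] f1[of "w + h / 2"] f1[of "w - h / 2"] f1[of "w + h * \<xi>"]
      f2[of "w + h / 2"] f2[of "w - h / 2"] d by (rule gen)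
  also have "norm \<dots> \<le> norm (h * R1 (w + h * \<xi>)) + (norm (R0 (w + h / 2)) + norm (R0 (w - h / 2)))
      + norm (h * \<xi>) * (norm (R1 (w + h / 2)) + norm (R1 (w - h / 2)))
      + norm (h\<^sup>2 * ?k) * (norm (R2 (w + h / 2)) + norm (R2 (w - h / 2)))"
  proof -
    have tri: "norm (u - v - x * x' - y * y') \<le> norm u + norm v + norm x * norm x' + norm y * norm y'" for u v x x' y y' :: complex
      using norm_triangle_ineq4[of "u - v - x * x'" "y * y'"] norm_triangle_ineq4[of "u - v" "x * x'"] norm_triangle_ineq4[of u v]
      unfolding norm_mult by linarith
    show ?thesis
      by (rule order_trans[OF tri]) (intro add_mono mult_left_mono order_refl norm_triangle_ineq4 norm_ge_zero)
  qed
  also have "\<dots> \<le> norm h * (B * norm (h * \<xi>) ^ 3) + (B * norm h ^ 4 / 96 + B * norm h ^ 4 / 96)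
      + norm (h * \<xi>) * (B * norm h ^ 3 / 16 + B * norm h ^ 3 / 16)
      + norm (h\<^sup>2 * ?k) * (B * norm h ^ 2 / 4 + B * norm h ^ 2 / 4)"
  proof (intro add_mono mult_left_mono norm_ge_zero)
    have "norm (R1 (w + h * \<xi>)) \<le> B * norm (h * \<xi>) ^ 3 / 2" using T1[OF S_in(4)] by (simp add: R1_def)
    also have "\<dots> \<le> B * norm (h * \<xi>) ^ 3" using B0 by simp
    finally show "norm (h * R1 (w + h * \<xi>)) \<le> norm h * (B * norm (h * \<xi>) ^ 3)"
      by (simp add: norm_mult mult_left_mono)
    show "norm (R0 (w + h / 2)) \<le> B * norm h ^ 4 / 96" "norm (R0 (w - h / 2)) \<le> B * norm h ^ 4 / 96"
      using T0[OF S_in(2)] T0[OF S_in(3)] by (simp_all add: R0_def norm_divide power_divide)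
    show "norm (R1 (w + h / 2)) \<le> B * norm h ^ 3 / 16" "norm (R1 (w - h / 2)) \<le> B * norm h ^ 3 / 16"
      using T1[OF S_in(2)] T1[OF S_in(3)] by (simp_all add: R1_def norm_divide power_divide)
    show "norm (R2 (w + h / 2)) \<le> B * norm h ^ 2 / 4" "norm (R2 (w - h / 2)) \<le> B * norm h ^ 2 / 4"
      using T2[OF S_in(2)] T2[OF S_in(3)] by (simp_all add: R2_def norm_divide power_divide)
  qed
  also have "\<dots> = B * norm h ^ 4 * (norm \<xi> ^ 3 + 1 / 48 + norm \<xi> / 8 + norm ?k / 2)"
    unfolding norm_mult norm_power
    by (simp add: power2_eq_square power3_eq_cube power4_eq_xxxx algebra_simps)
  also have "\<dots> \<le> B * norm h ^ 4 * (norm \<xi> ^ 3 + 1 + norm \<xi> + norm ?k)"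
    using B0 by (intro mult_left_mono add_mono) auto
  finally show ?thesis .
qed

text \<open>The bound \<open>5 \<pi> / 6\<close> lies strictly between the Fermi momentum
  \<open>2 \<pi> / 3\<close> and the singularity at \<open>\<pi>\<close>, leaving a margin of
  \<open>\<pi> / 6\<close> for shifted nodes.\<close>

lemma compact_bound_log_band:
  "\<exists>B. \<forall>z. \<bar>Re z\<bar> \<le> 5 * pi / 6 \<longrightarrow> \<bar>Im z\<bar> \<le> 1 \<longrightarrow> norm (- (sin (z / 2) / (2 * (cos (z / 2)) ^ 3))) \<le> B"
proof -
  let ?K = "cbox (Complex (- (5 * pi / 6)) (- 1)) (Complex (5 * pi / 6) 1)"
  have K: "z \<in> ?K \<longleftrightarrow> \<bar>Re z\<bar> \<le> 5 * pi / 6 \<and> \<bar>Im z\<bar> \<le> 1" for z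
    by (auto simp: in_cbox_complex_iff abs_le_iff)
  have "?K \<subseteq> band_strip"
  proof
    fix z assume "z \<in> ?K"
    then have "\<bar>Re z\<bar> \<le> 5 * pi / 6" by (simp add: K)
    also have "\<dots> < pi" by simp
    finally show "z \<in> band_strip" by (simp add: band_strip_def)
  qed
  then have "continuous_on ?K (\<lambda>z. - (sin (z / 2) / (2 * (cos (z / 2)) ^ 3)))"
    using cos_half_nonzero by (intro continuous_intros) auto
  then have "compact ((\<lambda>z. - (sin (z / 2) / (2 * (cos (z / 2)) ^ 3))) ` ?K)"
    by (intro compact_continuous_image compact_cbox)
  then have "bounded ((\<lambda>z. - (sin (z / 2) / (2 * (cos (z / 2)) ^ 3))) ` ?K)" by (rule compact_imp_bounded)
  then obtain B where "\<And>x. x \<in> (\<lambda>z. - (sin (z / 2) / (2 * (cos (z / 2)) ^ 3))) ` ?K \<Longrightarrow> norm x \<le> B"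
    unfolding bounded_iff by blast
  then show ?thesis using K by blast
qed

lemma log_band_of_real:
  assumes "\<bar>x\<bar> < pi" shows "log_band (of_real x) = of_real (ln (2 + 2 * cos x))"
proof -
  have c: "cos (x / 2) > 0" using assms by (intro cos_gt_zero_pi) auto
  have "2 * cos (complex_of_real x / 2) = of_real (2 * cos (x / 2))"
    using cos_of_real[of "x / 2", where 'a = complex] by simp
  then have "log_band (of_real x) = of_real (2 * ln (2 * cos (x / 2)))"
    unfolding log_band_def using c by (simp only: Ln_of_real mult_pos_pos zero_less_numeral) simp
  also have "2 * ln (2 * cos (x / 2)) = ln ((2 * cos (x / 2))\<^sup>2)" using c by (subst ln_realpow) auto
  also have "(2 * cos (x / 2))\<^sup>2 = 2 + 2 * cos (2 * (x / 2))" unfolding cos_double_cos by (simp add: power_mult_distrib)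
  finally show ?thesis by simp
qed

text \<open>The integral of the logarithm of the band over the momenta where
  \<open>2 + 2 cos x \<ge> 1\<close>; it governs the exponential growth of all four
  products.\<close>

definition fermi_integral :: real where
  "fermi_integral = integral {- (2 * pi / 3)..2 * pi / 3} (\<lambda>x. ln (2 + 2 * cos x))"

lemma cos_two_thirds_pi: "cos (2 * pi / 3) = - 1 / 2" and sin_two_thirds_pi: "sin (2 * pi / 3) = sqrt 3 / 2"
  using cos_120 sin_120 by simp_all

text \<open>The number \<open>n\<close> is represented as \<open>3 * p\<close>, so that the Fermi
  momentum \<open>2 \<pi> / 3\<close> is exactly mode number \<open>p\<close>.\<close>

locale torus_scaling =
  fixes m p :: "nat \<Rightarrow> nat" and \<rho> :: real
  assumes \<rho>: "\<rho> > 0" and m: "filterlim m at_top sequentially" and p: "filterlim p at_top sequentially"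
    and ratio: "(\<lambda>j. real (3 * p j) / (sqrt 3 * real (m j))) \<longlonglongrightarrow> \<rho>"
begin

lemma ev_pos: "eventually (\<lambda>j. 0 < m j \<and> 1 < p j) sequentially"
proof -
  have "eventually (\<lambda>j. 1 \<le> m j) sequentially" "eventually (\<lambda>j. 2 \<le> p j) sequentially"
    using m p by (auto simp: filterlim_at_top)
  then show ?thesis by eventually_elim auto
qed

lemma inv_ratio: "(\<lambda>j. real (m j) / real (3 * p j)) \<longlonglongrightarrow> 1 / (sqrt 3 * \<rho>)"
proof -
  have "(\<lambda>j. 1 / (sqrt 3 * (real (3 * p j) / (sqrt 3 * real (m j))))) \<longlonglongrightarrow> 1 / (sqrt 3 * \<rho>)"
    using \<rho> by (intro tendsto_intros ratio) auto
  moreover have "1 / (sqrt 3 * (real (3 * p j) / (sqrt 3 * real (m j)))) = real (m j) / real (3 * p j)" for j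
    by simp
  ultimately show ?thesis by simp
qed

lemma inv_p: "(\<lambda>j. 1 / real (3 * p j)) \<longlonglongrightarrow> 0"
proof -
  have "filterlim (\<lambda>j. real (p j)) at_top sequentially"
    using p by (simp add: filterlim_sequentially_iff_filterlim_real)
  then have "(\<lambda>j. inverse (real (p j))) \<longlonglongrightarrow> 0" by (rule tendsto_inverse_0_at_top)
  from tendsto_mult[OF tendsto_const[of "1/3"] this] show ?thesis by (simp add: field_simps)
qed

text \<open>Summed over the \<open>2 * p\<close> cells between the Fermi points, the cell formula
  leaves boundary terms. Order zero gives the integral, order one cancels, and order two is
  \<open>- 2 sqrt 3\<close>, coming from the slope of \<open>log_band\<close> at the Fermi points.
  Multiplied by \<open>m * h\<close>, whose limit is \<open>2 \<pi> / (sqrt 3 \<rho>)\<close>, the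
  last one is the bounded correction.\<close>

lemma bulk_product:
  fixes \<xi> :: complex
  shows "(\<lambda>j. (\<Prod>i\<in>{- int (p j)..<int (p j)}. (2 + 2 * cos (2 * of_real pi * (of_int i + 1 / 2 + \<xi>) / of_nat (3 * p j))) ^ m j)
     / of_real (exp (real (m j) * real (3 * p j) * fermi_integral / (2 * pi))))
    \<longlonglongrightarrow> exp (- 2 * of_real pi * \<xi>\<^sup>2 / of_real \<rho> + of_real (pi / (6 * \<rho>)))"
proof -
  obtain G where G: "\<And>z. z \<in> band_strip \<Longrightarrow> (G has_field_derivative log_band z) (at z within band_strip)"
  proof (rule holomorphic_convex_primitive'[OF convex_band_strip open_band_strip])
    show "log_band holomorphic_on band_strip"
      by (rule holomorphic_onI) (use log_band_derivs(1) field_differentiable_at_within field_differentiable_def in blast)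
  qed blast
  have Gd: "(G has_field_derivative log_band z) (at z)" if "z \<in> band_strip" for z
    using G[OF that] at_within_open[OF that open_band_strip] by simp
  define f where "f i = (if i = 0 then G else if i = 1 then log_band else if i = 2 then (\<lambda>z. - (sin (z / 2) / cos (z / 2)))
     else if i = 3 then (\<lambda>z. - (1 / (2 * (cos (z / 2))\<^sup>2))) else (\<lambda>z. - (sin (z / 2) / (2 * (cos (z / 2)) ^ 3))))" for i :: nat
  define K where "K = {z. \<bar>Re z\<bar> \<le> 5 * pi / 6 \<and> \<bar>Im z\<bar> \<le> 1}"
  have Kstrip: "K \<subseteq> band_strip"
  proof
    fix z assume "z \<in> K"
    then have "\<bar>Re z\<bar> \<le> 5 * pi / 6" by (simp add: K_def)
    also have "\<dots> < pi" by simp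
    finally show "z \<in> band_strip" by (simp add: band_strip_def)
  qed
  have convK: "convex K"
  proof -
    have "K = cbox (Complex (- (5 * pi / 6)) (- 1)) (Complex (5 * pi / 6) 1)"
      by (auto simp: K_def in_cbox_complex_iff abs_le_iff)
    then show ?thesis by (simp add: convex_box)
  qed
  have fd: "(f i has_field_derivative f (Suc i) z) (at z within K)" if "z \<in> K" "i \<le> 3" for i z
  proof -
    have z: "z \<in> band_strip" using that Kstrip by auto
    have "i = 0 \<or> i = 1 \<or> i = 2 \<or> i = 3" using that by auto
    then have "(f i has_field_derivative f (Suc i) z) (at z)"
      using Gd[OF z] log_band_derivs[OF z] by (auto simp: f_def)
    then show ?thesis by (rule has_field_derivative_at_within)
  qed
  obtain B where B: "\<And>z. z \<in> K \<Longrightarrow> norm (f 4 z) \<le> B"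
    using compact_bound_log_band by (auto simp: f_def K_def)
  define C where "C = B * (norm \<xi> ^ 3 + 1 + norm \<xi> + norm (\<xi>\<^sup>2 / 2 - 1 / 24))"
  define h where "h j = 2 * pi / real (3 * p j)" for j
  have h0: "h \<longlonglongrightarrow> 0"
    using tendsto_mult[OF tendsto_const[of "2 * pi"] inv_p] by (simp add: h_def[abs_def])
  define J where "J = G (of_real (2 * pi / 3)) - G (of_real (- (2 * pi / 3)))"
  have J: "J = of_real fermi_integral"
  proof -
    have "((\<lambda>x. complex_of_real (ln (2 + 2 * cos x))) has_integral (G (of_real (2 * pi / 3)) - G (of_real (- (2 * pi / 3))))) {- (2 * pi / 3)..2 * pi / 3}"
    proof (rule fundamental_theorem_of_calculus)
      fix x assume x: "x \<in> {- (2 * pi / 3)..2 * pi / 3}"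
      then have "\<bar>x\<bar> \<le> 2 * pi / 3" by (auto simp: abs_le_iff)
      also have "\<dots> < pi" by simp
      finally have x': "\<bar>x\<bar> < pi" .
      have "(G has_field_derivative of_real (ln (2 + 2 * cos x))) (at (of_real x))"
        using Gd[of "of_real x"] log_band_of_real[OF x'] x' by (simp add: band_strip_def)
      then show "((\<lambda>x. G (complex_of_real x)) has_vector_derivative complex_of_real (ln (2 + 2 * cos x))) (at x within {- (2 * pi / 3)..2 * pi / 3})"
        by (intro has_vector_derivative_real_field)
    qed simp
    then have Jint: "((\<lambda>x. complex_of_real (ln (2 + 2 * cos x))) has_integral J) {- (2 * pi / 3)..2 * pi / 3}" by (simp add: J_def)
    have "(\<lambda>x. ln (2 + 2 * cos x)) integrable_on {- (2 * pi / 3)..2 * pi / 3}"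
      using has_integral_linear[OF Jint bounded_linear_Re] by (auto simp: o_def integrable_on_def)
    then have "((\<lambda>x. ln (2 + 2 * cos x)) has_integral fermi_integral) {- (2 * pi / 3)..2 * pi / 3}"
      unfolding fermi_integral_def by (rule integrable_integral)
    then have "((\<lambda>x. complex_of_real (ln (2 + 2 * cos x))) has_integral of_real fermi_integral) {- (2 * pi / 3)..2 * pi / 3}"
      by (rule has_integral_of_real)
    then show ?thesis using Jint has_integral_unique by blast
  qed
  define \<Sigma> where "\<Sigma> j = (\<Sum>i\<in>{- int (p j)..<int (p j)}. log_band (of_real (h j) * (of_int i + 1 / 2) + of_real (h j) * \<xi>))" for j
  let ?k = "\<xi>\<^sup>2 / 2 - 1 / 24"
  have smallh: "eventually (\<lambda>j. h j * (norm \<xi> + 1) \<le> pi / 6 \<and> h j * (norm \<xi> + 1) \<le> 1) sequentially"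
  proof -
    have "(\<lambda>j. h j * (norm \<xi> + 1)) \<longlonglongrightarrow> 0 * (norm \<xi> + 1)" by (intro tendsto_intros h0)
    then have l: "(\<lambda>j. h j * (norm \<xi> + 1)) \<longlonglongrightarrow> 0" by simp
    have "eventually (\<lambda>j. h j * (norm \<xi> + 1) < pi / 6) sequentially" "eventually (\<lambda>j. h j * (norm \<xi> + 1) < 1) sequentially"
      using order_tendstoD(2)[OF l, of "pi / 6"] order_tendstoD(2)[OF l, of 1] by simp_all
    then show ?thesis by eventually_elim auto
  qed
  have cells: "eventually (\<lambda>j. (\<forall>i\<in>{- int (p j)..<int (p j)}. of_real (h j) * (of_int i + 1 / 2) + of_real (h j) * \<xi> \<in> K) \<and>
     norm (of_real (h j) * \<Sigma> j - (J + (of_real (h j))\<^sup>2 * ?k * (- 2 * of_real (sqrt 3)))) \<le> 2 * real (p j) * (C * h j ^ 4)) sequentially"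
    using smallh ev_pos
  proof eventually_elim
    case (elim j)
    let ?h = "complex_of_real (h j)" and ?n = "int (p j)"
    have hp: "h j > 0" using elim by (simp add: h_def)
    have hn: "h j * real (p j) = 2 * pi / 3" using elim by (simp add: h_def)
    have inK: "?h * u + v \<in> K" if "\<bar>Re u\<bar> \<le> real (p j)" "Im u = 0" "norm v \<le> h j * (norm \<xi> + 1)" for u v
    proof -
      have "\<bar>Re (?h * u + v)\<bar> \<le> \<bar>h j * Re u\<bar> + \<bar>Re v\<bar>" by simp
      also have "\<dots> \<le> h j * real (p j) + norm v"
        using that(1) hp abs_Re_le_cmod[of v] by (intro add_mono) (auto simp: abs_mult)
      also have "\<dots> \<le> 2 * pi / 3 + pi / 6" using that(3) elim hn by linarith
      finally have "\<bar>Re (?h * u + v)\<bar> \<le> 5 * pi / 6" by simp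
      moreover have "\<bar>Im (?h * u + v)\<bar> \<le> 1" using that abs_Im_le_cmod[of v] elim by simp
      ultimately show ?thesis by (simp add: K_def)
    qed
    have c: "?h * (of_int i + 1 / 2) \<in> K" "?h * (of_int i + 1 / 2) + ?h / 2 \<in> K" "?h * (of_int i + 1 / 2) - ?h / 2 \<in> K"
        "?h * (of_int i + 1 / 2) + ?h * \<xi> \<in> K" if "i \<in> {- ?n..<?n}" for i
    proof -
      have "\<bar>real_of_int i + 1 / 2\<bar> \<le> real (p j)" using that by (auto simp: abs_le_iff)
      then have u: "\<bar>Re (of_int i + 1 / 2)\<bar> \<le> real (p j)" "Im (of_int i + 1 / 2) = 0" by simp_all
      have "norm (?h / 2) \<le> h j * (norm \<xi> + 1)" "norm (- (?h / 2)) \<le> h j * (norm \<xi> + 1)" "norm (?h * \<xi>) \<le> h j * (norm \<xi> + 1)"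
        using hp by (simp_all add: norm_mult norm_divide algebra_simps)
      then show "?h * (of_int i + 1 / 2) + ?h / 2 \<in> K" "?h * (of_int i + 1 / 2) - ?h / 2 \<in> K" "?h * (of_int i + 1 / 2) + ?h * \<xi> \<in> K"
        using inK[OF u, of "?h / 2"] inK[OF u, of "- (?h / 2)"] inK[OF u, of "?h * \<xi>"] by simp_all
      show "?h * (of_int i + 1 / 2) \<in> K" using inK[OF u, of 0] hp by simp
    qed
    have left: "?h * (of_int i + 1 / 2) - ?h / 2 = ?h * of_int i" and right: "?h * (of_int i + 1 / 2) + ?h / 2 = ?h * of_int (i + 1)" for i
      by (simp_all add: algebra_simps)
    have tele: "(\<Sum>i\<in>{- ?n..<?n}. g (?h * of_int (i + 1)) - g (?h * of_int i)) = g (of_real (2 * pi / 3)) - g (of_real (- (2 * pi / 3)))" for g :: "complex \<Rightarrow> complex"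
    proof -
      have "(\<Sum>i\<in>{- ?n..<?n}. g (?h * of_int (i + 1)) - g (?h * of_int i)) = (\<Sum>s<2 * p j. g (?h * of_int (int (Suc s) - ?n)) - g (?h * of_int (int s - ?n)))"
        by (rule sum.reindex_bij_witness[where i = "\<lambda>s. int s - ?n" and j = "\<lambda>i. nat (i + ?n)"]) (auto simp: algebra_simps)
      also have "\<dots> = g (?h * of_int (int (2 * p j) - ?n)) - g (?h * of_int (int 0 - ?n))"
        by (rule sum_lessThan_telescope)
      also have "?h * of_int (int (2 * p j) - ?n) = of_real (h j * real (p j))" by simp
      also have "?h * of_int (int 0 - ?n) = of_real (- (h j * real (p j)))" by simp
      finally show ?thesis unfolding hn .
    qed
    let ?E = "\<lambda>i. ?h * f 1 (?h * (of_int i + 1 / 2) + ?h * \<xi>) - ((f 0 (?h * of_int (i + 1)) - f 0 (?h * of_int i))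
      + ?h * \<xi> * (f 1 (?h * of_int (i + 1)) - f 1 (?h * of_int i))
      + ?h\<^sup>2 * ?k * (f 2 (?h * of_int (i + 1)) - f 2 (?h * of_int i)))"
    have bound: "norm (?E i) \<le> C * h j ^ 4" if "i \<in> {- ?n..<?n}" for i
      using midpoint_cell[OF convK fd B c(1)[OF that] c(2)[OF that] c(3)[OF that] c(4)[OF that]] hp
      unfolding left right C_def by (simp add: mult_ac)
    have sumE: "(\<Sum>i\<in>{- ?n..<?n}. ?E i) = ?h * \<Sigma> j - ((f 0 (of_real (2 * pi / 3)) - f 0 (of_real (- (2 * pi / 3))))
      + ?h * \<xi> * (f 1 (of_real (2 * pi / 3)) - f 1 (of_real (- (2 * pi / 3))))
      + ?h\<^sup>2 * ?k * (f 2 (of_real (2 * pi / 3)) - f 2 (of_real (- (2 * pi / 3)))))"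
      unfolding sum_subtractf sum.distrib sum_distrib_left[symmetric] tele[unfolded sum_subtractf]
      by (simp add: \<Sigma>_def f_def)
    \<comment> \<open>\<open>log_band\<close> takes equal values at the two symmetric end points, so
      there is no term linear in \<xi>.\<close>
    have f1: "f 1 (of_real (2 * pi / 3)) - f 1 (of_real (- (2 * pi / 3))) = 0"
    proof -
      have "\<bar>2 * pi / 3\<bar> < pi" "\<bar>- (2 * pi / 3)\<bar> < pi" using pi_gt_zero by simp_all
      then have "f 1 (of_real (2 * pi / 3)) = of_real (ln (2 + 2 * cos (2 * pi / 3)))" "f 1 (of_real (- (2 * pi / 3))) = of_real (ln (2 + 2 * cos (- (2 * pi / 3))))"
        using log_band_of_real[of "2 * pi / 3"] log_band_of_real[of "- (2 * pi / 3)"] by (simp_all only: f_def) simp_all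
      then show ?thesis by (simp only: cos_minus) simp
    qed
    have f2: "f 2 (of_real (2 * pi / 3)) - f 2 (of_real (- (2 * pi / 3))) = - 2 * of_real (sqrt 3)"
    proof -
      have e: "complex_of_real (2 * pi / 3) / 2 = of_real (pi / 3)" "complex_of_real (- (2 * pi / 3)) / 2 = - of_real (pi / 3)" by simp_all
      have sc: "sin (complex_of_real (pi / 3)) = of_real (sqrt 3 / 2)" "cos (complex_of_real (pi / 3)) = of_real (1 / 2)"
        by (simp_all only: sin_of_real cos_of_real sin_60 cos_60)
      have F: "f 2 z = - (sin (z / 2) / cos (z / 2))" for z by (simp add: f_def)
      show ?thesis unfolding F e sin_minus cos_minus sc by simp
    qed
    have "norm (?h * \<Sigma> j - (J + ?h\<^sup>2 * ?k * (- 2 * of_real (sqrt 3)))) = norm (\<Sum>i\<in>{- ?n..<?n}. ?E i)"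
      unfolding sumE f1 f2 J_def by (simp add: f_def)
    also have "\<dots> \<le> (\<Sum>i\<in>{- ?n..<?n}. C * h j ^ 4)"
      by (rule order_trans[OF norm_sum sum_mono[OF bound]])
    also have "\<dots> = 2 * real (p j) * (C * h j ^ 4)" by simp
    finally show ?case using c(4) by blast
  qed
  define D where "D j = of_nat (m j) * \<Sigma> j - of_real (real (m j) * real (3 * p j) * fermi_integral / (2 * pi))" for j
  have mh: "(\<lambda>j. real (m j) * h j) \<longlonglongrightarrow> 2 * pi / (sqrt 3 * \<rho>)"
    using tendsto_mult[OF tendsto_const[of "2 * pi"] inv_ratio] by (simp add: h_def mult_ac)
  have Dlim: "D \<longlonglongrightarrow> - 2 * of_real pi * \<xi>\<^sup>2 / of_real \<rho> + of_real (pi / (6 * \<rho>))"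
  proof -
    have main: "(\<lambda>j. of_real (real (m j) * h j) * ?k * (- 2 * of_real (sqrt 3))) \<longlonglongrightarrow> of_real (2 * pi / (sqrt 3 * \<rho>)) * ?k * (- 2 * of_real (sqrt 3))"
      by (intro tendsto_intros tendsto_of_real mh)
    have val: "complex_of_real (2 * pi / (sqrt 3 * \<rho>)) * ?k * (- 2 * of_real (sqrt 3)) = - 2 * of_real pi * \<xi>\<^sup>2 / of_real \<rho> + of_real (pi / (6 * \<rho>))"
    proof -
      have "complex_of_real (2 * pi / (sqrt 3 * \<rho>)) * (- 2 * of_real (sqrt 3)) = of_real (- 4 * pi / \<rho>)"
        by (simp add: field_simps)
      moreover have "a * k * b = a * b * k" for a b k :: complex by simp
      ultimately have "complex_of_real (2 * pi / (sqrt 3 * \<rho>)) * ?k * (- 2 * of_real (sqrt 3)) = of_real (- 4 * pi / \<rho>) * ?k"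
        by (simp only:)
      also have "\<dots> = - 2 * of_real pi * \<xi>\<^sup>2 / of_real \<rho> + of_real (pi / (6 * \<rho>))"
        using \<rho> by (simp add: field_simps)
      finally show ?thesis .
    qed
    \<comment> \<open>Each of the \<open>2 * p\<close> cells costs \<open>O(h^4)\<close>.
      Multiplication by \<open>m / h\<close> leaves \<open>O(h)\<close>, because
      \<open>m * h\<close> converges and \<open>p * h\<close> is constant.\<close>
    have err: "(\<lambda>j. D j - of_real (real (m j) * h j) * ?k * (- 2 * of_real (sqrt 3))) \<longlonglongrightarrow> 0"
    proof (rule Lim_null_comparison)
      show "eventually (\<lambda>j. norm (D j - of_real (real (m j) * h j) * ?k * (- 2 * of_real (sqrt 3)))
          \<le> (real (m j) * h j) * (2 * (2 * pi / 3)) * C * h j) sequentially"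
        using cells ev_pos
      proof eventually_elim
        case (elim j)
        have hp: "h j > 0" using elim by (simp add: h_def)
        have hn: "h j * real (p j) = 2 * pi / 3" using elim by (simp add: h_def)
        have bulk: "complex_of_real (real (m j) * real (3 * p j) * fermi_integral / (2 * pi)) = of_nat (m j) / of_real (h j) * J"
          using elim by (simp add: J h_def field_simps)
        have "D j - of_real (real (m j) * h j) * ?k * (- 2 * of_real (sqrt 3))
          = of_nat (m j) / of_real (h j) * (of_real (h j) * \<Sigma> j - (J + (of_real (h j))\<^sup>2 * ?k * (- 2 * of_real (sqrt 3))))"
          unfolding D_def bulk using hp by (simp add: field_simps power2_eq_square)
        also have "norm \<dots> \<le> real (m j) / h j * (2 * real (p j) * (C * h j ^ 4))"
          unfolding norm_mult using elim hp by (intro mult_mono) (auto simp: norm_divide)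
        also have "\<dots> = (real (m j) * h j) * (2 * (h j * real (p j))) * C * h j"
          using hp by (simp add: power4_eq_xxxx)
        finally show ?case unfolding hn .
      qed
      have "(\<lambda>j. (real (m j) * h j) * (2 * (2 * pi / 3)) * C * h j) \<longlonglongrightarrow> (2 * pi / (sqrt 3 * \<rho>)) * (2 * (2 * pi / 3)) * C * 0"
        by (intro tendsto_intros mh h0)
      then show "(\<lambda>j. (real (m j) * h j) * (2 * (2 * pi / 3)) * C * h j) \<longlonglongrightarrow> 0" by simp
    qed
    from tendsto_add[OF err main] show ?thesis unfolding val by simp
  qed
  have "(\<lambda>j. exp (D j)) \<longlonglongrightarrow> exp (- 2 * of_real pi * \<xi>\<^sup>2 / of_real \<rho> + of_real (pi / (6 * \<rho>)))"
    by (intro tendsto_intros Dlim)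
  moreover have "eventually (\<lambda>j. exp (D j) = (\<Prod>i\<in>{- int (p j)..<int (p j)}. (2 + 2 * cos (2 * of_real pi * (of_int i + 1 / 2 + \<xi>) / of_nat (3 * p j))) ^ m j)
     / of_real (exp (real (m j) * real (3 * p j) * fermi_integral / (2 * pi)))) sequentially"
    using cells
  proof eventually_elim
    case (elim j)
    let ?z = "\<lambda>i. of_real (h j) * (of_int i + 1 / 2) + of_real (h j) * \<xi>"
    have z: "?z i = 2 * of_real pi * (of_int i + 1 / 2 + \<xi>) / of_nat (3 * p j)" for i
      by (simp add: h_def add_divide_distrib ring_distribs)
    have "exp (of_nat (m j) * \<Sigma> j) = (\<Prod>i\<in>{- int (p j)..<int (p j)}. exp (log_band (?z i)) ^ m j)"
      unfolding \<Sigma>_def sum_distrib_left by (simp add: exp_sum exp_of_nat_mult)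
    also have "\<dots> = (\<Prod>i\<in>{- int (p j)..<int (p j)}. (2 + 2 * cos (?z i)) ^ m j)"
      using elim Kstrip by (intro prod.cong refl) (simp add: exp_log_band subset_iff)
    finally have e: "exp (of_nat (m j) * \<Sigma> j) = (\<Prod>i\<in>{- int (p j)..<int (p j)}. (2 + 2 * cos (2 * of_real pi * (of_int i + 1 / 2 + \<xi>) / of_nat (3 * p j))) ^ m j)"
      unfolding z .
    show ?case unfolding D_def exp_diff e exp_of_real ..
  qed
  ultimately show ?thesis by (rule Lim_transform_eventually)
qed

end

subsection \<open>Modes near the Fermi points\<close>

lemma band_identity: "2 + 2 * cos (2 * pi / 3 + \<psi>) = 1 - 4 * sin (2 * pi / 3 + \<psi> / 2) * sin (\<psi> / 2)" for \<psi> :: real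
proof -
  have "cos (2 * pi / 3 + \<psi>) - cos (2 * pi / 3) = - 2 * sin (2 * pi / 3 + \<psi> / 2) * sin (\<psi> / 2)"
  proof -
    have "(2 * pi / 3 + \<psi> + 2 * pi / 3) / 2 = 2 * pi / 3 + \<psi> / 2" "(2 * pi / 3 - (2 * pi / 3 + \<psi>)) / 2 = - (\<psi> / 2)" by simp_all
    then show ?thesis unfolding cos_diff_cos by (simp only: sin_minus)
  qed
  then show ?thesis using cos_two_thirds_pi by simp
qed

text \<open>Jordan's inequality for both sines in \<open>band_identity\<close>: the far one is at
  least \<open>2 / \<pi> * (\<pi> / 3 - \<pi> / 4) = 1 / 6\<close>, the near one at least
  \<open>\<psi> / 4\<close> because \<open>\<pi> < 4\<close>.\<close>

lemma band_upper:
  fixes \<psi> :: real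
  assumes "0 \<le> \<psi>" "\<psi> \<le> pi / 2"
  shows "2 + 2 * cos (2 * pi / 3 + \<psi>) \<le> 1 - \<psi> / 6"
proof -
  have "sin (2 * pi / 3 + \<psi> / 2) = sin (pi / 3 - \<psi> / 2)"
    using sin_pi_minus[of "pi / 3 - \<psi> / 2"] by (simp add: algebra_simps)
  moreover have "2 / pi * (pi / 3 - \<psi> / 2) \<le> sin (pi / 3 - \<psi> / 2)"
    using assms by (intro jordan_sin) auto
  moreover have "1 / 6 \<le> 2 / pi * (pi / 3 - \<psi> / 2)" using assms by (simp add: field_simps)
  ultimately have s1: "1 / 6 \<le> sin (2 * pi / 3 + \<psi> / 2)" by linarith
  have s2: "2 / pi * (\<psi> / 2) \<le> sin (\<psi> / 2)" using assms by (intro jordan_sin) auto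
  have "\<psi> / 4 \<le> \<psi> / pi" using assms pi_less_4 by (intro divide_left_mono) auto
  then have "\<psi> / 4 \<le> 2 / pi * (\<psi> / 2)" by simp
  then have s3: "\<psi> / 4 \<le> sin (\<psi> / 2)" using s2 by linarith
  have "1 / 6 * (\<psi> / 4) \<le> sin (2 * pi / 3 + \<psi> / 2) * sin (\<psi> / 2)"
    using s1 s3 assms by (intro mult_mono) auto
  then show ?thesis unfolding band_identity by simp
qed

text \<open>The first sine is at least \<open>2 / 3\<close> over the whole range; its argument
  passes \<open>\<pi> / 2\<close>, so Jordan's inequality is applied on one side directly and on the
  other after reflection.\<close>

lemma band_lower:
  fixes \<phi> :: real
  assumes "0 \<le> \<phi>" "\<phi> \<le> 2 * pi / 3"
  shows "1 + \<phi> / 2 \<le> 2 + 2 * cos (2 * pi / 3 - \<phi>)"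
proof -
  have s1: "2 / 3 \<le> sin (2 * pi / 3 - \<phi> / 2)"
  proof (cases "2 * pi / 3 - \<phi> / 2 \<le> pi / 2")
    case True
    have "2 / pi * (2 * pi / 3 - \<phi> / 2) \<le> sin (2 * pi / 3 - \<phi> / 2)"
      using assms True by (intro jordan_sin) auto
    moreover have "2 / 3 \<le> 2 / pi * (2 * pi / 3 - \<phi> / 2)" using assms by (simp add: field_simps)
    ultimately show ?thesis by linarith
  next
    case False
    have "sin (2 * pi / 3 - \<phi> / 2) = sin (pi / 3 + \<phi> / 2)"
      using sin_pi_minus[of "pi / 3 + \<phi> / 2"] by (simp add: algebra_simps)
    moreover have "2 / pi * (pi / 3 + \<phi> / 2) \<le> sin (pi / 3 + \<phi> / 2)"
      using assms False by (intro jordan_sin) auto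
    moreover have "2 / 3 \<le> 2 / pi * (pi / 3 + \<phi> / 2)" using assms by (simp add: field_simps)
    ultimately show ?thesis by linarith
  qed
  have s2: "2 / pi * (\<phi> / 2) \<le> sin (\<phi> / 2)" using assms by (intro jordan_sin) auto
  have "\<phi> / 4 \<le> \<phi> / pi" using assms pi_less_4 by (intro divide_left_mono) auto
  then have "\<phi> / 4 \<le> 2 / pi * (\<phi> / 2)" by simp
  then have s3: "\<phi> / 4 \<le> sin (\<phi> / 2)" using s2 by linarith
  have "2 / 3 * (\<phi> / 4) \<le> sin (2 * pi / 3 - \<phi> / 2) * sin (\<phi> / 2)"
    using s1 s3 assms by (intro mult_mono) auto
  moreover have "2 + 2 * cos (2 * pi / 3 - \<phi>) = 1 + 4 * (sin (2 * pi / 3 - \<phi> / 2) * sin (\<phi> / 2))"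
    using band_identity[of "- \<phi>"] by simp
  ultimately show ?thesis using assms by simp
qed

text \<open>An imaginary part of the momentum can only enlarge the modulus. Lower bounds for real
  momenta therefore carry over unchanged, and upper bounds need only that the \<open>sinh\<close>
  term be small.\<close>

lemma norm_band: "norm (2 + 2 * cos z) = 2 + 2 * cos (Re z) + 4 * (sinh (Im z / 2))\<^sup>2" for z :: complex
proof -
  have "2 + 2 * cos z = 4 * (cos (z / 2))\<^sup>2"
    using cos_double_cos[of "z / 2"] by simp
  moreover have "(norm (cos (z / 2)))\<^sup>2 = (cos (Re z / 2))\<^sup>2 + (sinh (Im z / 2))\<^sup>2"
  proof -
    have "Re (cos (z / 2)) = cos (Re z / 2) * cosh (Im z / 2)" "Im (cos (z / 2)) = - sin (Re z / 2) * sinh (Im z / 2)"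
      by (simp_all add: Re_cos Im_cos cosh_def sinh_def algebra_simps diff_divide_distrib)
    then have "(norm (cos (z / 2)))\<^sup>2 = (cos (Re z / 2) * cosh (Im z / 2))\<^sup>2 + (sin (Re z / 2) * sinh (Im z / 2))\<^sup>2"
      by (simp add: cmod_power2)
    also have "\<dots> = (cos (Re z / 2))\<^sup>2 + (sinh (Im z / 2))\<^sup>2"
      unfolding power_mult_distrib cosh_square_eq sin_squared_eq by (simp add: algebra_simps)
    finally show ?thesis .
  qed
  moreover have "2 + 2 * cos (Re z) = 4 * (cos (Re z / 2))\<^sup>2"
    using cos_double_cos[of "Re z / 2"] by simp
  ultimately show ?thesis by (simp add: norm_mult norm_power)
qed

lemma sinh_sq_le:
  fixes u :: real
  assumes "\<bar>u\<bar> \<le> 1" shows "(sinh u)\<^sup>2 \<le> 4 * u\<^sup>2"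
proof -
  have "sinh \<bar>u\<bar> \<le> 2 * \<bar>u\<bar>"
  proof -
    have "exp \<bar>u\<bar> \<le> 1 + \<bar>u\<bar> + \<bar>u\<bar>\<^sup>2" using assms by (intro exp_bound) auto
    moreover have "1 - \<bar>u\<bar> \<le> exp (- \<bar>u\<bar>)" using exp_ge_add_one_self[of "- \<bar>u\<bar>"] by simp
    moreover have "\<bar>u\<bar>\<^sup>2 \<le> \<bar>u\<bar>"
    proof -
      have "\<bar>u\<bar> * \<bar>u\<bar> \<le> \<bar>u\<bar> * 1" using assms by (intro mult_left_mono) auto
      then show ?thesis by (simp only: power2_eq_square mult_1_right)
    qed
    ultimately show ?thesis by (simp add: sinh_def)
  qed
  then have "(sinh \<bar>u\<bar>)\<^sup>2 \<le> (2 * \<bar>u\<bar>)\<^sup>2" by (intro power_mono) auto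
  moreover have "(sinh \<bar>u\<bar>)\<^sup>2 = (sinh u)\<^sup>2" by (cases "u \<ge> 0") auto
  ultimately show ?thesis by (simp add: power_mult_distrib)
qed

context torus_scaling
begin

definition mode :: "nat \<Rightarrow> complex \<Rightarrow> complex" where
  "mode j u = (2 + 2 * cos (2 * of_real pi * u / of_nat (3 * p j))) ^ m j"

lemma mode_minus: "mode j (- u) = mode j u"
  by (simp add: mode_def)

lemma mode_period: "p j > 0 \<Longrightarrow> mode j (u + of_nat (3 * p j)) = mode j u"
proof -
  assume "p j > 0"
  then have "2 * of_real pi * (u + of_nat (3 * p j)) / of_nat (3 * p j) = 2 * of_real pi * u / of_nat (3 * p j) + 2 * of_real pi"
    by (simp add: field_simps)
  moreover have "cos (z + 2 * of_real pi) = cos z" for z :: complex by (simp add: cos_add)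
  ultimately show ?thesis by (simp add: mode_def)
qed

text \<open>At the Fermi point the band equals 1 with slope \<open>- sqrt 3\<close>; the
  displacement \<open>2 \<pi> v / (3 p)\<close> times the exponent \<open>m\<close> times this slope
  tends to \<open>- 2 \<pi> v / \<rho>\<close>.\<close>

lemma mode_limit: "(\<lambda>j. mode j (of_nat (p j) + v)) \<longlonglongrightarrow> exp (- 2 * of_real pi * v / of_real \<rho>)"
proof -
  define w where "w j = 2 * of_real pi * v / of_nat (3 * p j)" for j
  define y where "y j = 1 + 2 * cos (of_real (2 * pi / 3) + w j)" for j
  have w0: "w \<longlonglongrightarrow> 0"
  proof -
    have "(\<lambda>j. 2 * of_real pi * v * of_real (1 / real (3 * p j))) \<longlonglongrightarrow> 2 * of_real pi * v * of_real 0"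
      by (intro tendsto_intros tendsto_of_real inv_p)
    then show ?thesis by (simp add: w_def[abs_def])
  qed
  have my: "(\<lambda>j. of_nat (m j) * y j) \<longlonglongrightarrow> - 2 * of_real pi * v / of_real \<rho>"
  proof (cases "v = 0")
    case True
    have "cos (complex_of_real (2 * pi / 3)) = of_real (- 1 / 2)"
      by (simp only: cos_of_real cos_two_thirds_pi)
    then have "y j = 0" for j using True by (simp add: y_def w_def)
    then show ?thesis using True by simp
  next
    case False
    have c: "cos (complex_of_real (2 * pi / 3)) = of_real (- 1 / 2)" "sin (complex_of_real (2 * pi / 3)) = of_real (sqrt 3 / 2)"
      by (simp_all only: cos_of_real sin_of_real cos_two_thirds_pi sin_two_thirds_pi)
    have "((\<lambda>w. 1 + 2 * cos (complex_of_real (2 * pi / 3) + w)) has_field_derivative - 2 * sin (of_real (2 * pi / 3) + 0)) (at 0)"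
      by (auto intro!: derivative_eq_intros)
    then have "((\<lambda>w. (1 + 2 * cos (complex_of_real (2 * pi / 3) + w)) / w) \<longlongrightarrow> - of_real (sqrt 3)) (at 0)"
      unfolding has_field_derivative_iff add_0_right c by simp
    moreover have "filterlim w (at 0) sequentially"
    proof (rule filterlim_atI[OF w0])
      show "eventually (\<lambda>j. w j \<noteq> 0) sequentially"
        using ev_pos by eventually_elim (use False in \<open>auto simp: w_def\<close>)
    qed
    ultimately have "(\<lambda>j. y j / w j) \<longlonglongrightarrow> - of_real (sqrt 3)"
      unfolding y_def by (rule filterlim_compose)
    then have "(\<lambda>j. y j / w j * (2 * of_real pi * v * of_real (real (m j) / real (3 * p j)))) \<longlonglongrightarrow> - of_real (sqrt 3) * (2 * of_real pi * v * of_real (1 / (sqrt 3 * \<rho>)))"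
      by (intro tendsto_intros tendsto_of_real inv_ratio)
    also have "- of_real (sqrt 3) * (2 * of_real pi * v * of_real (1 / (sqrt 3 * \<rho>))) = - 2 * of_real pi * v / of_real \<rho>"
      by simp
    finally show ?thesis
    proof (rule Lim_transform_eventually)
      show "eventually (\<lambda>j. y j / w j * (2 * of_real pi * v * of_real (real (m j) / real (3 * p j))) = of_nat (m j) * y j) sequentially"
        using ev_pos
      proof eventually_elim
        case (elim j)
        have "2 * of_real pi * v * of_real (real (m j) / real (3 * p j)) = of_nat (m j) * w j" by (simp add: w_def)
        moreover have "w j \<noteq> 0" using False elim by (simp add: w_def)
        ultimately show ?case by (simp only:) simp
      qed
    qed
  qed
  have "(\<lambda>j. (1 + y j) ^ m j) \<longlonglongrightarrow> exp (- 2 * of_real pi * v / of_real \<rho>)"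
    by (rule tendsto_one_plus_power[OF m my])
  moreover have "eventually (\<lambda>j. (1 + y j) ^ m j = mode j (of_nat (p j) + v)) sequentially"
    using ev_pos
  proof eventually_elim
    case (elim j)
    have "2 * of_real pi * (of_nat (p j) + v) / of_nat (3 * p j) = of_real (2 * pi / 3) + w j"
      using elim by (simp add: w_def add_divide_distrib ring_distribs)
    then have "mode j (of_nat (p j) + v) = (2 + 2 * cos (of_real (2 * pi / 3) + w j)) ^ m j" by (simp only: mode_def)
    then show ?case by (simp add: y_def)
  qed
  ultimately show ?thesis by (rule Lim_transform_eventually)
qed

text \<open>A deliberately weak rate: \<open>4 * decay\<close> is half the limit of
  \<open>m / (3 p)\<close>, so it is eventually a strict lower bound, and the remaining factor 4
  absorbs the constants of the band estimates.\<close>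

definition decay :: real where "decay = 1 / (8 * sqrt 3 * \<rho>)"

lemma decay_pos: "decay > 0" using \<rho> by (simp add: decay_def)

lemma ev_ratio: "eventually (\<lambda>j. 4 * decay \<le> real (m j) / real (3 * p j)) sequentially"
proof -
  have "4 * decay < 1 / (sqrt 3 * \<rho>)" using \<rho> by (simp add: decay_def field_simps)
  from order_tendstoD(1)[OF inv_ratio this] show ?thesis by eventually_elim simp
qed

text \<open>The \<open>sinh\<close> argument is of order \<open>1 / p\<close>, and \<open>m\<close>
  is of the same order as \<open>p\<close>, so the expression even tends to 0. The bound 1 is what
  becomes the factor \<open>exp 1\<close> in the majorant.\<close>

lemma ev_sinh: "eventually (\<lambda>j. real (m j) * (4 * (sinh (pi * x / real (3 * p j)))\<^sup>2) \<le> 1) sequentially"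
proof -
  let ?a = "\<lambda>j. pi * x / real (3 * p j)"
  have a0: "?a \<longlonglongrightarrow> 0"
    using tendsto_mult[OF tendsto_const[of "pi * x"] inv_p] by simp
  have "(\<lambda>j. real (m j) / real (3 * p j) * (16 * (pi * x)) * ?a j) \<longlonglongrightarrow> 1 / (sqrt 3 * \<rho>) * (16 * (pi * x)) * 0"
    by (intro tendsto_mult tendsto_const inv_ratio a0)
  then have "eventually (\<lambda>j. real (m j) / real (3 * p j) * (16 * (pi * x)) * ?a j < 1) sequentially"
    by (intro order_tendstoD) auto
  moreover have "eventually (\<lambda>j. \<bar>?a j\<bar> < 1) sequentially"
    using order_tendstoD(2)[OF tendsto_rabs[OF a0], of 1] by simp
  ultimately show ?thesis
  proof eventually_elim
    case (elim j)
    have "real (m j) * (4 * (sinh (?a j))\<^sup>2) \<le> real (m j) * (4 * (4 * (?a j)\<^sup>2))"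
      using elim by (intro mult_left_mono sinh_sq_le) auto
    also have "\<dots> = real (m j) / real (3 * p j) * (16 * (pi * x)) * ?a j" by (simp add: power2_eq_square)
    finally show ?case using elim by linarith
  qed
qed

text \<open>The range \<open>2 * s \<le> p j\<close> is the half of the empty modes nearest to this
  Fermi point; it keeps the momentum offset below \<open>\<pi> / 2\<close>, where
  \<open>band_upper\<close> holds. The majorant uses \<open>1 + x \<le> exp x\<close> in the modulus
  formula.\<close>

lemma mode_decay_outside:
  assumes \<xi>: "\<bar>Re \<xi>\<bar> \<le> 1 / 2"
  shows "eventually (\<lambda>j. \<forall>s. 2 * s \<le> p j \<longrightarrow> norm (mode j (of_nat (p j) + (of_nat s + 1 / 2 + \<xi>))) \<le> exp 1 * exp (- decay) ^ s) sequentially"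
proof -
  have pl: "eventually (\<lambda>j. 4 \<le> p j) sequentially" using p by (simp add: filterlim_at_top)
  show ?thesis using ev_ratio ev_sinh[of "Im \<xi>"] pl
  proof eventually_elim
    case (elim j)
    show ?case
    proof (intro allI impI)
      fix s assume s: "2 * s \<le> p j"
      define a where "a = real s + 1 / 2 + Re \<xi>"
      define \<psi> where "\<psi> = 2 * pi * a / real (3 * p j)"
      define S where "S = (sinh (pi * Im \<xi> / real (3 * p j)))\<^sup>2"
      have pj: "0 < real (p j)" using elim by simp
      have a: "real s \<le> a" "a \<le> real s + 1" using \<xi> by (auto simp: a_def abs_le_iff)
      have \<psi>0: "0 \<le> \<psi>" using a pj by (simp add: \<psi>_def)
      \<comment> \<open>\<open>4 \<le> p j\<close> absorbs the extra unit:
        \<open>p + 2 \<le> 3 / 2 * p\<close>.\<close>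
      have \<psi>1: "\<psi> \<le> pi / 2"
      proof -
        have "2 * a \<le> real (p j) + 2" using a s by linarith
        also have "\<dots> \<le> 3 / 2 * real (p j)" using elim by linarith
        finally have "pi * (2 * a) \<le> pi * (3 / 2 * real (p j))" by (intro mult_left_mono) auto
        then show ?thesis using pj by (simp add: \<psi>_def field_simps)
      qed
      let ?z = "2 * of_real pi * (of_nat (p j) + (of_nat s + 1 / 2 + \<xi>)) / of_nat (3 * p j) :: complex"
      have zr: "?z = (2 * of_real pi * (of_nat (p j) + (of_nat s + 1 / 2 + \<xi>))) / of_real (real (3 * p j))" by simp
      have Re: "Re ?z = 2 * pi / 3 + \<psi>"
        unfolding zr Re_divide_of_real using pj by (simp add: \<psi>_def a_def field_simps)
      have Im: "Im ?z / 2 = pi * Im \<xi> / real (3 * p j)"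
        unfolding zr Im_divide_of_real using pj by simp
      have "norm (2 + 2 * cos ?z) = 2 + 2 * cos (2 * pi / 3 + \<psi>) + 4 * S"
        unfolding norm_band Re Im S_def ..
      also have "\<dots> \<le> 1 + (- \<psi> / 6 + 4 * S)" using band_upper[OF \<psi>0 \<psi>1] by simp
      also have "\<dots> \<le> exp (- \<psi> / 6 + 4 * S)" by (rule exp_ge_add_one_self)
      finally have "norm (2 + 2 * cos ?z) ^ m j \<le> exp (- \<psi> / 6 + 4 * S) ^ m j" by (intro power_mono) auto
      also have "\<dots> = exp (real (m j) * (4 * S) - real (m j) * (\<psi> / 6))"
        by (simp add: algebra_simps flip: exp_of_nat_mult)
      also have "\<dots> \<le> exp (1 - decay * real s)"
      proof -
        have "decay * real s \<le> real (m j) * (\<psi> / 6)"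
        proof -
          have "decay * real s \<le> decay * a" using a decay_pos by (intro mult_left_mono) auto
          also have "\<dots> \<le> (4 * decay) * (a * (pi / 3))"
          proof -
            have "1 \<le> 4 * (pi / 3)" using pi_gt3 by simp
            then have "decay * a * 1 \<le> decay * a * (4 * (pi / 3))"
              using a decay_pos by (intro mult_left_mono) auto
            then show ?thesis by simp
          qed
          also have "\<dots> \<le> real (m j) / real (3 * p j) * (a * (pi / 3))"
            using elim a by (intro mult_right_mono) auto
          also have "\<dots> = real (m j) * (\<psi> / 6)" by (simp add: \<psi>_def)
          finally show ?thesis .
        qed
        then show ?thesis using elim by (simp add: S_def)
      qed
      also have "\<dots> = exp 1 * exp (- decay) ^ s"
        by (simp add: exp_diff exp_minus field_simps flip: exp_of_nat_mult)
      finally show "norm (mode j (of_nat (p j) + (of_nat s + 1 / 2 + \<xi>))) \<le> exp 1 * exp (- decay) ^ s"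
        by (simp add: mode_def norm_power)
    qed
  qed
qed

text \<open>The modulus of the band is at least \<open>1 + \<phi> / 2\<close> in the filled region,
  by \<open>norm_band\<close> without any loss from the imaginary shift. So nonvanishing and decay
  of the reciprocal come together.\<close>

lemma mode_growth_inside:
  assumes \<xi>: "\<bar>Re \<xi>\<bar> \<le> 1 / 2"
  shows "eventually (\<lambda>j. \<forall>s<p j. mode j (of_nat (p j) - (of_nat s + 1 / 2 + \<xi>)) \<noteq> 0 \<and>
     norm (1 / mode j (of_nat (p j) - (of_nat s + 1 / 2 + \<xi>))) \<le> exp (- decay) ^ s) sequentially"
  using ev_ratio ev_pos
proof eventually_elim
  case (elim j)
  show ?case
  proof (intro allI impI)
    fix s assume s: "s < p j"
    define a where "a = real s + 1 / 2 + Re \<xi>"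
    define \<phi> where "\<phi> = 2 * pi * a / real (3 * p j)"
    have pj: "0 < real (p j)" using elim by simp
    have a: "real s \<le> a" "a \<le> real s + 1" using \<xi> by (auto simp: a_def abs_le_iff)
    have \<phi>0: "0 \<le> \<phi>" using a pj by (simp add: \<phi>_def)
    have \<phi>1: "\<phi> \<le> 2 * pi / 3"
    proof -
      have "a \<le> real (p j)" using a s by linarith
      then have "pi * a \<le> pi * real (p j)" by (intro mult_left_mono) auto
      then show ?thesis using pj by (simp add: \<phi>_def field_simps)
    qed
    let ?z = "2 * of_real pi * (of_nat (p j) - (of_nat s + 1 / 2 + \<xi>)) / of_nat (3 * p j) :: complex"
    have zr: "?z = (2 * of_real pi * (of_nat (p j) - (of_nat s + 1 / 2 + \<xi>))) / of_real (real (3 * p j))" by simp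
    have Re: "Re ?z = 2 * pi / 3 - \<phi>"
      unfolding zr Re_divide_of_real using pj by (simp add: \<phi>_def a_def field_simps)
    have lower: "1 + \<phi> / 2 \<le> norm (2 + 2 * cos ?z)"
      unfolding norm_band Re using band_lower[OF \<phi>0 \<phi>1] zero_le_power2[of "sinh (Im ?z / 2)"] by linarith
    have pos: "0 < 1 + \<phi> / 2" using \<phi>0 by simp
    have nz: "2 + 2 * cos ?z \<noteq> 0" using lower pos by (metis norm_zero not_le)
    have "1 / norm (2 + 2 * cos ?z) \<le> 1 / (1 + \<phi> / 2)"
      using lower pos by (intro divide_left_mono) (auto intro!: mult_pos_pos order_less_le_trans[OF pos lower])
    also have "\<dots> = 1 + - (\<phi> / 2 / (1 + \<phi> / 2))" using pos by (simp add: field_simps)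
    also have "\<dots> \<le> exp (- (\<phi> / 2 / (1 + \<phi> / 2)))" by (rule exp_ge_add_one_self)
    also have "\<dots> \<le> exp (- (\<phi> / 6))"
    proof -
      \<comment> \<open>This bounds the denominator \<open>1 + \<phi> / 2\<close> by 3 and makes the
        exponent linear in \<phi>.\<close>
      have "\<phi> \<le> 4" using \<phi>1 pi_less_4 by linarith
      then have "\<phi> / 2 / 3 \<le> \<phi> / 2 / (1 + \<phi> / 2)" using \<phi>0 by (intro divide_left_mono) auto
      then show ?thesis by simp
    qed
    finally have "(1 / norm (2 + 2 * cos ?z)) ^ m j \<le> exp (- (\<phi> / 6)) ^ m j" by (intro power_mono) auto
    also have "\<dots> = exp (- (real (m j) * (\<phi> / 6)))"
      by (simp flip: exp_of_nat_mult)
    also have "\<dots> \<le> exp (- (decay * real s))"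
    proof -
      have "decay * real s \<le> decay * a" using a decay_pos by (intro mult_left_mono) auto
      also have "\<dots> \<le> (4 * decay) * (a * (pi / 3))"
      proof -
        have "1 \<le> 4 * (pi / 3)" using pi_gt3 by simp
        then have "decay * a * 1 \<le> decay * a * (4 * (pi / 3))"
          using a decay_pos by (intro mult_left_mono) auto
        then show ?thesis by simp
      qed
      also have "\<dots> \<le> real (m j) / real (3 * p j) * (a * (pi / 3))"
        using elim a by (intro mult_right_mono) auto
      also have "\<dots> = real (m j) * (\<phi> / 6)" by (simp add: \<phi>_def)
      finally show ?thesis by simp
    qed
    also have "\<dots> = exp (- decay) ^ s" by (simp add: mult.commute flip: exp_of_nat_mult)
    finally show "mode j (of_nat (p j) - (of_nat s + 1 / 2 + \<xi>)) \<noteq> 0 \<and>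
     norm (1 / mode j (of_nat (p j) - (of_nat s + 1 / 2 + \<xi>))) \<le> exp (- decay) ^ s"
      using nz by (simp add: mode_def norm_divide norm_power power_divide)
  qed
qed

text \<open>The limiting contribution of the modes on one side of one Fermi point: particles above
  it, or holes below it, displaced by \<open>v\<close>. Each is one half of a triple
  product.\<close>

definition half_product :: "complex \<Rightarrow> complex \<Rightarrow> complex" where
  "half_product w v = (\<Prod>s. 1 + w * exp (- 2 * of_real pi * (of_nat s + 1 / 2 + v) / of_real \<rho>))"

lemma summable_decay: "summable (\<lambda>s. K * exp (- decay) ^ s)"
  using decay_pos by (intro summable_mult summable_geometric) simp

text \<open>The bound on \<open>K j\<close> is exactly what turns \<open>s < K j\<close> into
  \<open>2 * s \<le> p j\<close>, the range of the majorant.\<close>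

lemma outside_product:
  assumes \<xi>: "\<bar>Re \<xi>\<bar> \<le> 1 / 2" and K: "filterlim K at_top sequentially" and Kp: "\<And>j. 2 * K j \<le> p j + 2"
  shows "(\<lambda>j. \<Prod>s<K j. 1 + w * mode j (of_nat (p j) + (of_nat s + 1 / 2 + \<xi>))) \<longlonglongrightarrow> half_product w \<xi>"
  unfolding half_product_def
proof (rule tannery_prod(1)[OF _ _ summable_decay _ K])
  show "(\<lambda>j. w * mode j (of_nat (p j) + (of_nat s + 1 / 2 + \<xi>))) \<longlonglongrightarrow> w * exp (- 2 * of_real pi * (of_nat s + 1 / 2 + \<xi>) / of_real \<rho>)" for s
    by (intro tendsto_intros mode_limit)
  show "eventually (\<lambda>j. \<forall>s<K j. norm (w * mode j (of_nat (p j) + (of_nat s + 1 / 2 + \<xi>))) \<le> (norm w * exp 1) * exp (- decay) ^ s) sequentially"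
    using mode_decay_outside[OF \<xi>]
  proof eventually_elim
    case (elim j)
    show ?case
    proof (intro allI impI)
      fix s assume "s < K j"
      then have "2 * s \<le> p j" using Kp[of j] by linarith
      then have "norm w * norm (mode j (of_nat (p j) + (of_nat s + 1 / 2 + \<xi>))) \<le> norm w * (exp 1 * exp (- decay) ^ s)"
        using elim by (intro mult_left_mono) auto
      then show "norm (w * mode j (of_nat (p j) + (of_nat s + 1 / 2 + \<xi>))) \<le> (norm w * exp 1) * exp (- decay) ^ s"
        by (simp only: norm_mult mult.assoc)
    qed
  qed
  show "0 \<le> (norm w * exp 1) * exp (- decay) ^ s" for s by simp
qed

lemma inside_product:
  assumes \<xi>: "\<bar>Re \<xi>\<bar> \<le> 1 / 2"
  shows "(\<lambda>j. \<Prod>s<p j. 1 + w / mode j (of_nat (p j) - (of_nat s + 1 / 2 + \<xi>))) \<longlonglongrightarrow> half_product w \<xi>"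
proof -
  have "(\<lambda>j. \<Prod>s<p j. 1 + w * (1 / mode j (of_nat (p j) - (of_nat s + 1 / 2 + \<xi>)))) \<longlonglongrightarrow> half_product w \<xi>"
    unfolding half_product_def
  proof (rule tannery_prod(1)[OF _ _ summable_decay _ p])
    fix s
    have "(\<lambda>j. 1 / mode j (of_nat (p j) + - (of_nat s + 1 / 2 + \<xi>))) \<longlonglongrightarrow> 1 / exp (- 2 * of_real pi * - (of_nat s + 1 / 2 + \<xi>) / of_real \<rho>)"
      by (intro tendsto_intros mode_limit) auto
    also have "1 / exp (- 2 * of_real pi * - (of_nat s + 1 / 2 + \<xi>) / of_real \<rho>) = exp (- 2 * of_real pi * (of_nat s + 1 / 2 + \<xi>) / of_real \<rho>)"
      by (simp add: exp_minus field_simps)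
    finally have lim: "(\<lambda>j. 1 / mode j (of_nat (p j) + - (of_nat s + 1 / 2 + \<xi>))) \<longlonglongrightarrow> exp (- 2 * of_real pi * (of_nat s + 1 / 2 + \<xi>) / of_real \<rho>)" .
    show "(\<lambda>j. w * (1 / mode j (of_nat (p j) - (of_nat s + 1 / 2 + \<xi>)))) \<longlonglongrightarrow> w * exp (- 2 * of_real pi * (of_nat s + 1 / 2 + \<xi>) / of_real \<rho>)"
      using tendsto_mult[OF tendsto_const[of w] lim] by (simp only: add_uminus_conv_diff)
  next
    show "eventually (\<lambda>j. \<forall>s<p j. norm (w * (1 / mode j (of_nat (p j) - (of_nat s + 1 / 2 + \<xi>)))) \<le> norm w * exp (- decay) ^ s) sequentially"
      using mode_growth_inside[OF \<xi>]
      by eventually_elim (simp only: norm_mult, auto intro!: mult_left_mono)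
    show "0 \<le> norm w * exp (- decay) ^ s" for s by simp
  qed
  then show ?thesis by simp
qed

text \<open>The Fermi points are the momenta \<open>\<plusminus> p\<close>: modes with \<open>|i + 1/2| < p\<close> are filled, the other ones empty.\<close>

lemma momentum_split:
  assumes p: "p j > 0" and z: "z \<in> {1, -1}" and c: "c \<noteq> 0"
    and nz: "\<And>s. s < p j \<Longrightarrow> mode j (of_nat (p j) - (of_nat s + 1 / 2 - \<xi>)) \<noteq> 0"
      "\<And>s. s < p j \<Longrightarrow> mode j (of_nat (p j) - (of_nat s + 1 / 2 + \<xi>)) \<noteq> 0"
    and K: "K + K' = p j"
  shows "(\<Prod>s<3 * p j. c + z * mode j (of_nat s + (1 / 2 + \<xi>)))
    = c ^ p j * (\<Prod>i\<in>{- int (p j)..<int (p j)}. mode j (of_int i + 1 / 2 + \<xi>))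
      * (\<Prod>s<p j. 1 + z * c / mode j (of_nat (p j) - (of_nat s + 1 / 2 - \<xi>)))
      * (\<Prod>s<p j. 1 + z * c / mode j (of_nat (p j) - (of_nat s + 1 / 2 + \<xi>)))
      * (\<Prod>s<K. 1 + z / c * mode j (of_nat (p j) + (of_nat s + 1 / 2 + \<xi>)))
      * (\<Prod>s<K'. 1 + z / c * mode j (of_nat (p j) + (of_nat s + 1 / 2 - \<xi>)))"
proof -
  let ?g = "\<lambda>u. c + z * mode j u"
  have zz: "z * z = 1" using z by auto
  have right: "(\<Prod>s<p j. f (of_nat s + (1 / 2 + \<xi>))) = (\<Prod>s<p j. f (of_nat (p j) - (of_nat s + 1 / 2 - \<xi>)))" for f :: "complex \<Rightarrow> complex"
  proof -
    have "(\<Prod>s<p j. f (of_nat s + (1 / 2 + \<xi>))) = (\<Prod>s<p j. f (of_nat (p j - Suc s) + (1 / 2 + \<xi>)))"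
      by (rule prod.nat_diff_reindex[symmetric])
    also have "\<dots> = (\<Prod>s<p j. f (of_nat (p j) - (of_nat s + 1 / 2 - \<xi>)))"
      by (intro prod.cong refl arg_cong[where f = f]) (simp add: of_nat_diff algebra_simps)
    finally show ?thesis .
  qed
  \<comment> \<open>The first and the last \<open>p\<close> modes are filled, the last ones standing
    for negative momenta. The \<open>p\<close> empty modes in between are divided into
    \<open>K\<close> and \<open>K'\<close> and attached to the nearer Fermi point.\<close>
  have split: "(\<Prod>s<3 * p j. f s) = (\<Prod>s<p j. f s) * (\<Prod>s<K. f (p j + s)) * (\<Prod>s<K'. f (p j + K + s)) * (\<Prod>s<p j. f (2 * p j + s))" for f :: "nat \<Rightarrow> complex"
  proof -
    have add: "(\<Prod>s<a + b. f s) = (\<Prod>s<a. f s) * (\<Prod>s<b. f (a + s))" for a b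
      by (induction b) (simp_all add: mult.assoc)
    have "3 * p j = p j + K + K' + p j" using K by simp
    then have "(\<Prod>s<3 * p j. f s) = (\<Prod>s<p j + K + K' + p j. f s)" by (rule arg_cong[where f = "\<lambda>n. \<Prod>s<n. f s"])
    also have "\<dots> = (\<Prod>s<p j. f s) * (\<Prod>s<K. f (p j + s)) * (\<Prod>s<K'. f (p j + K + s)) * (\<Prod>s<p j. f (p j + K + K' + s))"
      by (simp only: add)
    also have "p j + K + K' = 2 * p j" using K by simp
    finally show ?thesis .
  qed
  have P3: "(\<Prod>s<K'. ?g (of_nat (p j + K + s) + (1 / 2 + \<xi>))) = (\<Prod>s<K'. ?g (of_nat (p j) + (of_nat s + 1 / 2 - \<xi>)))"
  proof -
    have "(\<Prod>s<K'. ?g (of_nat (p j + K + s) + (1 / 2 + \<xi>))) = (\<Prod>s<K'. ?g (of_nat (p j + K + (K' - Suc s)) + (1 / 2 + \<xi>)))"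
      by (rule prod.nat_diff_reindex[symmetric])
    also have "\<dots> = (\<Prod>s<K'. ?g (of_nat (p j) + (of_nat s + 1 / 2 - \<xi>)))"
    proof (intro prod.cong refl)
      fix s assume "s \<in> {..<K'}"
      then have e: "p j + K + (K' - Suc s) = 2 * p j - Suc s" "Suc s \<le> 2 * p j" using K by auto
      have "of_nat (2 * p j - Suc s) + (1 / 2 + \<xi>) = - (of_nat (p j) + (of_nat s + 1 / 2 - \<xi>)) + of_nat (3 * p j)"
        using e(2) by (simp add: of_nat_diff algebra_simps)
      then have "mode j (of_nat (2 * p j - Suc s) + (1 / 2 + \<xi>)) = mode j (of_nat (p j) + (of_nat s + 1 / 2 - \<xi>))"
        using mode_period[OF p] mode_minus by metis
      then show "?g (of_nat (p j + K + (K' - Suc s)) + (1 / 2 + \<xi>)) = ?g (of_nat (p j) + (of_nat s + 1 / 2 - \<xi>))"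
        unfolding e(1) by simp
    qed
    finally show ?thesis .
  qed
  have left: "mode j (of_nat (2 * p j + s) + (1 / 2 + \<xi>)) = mode j (of_nat (p j) - (of_nat s + 1 / 2 + \<xi>))" for s
  proof -
    have "of_nat (2 * p j + s) + (1 / 2 + \<xi>) = - (of_nat (p j) - (of_nat s + 1 / 2 + \<xi>)) + of_nat (3 * p j)"
      by (simp add: algebra_simps)
    then show ?thesis using mode_period[OF p] mode_minus by metis
  qed
  have fill: "(\<Prod>s<p j. ?g (of_nat (p j) - (of_nat s + 1 / 2 + v))) = z ^ p j * (\<Prod>s<p j. mode j (of_nat (p j) - (of_nat s + 1 / 2 + v)))
      * (\<Prod>s<p j. 1 + z * c / mode j (of_nat (p j) - (of_nat s + 1 / 2 + v)))"
    if "\<And>s. s < p j \<Longrightarrow> mode j (of_nat (p j) - (of_nat s + 1 / 2 + v)) \<noteq> 0" for v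
  proof -
    have g: "c + z * u = z * u * (1 + z * c / u)" if "u \<noteq> 0" for u
    proof -
      have "z * u * (1 + z * c / u) = z * u + (z * z) * c" using that by (simp add: field_simps)
      then show ?thesis unfolding zz by simp
    qed
    have "(\<Prod>s<p j. ?g (of_nat (p j) - (of_nat s + 1 / 2 + v))) = (\<Prod>s<p j. z * mode j (of_nat (p j) - (of_nat s + 1 / 2 + v)) * (1 + z * c / mode j (of_nat (p j) - (of_nat s + 1 / 2 + v))))"
      using that by (intro prod.cong refl g) auto
    then show ?thesis by (simp add: prod.distrib)
  qed
  have empty: "(\<Prod>s<k. c + z * f s) = c ^ k * (\<Prod>s<k. 1 + z / c * f s)" for f :: "nat \<Rightarrow> complex" and k
  proof -
    have "(\<Prod>s<k. c + z * f s) = (\<Prod>s<k. c * (1 + z / c * f s))" using c by (intro prod.cong) (auto simp: field_simps)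
    then show ?thesis by (simp add: prod.distrib)
  qed
  have bulk: "(\<Prod>i\<in>{- int (p j)..<int (p j)}. mode j (of_int i + 1 / 2 + \<xi>))
    = (\<Prod>s<p j. mode j (of_nat (p j) - (of_nat s + 1 / 2 - \<xi>))) * (\<Prod>s<p j. mode j (of_nat (p j) - (of_nat s + 1 / 2 + \<xi>)))"
  proof -
    have "{- int (p j)..<int (p j)} = {0..<int (p j)} \<union> {- int (p j)..<0}" by auto
    then have "(\<Prod>i\<in>{- int (p j)..<int (p j)}. mode j (of_int i + 1 / 2 + \<xi>))
      = (\<Prod>i\<in>{0..<int (p j)}. mode j (of_int i + 1 / 2 + \<xi>)) * (\<Prod>i\<in>{- int (p j)..<0}. mode j (of_int i + 1 / 2 + \<xi>))"
      by (simp add: prod.union_disjoint)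
    also have "(\<Prod>i\<in>{0..<int (p j)}. mode j (of_int i + 1 / 2 + \<xi>)) = (\<Prod>s<p j. mode j (of_nat s + (1 / 2 + \<xi>)))"
      by (rule prod.reindex_bij_witness[where i = int and j = nat]) (auto simp: add.assoc)
    also have "\<dots> = (\<Prod>s<p j. mode j (of_nat (p j) - (of_nat s + 1 / 2 - \<xi>)))" by (rule right)
    also have "(\<Prod>i\<in>{- int (p j)..<0}. mode j (of_int i + 1 / 2 + \<xi>)) = (\<Prod>s<p j. mode j (of_nat (p j) - (of_nat s + 1 / 2 + \<xi>)))"
    proof (rule prod.reindex_bij_witness[where i = "\<lambda>s. int s - int (p j)" and j = "\<lambda>i. nat (i + int (p j))"])
      fix i assume i: "i \<in> {- int (p j)..<0}"
      have "of_nat (p j) - (of_nat (nat (i + int (p j))) + 1 / 2 + \<xi>) = - (of_int i + 1 / 2 + \<xi>)"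
        using i by simp
      then show "mode j (of_nat (p j) - (of_nat (nat (i + int (p j))) + 1 / 2 + \<xi>)) = mode j (of_int i + 1 / 2 + \<xi>)"
        by (simp only: mode_minus)
    qed auto
    finally show ?thesis .
  qed
  have "(\<Prod>s<3 * p j. c + z * mode j (of_nat s + (1 / 2 + \<xi>)))
    = (\<Prod>s<p j. ?g (of_nat (p j) - (of_nat s + 1 / 2 + - \<xi>)))
      * (\<Prod>s<K. ?g (of_nat (p j) + (of_nat s + 1 / 2 + \<xi>)))
      * (\<Prod>s<K'. ?g (of_nat (p j) + (of_nat s + 1 / 2 - \<xi>)))
      * (\<Prod>s<p j. ?g (of_nat (p j) - (of_nat s + 1 / 2 + \<xi>)))"
    unfolding split P3 left using right[of ?g] by (simp add: add.assoc)
  also have "\<dots> = (z ^ p j * (\<Prod>s<p j. mode j (of_nat (p j) - (of_nat s + 1 / 2 + - \<xi>))) * (\<Prod>s<p j. 1 + z * c / mode j (of_nat (p j) - (of_nat s + 1 / 2 + - \<xi>))))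
     * (c ^ K * (\<Prod>s<K. 1 + z / c * mode j (of_nat (p j) + (of_nat s + 1 / 2 + \<xi>))))
     * (c ^ K' * (\<Prod>s<K'. 1 + z / c * mode j (of_nat (p j) + (of_nat s + 1 / 2 - \<xi>))))
     * (z ^ p j * (\<Prod>s<p j. mode j (of_nat (p j) - (of_nat s + 1 / 2 + \<xi>))) * (\<Prod>s<p j. 1 + z * c / mode j (of_nat (p j) - (of_nat s + 1 / 2 + \<xi>))))"
    using nz by (subst (1 2) fill) (simp_all add: empty)
  \<comment> \<open>Pulling \<open>z\<close> out of the filled modes occurs once at each Fermi
    point, so the signs appear as a square and disappear.\<close>
  also have "\<dots> = (z * z) ^ p j * (c ^ (K + K') * ((\<Prod>s<p j. mode j (of_nat (p j) - (of_nat s + 1 / 2 - \<xi>))) * (\<Prod>s<p j. mode j (of_nat (p j) - (of_nat s + 1 / 2 + \<xi>))))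
      * (\<Prod>s<p j. 1 + z * c / mode j (of_nat (p j) - (of_nat s + 1 / 2 - \<xi>)))
      * (\<Prod>s<p j. 1 + z * c / mode j (of_nat (p j) - (of_nat s + 1 / 2 + \<xi>)))
      * (\<Prod>s<K. 1 + z / c * mode j (of_nat (p j) + (of_nat s + 1 / 2 + \<xi>)))
      * (\<Prod>s<K'. 1 + z / c * mode j (of_nat (p j) + (of_nat s + 1 / 2 - \<xi>))))"
    by (simp only: power_mult_distrib power_add mult_ac diff_conv_add_uminus)
  finally show ?thesis unfolding zz K bulk by simp
qed

text \<open>The strip for \<xi> contains the two sectors, with real parts 0 and
  \<open>- 1 / 2\<close>. At the boundary and for real momentum a mode lies exactly on a Fermi
  point, where \<open>c + z * mode\<close> may vanish; the statement remains valid since the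
  products converge without logarithms.\<close>

lemma momentum_asymptotics:
  assumes \<xi>: "\<bar>Re \<xi>\<bar> \<le> 1 / 2" and z: "z \<in> {1, -1}" and c: "c \<noteq> 0"
  shows "(\<lambda>j. (\<Prod>s<3 * p j. c + z * mode j (of_nat s + (1 / 2 + \<xi>)))
       / (c ^ p j * of_real (exp (real (m j) * real (3 * p j) * fermi_integral / (2 * pi)))))
    \<longlonglongrightarrow> exp (- 2 * of_real pi * \<xi>\<^sup>2 / of_real \<rho> + of_real (pi / (6 * \<rho>)))
      * half_product (z * c) (- \<xi>) * half_product (z * c) \<xi> * half_product (z / c) \<xi> * half_product (z / c) (- \<xi>)"
proof -
  have \<xi>': "\<bar>Re (- \<xi>)\<bar> \<le> 1 / 2" using \<xi> by simp
  define K where "K j = p j - p j div 2" for j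
  define K' where "K' j = p j div 2" for j
  have KK: "K j + K' j = p j" "2 * K j \<le> p j + 2" "2 * K' j \<le> p j + 2" for j by (auto simp: K_def K'_def)
  have K'top: "filterlim K' at_top sequentially"
    unfolding filterlim_at_top
  proof
    fix Z
    have "eventually (\<lambda>j. 2 * Z \<le> p j) sequentially" using p by (simp add: filterlim_at_top)
    then show "eventually (\<lambda>j. Z \<le> K' j) sequentially" by eventually_elim (simp add: K'_def)
  qed
  have Ktop: "filterlim K at_top sequentially"
    by (rule filterlim_at_top_mono[OF K'top], intro always_eventually allI, unfold K_def K'_def, arith)
  let ?B = "\<lambda>j. \<Prod>i\<in>{- int (p j)..<int (p j)}. mode j (of_int i + 1 / 2 + \<xi>)"
  let ?X = "\<lambda>j. complex_of_real (exp (real (m j) * real (3 * p j) * fermi_integral / (2 * pi)))"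
  have ins: "(\<lambda>j. \<Prod>s<p j. 1 + w / mode j (of_nat (p j) - (of_nat s + 1 / 2 - \<xi>))) \<longlonglongrightarrow> half_product w (- \<xi>)" for w
    using inside_product[OF \<xi>', of w] by (simp only: add_uminus_conv_diff)
  have outs: "(\<lambda>j. \<Prod>s<K' j. 1 + w * mode j (of_nat (p j) + (of_nat s + 1 / 2 - \<xi>))) \<longlonglongrightarrow> half_product w (- \<xi>)" for w
    using outside_product[OF \<xi>' K'top KK(3), of w] by (simp only: add_uminus_conv_diff)
  have L: "(\<lambda>j. ?B j / ?X j
      * (\<Prod>s<p j. 1 + z * c / mode j (of_nat (p j) - (of_nat s + 1 / 2 - \<xi>)))
      * (\<Prod>s<p j. 1 + z * c / mode j (of_nat (p j) - (of_nat s + 1 / 2 + \<xi>)))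
      * (\<Prod>s<K j. 1 + z / c * mode j (of_nat (p j) + (of_nat s + 1 / 2 + \<xi>)))
      * (\<Prod>s<K' j. 1 + z / c * mode j (of_nat (p j) + (of_nat s + 1 / 2 - \<xi>))))
    \<longlonglongrightarrow> exp (- 2 * of_real pi * \<xi>\<^sup>2 / of_real \<rho> + of_real (pi / (6 * \<rho>)))
      * half_product (z * c) (- \<xi>) * half_product (z * c) \<xi> * half_product (z / c) \<xi> * half_product (z / c) (- \<xi>)"
    by (intro tendsto_mult bulk_product[of \<xi>, folded mode_def] inside_product[OF \<xi>] outside_product[OF \<xi> Ktop KK(2)] ins outs)
  have ev: "eventually (\<lambda>j. ?B j / ?X j
      * (\<Prod>s<p j. 1 + z * c / mode j (of_nat (p j) - (of_nat s + 1 / 2 - \<xi>)))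
      * (\<Prod>s<p j. 1 + z * c / mode j (of_nat (p j) - (of_nat s + 1 / 2 + \<xi>)))
      * (\<Prod>s<K j. 1 + z / c * mode j (of_nat (p j) + (of_nat s + 1 / 2 + \<xi>)))
      * (\<Prod>s<K' j. 1 + z / c * mode j (of_nat (p j) + (of_nat s + 1 / 2 - \<xi>)))
     = (\<Prod>s<3 * p j. c + z * mode j (of_nat s + (1 / 2 + \<xi>))) / (c ^ p j * ?X j)) sequentially"
    using mode_growth_inside[OF \<xi>] mode_growth_inside[OF \<xi>', unfolded add_uminus_conv_diff] ev_pos
  proof eventually_elim
    case (elim j)
    have pj: "p j > 0" using elim by simp
    have split: "(\<Prod>s<3 * p j. c + z * mode j (of_nat s + (1 / 2 + \<xi>)))
    = c ^ p j * ?B j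
      * (\<Prod>s<p j. 1 + z * c / mode j (of_nat (p j) - (of_nat s + 1 / 2 - \<xi>)))
      * (\<Prod>s<p j. 1 + z * c / mode j (of_nat (p j) - (of_nat s + 1 / 2 + \<xi>)))
      * (\<Prod>s<K j. 1 + z / c * mode j (of_nat (p j) + (of_nat s + 1 / 2 + \<xi>)))
      * (\<Prod>s<K' j. 1 + z / c * mode j (of_nat (p j) + (of_nat s + 1 / 2 - \<xi>)))"
      by (rule momentum_split[where K = "K j" and K' = "K' j", OF pj z c]) (use elim KK in blast)+
    have gen: "b / x * a1 * a2 * a3 * a4 = cc * b * a1 * a2 * a3 * a4 / (cc * x)" if "cc \<noteq> 0" for b x a1 a2 a3 a4 cc :: complex
      using that by simp
    have "c ^ p j \<noteq> 0" using c by simp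
    then show ?case unfolding split by (rule gen)
  qed
  show ?thesis by (rule Lim_transform_eventually[OF L ev])
qed

end

subsection \<open>Summation over the four sectors\<close>

lemma summable_int_product:
  fixes f g :: "int \<Rightarrow> complex"
  assumes f: "(\<lambda>k. norm (f k)) summable_on UNIV" and g: "(\<lambda>l. norm (g l)) summable_on UNIV"
  shows "(\<lambda>(k, l). f k * g l) summable_on UNIV"
    "infsum (\<lambda>(k, l). f k * g l) UNIV = infsum f UNIV * infsum g UNIV"
proof -
  have "(\<lambda>x. norm (f (fst x) * g (snd x))) summable_on UNIV \<times> UNIV"
  proof (rule summable_on_SigmaI[where g = "\<lambda>k. norm (f k) * infsum (\<lambda>l. norm (g l)) UNIV"], goal_cases)
    case (1 k)
    show ?case using has_sum_cmult_right[OF has_sum_infsum[OF g], of "norm (f k)"] by (simp add: norm_mult)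
  next
    case 2
    show ?case using f by (rule summable_on_cmult_left)
  qed auto
  then have "(\<lambda>x. norm ((\<lambda>(k, l). f k * g l) x)) summable_on UNIV" by (simp add: case_prod_unfold)
  then show s: "(\<lambda>(k, l). f k * g l) summable_on UNIV" by (rule abs_summable_summable)
  have "infsum (\<lambda>(k, l). f k * g l) (UNIV \<times> UNIV) = infsum (\<lambda>k. infsum (\<lambda>l. f k * g l) UNIV) UNIV"
    using s by (intro infsum_Sigma'_banach[symmetric]) simp
  also have "\<dots> = infsum (\<lambda>k. f k * infsum g UNIV) UNIV"
    by (simp only: infsum_cmult_right')
  also have "\<dots> = infsum f UNIV * infsum g UNIV" by (rule infsum_cmult_left')
  finally show "infsum (\<lambda>(k, l). f k * g l) UNIV = infsum f UNIV * infsum g UNIV" by simp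
qed

context torus_scaling
begin

definition nome :: real where "nome = exp (- pi * (1 / \<rho>))"

lemma nome: "0 < nome" "nome < 1" using \<rho> by (auto simp: nome_def)

lemma nome_powi: "nome powi (k\<^sup>2) = exp (- pi * (1 / \<rho>) * (real_of_int k)\<^sup>2)"
  unfolding nome_def by (rule exp_powi_sq)

text \<open>Holes below and particles above the same Fermi point see the displacement with opposite
  signs and reciprocal weights, which is precisely the shape of the triple product with base
  \<open>nome\<close>.\<close>

lemma half_product_pair:
  assumes "w \<noteq> 0"
  shows "half_product w v * half_product (1 / w) (- v)
    = theta_series nome (w * exp (- 2 * of_real pi * v / of_real \<rho>)) / of_real (P_prod nome)"
proof -
  have e: "exp (- 2 * of_real pi * (of_nat s + 1 / 2 + u) / of_real \<rho>) = of_real (nome ^ (2 * s + 1)) * exp (- 2 * of_real pi * u / of_real \<rho>)" for s and u :: complex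
  proof -
    have "nome ^ (2 * s + 1) = exp (real (2 * s + 1) * (- pi * (1 / \<rho>)))" unfolding nome_def by (rule exp_of_nat_mult[symmetric])
    then have "complex_of_real (nome ^ (2 * s + 1)) = exp (of_real (real (2 * s + 1) * (- pi * (1 / \<rho>))))" by (simp only: exp_of_real)
    moreover have "- 2 * of_real pi * (of_nat s + 1 / 2 + u) / of_real \<rho>
        = of_real (real (2 * s + 1) * (- pi * (1 / \<rho>))) + (- 2 * of_real pi * u / of_real \<rho> :: complex)"
      using \<rho> by (simp add: field_simps)
    ultimately show ?thesis by (simp only: exp_add)
  qed
  let ?E = "exp (- 2 * of_real pi * v / of_real \<rho>)"
  have E: "exp (- 2 * of_real pi * (- v) / of_real \<rho>) = 1 / ?E" by (simp add: exp_minus divide_inverse)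
  have 1: "half_product w v = (\<Prod>s. 1 + of_real (nome ^ (2 * s + 1)) * (w * ?E))"
    unfolding half_product_def e by (simp only: mult_ac)
  have 2: "half_product (1 / w) (- v) = (\<Prod>s. 1 + of_real (nome ^ (2 * s + 1)) / (w * ?E))"
    unfolding half_product_def e E by (simp only: divide_inverse mult_ac inverse_mult_distrib mult_1_left)
  show ?thesis unfolding 1 2 using assms by (intro jacobi_triple_product nome) simp
qed

text \<open>One theta series for each of the two Fermi points, with opposite displacements. The
  Gaussian in front is the part of the bulk correction that depends on \<xi>.\<close>

definition sector_sum :: "complex \<Rightarrow> complex \<Rightarrow> complex \<Rightarrow> complex" where
  "sector_sum c z \<xi> = exp (- 2 * of_real pi * \<xi>\<^sup>2 / of_real \<rho>)
     * theta_series nome (z * c * exp (- 2 * of_real pi * \<xi> / of_real \<rho>))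
     * theta_series nome (z * c * exp (2 * of_real pi * \<xi> / of_real \<rho>))"

definition charge_term :: "complex \<Rightarrow> int \<Rightarrow> complex" where
  "charge_term c k = c powi k * of_real (exp (- pi * (real_of_int k)\<^sup>2 / (2 * \<rho>)))"

definition current_term :: "complex \<Rightarrow> complex \<Rightarrow> complex" where
  "current_term \<xi> d = exp (- 2 * of_real pi * (d + \<xi>)\<^sup>2 / of_real \<rho>)"

text \<open>In the coordinates \<open>k + l\<close> (charge) and \<open>k - l\<close> (twice the
  current) the form \<open>k^2 + l^2\<close> stays diagonal, and completing the square absorbs \<xi>
  and the Gaussian prefactor into the current.\<close>

lemma sector_sum_eq:
  fixes c z \<xi> :: complex
  assumes c: "c \<noteq> 0" and z: "z \<in> {1, -1}"
  defines "t \<equiv> \<lambda>(k1, k2). z powi (k1 + k2) * charge_term c (k1 + k2) * current_term \<xi> (of_int (k1 - k2) / 2)"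
  shows "t summable_on UNIV" "infsum t UNIV = sector_sum c z \<xi>"
proof -
  let ?E = "exp (- 2 * of_real pi * \<xi> / of_real \<rho>)" and ?E' = "exp (2 * of_real pi * \<xi> / of_real \<rho>)"
  let ?g = "\<lambda>w k. complex_of_real (nome powi (k\<^sup>2)) * w powi k"
  have zc: "z * c * ?E \<noteq> 0" "z * c * ?E' \<noteq> 0" using c z by auto
  note P = summable_int_product[OF summable_theta_series[OF nome zc(1)] summable_theta_series[OF nome zc(2)]]
  have eq: "exp (- 2 * of_real pi * \<xi>\<^sup>2 / of_real \<rho>) * (case x of (k, l) \<Rightarrow> ?g (z * c * ?E) k * ?g (z * c * ?E') l) = t x" for x
  proof -
    obtain k l where x: "x = (k, l)" by (cases x)
    have zc0: "z * c \<noteq> 0" using c z by auto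
    have p1: "(z * c * ?E) powi k = (z * c) powi k * exp (of_int k * (- 2 * of_real pi * \<xi> / of_real \<rho>))"
      unfolding power_int_mult_distrib exp_power_int ..
    have p2: "(z * c * ?E') powi l = (z * c) powi l * exp (of_int l * (2 * of_real pi * \<xi> / of_real \<rho>))"
      unfolding power_int_mult_distrib exp_power_int ..
    have zz: "(z * c) powi k * (z * c) powi l = z powi (k + l) * c powi (k + l)"
      using zc0 by (simp add: power_int_add power_int_mult_distrib)
    have "exp (- 2 * of_real pi * \<xi>\<^sup>2 / of_real \<rho>) * (?g (z * c * ?E) k * ?g (z * c * ?E') l)
      = ((z * c) powi k * (z * c) powi l) * (exp (- 2 * of_real pi * \<xi>\<^sup>2 / of_real \<rho>)
         * exp (of_real (- pi * (1 / \<rho>) * (real_of_int k)\<^sup>2)) * exp (of_real (- pi * (1 / \<rho>) * (real_of_int l)\<^sup>2))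
         * exp (of_int k * (- 2 * of_real pi * \<xi> / of_real \<rho>)) * exp (of_int l * (2 * of_real pi * \<xi> / of_real \<rho>)))"
      unfolding p1 p2 nome_powi exp_of_real[symmetric] by (simp only: mult_ac)
    also have "exp (- 2 * of_real pi * \<xi>\<^sup>2 / of_real \<rho>)
         * exp (of_real (- pi * (1 / \<rho>) * (real_of_int k)\<^sup>2)) * exp (of_real (- pi * (1 / \<rho>) * (real_of_int l)\<^sup>2))
         * exp (of_int k * (- 2 * of_real pi * \<xi> / of_real \<rho>)) * exp (of_int l * (2 * of_real pi * \<xi> / of_real \<rho>))
      = exp (of_real (- pi * (real_of_int (k + l))\<^sup>2 / (2 * \<rho>))) * exp (- 2 * of_real pi * (of_int (k - l) / 2 + \<xi>)\<^sup>2 / of_real \<rho>)"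
      unfolding exp_add[symmetric]
      by (rule arg_cong[where f = exp]) (use \<rho> in \<open>simp add: field_simps power2_eq_square\<close>)
    finally show ?thesis
      unfolding x t_def charge_term_def current_term_def zz by (simp add: exp_of_real[symmetric] mult_ac)
  qed
  have "(\<lambda>x. exp (- 2 * of_real pi * \<xi>\<^sup>2 / of_real \<rho>) * (case x of (k, l) \<Rightarrow> ?g (z * c * ?E) k * ?g (z * c * ?E') l)) summable_on UNIV"
    using P(1) by (rule summable_on_cmult_right)
  then show "t summable_on UNIV" unfolding eq .
  have "infsum t UNIV = infsum (\<lambda>x. exp (- 2 * of_real pi * \<xi>\<^sup>2 / of_real \<rho>) * (case x of (k, l) \<Rightarrow> ?g (z * c * ?E) k * ?g (z * c * ?E') l)) UNIV"
    unfolding eq ..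
  also have "\<dots> = exp (- 2 * of_real pi * \<xi>\<^sup>2 / of_real \<rho>) * (infsum (?g (z * c * ?E)) UNIV * infsum (?g (z * c * ?E')) UNIV)"
    unfolding infsum_cmult_right' P(2) ..
  finally show "infsum t UNIV = sector_sum c z \<xi>"
    unfolding sector_sum_def theta_series_def by (simp only: mult.assoc)
qed

lemma summable_charge_term: "c \<noteq> 0 \<Longrightarrow> (\<lambda>k. norm (charge_term c k)) summable_on UNIV"
proof (rule summable_on_comparison_test)
  assume c: "c \<noteq> 0"
  show "(\<lambda>k. exp (- (pi / (2 * \<rho>)) * (real_of_int k)\<^sup>2 + \<bar>ln (norm c)\<bar> * real_of_int \<bar>k\<bar>)) summable_on UNIV"
    using \<rho> by (intro summable_on_gaussian) simp
  fix k :: int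
  have "norm c powi k = exp (real_of_int k * ln (norm c))"
    using c by (simp add: powr_real_of_int'[symmetric] powr_def)
  moreover have "real_of_int k * ln (norm c) \<le> \<bar>ln (norm c)\<bar> * real_of_int \<bar>k\<bar>"
    by (metis abs_ge_self abs_mult mult.commute of_int_abs)
  ultimately show "norm (charge_term c k) \<le> exp (- (pi / (2 * \<rho>)) * (real_of_int k)\<^sup>2 + \<bar>ln (norm c)\<bar> * real_of_int \<bar>k\<bar>)"
    by (simp add: charge_term_def norm_mult norm_power_int flip: exp_add)
qed simp

lemma summable_current_term: "(\<lambda>d :: int. norm (current_term \<xi> (of_int d))) summable_on UNIV"
proof (rule summable_on_comparison_test)
  let ?C = "exp (2 * pi * norm (\<xi>\<^sup>2) / \<rho>)"
  show "(\<lambda>k :: int. ?C * exp (- (2 * pi / \<rho>) * (real_of_int k)\<^sup>2 + (4 * pi * norm \<xi> / \<rho>) * real_of_int \<bar>k\<bar>)) summable_on UNIV"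
    using \<rho> by (intro summable_on_cmult_right summable_on_gaussian) simp
  fix k :: int
  have "current_term \<xi> (of_int k) = exp (of_real (- (2 * pi / \<rho>) * (real_of_int k)\<^sup>2)) * exp (- 4 * of_real pi * of_int k * \<xi> / of_real \<rho>) * exp (- 2 * of_real pi * \<xi>\<^sup>2 / of_real \<rho>)"
    unfolding current_term_def exp_add[symmetric]
    by (rule arg_cong[where f = exp]) (use \<rho> in \<open>simp add: field_simps power2_eq_square\<close>)
  also have "norm \<dots> \<le> exp (- (2 * pi / \<rho>) * (real_of_int k)\<^sup>2) * exp ((4 * pi * norm \<xi> / \<rho>) * real_of_int \<bar>k\<bar>) * ?C"
    unfolding norm_mult
  proof (intro mult_mono)
    show "norm (exp (complex_of_real (- (2 * pi / \<rho>) * (real_of_int k)\<^sup>2))) \<le> exp (- (2 * pi / \<rho>) * (real_of_int k)\<^sup>2)" by simp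
    have "norm (exp (- 4 * of_real pi * of_int k * \<xi> / of_real \<rho>)) \<le> exp (norm (- 4 * of_real pi * of_int k * \<xi> / of_real \<rho>))" by (rule norm_exp)
    also have "norm (- 4 * of_real pi * of_int k * \<xi> / of_real \<rho>) = (4 * pi * norm \<xi> / \<rho>) * real_of_int \<bar>k\<bar>"
      using \<rho> by (simp add: norm_mult norm_divide)
    finally show "norm (exp (- 4 * of_real pi * of_int k * \<xi> / of_real \<rho>)) \<le> exp ((4 * pi * norm \<xi> / \<rho>) * real_of_int \<bar>k\<bar>)" .
    have "norm (exp (- 2 * of_real pi * \<xi>\<^sup>2 / of_real \<rho>)) \<le> exp (norm (- 2 * of_real pi * \<xi>\<^sup>2 / of_real \<rho>))" by (rule norm_exp)
    also have "norm (- 2 * of_real pi * \<xi>\<^sup>2 / of_real \<rho>) = 2 * pi * norm (\<xi>\<^sup>2) / \<rho>"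
      using \<rho> by (simp add: norm_mult norm_divide)
    finally show "norm (exp (- 2 * of_real pi * \<xi>\<^sup>2 / of_real \<rho>)) \<le> ?C" .
  qed simp_all
  also have "\<dots> = ?C * exp (- (2 * pi / \<rho>) * (real_of_int k)\<^sup>2 + (4 * pi * norm \<xi> / \<rho>) * real_of_int \<bar>k\<bar>)"
    by (simp only: exp_add mult_ac)
  finally show "norm (current_term \<xi> (of_int k)) \<le> ?C * exp (- (2 * pi / \<rho>) * (real_of_int k)\<^sup>2 + (4 * pi * norm \<xi> / \<rho>) * real_of_int \<bar>k\<bar>)" .
qed simp

text \<open>The signs select even total charge from the antiperiodic sector and odd total charge from the
  periodic one; in both cases the current is then an integer, so charge and current decouple.\<close>

lemma sectors_decouple:
  assumes c: "c \<noteq> 0"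
  shows "(sector_sum c 1 (\<xi> - 1 / 2) - sector_sum c (-1) (\<xi> - 1 / 2) + sector_sum c 1 \<xi> + sector_sum c (-1) \<xi>) / 2
    = infsum (charge_term c) UNIV * infsum (\<lambda>d :: int. current_term \<xi> (of_int d)) UNIV"
proof -
  let ?t = "\<lambda>z \<xi> (k1, k2). z powi (k1 + k2) * charge_term c (k1 + k2) * current_term \<xi> (of_int (k1 - k2) / 2)"
  note S = sector_sum_eq[OF c]
  have A: "(?t z \<xi> has_sum sector_sum c z \<xi>) UNIV" if "z \<in> {1, -1}" for z \<xi>
    unfolding has_sum_iff using S[OF that] by simp
  have "((\<lambda>x. (?t 1 (\<xi> - 1 / 2) x + - ?t (-1) (\<xi> - 1 / 2) x + ?t 1 \<xi> x + ?t (-1) \<xi> x) / 2) has_sum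
    (sector_sum c 1 (\<xi> - 1 / 2) + - sector_sum c (-1) (\<xi> - 1 / 2) + sector_sum c 1 \<xi> + sector_sum c (-1) \<xi>) / 2) UNIV"
    by (intro has_sum_divide_const has_sum_add has_sum_uminusI A) simp_all
  then have "(sector_sum c 1 (\<xi> - 1 / 2) - sector_sum c (-1) (\<xi> - 1 / 2) + sector_sum c 1 \<xi> + sector_sum c (-1) \<xi>) / 2
    = infsum (\<lambda>x. (?t 1 (\<xi> - 1 / 2) x + - ?t (-1) (\<xi> - 1 / 2) x + ?t 1 \<xi> x + ?t (-1) \<xi> x) / 2) UNIV"
    by (simp only: infsumI add_uminus_conv_diff)
  \<comment> \<open>In the inverse substitution \<open>k1 - k2 = 2 * s + k mod 2\<close>: for odd
    charge the halved difference is off by \<open>1 / 2\<close>, which is what the shift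
    \<open>\<xi> - 1 / 2\<close> of the periodic sector compensates.\<close>
  also have "\<dots> = infsum (\<lambda>(k, s). charge_term c k * current_term \<xi> (of_int s)) UNIV"
  proof (rule infsum_reindex_bij_witness[where i = "\<lambda>(k, s). (k - (k div 2 - s), k div 2 - s)" and j = "\<lambda>(k1, k2). (k1 + k2, (k1 - k2) div 2)"])
    fix x :: "int \<times> int"
    obtain k1 k2 where x: "x = (k1, k2)" by (cases x)
    have d: "(k1 + k2) div 2 - (k1 - k2) div 2 = k2" by presburger
    show "(case case x of (k1, k2) \<Rightarrow> (k1 + k2, (k1 - k2) div 2) of (k, s) \<Rightarrow> (k - (k div 2 - s), k div 2 - s)) = x"
      using d by (simp add: x)
    show "(case x of (k1, k2) \<Rightarrow> (k1 + k2, (k1 - k2) div 2)) \<in> UNIV" by simp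
    show "(case case x of (k1, k2) \<Rightarrow> (k1 + k2, (k1 - k2) div 2) of (k, s) \<Rightarrow> charge_term c k * current_term \<xi> (of_int s))
      = (?t 1 (\<xi> - 1 / 2) x + - ?t (-1) (\<xi> - 1 / 2) x + ?t 1 \<xi> x + ?t (-1) \<xi> x) / 2"
    proof (cases "even (k1 + k2)")
      case True
      then have "(k1 - k2) = 2 * ((k1 - k2) div 2)" by presburger
      then have "complex_of_int (k1 - k2) / 2 = of_int ((k1 - k2) div 2)" by (metis nonzero_mult_div_cancel_left of_int_mult of_int_numeral zero_neq_numeral)
      moreover have "(-1 :: complex) powi (k1 + k2) = 1" using True by (simp add: power_int_minus_left)
      ultimately show ?thesis by (simp add: x)
    next
      case False
      then have e: "(k1 - k2) = 2 * ((k1 - k2) div 2) + 1" by presburger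
      have "complex_of_int (k1 - k2) = 2 * of_int ((k1 - k2) div 2) + 1" by (subst e) simp
      then have "complex_of_int (k1 - k2) / 2 + (\<xi> - 1 / 2) = of_int ((k1 - k2) div 2) + \<xi>" by (simp add: field_simps)
      then have "current_term (\<xi> - 1 / 2) (of_int (k1 - k2) / 2) = current_term \<xi> (of_int ((k1 - k2) div 2))"
        by (simp only: current_term_def)
      moreover have "(-1 :: complex) powi (k1 + k2) = -1" using False by (simp add: power_int_minus_left)
      ultimately show ?thesis by (simp add: x)
    qed
  next
    fix y :: "int \<times> int"
    obtain k s where y: "y = (k, s)" by (cases y)
    have "(k - (k div 2 - s) - (k div 2 - s)) div 2 = s" by presburger
    then show "(case case y of (k, s) \<Rightarrow> (k - (k div 2 - s), k div 2 - s) of (k1, k2) \<Rightarrow> (k1 + k2, (k1 - k2) div 2)) = y"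
      by (simp add: y)
    show "(case y of (k, s) \<Rightarrow> (k - (k div 2 - s), k div 2 - s)) \<in> UNIV" by simp
  qed
  also have "\<dots> = infsum (charge_term c) UNIV * infsum (\<lambda>d :: int. current_term \<xi> (of_int d)) UNIV"
    by (rule summable_int_product(2)[OF summable_charge_term[OF c] summable_current_term])
  finally show ?thesis .
qed

text \<open>The theta transformation with \<open>t = 2 / (\<pi> \<rho>)\<close> and
  \<open>s = \<pi> \<beta>\<close>. The imaginary shift of the current turns into the real weight
  \<open>exp (\<pi> \<beta> l)\<close> of the dual variable, and \<open>1 / sqrt (\<pi> t)\<close>
  is \<open>sqrt (\<rho> / 2)\<close>.\<close>

lemma current_sum:
  fixes \<beta> :: real
  shows "infsum (\<lambda>d :: int. current_term (- \<i> * of_real \<beta> / 2) (of_int d)) UNIV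
    = of_real (sqrt (\<rho> / 2)) * infsum (\<lambda>l :: int. exp (of_real (pi * \<beta> * real_of_int l - pi * \<rho> * (real_of_int l)\<^sup>2 / 2))) UNIV"
proof -
  define t where "t = 2 / (pi * \<rho>)"
  have t: "t > 0" using \<rho> by (simp add: t_def)
  have "infsum (\<lambda>d :: int. current_term (- \<i> * of_real \<beta> / 2) (of_int d)) UNIV
    = (\<Sum>\<^sub>\<infinity>\<nu>\<in>(UNIV :: int set). exp (of_real t * (of_real (pi * \<beta>) + 2 * of_real pi * \<i> * of_int \<nu>)\<^sup>2 / 4))"
  proof (intro infsum_cong)
    fix d :: int
    have "of_real (pi * \<beta>) + 2 * of_real pi * \<i> * of_int d = (2 * of_real pi * \<i>) * (of_int d + - \<i> * of_real \<beta> / 2)"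
      by (simp add: algebra_simps)
    then have "of_real t * (of_real (pi * \<beta>) + 2 * of_real pi * \<i> * of_int d)\<^sup>2 / 4 = of_real t * ((2 * of_real pi * \<i>)\<^sup>2 * (of_int d + - \<i> * of_real \<beta> / 2)\<^sup>2) / 4"
      by (simp only: power_mult_distrib)
    also have "(2 * of_real pi * \<i>)\<^sup>2 = complex_of_real (- 4 * pi\<^sup>2)" by (simp add: power_mult_distrib)
    also have "of_real t * (complex_of_real (- 4 * pi\<^sup>2) * (of_int d + - \<i> * of_real \<beta> / 2)\<^sup>2) / 4 = - 2 * of_real pi * (of_int d + - \<i> * of_real \<beta> / 2)\<^sup>2 / of_real \<rho>"
      using \<rho> by (simp add: t_def power2_eq_square)
    finally show "current_term (- \<i> * of_real \<beta> / 2) (of_int d) = exp (of_real t * (of_real (pi * \<beta>) + 2 * of_real pi * \<i> * of_int d)\<^sup>2 / 4)"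
      by (simp only: current_term_def)
  qed
  also have "\<dots> = of_real (1 / sqrt (pi * t)) * (\<Sum>\<^sub>\<infinity>j\<in>(UNIV :: int set). exp (- of_int (j\<^sup>2) / of_real t + of_int j * of_real (pi * \<beta>)))"
    by (rule theta_transformation[OF t]) simp
  also have "1 / sqrt (pi * t) = sqrt (\<rho> / 2)" using \<rho> by (simp add: t_def real_sqrt_divide)
  also have "(\<Sum>\<^sub>\<infinity>j\<in>(UNIV :: int set). exp (- of_int (j\<^sup>2) / complex_of_real t + of_int j * of_real (pi * \<beta>)))
     = infsum (\<lambda>l :: int. exp (of_real (pi * \<beta> * real_of_int l - pi * \<rho> * (real_of_int l)\<^sup>2 / 2))) UNIV"
  proof (intro infsum_cong arg_cong[where f = exp])
    fix l :: int
    have "- of_int (l\<^sup>2) / of_real t + of_int l * of_real (pi * \<beta>) = complex_of_real (- (real_of_int l)\<^sup>2 / t + real_of_int l * (pi * \<beta>))"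
      by simp
    also have "- (real_of_int l)\<^sup>2 / t + real_of_int l * (pi * \<beta>) = pi * \<beta> * real_of_int l - pi * \<rho> * (real_of_int l)\<^sup>2 / 2"
      using \<rho> by (simp add: t_def field_simps)
    finally show "- of_int (l\<^sup>2) / of_real t + of_int l * of_real (pi * \<beta>) = complex_of_real (pi * \<beta> * real_of_int l - pi * \<rho> * (real_of_int l)\<^sup>2 / 2)" .
  qed
  finally show ?thesis .
qed

definition winding_sum :: "real \<Rightarrow> real \<Rightarrow> real" where
  "winding_sum \<alpha> \<beta> = (\<Sum>\<^sub>\<infinity>(k, l)\<in>(UNIV :: (int \<times> int) set).
     exp (pi * (\<alpha> * real_of_int k + \<beta> * real_of_int l))
     * exp (- pi / 2 * ((real_of_int k)\<^sup>2 / \<rho> + \<rho> * (real_of_int l)\<^sup>2)))"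

text \<open>Powers of \<open>exp (- \<alpha> \<pi>)\<close> carry the opposite sign of \<alpha>,
  corrected by reflecting \<open>k\<close>. Positivity ensures a nonzero limit, as needed for
  asymptotic equivalence.\<close>

lemma winding_sum_factor:
  "complex_of_real (winding_sum \<alpha> \<beta>) = infsum (charge_term (of_real (exp (- \<alpha> * pi)))) UNIV
     * infsum (\<lambda>l :: int. exp (of_real (pi * \<beta> * real_of_int l - pi * \<rho> * (real_of_int l)\<^sup>2 / 2))) UNIV"
  "winding_sum \<alpha> \<beta> > 0"
proof -
  let ?c = "complex_of_real (exp (- \<alpha> * pi))"
  let ?f = "\<lambda>k :: int. charge_term ?c (- k)" and ?g = "\<lambda>l :: int. exp (complex_of_real (pi * \<beta> * real_of_int l - pi * \<rho> * (real_of_int l)\<^sup>2 / 2))"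
  let ?h = "\<lambda>(k, l). exp (pi * (\<alpha> * real_of_int k + \<beta> * real_of_int l)) * exp (- pi / 2 * ((real_of_int k)\<^sup>2 / \<rho> + \<rho> * (real_of_int l)\<^sup>2))"
  have bij: "bij (uminus :: int \<Rightarrow> int)" by (rule bij_uminus)
  have f: "(\<lambda>k. norm (?f k)) summable_on UNIV"
    using summable_on_reindex_bij_betw[OF bij, of "\<lambda>k. norm (charge_term ?c k)"] summable_charge_term[of ?c] by simp
  have g: "(\<lambda>l. norm (?g l)) summable_on UNIV"
  proof (rule summable_on_comparison_test)
    show "(\<lambda>l :: int. exp (- (pi * \<rho> / 2) * (real_of_int l)\<^sup>2 + \<bar>pi * \<beta>\<bar> * real_of_int \<bar>l\<bar>)) summable_on UNIV"
      using \<rho> by (intro summable_on_gaussian) simp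
    fix l :: int
    have "pi * \<beta> * real_of_int l \<le> \<bar>pi * \<beta>\<bar> * real_of_int \<bar>l\<bar>" by (metis abs_ge_self abs_mult of_int_abs)
    then show "norm (?g l) \<le> exp (- (pi * \<rho> / 2) * (real_of_int l)\<^sup>2 + \<bar>pi * \<beta>\<bar> * real_of_int \<bar>l\<bar>)" by simp
  qed simp
  have eq: "(case x of (k, l) \<Rightarrow> ?f k * ?g l) = complex_of_real (?h x)" for x :: "int \<times> int"
  proof -
    obtain k l where x: "x = (k, l)" by (cases x)
    have "?c powi (- k) = complex_of_real (exp (- \<alpha> * pi) powi (- k))" by (simp only: of_real_power_int)
    also have "exp (- \<alpha> * pi) powi (- k) = exp (of_int (- k) * (- \<alpha> * pi))" by (rule exp_power_int)
    finally have "?f k * ?g l = complex_of_real (exp (of_int (- k) * (- \<alpha> * pi)) * exp (- pi * (real_of_int (- k))\<^sup>2 / (2 * \<rho>)) * exp (pi * \<beta> * real_of_int l - pi * \<rho> * (real_of_int l)\<^sup>2 / 2))"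
      unfolding charge_term_def by (simp only: of_real_mult exp_of_real)
    also have "exp (of_int (- k) * (- \<alpha> * pi)) * exp (- pi * (real_of_int (- k))\<^sup>2 / (2 * \<rho>)) * exp (pi * \<beta> * real_of_int l - pi * \<rho> * (real_of_int l)\<^sup>2 / 2) = ?h (k, l)"
      unfolding prod.case exp_add[symmetric] by (rule arg_cong[where f = exp]) (use \<rho> in \<open>simp add: field_simps\<close>)
    finally show ?thesis by (simp add: x)
  qed
  have sc: "(\<lambda>x. complex_of_real (?h x)) summable_on UNIV" using summable_int_product(1)[OF f g] unfolding eq .
  then have sh: "?h summable_on UNIV" using summable_on_Re[OF sc] by simp
  have "complex_of_real (winding_sum \<alpha> \<beta>) = infsum (\<lambda>x. complex_of_real (?h x)) UNIV"
    unfolding winding_sum_def by (rule infsumI[OF has_sum_of_real[OF has_sum_infsum[OF sh]], symmetric])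
  also have "\<dots> = infsum ?f UNIV * infsum ?g UNIV"
    unfolding eq[symmetric] by (rule summable_int_product(2)[OF f g])
  also have "infsum ?f UNIV = infsum (charge_term ?c) UNIV"
    by (rule infsum_reindex_bij_betw[OF bij])
  finally show "complex_of_real (winding_sum \<alpha> \<beta>) = infsum (charge_term ?c) UNIV * infsum ?g UNIV" .
  have "infsum (\<lambda>_. 0) UNIV < infsum ?h (UNIV :: (int \<times> int) set)"
    by (rule has_sum_strict_mono[where A = UNIV and f = "\<lambda>_. 0" and g = ?h and x = "(0, 0)"])
       (use sh in \<open>auto simp: has_sum_infsum\<close>)
  then show "winding_sum \<alpha> \<beta> > 0" unfolding winding_sum_def by simp
qed

text \<open>The Fermi points produce \<open>exp (\<pi> / (6 \<rho>)) / P^2\<close> at the nome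
  \<open>exp (- \<pi> / \<rho>)\<close>. Inverting eta moves this to
  \<open>exp (- \<rho> \<pi>)\<close> with an extra \<open>1 / \<rho>\<close>, which combines with
  \<open>sqrt (\<rho> / 2)\<close> from the current sum to
  \<open>1 / sqrt (2 \<rho>)\<close>.\<close>

lemma partition_limit:
  "(\<lambda>j. partition_function (m j) (3 * p j) \<alpha> \<beta>
     / (exp (- \<alpha> * pi) ^ p j * exp (real (m j) * real (3 * p j) * fermi_integral / (2 * pi))))
   \<longlonglongrightarrow> exp (pi * \<rho> / 6) / (sqrt (2 * \<rho>) * (P_prod (exp (- \<rho> * pi)))\<^sup>2) * winding_sum \<alpha> \<beta>"
proof -
  let ?c = "complex_of_real (exp (- \<alpha> * pi))" and ?\<xi> = "- \<i> * of_real \<beta> / 2"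
  let ?D = "\<lambda>j. ?c ^ p j * complex_of_real (exp (real (m j) * real (3 * p j) * fermi_integral / (2 * pi)))"
  let ?A = "exp (pi / (6 * \<rho>)) / (P_prod nome)\<^sup>2"
  have c: "?c \<noteq> 0" by simp
  have lim: "(\<lambda>j. momentum_product (m j) (3 * p j) ?c z (1 / 2 + \<xi>) / ?D j) \<longlonglongrightarrow> of_real ?A * sector_sum ?c z \<xi>"
    if \<xi>: "\<bar>Re \<xi>\<bar> \<le> 1 / 2" and z: "z \<in> {1, -1}" for z \<xi>
  proof -
    have zc: "z * ?c \<noteq> 0" "1 / (z * ?c) = z / ?c" using z by auto
    have h1: "half_product (z * ?c) \<xi> * half_product (z / ?c) (- \<xi>) = theta_series nome (z * ?c * exp (- 2 * of_real pi * \<xi> / of_real \<rho>)) / of_real (P_prod nome)"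
      using half_product_pair[OF zc(1), of \<xi>] unfolding zc(2) .
    have h2: "half_product (z * ?c) (- \<xi>) * half_product (z / ?c) \<xi> = theta_series nome (z * ?c * exp (2 * of_real pi * \<xi> / of_real \<rho>)) / of_real (P_prod nome)"
      using half_product_pair[OF zc(1), of "- \<xi>"] unfolding zc(2) by simp
    have "exp (- 2 * of_real pi * \<xi>\<^sup>2 / of_real \<rho> + of_real (pi / (6 * \<rho>)))
      * half_product (z * ?c) (- \<xi>) * half_product (z * ?c) \<xi> * half_product (z / ?c) \<xi> * half_product (z / ?c) (- \<xi>)
      = exp (of_real (pi / (6 * \<rho>))) * (exp (- 2 * of_real pi * \<xi>\<^sup>2 / of_real \<rho>)
      * (half_product (z * ?c) \<xi> * half_product (z / ?c) (- \<xi>)) * (half_product (z * ?c) (- \<xi>) * half_product (z / ?c) \<xi>))"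
      by (simp only: exp_add mult_ac)
    also have "\<dots> = of_real ?A * sector_sum ?c z \<xi>"
      unfolding h1 h2 exp_of_real sector_sum_def by (simp add: power2_eq_square)
    finally show ?thesis
      using momentum_asymptotics[OF \<xi> z c] unfolding momentum_product_def mode_def by simp
  qed
  have Z: "(\<lambda>j. complex_of_real (partition_function (m j) (3 * p j) \<alpha> \<beta>) / ?D j)
    \<longlonglongrightarrow> (of_real ?A * sector_sum ?c 1 (?\<xi> - 1 / 2) - of_real ?A * sector_sum ?c (-1) (?\<xi> - 1 / 2)
        + of_real ?A * sector_sum ?c 1 ?\<xi> + of_real ?A * sector_sum ?c (-1) ?\<xi>) / 2"
  proof (rule Lim_transform_eventually)
    show "(\<lambda>j. (momentum_product (m j) (3 * p j) ?c 1 (1 / 2 + (?\<xi> - 1 / 2)) / ?D j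
        - momentum_product (m j) (3 * p j) ?c (-1) (1 / 2 + (?\<xi> - 1 / 2)) / ?D j
        + momentum_product (m j) (3 * p j) ?c 1 (1 / 2 + ?\<xi>) / ?D j
        + momentum_product (m j) (3 * p j) ?c (-1) (1 / 2 + ?\<xi>) / ?D j) / 2)
      \<longlonglongrightarrow> (of_real ?A * sector_sum ?c 1 (?\<xi> - 1 / 2) - of_real ?A * sector_sum ?c (-1) (?\<xi> - 1 / 2)
        + of_real ?A * sector_sum ?c 1 ?\<xi> + of_real ?A * sector_sum ?c (-1) ?\<xi>) / 2"
      by (intro tendsto_divide tendsto_add tendsto_diff lim tendsto_const) auto
    show "eventually (\<lambda>j. (momentum_product (m j) (3 * p j) ?c 1 (1 / 2 + (?\<xi> - 1 / 2)) / ?D j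
        - momentum_product (m j) (3 * p j) ?c (-1) (1 / 2 + (?\<xi> - 1 / 2)) / ?D j
        + momentum_product (m j) (3 * p j) ?c 1 (1 / 2 + ?\<xi>) / ?D j
        + momentum_product (m j) (3 * p j) ?c (-1) (1 / 2 + ?\<xi>) / ?D j) / 2
      = complex_of_real (partition_function (m j) (3 * p j) \<alpha> \<beta>) / ?D j) sequentially"
      using ev_pos
    proof eventually_elim
      case (elim j)
      \<comment> \<open>Momenta were centred at half-integers, so the antiperiodic sector has no
        further real shift and the periodic one is shifted by \<open>- 1 / 2\<close>.\<close>
      have e: "1 / 2 + (?\<xi> - 1 / 2) = ?\<xi>" "1 / 2 + ?\<xi> = 1 / 2 - \<i> * of_real \<beta> / 2" by simp_all
      have "m j > 0" "3 * p j > 0" using elim by auto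
      from partition_function_exact[OF this, of \<alpha> \<beta>] show ?case
        unfolding e by (simp only: add_divide_distrib diff_divide_distrib divide_divide_eq_left mult.commute)
    qed
  qed
  have val: "(of_real ?A * sector_sum ?c 1 (?\<xi> - 1 / 2) - of_real ?A * sector_sum ?c (-1) (?\<xi> - 1 / 2)
        + of_real ?A * sector_sum ?c 1 ?\<xi> + of_real ?A * sector_sum ?c (-1) ?\<xi>) / 2
     = complex_of_real (exp (pi * \<rho> / 6) / (sqrt (2 * \<rho>) * (P_prod (exp (- \<rho> * pi)))\<^sup>2) * winding_sum \<alpha> \<beta>)"
  proof -
    have "(of_real ?A * sector_sum ?c 1 (?\<xi> - 1 / 2) - of_real ?A * sector_sum ?c (-1) (?\<xi> - 1 / 2)
        + of_real ?A * sector_sum ?c 1 ?\<xi> + of_real ?A * sector_sum ?c (-1) ?\<xi>) / 2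
      = of_real ?A * ((sector_sum ?c 1 (?\<xi> - 1 / 2) - sector_sum ?c (-1) (?\<xi> - 1 / 2) + sector_sum ?c 1 ?\<xi> + sector_sum ?c (-1) ?\<xi>) / 2)"
      by (simp only: ring_distribs times_divide_eq_right)
    also have "\<dots> = of_real ?A * (of_real (sqrt (\<rho> / 2)) * of_real (winding_sum \<alpha> \<beta>))"
      unfolding sectors_decouple[OF c] current_sum winding_sum_factor(1) by (simp only: mult_ac)
    also have "\<dots> = of_real (?A * sqrt (\<rho> / 2) * winding_sum \<alpha> \<beta>)" by simp
    also have "?A * sqrt (\<rho> / 2) = exp (pi * \<rho> / 6) / (sqrt (2 * \<rho>) * (P_prod (exp (- \<rho> * pi)))\<^sup>2)"
    proof -
      have "?A = exp (pi * \<rho> / 6) / (\<rho> * (P_prod (exp (- pi * \<rho>)))\<^sup>2)"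
        using eta_inversion[OF \<rho>] by (simp add: nome_def)
      moreover have "sqrt (\<rho> / 2) / \<rho> = 1 / sqrt (2 * \<rho>)"
        using \<rho> by (simp add: real_sqrt_divide real_sqrt_mult field_simps)
      moreover have "a / (\<rho> * b) * s = a / b * (s / \<rho>)" "a / b * (1 / u) = a / (u * b)" for a b s u :: real by simp_all
      moreover have "- pi * \<rho> = - \<rho> * pi" by simp
      ultimately show ?thesis by (simp only:)
    qed
    finally show ?thesis .
  qed
  have "(\<lambda>j. Re (complex_of_real (partition_function (m j) (3 * p j) \<alpha> \<beta>) / ?D j))
     \<longlonglongrightarrow> Re (complex_of_real (exp (pi * \<rho> / 6) / (sqrt (2 * \<rho>) * (P_prod (exp (- \<rho> * pi)))\<^sup>2) * winding_sum \<alpha> \<beta>))"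
    using tendsto_Re[OF Z] unfolding val .
  moreover have "Re (complex_of_real (partition_function (m j) (3 * p j) \<alpha> \<beta>) / ?D j)
     = partition_function (m j) (3 * p j) \<alpha> \<beta> / (exp (- \<alpha> * pi) ^ p j * exp (real (m j) * real (3 * p j) * fermi_integral / (2 * pi)))" for j
    by (simp only: of_real_power[symmetric] of_real_mult[symmetric] of_real_divide[symmetric] Re_complex_of_real)
  ultimately show ?thesis by (simp only: Re_complex_of_real)
qed

end

subsection \<open>Free energy\<close>

text \<open>A palindromic product is a square, times the middle factor if the length is odd.\<close>

lemma symmetric_prod_nonneg:
  fixes a :: "nat \<Rightarrow> real"
  assumes sym: "\<And>s. s < n \<Longrightarrow> a (n - Suc s) = a s"
    and mid: "\<And>k. n = 2 * k + 1 \<Longrightarrow> a k \<ge> 0"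
  shows "(\<Prod>s<n. a s) \<ge> 0"
proof -
  have split: "(\<Prod>s<k + l. a s) = (\<Prod>s<k. a s) * (\<Prod>s<l. a (k + s))" for k l
    by (induction l) (simp_all add: mult.assoc)
  show ?thesis
  proof (cases "even n")
    case True
    then obtain k where n: "n = k + k" by (metis evenE mult_2)
    have "(\<Prod>s<k. a (k + s)) = (\<Prod>s<k. a (k + (k - Suc s)))"
      by (rule prod.nat_diff_reindex[symmetric])
    also have "\<dots> = (\<Prod>s<k. a s)"
    proof (rule prod.cong[OF refl])
      fix s assume "s \<in> {..<k}"
      then have "k + (k - Suc s) = n - Suc s" "s < n" using n by auto
      then show "a (k + (k - Suc s)) = a s" using sym by simp
    qed
    finally show ?thesis using split[of k k] n by simp
  next
    case False
    then obtain k where n: "n = 2 * k + 1" by (metis oddE)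
    have "(\<Prod>s<k. a (Suc k + s)) = (\<Prod>s<k. a (Suc k + (k - Suc s)))"
      by (rule prod.nat_diff_reindex[symmetric])
    also have "\<dots> = (\<Prod>s<k. a s)"
    proof (rule prod.cong[OF refl])
      fix s assume "s \<in> {..<k}"
      then have "Suc k + (k - Suc s) = n - Suc s" "s < n" using n by auto
      then show "a (Suc k + (k - Suc s)) = a s" using sym by simp
    qed
    finally have "(\<Prod>s<n. a s) = (\<Prod>s<k. a s) * a k * (\<Prod>s<k. a s)"
      using split[of "Suc k" k] n by (simp add: mult_2)
    also have "\<dots> = a k * ((\<Prod>s<k. a s) * (\<Prod>s<k. a s))" by (simp add: mult_ac)
    finally show ?thesis using mid[OF n] by simp
  qed
qed

definition real_product :: "nat \<Rightarrow> nat \<Rightarrow> real \<Rightarrow> real \<Rightarrow> real" where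
  "real_product m n z \<delta> = (\<Prod>s<n. 1 + z * (2 + 2 * cos (2 * pi * (real s + \<delta>) / real n)) ^ m)"

lemma momentum_product_of_real:
  "momentum_product m n 1 (of_real z) (of_real \<delta>) = of_real (real_product m n z \<delta>)"
  by (simp add: momentum_product_def real_product_def flip: cos_of_real)

lemma partition_function_uniform:
  assumes "m > 0" "n > 0"
  shows "partition_function m n 0 0 =
    (real_product m n 1 0 - real_product m n (-1) 0 + real_product m n 1 (1/2) + real_product m n (-1) (1/2)) / 2"
proof -
  have "complex_of_real (partition_function m n 0 0) = of_real
    ((real_product m n 1 0 - real_product m n (-1) 0 + real_product m n 1 (1/2) + real_product m n (-1) (1/2)) / 2)"
    using partition_function_exact[OF assms, of 0 0]
      momentum_product_of_real[of m n 1 0] momentum_product_of_real[of m n "-1" 0]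
      momentum_product_of_real[of m n 1 "1/2"] momentum_product_of_real[of m n "-1" "1/2"]
    by simp
  then show ?thesis by (simp only: of_real_eq_iff)
qed

lemma two_plus_two_cos_nonneg: "0 \<le> 2 + 2 * cos (x :: real)"
  using cos_ge_minus_one[of x] by linarith

lemma abs_real_product_le: "\<bar>real_product m n (-1) \<delta>\<bar> \<le> real_product m n 1 \<delta>"
proof -
  have "\<bar>real_product m n (-1) \<delta>\<bar> = (\<Prod>s<n. \<bar>1 + (-1) * (2 + 2 * cos (2 * pi * (real s + \<delta>) / real n)) ^ m\<bar>)"
    unfolding real_product_def by (rule abs_prod)
  also have "\<dots> \<le> real_product m n 1 \<delta>"
    unfolding real_product_def
  proof (rule prod_mono)
    fix s
    have "0 \<le> (2 + 2 * cos (2 * pi * (real s + \<delta>) / real n)) ^ m"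
      using two_plus_two_cos_nonneg by (rule zero_le_power)
    then show "0 \<le> \<bar>1 + (-1) * (2 + 2 * cos (2 * pi * (real s + \<delta>) / real n)) ^ m\<bar> \<and>
        \<bar>1 + (-1) * (2 + 2 * cos (2 * pi * (real s + \<delta>) / real n)) ^ m\<bar>
        \<le> 1 + 1 * (2 + 2 * cos (2 * pi * (real s + \<delta>) / real n)) ^ m" by linarith
  qed
  finally show ?thesis .
qed

text \<open>Half-integer momenta come in pairs of opposite sign. For odd \<open>n\<close> the
  unpaired momentum is \<open>\<pi>\<close>, where the band vanishes and the factor equals
  1.\<close>

lemma real_product_half_nonneg:
  assumes "m > 0"
  shows "real_product m n (-1) (1/2) \<ge> 0"
  unfolding real_product_def
proof (rule symmetric_prod_nonneg)
  fix s assume s: "s < n"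
  have "2 * pi * (real (n - Suc s) + 1 / 2) / real n = - (2 * pi * (real s + 1 / 2) / real n) + 2 * pi"
    using s by (simp add: of_nat_diff field_simps)
  then have "cos (2 * pi * (real (n - Suc s) + 1 / 2) / real n) = cos (2 * pi * (real s + 1 / 2) / real n)"
    by (simp only: cos_periodic cos_minus)
  then show "1 + (-1) * (2 + 2 * cos (2 * pi * (real (n - Suc s) + 1 / 2) / real n)) ^ m
      = 1 + (-1) * (2 + 2 * cos (2 * pi * (real s + 1 / 2) / real n)) ^ m" by simp
next
  fix k assume n: "n = 2 * k + 1"
  have "real n > 0" "real k = (real n - 1) / 2" using n by auto
  then have "2 * pi * (real k + 1 / 2) / real n = pi" by (simp add: field_simps)
  then show "0 \<le> 1 + (-1) * (2 + 2 * cos (2 * pi * (real k + 1 / 2) / real n)) ^ m"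
    using assms by (simp add: power_0_left)
qed

section \<open>Riemann sums for the exponential growth rate\<close>

text \<open>The limit of \<open>ln (1 + g ^ m) / m\<close> for \<open>g = 2 + 2 cos x\<close>: empty
  momenta contribute nothing, filled ones \<open>ln g\<close>. Unlike \<open>ln g\<close> it is
  Lipschitz on the whole line.\<close>

definition max_log :: "real \<Rightarrow> real" where
  "max_log x = ln (max 1 (2 + 2 * cos x))"

lemma ln_max_one_lipschitz: "\<bar>ln (max 1 a) - ln (max 1 b)\<bar> \<le> \<bar>a - b\<bar>" for a b :: real
proof -
  have *: "ln (max 1 a) - ln (max 1 b) \<le> \<bar>a - b\<bar>" for a b :: real
  proof -
    have pos: "max 1 a > 0" "max 1 b > 0" "max 1 b \<ge> 1" by auto
    have "ln (max 1 a) - ln (max 1 b) = ln (max 1 a / max 1 b)" using pos by (simp add: ln_div)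
    also have "\<dots> \<le> max 1 a / max 1 b - 1" using pos by (intro ln_le_minus_one) auto
    also have "\<dots> = (max 1 a - max 1 b) / max 1 b" using pos by (simp add: field_simps)
    also have "\<dots> \<le> \<bar>a - b\<bar> / max 1 b" using pos by (intro divide_right_mono) auto
    also have "\<dots> \<le> \<bar>a - b\<bar> / 1" using pos by (intro divide_left_mono) auto
    finally show ?thesis by simp
  qed
  show ?thesis using *[of a b] *[of b a] by linarith
qed

lemma max_log_lipschitz: "\<bar>max_log x - max_log y\<bar> \<le> 2 * \<bar>x - y\<bar>"
proof -
  have "\<bar>cos x - cos y\<bar> \<le> \<bar>x - y\<bar>"
  proof -
    have "\<bar>cos x - cos y\<bar> = 2 * \<bar>sin ((x + y) / 2)\<bar> * \<bar>sin ((y - x) / 2)\<bar>"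
      by (simp add: cos_diff_cos abs_mult)
    also have "\<dots> \<le> 2 * 1 * \<bar>(y - x) / 2\<bar>"
      by (intro mult_mono abs_sin_x_le_abs_x) auto
    finally show ?thesis by simp
  qed
  moreover have "\<bar>(2 + 2 * cos x) - (2 + 2 * cos y)\<bar> = 2 * \<bar>cos x - cos y\<bar>" by (simp add: abs_if)
  ultimately show ?thesis
    using ln_max_one_lipschitz[of "2 + 2 * cos x" "2 + 2 * cos y"] unfolding max_log_def by linarith
qed

lemma continuous_on_max_log: "continuous_on A max_log"
  unfolding max_log_def[abs_def] by (intro continuous_intros) auto

text \<open>The offset \<delta> of the sample point within its cell is arbitrary, so that the
  periodic and the antiperiodic sector are covered by one estimate.\<close>

lemma riemann_sum_lipschitz:
  fixes f :: "real \<Rightarrow> real"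
  assumes lip: "\<And>x y. \<bar>f x - f y\<bar> \<le> L * \<bar>x - y\<bar>" and L: "L \<ge> 0" and cont: "continuous_on UNIV f"
    and h: "h \<ge> 0" and \<delta>: "0 \<le> \<delta>" "\<delta> \<le> 1"
  shows "\<bar>integral {0..real n * h} f - h * (\<Sum>s<n. f ((real s + \<delta>) * h))\<bar> \<le> real n * (L * h\<^sup>2)"
proof (induction n)
  case (Suc n)
  have int: "f integrable_on {a..b}" for a b
    by (rule integrable_continuous_real) (rule continuous_on_subset[OF cont], simp)
  let ?a = "real n * h" and ?x = "(real n + \<delta>) * h"
  have ab: "0 \<le> ?a" "?a \<le> real (Suc n) * h" using h by (auto simp: algebra_simps)
  have split: "integral {0..real (Suc n) * h} f = integral {0..?a} f + integral {?a..real (Suc n) * h} f"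
    using Henstock_Kurzweil_Integration.integral_combine[OF ab int] by simp
  have len: "measure lborel {?a..real (Suc n) * h} = h" using ab by (simp add: algebra_simps)
  have "((\<lambda>x. f x - f ?x) has_integral (integral {?a..real (Suc n) * h} f - h * f ?x)) {?a..real (Suc n) * h}"
    using has_integral_diff[OF integrable_integral[OF int] has_integral_const_real[of "f ?x" ?a "real (Suc n) * h"]]
    unfolding len by simp
  then have "norm (integral {?a..real (Suc n) * h} f - h * f ?x) \<le> (L * h) * measure lborel {?a..real (Suc n) * h}"
  proof (rule has_integral_bound_real[where S = "{}", rotated 2])
    fix x assume x: "x \<in> {?a..real (Suc n) * h} - {}"
    have "0 \<le> \<delta> * h" "\<delta> * h \<le> h" using h \<delta> by (auto intro: mult_left_le_one_le)
    then have "\<bar>x - ?x\<bar> \<le> h" using x by (auto simp: algebra_simps)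
    then have "L * \<bar>x - ?x\<bar> \<le> L * h" using L by (rule mult_left_mono)
    then show "norm (f x - f ?x) \<le> L * h" using lip[of x ?x] by simp
  qed (use L h in auto)
  then have "\<bar>integral {?a..real (Suc n) * h} f - h * f ?x\<bar> \<le> L * h\<^sup>2"
    unfolding len by (simp add: power2_eq_square mult.assoc)
  with Suc.IH have "\<bar>integral {0..?a} f + integral {?a..real (Suc n) * h} f - (h * (\<Sum>s<n. f ((real s + \<delta>) * h)) + h * f ?x)\<bar>
      \<le> real n * (L * h\<^sup>2) + L * h\<^sup>2" by linarith
  then show ?case unfolding split by (simp add: algebra_simps)
qed simp

definition max_log_integral :: real where
  "max_log_integral = integral {0..2 * pi} max_log"

lemma mean_max_log:
  assumes n: "n > 0" and \<delta>: "0 \<le> \<delta>" "\<delta> \<le> 1"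
  shows "\<bar>(\<Sum>s<n. max_log (2 * pi * (real s + \<delta>) / real n)) / real n - max_log_integral / (2 * pi)\<bar> \<le> 4 * pi / real n"
proof -
  let ?h = "2 * pi / real n" and ?S = "\<Sum>s<n. max_log (2 * pi * (real s + \<delta>) / real n)"
  have h: "?h \<ge> 0" by simp
  have nh: "real n * ?h = 2 * pi" using n by simp
  have sh: "(real s + \<delta>) * ?h = 2 * pi * (real s + \<delta>) / real n" for s by simp
  have "\<bar>max_log_integral - ?h * ?S\<bar> \<le> real n * (2 * ?h\<^sup>2)"
    using riemann_sum_lipschitz[OF max_log_lipschitz _ continuous_on_max_log h \<delta>, of n]
    unfolding nh sh max_log_integral_def by simp
  then have "\<bar>?h * ?S - max_log_integral\<bar> / (2 * pi) \<le> real n * (2 * ?h\<^sup>2) / (2 * pi)"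
    by (intro divide_right_mono) (auto simp: abs_minus_commute)
  moreover have "\<bar>?h * ?S - max_log_integral\<bar> / (2 * pi) = \<bar>?S / real n - max_log_integral / (2 * pi)\<bar>"
  proof -
    have "\<bar>?h * ?S - max_log_integral\<bar> / (2 * pi) = \<bar>(?h * ?S - max_log_integral) / (2 * pi)\<bar>" by simp
    also have "(?h * ?S - max_log_integral) / (2 * pi) = ?S / real n - max_log_integral / (2 * pi)"
      by (simp add: diff_divide_distrib)
    finally show ?thesis .
  qed
  moreover have "real n * (2 * ?h\<^sup>2) / (2 * pi) = 4 * pi / real n"
    using n by (simp add: power2_eq_square field_simps)
  ultimately show ?thesis by simp
qed

text \<open>\<open>G ^ m \<le> 1 + g ^ m \<le> 2 * G ^ m\<close> with \<open>G = max 1 g\<close>, so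
  each factor contributes \<open>m * max_log\<close> up to an error of \<open>ln 2 < 1\<close>.
  After division by \<open>m * n\<close> this is the term \<open>1 / m\<close>.\<close>

lemma ln_real_product:
  assumes m: "m > 0" and n: "n > 0" and \<delta>: "0 \<le> \<delta>" "\<delta> \<le> 1"
  shows "real_product m n 1 \<delta> > 0"
    and "\<bar>ln (real_product m n 1 \<delta>) / (real m * real n) - max_log_integral / (2 * pi)\<bar> \<le> 4 * pi / real n + 1 / real m"
proof -
  let ?x = "\<lambda>s. 2 * pi * (real s + \<delta>) / real n"
  let ?g = "\<lambda>s. 2 + 2 * cos (?x s)"
  let ?S = "\<Sum>s<n. max_log (?x s)"
  have g: "0 \<le> ?g s" for s by (rule two_plus_two_cos_nonneg)
  have pos: "1 + ?g s ^ m > 0" for s using zero_le_power[OF g, of s m] by linarith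
  then show pos': "real_product m n 1 \<delta> > 0" unfolding real_product_def by (intro prod_pos) simp
  have ln_eq: "ln (real_product m n 1 \<delta>) = (\<Sum>s<n. ln (1 + ?g s ^ m))"
    unfolding real_product_def mult_1 by (rule ln_prod) (use pos in \<open>auto simp: less_imp_neq[symmetric]\<close>)
  have bounds: "real m * max_log (?x s) \<le> ln (1 + ?g s ^ m) \<and> ln (1 + ?g s ^ m) \<le> real m * max_log (?x s) + 1" for s
  proof -
    let ?G = "max 1 (?g s)"
    have eq: "real m * max_log (?x s) = ln (?G ^ m)" by (simp add: max_log_def ln_realpow)
    have G1: "1 \<le> ?G ^ m" by (intro one_le_power) simp
    have gG: "?g s ^ m \<le> ?G ^ m" using g by (intro power_mono) auto
    have lower: "?G ^ m \<le> 1 + ?g s ^ m"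
      using zero_le_power[OF g, of s m] by (cases "?g s \<le> 1") (auto simp: max_def)
    have "1 + ?g s ^ m \<le> ?G ^ m + ?G ^ m" by (rule add_mono[OF G1 gG])
    then have "1 + ?g s ^ m \<le> 2 * ?G ^ m" by (simp only: mult_2)
    from ln_mono[OF this pos] have "ln (1 + ?g s ^ m) \<le> ln (2 * ?G ^ m)" .
    also have "\<dots> = ln 2 + ln (?G ^ m)" using G1 by (subst ln_mult) auto
    also have "\<dots> \<le> 1 + ln (?G ^ m)" using ln_2_less_1 by simp
    finally show ?thesis unfolding eq using lower G1 pos[of s] by simp
  qed
  have lo: "real m * ?S \<le> ln (real_product m n 1 \<delta>)"
    unfolding ln_eq sum_distrib_left using bounds by (intro sum_mono) auto
  have hi: "ln (real_product m n 1 \<delta>) \<le> real m * ?S + real n"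
  proof -
    have "ln (real_product m n 1 \<delta>) \<le> (\<Sum>s<n. real m * max_log (?x s) + 1)"
      unfolding ln_eq using bounds by (intro sum_mono) auto
    then show ?thesis by (simp add: sum.distrib sum_distrib_left)
  qed
  have mn: "real m * real n > 0" using m n by simp
  have e1: "real m * ?S / (real m * real n) = ?S / real n" using m by simp
  have e2: "(real m * ?S + real n) / (real m * real n) = ?S / real n + 1 / real m" using m n by (simp add: field_simps)
  have "?S / real n \<le> ln (real_product m n 1 \<delta>) / (real m * real n)"
    using divide_right_mono[OF lo less_imp_le[OF mn]] unfolding e1 .
  moreover have "ln (real_product m n 1 \<delta>) / (real m * real n) \<le> ?S / real n + 1 / real m"
    using divide_right_mono[OF hi less_imp_le[OF mn]] unfolding e2 .
  ultimately show "\<bar>ln (real_product m n 1 \<delta>) / (real m * real n) - max_log_integral / (2 * pi)\<bar> \<le> 4 * pi / real n + 1 / real m"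
    using mean_max_log[OF n \<delta>] unfolding abs_le_iff by linarith
qed

text \<open>The subtracted product is dominated by the positive one with the same shift, and the two
  half-integer products are nonnegative. Hence the partition function lies between
  \<open>?R (1/2) / 2\<close> and \<open>?R 0 + ?R (1/2)\<close>; the factors of 2 cost at most 1 in
  the logarithm.\<close>

lemma free_energy_approx_bound:
  assumes m: "m > 0" and n: "n > 0"
  shows "\<bar>free_energy_approx (m, n) + max_log_integral / (2 * pi)\<bar> \<le> 4 * pi / real n + 2 / real m"
proof -
  let ?Z = "partition_function m n 0 0" and ?R = "real_product m n 1"
  let ?M = "real m * real n" and ?I = "max_log_integral / (2 * pi)"
  have R: "?R \<delta> > 0" "\<bar>ln (?R \<delta>) / ?M - ?I\<bar> \<le> 4 * pi / real n + 1 / real m" if "\<delta> \<in> {0, 1/2}" for \<delta>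
    using ln_real_product[OF m n, of \<delta>] that by auto
  have M: "?M > 0" "real n \<ge> 1" using m n by (auto simp: Suc_le_eq)
  have Z1: "?R (1/2) / 2 \<le> ?Z" and Z2: "?Z \<le> ?R 0 + ?R (1/2)"
    using abs_real_product_le[of m n 0] abs_real_product_le[of m n "1/2"] real_product_half_nonneg[OF m, of n]
    unfolding partition_function_uniform[OF m n] by (auto simp: abs_le_iff)
  have Zpos: "?Z > 0" using Z1 R(1)[of "1/2"] by simp
  have "ln (?R (1/2)) - ln 2 \<le> ln ?Z"
    using ln_mono[OF Z1] R(1)[of "1/2"] by (simp add: ln_div)
  then have lo: "ln (?R (1/2)) - 1 \<le> ln ?Z" using ln_2_less_1 by linarith
  obtain \<delta> where \<delta>: "\<delta> \<in> {0, 1/2}" "?Z \<le> 2 * ?R \<delta>"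
  proof (cases "?R 0 \<le> ?R (1/2)")
    case True
    then show ?thesis using Z2 by (intro that[of "1/2"]) auto
  next
    case False
    then show ?thesis using Z2 by (intro that[of 0]) auto
  qed
  have "ln ?Z \<le> ln (2 * ?R \<delta>)" using \<delta>(2) Zpos by simp
  also have "\<dots> = ln 2 + ln (?R \<delta>)" using R(1)[OF \<delta>(1)] by (subst ln_mult) auto
  finally have hi: "ln ?Z \<le> ln (?R \<delta>) + 1" using ln_2_less_1 by linarith
  have inv: "1 / ?M \<le> 1 / real m"
    using M m by (intro divide_left_mono) auto
  have "ln (?R (1/2)) / ?M - 1 / ?M \<le> ln ?Z / ?M"
    using divide_right_mono[OF lo less_imp_le[OF M(1)]] by (simp add: diff_divide_distrib)
  moreover have "ln ?Z / ?M \<le> ln (?R \<delta>) / ?M + 1 / ?M"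
    using divide_right_mono[OF hi less_imp_le[OF M(1)]] by (simp add: add_divide_distrib)
  moreover have "2 / real m = 1 / real m + 1 / real m" by simp
  ultimately have "\<bar>ln ?Z / ?M - ?I\<bar> \<le> 4 * pi / real n + 2 / real m"
    using R(2)[OF \<delta>(1)] R(2)[of "1/2"] inv unfolding abs_le_iff by simp
  then show ?thesis by (simp add: free_energy_approx_def abs_minus_commute)
qed

lemma free_energy_limit:
  "(free_energy_approx \<longlongrightarrow> - max_log_integral / (2 * pi)) (at_top \<times>\<^sub>F at_top)"
proof -
  let ?F = "at_top \<times>\<^sub>F at_top :: (nat \<times> nat) filter"
  have fst: "filterlim fst at_top ?F"
    unfolding filterlim_iff eventually_prod_filter by (metis eventually_True fst_conv)
  have snd: "filterlim snd at_top ?F"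
    unfolding filterlim_iff eventually_prod_filter by (metis eventually_True snd_conv)
  have inv: "((\<lambda>x. c / real (g x)) \<longlongrightarrow> 0) ?F" if "filterlim g at_top ?F" for c g
    by (rule tendsto_divide_0[OF tendsto_const])
       (rule filterlim_compose[OF filterlim_at_top_imp_at_infinity[OF filterlim_real_sequentially] that])
  have "((\<lambda>x. 4 * pi / real (snd x) + 2 / real (fst x)) \<longlongrightarrow> 0 + 0) ?F"
    by (intro tendsto_add inv fst snd)
  then have lim: "((\<lambda>x. 4 * pi / real (snd x) + 2 / real (fst x)) \<longlongrightarrow> 0) ?F" by simp
  have "eventually (\<lambda>x. 0 < fst x) ?F" and "eventually (\<lambda>x. 0 < snd x) ?F"
    using eventually_compose_filterlim[OF eventually_gt_at_top fst, of 0]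
      eventually_compose_filterlim[OF eventually_gt_at_top snd, of 0] by simp_all
  then have "eventually (\<lambda>x. norm (free_energy_approx x - (- max_log_integral / (2 * pi)))
      \<le> 4 * pi / real (snd x) + 2 / real (fst x)) ?F"
  proof eventually_elim
    case (elim x)
    then show ?case using free_energy_approx_bound[of "fst x" "snd x"] by simp
  qed
  from LIM_zero_cancel[OF Lim_null_comparison[OF this lim]] show ?thesis .
qed

lemma free_energy_eq: "free_energy = - max_log_integral / (2 * pi)"
  unfolding free_energy_def
  by (rule tendsto_Lim[OF _ free_energy_limit]) (simp add: prod_filter_eq_bot)

text \<open>\<open>max_log\<close> vanishes between the Fermi momenta \<open>2 \<pi> / 3\<close> and
  \<open>4 \<pi> / 3\<close>, and periodicity carries the last third of the period to the left of
  0.\<close>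

lemma max_log_integral_eq: "max_log_integral = fermi_integral"
proof -
  let ?a = "2 * pi / 3"
  have int: "max_log integrable_on {a..b}" for a b
    by (rule integrable_continuous_real[OF continuous_on_max_log])
  have inside: "max_log x = ln (2 + 2 * cos x)" if "\<bar>x\<bar> \<le> ?a" for x
  proof -
    have "cos ?a \<le> cos \<bar>x\<bar>" using that by (intro cos_monotone_0_pi_le) auto
    then have "1 \<le> 2 + 2 * cos x" using cos_two_thirds_pi by simp
    then show ?thesis by (simp add: max_log_def)
  qed
  have outside: "max_log x = 0" if "?a \<le> x" "x \<le> 4 * pi / 3" for x
  proof -
    have "cos x = - cos (x - pi)" by (simp add: cos_diff)
    also have "cos (x - pi) = cos \<bar>x - pi\<bar>" by simp
    finally have "cos x = - cos \<bar>x - pi\<bar>" .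
    moreover have "cos (pi / 3) \<le> cos \<bar>x - pi\<bar>" using that by (intro cos_monotone_0_pi_le abs_leI) auto
    ultimately have "2 + 2 * cos x \<le> 1" using cos_60 by simp
    then show ?thesis by (simp add: max_log_def)
  qed
  have mid: "integral {?a..4 * pi / 3} max_log = 0"
    using outside by (intro integral_unique has_integral_is_0) auto
  have "((max_log \<circ> (+) (2 * pi)) has_integral integral {4 * pi / 3..2 * pi} max_log) {- ?a..0}"
    unfolding has_integral_shift_Icc_real using integrable_integral[OF int, of "4 * pi / 3" "2 * pi"] by (simp add: field_simps)
  moreover have "max_log \<circ> (+) (2 * pi) = max_log"
    by (auto simp: max_log_def add.commute[of "2 * pi"])
  ultimately have shift: "integral {4 * pi / 3..2 * pi} max_log = integral {- ?a..0} max_log"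
    by (simp add: integral_unique)
  have "max_log_integral = integral {0..?a} max_log + integral {?a..2 * pi} max_log"
    unfolding max_log_integral_def by (rule Henstock_Kurzweil_Integration.integral_combine[symmetric, OF _ _ int]) auto
  also have "integral {?a..2 * pi} max_log = integral {?a..4 * pi / 3} max_log + integral {4 * pi / 3..2 * pi} max_log"
    by (rule Henstock_Kurzweil_Integration.integral_combine[symmetric, OF _ _ int]) auto
  also have "integral {0..?a} max_log + (integral {?a..4 * pi / 3} max_log + integral {4 * pi / 3..2 * pi} max_log)
      = integral {- ?a..0} max_log + integral {0..?a} max_log"
    by (simp only: mid shift)
  also have "\<dots> = integral {- ?a..?a} max_log"
    by (rule Henstock_Kurzweil_Integration.integral_combine[OF _ _ int]) auto
  also have "\<dots> = fermi_integral"
    unfolding fermi_integral_def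
  proof (rule integral_cong)
    fix x assume "x \<in> {- ?a..?a}"
    then have "\<bar>x\<bar> \<le> ?a" by (intro abs_leI) auto
    then show "max_log x = ln (2 + 2 * cos x)" by (rule inside)
  qed
  finally show ?thesis .
qed

section \<open>The double integral of the principal logarithm\<close>

lemma circle_mean_value:
  fixes f :: "complex \<Rightarrow> complex"
  assumes "continuous_on (cball 0 1) f" "f holomorphic_on (ball 0 1)"
  shows "((\<lambda>t. f (cis t)) has_integral (2 * pi * f 0)) {0..2 * pi}"
proof -
  have "((\<lambda>u. f u / (u - 0)) has_contour_integral (2 * of_real pi * \<i> * f 0)) (circlepath 0 1)"
    by (rule Cauchy_integral_circlepath[OF assms]) simp
  then have "((\<lambda>t. f (0 + of_real 1 * cis t) / (0 + of_real 1 * cis t - 0) * of_real 1 * \<i> * cis t)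
      has_integral (2 * of_real pi * \<i> * f 0)) {0..2 * pi}"
    unfolding circlepath_def by (subst (asm) has_contour_integral_part_circlepath_iff) auto
  then have "((\<lambda>t. \<i> * f (cis t)) has_integral (2 * of_real pi * \<i> * f 0)) {0..2 * pi}"
    by (simp add: mult.commute)
  from has_integral_mult_right[OF this, of "- \<i>"] show ?thesis by (simp add: algebra_simps)
qed

text \<open>\<open>r - cis \<phi>\<close> is \<open>- cis \<phi>\<close> times the conjugate of
  \<open>1 - r * cis \<phi>\<close>, and \<open>\<phi> - \<pi>\<close> is an argument of
  \<open>- cis \<phi>\<close>. The argument of the conjugate factor is below
  \<open>\<pi> / 2\<close> in modulus and points towards 0, so the sum of arguments stays in the
  principal range.\<close>

lemma Ln_rotate:
  assumes r: "0 \<le> r" "r < 1" and \<phi>: "0 < \<phi>" "\<phi> < 2 * pi"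
  shows "Ln (of_real r - cis \<phi>) = \<i> * of_real (\<phi> - pi) + cnj (Ln (1 - of_real r * cis \<phi>))"
proof -
  let ?w = "1 - of_real r * cis \<phi>"
  have re: "Re ?w > 0"
  proof -
    have "r * cos \<phi> \<le> r * 1" using r by (intro mult_left_mono) auto
    then show ?thesis using r by simp
  qed
  then have w0: "?w \<noteq> 0" by (metis less_irrefl zero_complex.simps(1))
  have cw: "cnj ?w = 1 - of_real r * cis (- \<phi>)" by (simp add: cis_cnj)
  have "exp (\<i> * of_real (\<phi> - pi) + cnj (Ln ?w)) = cis (\<phi> - pi) * cnj (exp (Ln ?w))"
    by (simp only: exp_add exp_cnj cis_conv_exp)
  also have "cnj (exp (Ln ?w)) = 1 - of_real r * cis (- \<phi>)" using w0 cw by simp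
  also have "cis (\<phi> - pi) = - cis \<phi>" by (simp add: complex_eq_iff cos_diff sin_diff)
  also have "- cis \<phi> * (1 - of_real r * cis (- \<phi>)) = of_real r - cis \<phi>"
    by (simp add: algebra_simps cis_mult)
  finally have ex: "exp (\<i> * of_real (\<phi> - pi) + cnj (Ln ?w)) = of_real r - cis \<phi>" .
  have half: "\<bar>Im (Ln ?w)\<bar> < pi / 2" using re by (rule Re_Ln_pos_lt_imp)
  have im: "Im ?w = - r * sin \<phi>" by simp
  have key: "- pi < \<phi> - pi - Im (Ln ?w) \<and> \<phi> - pi - Im (Ln ?w) \<le> pi"
  proof (cases "\<phi> \<le> pi")
    case True
    have "sin \<phi> \<ge> 0" using \<phi> True by (intro sin_ge_zero) auto
    then have le: "Im ?w \<le> 0" using r im by simp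
    have "Im (Ln ?w) \<le> 0"
    proof (rule ccontr)
      assume "\<not> Im (Ln ?w) \<le> 0"
      then have "Im ?w > 0" using half Im_Ln_pos_lt[OF w0] pi_gt_zero by (auto simp: abs_less_iff)
      then show False using le by simp
    qed
    then show ?thesis using \<phi> True half unfolding abs_less_iff by auto
  next
    case False
    have "sin (2 * pi - \<phi>) \<ge> 0" using \<phi> False by (intro sin_ge_zero) auto
    then have "sin \<phi> \<le> 0" by (simp add: sin_diff)
    then have "0 \<le> Im ?w" using r im by (simp add: mult_nonneg_nonpos)
    then have "0 \<le> Im (Ln ?w)" using Im_Ln_pos_le[OF w0] by simp
    then show ?thesis using \<phi> False half unfolding abs_less_iff by auto
  qed
  show ?thesis by (rule Ln_unique[OF ex]) (use key in auto)
qed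

lemma Re_one_minus_pos:
  assumes "0 \<le> r" "r < 1" "norm (z :: complex) \<le> 1"
  shows "Re (1 - of_real r * z) > 0"
proof -
  have "r * Re z \<le> r * 1" using assms abs_Re_le_cmod[of z] by (intro mult_left_mono) auto
  then show ?thesis using assms by simp
qed

text \<open>Jensen's formula for a linear function. For \<open>r > 1\<close> it is the mean value
  property. For \<open>r < 1\<close> the function \<open>r - z\<close> has a zero in the disc; after
  \<open>Ln_rotate\<close> the linear phase integrates to 0 and the conjugated term has mean
  \<open>Ln 1 = 0\<close>.\<close>

lemma Ln_circle_integral:
  assumes r: "0 \<le> r" "r \<noteq> 1"
  shows "((\<lambda>\<phi>. Ln (of_real r - exp (\<i> * of_real \<phi>))) has_integral of_real (2 * pi * ln (max 1 r))) {0..2 * pi}"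
proof (cases "r < 1")
  case False
  then have r1: "r > 1" using r by simp
  have ns: "of_real r - z \<notin> \<real>\<^sub>\<le>\<^sub>0" if "norm z \<le> 1" for z :: complex
  proof -
    have "Re (of_real r - z) > 0" using that r1 abs_Re_le_cmod[of z] by simp
    then show ?thesis by (auto simp: complex_nonpos_Reals_iff)
  qed
  have "((\<lambda>t. Ln (of_real r - cis t)) has_integral (2 * pi * Ln (of_real r - 0))) {0..2 * pi}"
    by (rule circle_mean_value[of "\<lambda>z. Ln (of_real r - z)"]; use ns in \<open>intro continuous_intros holomorphic_intros; simp\<close>)
  moreover have "complex_of_real (2 * pi) * Ln (of_real r - 0) = of_real (2 * pi * ln (max 1 r))"
    using r1 by (simp add: Ln_of_real max_def)
  ultimately show ?thesis by (simp add: cis_conv_exp)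
next
  case True
  have ns: "1 - of_real r * z \<notin> \<real>\<^sub>\<le>\<^sub>0" if "norm z \<le> 1" for z :: complex
    using Re_one_minus_pos[OF r(1) True that] by (auto simp: complex_nonpos_Reals_iff)
  have "((\<lambda>t. Ln (1 - of_real r * cis t)) has_integral (2 * pi * Ln (1 - of_real r * 0))) {0..2 * pi}"
    by (rule circle_mean_value[of "\<lambda>z. Ln (1 - of_real r * z)"]; use ns in \<open>intro continuous_intros holomorphic_intros; simp\<close>)
  then have "((\<lambda>t. cnj (Ln (1 - of_real r * cis t))) has_integral 0) {0..2 * pi}"
    using has_integral_cnj[of "\<lambda>t. Ln (1 - of_real r * cis t)" 0 "{0..2 * pi}"] by (simp add: o_def)
  moreover have "((\<lambda>t. \<i> * complex_of_real (t - pi)) has_integral \<i> * of_real 0) {0..2 * pi}"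
  proof (intro has_integral_mult_right has_integral_of_real)
    show "((\<lambda>t. t - pi) has_integral 0) {0..2 * pi}"
      using has_integral_diff[OF ident_has_integral[of 0 "2 * pi"] has_integral_const_real[of pi 0 "2 * pi"]]
      by (simp add: power2_eq_square)
  qed
  ultimately have "((\<lambda>t. \<i> * of_real (t - pi) + cnj (Ln (1 - of_real r * cis t))) has_integral \<i> * of_real 0 + 0) {0..2 * pi}"
    by (intro has_integral_add)
  then have "((\<lambda>t. \<i> * of_real (t - pi) + cnj (Ln (1 - of_real r * cis t))) has_integral 0) {0..2 * pi}" by simp
  \<comment> \<open>At the end points the argument is a negative real number, on the branch cut, so
    they are excluded from the comparison.\<close>
  then have "((\<lambda>\<phi>. Ln (of_real r - cis \<phi>)) has_integral 0) {0..2 * pi}"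
    by (rule has_integral_spike_finite[where S = "{0, 2 * pi}", rotated 2])
       (use Ln_rotate[OF r(1) True] in auto)
  then show ?thesis using True by (simp add: cis_conv_exp max_def)
qed

lemma free_energy_integral:
  "complex_of_real free_energy = - 1 / (4 * complex_of_real pi ^ 2) *
     integral {0..2*pi} (\<lambda>\<psi>. integral {0..2*pi} (\<lambda>\<phi>.
       Ln (complex_of_real (2 * (cos \<psi> + 1)) - exp (\<i> * complex_of_real \<phi>))))"
proof -
  let ?inner = "\<lambda>\<psi>. integral {0..2*pi} (\<lambda>\<phi>. Ln (complex_of_real (2 * (cos \<psi> + 1)) - exp (\<i> * complex_of_real \<phi>)))"
  have "max_log integrable_on {0..2 * pi}" by (rule integrable_continuous_real[OF continuous_on_max_log])
  then have "(max_log has_integral max_log_integral) {0..2 * pi}"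
    unfolding max_log_integral_def by (rule integrable_integral)
  then have "((\<lambda>\<psi>. complex_of_real (2 * pi * max_log \<psi>)) has_integral of_real (2 * pi * max_log_integral)) {0..2 * pi}"
    by (intro has_integral_of_real has_integral_mult_right)
  \<comment> \<open>The two exceptional angles are the solutions of
    \<open>2 * (cos \<psi> + 1) = 1\<close>, the Fermi momenta, where the circle passes through the
    singularity of the logarithm.\<close>
  then have "(?inner has_integral of_real (2 * pi * max_log_integral)) {0..2 * pi}"
  proof (rule has_integral_spike_finite[where S = "{arccos (- 1 / 2), 2 * pi - arccos (- 1 / 2)}", rotated 2])
    fix \<psi> assume \<psi>: "\<psi> \<in> {0..2 * pi} - {arccos (- 1 / 2), 2 * pi - arccos (- 1 / 2)}"
    have "cos \<psi> \<noteq> - 1 / 2"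
    proof
      assume c: "cos \<psi> = - 1 / 2"
      show False
      proof (cases "\<psi> \<le> pi")
        case True
        then have "arccos (cos \<psi>) = \<psi>" using \<psi> by (intro arccos_cos) auto
        then show False using \<psi> c by auto
      next
        case False
        then have "arccos (cos (2 * pi - \<psi>)) = 2 * pi - \<psi>" using \<psi> by (intro arccos_cos) auto
        moreover have "cos (2 * pi - \<psi>) = cos \<psi>" by (simp add: cos_diff)
        ultimately show False using \<psi> c by auto
      qed
    qed
    then have "2 * (cos \<psi> + 1) \<noteq> 1" by auto
    moreover have "0 \<le> 2 * (cos \<psi> + 1)" using two_plus_two_cos_nonneg[of \<psi>] by simp
    ultimately have "?inner \<psi> = of_real (2 * pi * ln (max 1 (2 * (cos \<psi> + 1))))"
      using Ln_circle_integral integral_unique by blast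
    moreover have "max 1 (2 * (cos \<psi> + 1)) = max 1 (2 + 2 * cos \<psi>)" by simp
    ultimately show "?inner \<psi> = complex_of_real (2 * pi * max_log \<psi>)" by (simp only: max_log_def)
  qed simp
  then have "integral {0..2*pi} ?inner = of_real (2 * pi * max_log_integral)" by (rule integral_unique)
  then show ?thesis by (simp add: free_energy_eq power2_eq_square)
qed

theorem theorem4:
  fixes \<rho> \<alpha> \<beta> :: real and m n :: "nat \<Rightarrow> nat"
  assumes "\<rho> > 0"
    and "filterlim m at_top sequentially"
    and "filterlim n at_top sequentially"
    and "\<And>j. 3 dvd n j"
    and "(\<lambda>j. real (n j) / (sqrt 3 * real (m j))) \<longlonglongrightarrow> \<rho>"
  shows "((\<lambda>j. partition_function (m j) (n j) \<alpha> \<beta>) \<sim>[sequentially]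
           (\<lambda>j. exp (- pi * real (n j) * \<alpha> / 3) * exp (- real (m j) * real (n j) * free_energy)
                * (exp (pi * \<rho> / 6) / (sqrt (2 * \<rho>) * (P_prod (exp (- \<rho> * pi)))\<^sup>2))
                * (\<Sum>\<^sub>\<infinity>(k, l)\<in>(UNIV :: (int \<times> int) set).
                     exp (pi * (\<alpha> * real_of_int k + \<beta> * real_of_int l))
                     * exp (- pi / 2 * ((real_of_int k)\<^sup>2 / \<rho> + \<rho> * (real_of_int l)\<^sup>2)))))
    \<and> (free_energy_approx \<longlongrightarrow> free_energy) (at_top \<times>\<^sub>F at_top)
    \<and> complex_of_real free_energy = - 1 / (4 * complex_of_real pi ^ 2) *
           integral {0..2*pi} (\<lambda>\<psi>. integral {0..2*pi} (\<lambda>\<phi>.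
             Ln (complex_of_real (2 * (cos \<psi> + 1)) - exp (\<i> * complex_of_real \<phi>))))"
proof (intro conjI)
  define p where "p j = n j div 3" for j
  have n: "n j = 3 * p j" for j using assms(4)[of j] by (simp add: p_def)
  interpret torus_scaling m p \<rho>
  proof
    show "filterlim p at_top sequentially"
      unfolding filterlim_at_top
    proof
      fix k
      have "eventually (\<lambda>j. 3 * k \<le> n j) sequentially"
        using assms(3) unfolding filterlim_at_top by blast
      then show "eventually (\<lambda>j. k \<le> p j) sequentially" by eventually_elim (simp add: n)
    qed
    show "(\<lambda>j. real (3 * p j) / (sqrt 3 * real (m j))) \<longlonglongrightarrow> \<rho>"
      using assms(5) unfolding n .
  qed (use assms in auto)
  let ?K = "exp (pi * \<rho> / 6) / (sqrt (2 * \<rho>) * (P_prod (exp (- \<rho> * pi)))\<^sup>2)"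
  let ?D = "\<lambda>j. exp (- \<alpha> * pi) ^ p j * exp (real (m j) * real (3 * p j) * fermi_integral / (2 * pi))"
  have "P_prod (exp (- \<rho> * pi)) \<noteq> 0"
    using qpoch_tendsto(2)[of "exp (- \<rho> * pi)"] assms(1) by simp
  \<comment> \<open>A nonzero limit of the quotient is what turns convergence into asymptotic
    equivalence.\<close>
  then have "?K * winding_sum \<alpha> \<beta> \<noteq> 0"
    using winding_sum_factor(2)[of \<alpha> \<beta>] assms(1) by simp
  with partition_limit
  have "(\<lambda>j. partition_function (m j) (3 * p j) \<alpha> \<beta>) \<sim>[sequentially] (\<lambda>j. ?K * winding_sum \<alpha> \<beta> * ?D j)"
    by (rule asymp_equivI'_const)
  moreover have "?K * winding_sum \<alpha> \<beta> * ?D j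
      = exp (- pi * real (n j) * \<alpha> / 3) * exp (- real (m j) * real (n j) * free_energy) * ?K * winding_sum \<alpha> \<beta>" for j
  proof -
    have "exp (- \<alpha> * pi) ^ p j = exp (- pi * real (n j) * \<alpha> / 3)"
      by (simp add: n exp_of_nat_mult[symmetric] mult_ac)
    moreover have "real (m j) * real (3 * p j) * fermi_integral / (2 * pi) = - real (m j) * real (n j) * free_energy"
      by (simp add: n free_energy_eq max_log_integral_eq)
    ultimately show ?thesis by (simp only: mult_ac)
  qed
  ultimately have "(\<lambda>j. partition_function (m j) (n j) \<alpha> \<beta>) \<sim>[sequentially]
      (\<lambda>j. exp (- pi * real (n j) * \<alpha> / 3) * exp (- real (m j) * real (n j) * free_energy) * ?K * winding_sum \<alpha> \<beta>)"
    by (simp only: n)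
  then show "(\<lambda>j. partition_function (m j) (n j) \<alpha> \<beta>) \<sim>[sequentially]
           (\<lambda>j. exp (- pi * real (n j) * \<alpha> / 3) * exp (- real (m j) * real (n j) * free_energy)
                * (exp (pi * \<rho> / 6) / (sqrt (2 * \<rho>) * (P_prod (exp (- \<rho> * pi)))\<^sup>2))
                * (\<Sum>\<^sub>\<infinity>(k, l)\<in>(UNIV :: (int \<times> int) set).
                     exp (pi * (\<alpha> * real_of_int k + \<beta> * real_of_int l))
                     * exp (- pi / 2 * ((real_of_int k)\<^sup>2 / \<rho> + \<rho> * (real_of_int l)\<^sup>2))))"
    unfolding winding_sum_def .
  show "(free_energy_approx \<longlongrightarrow> free_energy) (at_top \<times>\<^sub>F at_top)"
    unfolding free_energy_eq by (rule free_energy_limit)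
qed (rule free_energy_integral)

end
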